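(* Let $\omega=K_1\cup K_2\subset\mathbb{R}^d$ be the union of two simplices $K_1,K_2$ with common face $E=K_1\cap K_2$, let $\ell\ge1$ and $\varepsilon>0$. For any $u\in H^1(\omega)$, let $P_E\in S|_\omega$ and $P_i\in\mathbb{P}_\ell(K_i)$, $i=1,2$, be the best approximations given by $$ |||u-P_E|||_\omega=\inf_{P\in S|_\omega}|||u-P|||_\omega,\qquad |||u-P_i|||_{K_i}=\inf_{P\in\mathbb{P}_\ell(K_i)}|||u-P|||_{K_i}. $$ Then $$ |||u-P_E|||_\omega\ \approx\ \Big(h_E\|P_1-P_2\|_E^2+\sum_{i=1}^2|||u-P_i|||_{K_i}^2\Big)^{1/2}, $$ i.e. each side is bounded by a constant times the other, where the constants depend on $\ell$, $d$ and $\sigma_E$, but are independent of $\varepsilon$.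
   Context: $\|\cdot\|_A$ is the $L^2(A)$-norm (for $A=E$ with respect to the $(d-1)$-dimensional Hausdorff measure) and $|||v|||_A=(\|v\|_A^2+\varepsilon\|\nabla v\|_A^2)^{1/2}$. $\mathbb{P}_\ell(K)$ is the space of polynomials of degree at most $\ell$ on $K$; $S|_\omega$ is the space of continuous functions on $\omega$ whose restriction to each $K_i$ is in $\mathbb{P}_\ell(K_i)$. Moreover $\sigma_E=\max\{h_1,h_2\}/\min\{\rho_1,\rho_2\}$ with $h_i=\mathrm{diam}(K_i)$ and $\rho_i$ the maximum diameter of a ball inscribed in $K_i$, and $h_E=\min\{|K_1|,|K_2|\}/|E|$, with $|K_i|$ the $d$-dimensional Lebesgue measure and $|E|$ the $(d-1)$-dimensional Hausdorff measure. *)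

theory Defs
  imports "HOL-Analysis.Analysis"
begin

text \<open>
  Hausdorff measure of integer dimension \<open>k\<close> with the usual normalisation (on \<open>k\<close>-dimensional
  planes it agrees with \<open>k\<close>-dimensional Lebesgue measure). Covering sets must be bounded because
  \<^const>\<open>diameter\<close> is only meaningful for those. The empty set is treated separately because
  \<open>0 ^ 0 = 1\<close>: for \<open>k = 0\<close> a singleton has to contribute \<open>1\<close> (counting measure), but the empty
  set \<open>0\<close>.
\<close>

definition hausdorff_premeasure :: "nat \<Rightarrow> real \<Rightarrow> 'a::metric_space set \<Rightarrow> ennreal" where
  "hausdorff_premeasure k \<delta> A =
     (INF U \<in> {U :: nat \<Rightarrow> 'a set. A \<subseteq> (\<Union>i. U i) \<and> (\<forall>i. bounded (U i) \<and> diameter (U i) \<le> \<delta>)}.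
        \<Sum>i. if U i = {} then 0 else ennreal (unit_ball_vol (real k) * (diameter (U i) / 2) ^ k))"

definition hausdorff_outer :: "nat \<Rightarrow> 'a::metric_space set \<Rightarrow> ennreal" where
  "hausdorff_outer k A = (SUP \<delta> \<in> {0<..}. hausdorff_premeasure k \<delta> A)"

definition hausdorff_measure :: "nat \<Rightarrow> 'a::metric_space measure" where
  "hausdorff_measure k = measure_of UNIV (sets borel) (hausdorff_outer k)"

definition L2_norm :: "'a measure \<Rightarrow> 'a set \<Rightarrow> ('a \<Rightarrow> 'b::real_normed_vector) \<Rightarrow> real" where
  "L2_norm M A v = sqrt (LINT x:A|M. (norm (v x))\<^sup>2)"

definition square_integrable_on ::
    "(real^'n \<Rightarrow> 'b::euclidean_space) \<Rightarrow> (real^'n) set \<Rightarrow> bool" (infix \<open>square'_integrable'_on\<close> 50) where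
  "v square_integrable_on A \<longleftrightarrow>
     set_borel_measurable lebesgue A v \<and> set_integrable lebesgue A (\<lambda>x. (norm (v x))\<^sup>2)"

definition partial_deriv :: "'n \<Rightarrow> (real^'n \<Rightarrow> real) \<Rightarrow> real^'n \<Rightarrow> real" where
  "partial_deriv i f x = frechet_derivative f (at x) (axis i 1)"

primrec C_k :: "nat \<Rightarrow> (real^'n \<Rightarrow> real) \<Rightarrow> bool" where
  "C_k 0 f \<longleftrightarrow> continuous_on UNIV f"
| "C_k (Suc k) f \<longleftrightarrow> (\<forall>x. f differentiable (at x)) \<and> (\<forall>i. C_k k (partial_deriv i f))"

definition test_functions :: "(real^'n) set \<Rightarrow> (real^'n \<Rightarrow> real) set" where
  "test_functions \<Omega> =
     {\<phi>. (\<forall>k. C_k k \<phi>) \<and> compact (closure {x. \<phi> x \<noteq> 0}) \<and> closure {x. \<phi> x \<noteq> 0} \<subseteq> \<Omega>}"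

text \<open>
  The domains \<open>A\<close> below are closed (simplices and unions of two of them); as usual, weak derivatives
  are those on the interior, and the boundary is a null set. Functions are total; their values
  outside \<open>A\<close> are irrelevant, and \<open>L\<^sup>2\<close>- and \<open>H\<^sup>1\<close>-functions are given by representatives.
\<close>

definition has_weak_gradient ::
    "(real^'n) set \<Rightarrow> (real^'n \<Rightarrow> real) \<Rightarrow> (real^'n \<Rightarrow> real^'n) \<Rightarrow> bool" where
  "has_weak_gradient A v g \<longleftrightarrow>
     (\<forall>\<phi> \<in> test_functions (interior A). \<forall>i.
        (LINT x:interior A|lebesgue. v x * partial_deriv i \<phi> x) =
        - (LINT x:interior A|lebesgue. g x $ i * \<phi> x))"

definition H1 :: "(real^'n) set \<Rightarrow> (real^'n \<Rightarrow> real) set" where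
  "H1 A = {v. v square_integrable_on A \<and> (\<exists>g. g square_integrable_on A \<and> has_weak_gradient A v g)}"

text \<open>The weak gradient of an \<open>H\<^sup>1\<close>-function, which is unique up to null sets.\<close>

definition weak_gradient :: "(real^'n) set \<Rightarrow> (real^'n \<Rightarrow> real) \<Rightarrow> real^'n \<Rightarrow> real^'n" where
  "weak_gradient A v = (SOME g. g square_integrable_on A \<and> has_weak_gradient A v g)"

definition energy_norm :: "real \<Rightarrow> (real^'n) set \<Rightarrow> (real^'n \<Rightarrow> real) \<Rightarrow> real" where
  "energy_norm \<epsilon> A v =
     sqrt ((L2_norm lebesgue A v)\<^sup>2 + \<epsilon> * (L2_norm lebesgue A (weak_gradient A v))\<^sup>2)"

definition polynomials_on :: "nat \<Rightarrow> (real^'n) set \<Rightarrow> (real^'n \<Rightarrow> real) set" where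
  "polynomials_on l K =
     {P. \<exists>c :: ('n \<Rightarrow> nat) \<Rightarrow> real. \<forall>x\<in>K.
        P x = (\<Sum>\<alpha> | sum \<alpha> UNIV \<le> l. c \<alpha> * (\<Prod>i\<in>UNIV. (x $ i) ^ \<alpha> i))}"

definition continuous_pw_polynomials ::
    "nat \<Rightarrow> (real^'n) set \<Rightarrow> (real^'n) set \<Rightarrow> (real^'n \<Rightarrow> real) set" where
  "continuous_pw_polynomials l K1 K2 =
     {P. continuous_on (K1 \<union> K2) P \<and> P \<in> polynomials_on l K1 \<and> P \<in> polynomials_on l K2}"

definition is_best_approx ::
    "real \<Rightarrow> (real^'n) set \<Rightarrow> (real^'n \<Rightarrow> real) set \<Rightarrow> (real^'n \<Rightarrow> real) \<Rightarrow> (real^'n \<Rightarrow> real) \<Rightarrow> bool" where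
  "is_best_approx \<epsilon> A V u P \<longleftrightarrow>
     P \<in> V \<and> energy_norm \<epsilon> A (\<lambda>x. u x - P x) = (INF Q\<in>V. energy_norm \<epsilon> A (\<lambda>x. u x - Q x))"

definition inball_diameter :: "(real^'n) set \<Rightarrow> real" where
  "inball_diameter K = Sup {diameter (cball a r) | a r. cball a r \<subseteq> K}"

definition shape_ratio :: "(real^'n) set \<Rightarrow> (real^'n) set \<Rightarrow> real" where
  "shape_ratio K1 K2 =
     max (diameter K1) (diameter K2) / min (inball_diameter K1) (inball_diameter K2)"

definition face_measure :: "(real^'n) measure" where
  "face_measure = hausdorff_measure (CARD('n) - 1)"

definition face_height :: "(real^'n) set \<Rightarrow> (real^'n) set \<Rightarrow> real" where
  "face_height K1 K2 =
     min (measure lebesgue K1) (measure lebesgue K2) / measure face_measure (K1 \<inter> K2)"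

end

theory Submission
  imports Defs
begin

text \<open>
  Write \<open>w\<^sub>i = u - P\<^sub>i\<close>, let \<open>h\<close> be the larger diameter and \<open>\<rho>\<close> the smaller inball diameter, and
  let \<open>\<sigma> = h / \<rho>\<close>. Constants \<open>C\<close> below depend on the degree, the dimension and \<open>\<sigma>\<close> only.

  The right-hand side is bounded by the left-hand side because \<open>P\<^sub>E\<close> is a competitor for both
  \<open>P\<^sub>i\<close>, which settles the element terms. On the face, \<open>P\<^sub>1 - P\<^sub>2 = (P\<^sub>1 - P\<^sub>E) - (P\<^sub>2 - P\<^sub>E)\<close>, and the
  value of a polynomial at a point of a convex set is bounded by its mean square there (lemma
  \<open>polynomial_point_value_bound\<close>). This bounds \<open>\<bar>P\<^sub>i - P\<^sub>E\<bar>\<^sup>2\<close> on \<open>E\<close> by \<open>C \<parallel>P\<^sub>i - P\<^sub>E\<parallel>\<^sup>2 / \<bar>K\<^sub>i\<bar>\<close>, and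
  \<open>h\<^sub>E \<bar>E\<bar> \<le> \<bar>K\<^sub>i\<bar>\<close> cancels the volume (lemma \<open>lower_estimate\<close>).

  For the converse, let \<open>\<pi>\<close> be the orthogonal projection onto the plane of \<open>E\<close> and put
  \<open>J = (P\<^sub>2 - P\<^sub>1) \<circ> \<pi>\<close>. The function that is \<open>P\<^sub>1\<close> on \<open>K\<^sub>1\<close> and \<open>P\<^sub>2 - J\<close> on \<open>K\<^sub>2\<close> is continuous, so
  it competes with \<open>P\<^sub>E\<close>, and it remains to bound \<open>\<parallel>J\<parallel>\<^sup>2 + \<epsilon> \<parallel>\<nabla>J\<parallel>\<^sup>2\<close> on \<open>K\<^sub>2\<close>. Everywhere on \<open>K\<^sub>2\<close>
  the polynomial \<open>J\<close> is controlled by the values of \<open>P\<^sub>2 - P\<^sub>1\<close> on a small disc in \<open>E\<close> around the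
  barycentre of \<open>E\<close> (lemma \<open>polynomial_extrapolation\<close>), hence by the mean square of \<open>P\<^sub>2 - P\<^sub>1\<close>
  over \<open>E\<close>. This gives \<open>\<parallel>J\<parallel>\<^sup>2 \<le> C h\<^sub>E \<parallel>P\<^sub>1 - P\<^sub>2\<parallel>\<^sub>E\<^sup>2\<close>. An inverse estimate would then only give
  \<open>\<epsilon> \<parallel>\<nabla>J\<parallel>\<^sup>2 \<le> C \<epsilon> h\<^sup>-\<^sup>2 \<parallel>J\<parallel>\<^sup>2\<close>, which is useless when \<open>\<epsilon>\<close> is large compared with \<open>h\<^sup>2\<close>.

  Robustness in \<open>\<epsilon>\<close> comes from a second bound of the jump, by the gradients of the \<open>w\<^sub>i\<close> alone. A
  ball around the barycentre of \<open>E\<close> whose radius is a multiple of \<open>\<rho>\<close> lies in the union (lemma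
  \<open>adjacent_simplices_ball\<close>). A function in \<open>H\<^sup>1\<close> of that ball does not jump at the face: a
  translation across the face changes it, in the mean square, by at most the length of the
  translation times its gradient (lemma \<open>difference_quotient_bound\<close>). Applied to \<open>u\<close> minus the
  competitor, this bounds \<open>J\<close> on a half ball by \<open>C (\<parallel>w\<^sub>1\<parallel> + \<parallel>w\<^sub>2\<parallel> + h \<parallel>\<nabla>w\<^sub>1\<parallel> + h \<parallel>\<nabla>w\<^sub>2\<parallel>)\<close> (lemma
  \<open>jump_half_ball\<close>). Moreover \<open>P\<^sub>i\<close> is at least as good as \<open>P\<^sub>i + c\<close> for constants \<open>c\<close>, which have
  no gradient, so a Poincare inequality gives \<open>\<parallel>w\<^sub>i\<parallel> \<le> C h \<parallel>\<nabla>w\<^sub>i\<parallel>\<close> (lemmas \<open>Poincare_convex\<close> and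
  \<open>residual_Poincare\<close>). Together, \<open>h\<^sup>-\<^sup>2 \<parallel>J\<parallel>\<^sup>2 \<le> C (\<parallel>\<nabla>w\<^sub>1\<parallel>\<^sup>2 + \<parallel>\<nabla>w\<^sub>2\<parallel>\<^sup>2)\<close>, and \<open>\<epsilon> \<parallel>\<nabla>J\<parallel>\<^sup>2\<close> is absorbed by
  the element terms (lemma \<open>upper_estimate\<close>).

  The polynomial estimates all come from Lagrange interpolation on lines. Of the Hausdorff
  measure three properties enter: it is a Borel measure, it scales under homotheties, and it is
  positive and finite on the face. Weak gradients are treated by duality with test functions,
  which are dense in \<open>L\<^sup>2\<close>.
\<close>

section \<open>Hausdorff outer measures are Borel measures\<close>

definition hausdorff_weight :: "nat \<Rightarrow> 'a::metric_space set \<Rightarrow> ennreal" where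
  "hausdorff_weight k U =
     (if U = {} then 0 else ennreal (unit_ball_vol (real k) * (diameter U / 2) ^ k))"

lemma hausdorff_premeasure_eq:
  "hausdorff_premeasure k \<delta> A =
     (INF U \<in> {U :: nat \<Rightarrow> 'a::metric_space set.
        A \<subseteq> (\<Union>i. U i) \<and> (\<forall>i. bounded (U i) \<and> diameter (U i) \<le> \<delta>)}.
        \<Sum>i. hausdorff_weight k (U i))"
  unfolding hausdorff_premeasure_def hausdorff_weight_def ..

lemma hausdorff_weight_empty [simp]: "hausdorff_weight k {} = 0"
  by (simp add: hausdorff_weight_def)

lemma hausdorff_weight_mono:
  assumes "U \<subseteq> V" "bounded V"
  shows "hausdorff_weight k U \<le> hausdorff_weight k V"
proof -
  have "diameter U \<le> diameter V" "0 \<le> diameter U"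
    using assms by (auto intro: diameter_subset diameter_ge_0 bounded_subset)
  then show ?thesis
    using assms unfolding hausdorff_weight_def
    by (auto intro!: ennreal_leI mult_left_mono power_mono)
qed

lemma hausdorff_premeasure_le:
  assumes "A \<subseteq> (\<Union>i. U i)" "\<And>i. bounded (U i)" "\<And>i. diameter (U i) \<le> \<delta>"
  shows "hausdorff_premeasure k \<delta> A \<le> (\<Sum>i. hausdorff_weight k (U i))"
  unfolding hausdorff_premeasure_eq using assms by (intro INF_lower) auto

lemma hausdorff_premeasure_ge:
  assumes "\<And>U. A \<subseteq> (\<Union>i. U i) \<Longrightarrow> (\<And>i. bounded (U i)) \<Longrightarrow> (\<And>i. diameter (U i) \<le> \<delta>)
     \<Longrightarrow> b \<le> (\<Sum>i. hausdorff_weight k (U i))"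
  shows "b \<le> hausdorff_premeasure k \<delta> A"
  unfolding hausdorff_premeasure_eq using assms by (intro INF_greatest) auto

lemma hausdorff_premeasure_mono:
  "A \<subseteq> B \<Longrightarrow> hausdorff_premeasure k \<delta> A \<le> hausdorff_premeasure k \<delta> B"
  by (rule hausdorff_premeasure_ge, rule hausdorff_premeasure_le) auto

lemma hausdorff_premeasure_antimono:
  assumes "\<delta> \<le> \<delta>'"
  shows "hausdorff_premeasure k \<delta>' A \<le> hausdorff_premeasure k \<delta> A"
proof (rule hausdorff_premeasure_ge)
  fix U :: "nat \<Rightarrow> 'a set"
  assume U: "A \<subseteq> (\<Union>i. U i)" "\<And>i. bounded (U i)" "\<And>i. diameter (U i) \<le> \<delta>"
  show "hausdorff_premeasure k \<delta>' A \<le> (\<Sum>i. hausdorff_weight k (U i))"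
    using U(1,2) order_trans[OF U(3) assms] by (rule hausdorff_premeasure_le)
qed

lemma hausdorff_premeasure_empty: "0 \<le> \<delta> \<Longrightarrow> hausdorff_premeasure k \<delta> {} = 0"
  using hausdorff_premeasure_le[of "{}" "\<lambda>_. {}" \<delta> k] by simp

lemma hausdorff_premeasure_le_weight:
  assumes "bounded A" "diameter A \<le> \<delta>" "0 \<le> \<delta>"
  shows "hausdorff_premeasure k \<delta> A \<le> hausdorff_weight k A"
proof -
  have "hausdorff_premeasure k \<delta> A \<le> (\<Sum>i. hausdorff_weight k (if i = 0 then A else {}))"
    using assms by (intro hausdorff_premeasure_le) (auto split: if_splits)
  also have "\<dots> = hausdorff_weight k A"
    by (subst suminf_finite[of "{0}"]) auto
  finally show ?thesis .
qed

text \<open>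
  Covers of the individual sets that are optimal up to \<open>e / 2 ^ (n + 1)\<close> combine to one cover of
  the union.
\<close>

lemma hausdorff_premeasure_subadditive:
  fixes A :: "nat \<Rightarrow> 'a::metric_space set"
  shows "hausdorff_premeasure k \<delta> (\<Union>i. A i) \<le> (\<Sum>i. hausdorff_premeasure k \<delta> (A i))"
proof (rule ennreal_le_epsilon)
  let ?O = "hausdorff_premeasure k \<delta>"
  fix e :: real assume e: "0 < e" and fin: "(\<Sum>n. ?O (A n)) < top"
  have ex: "\<exists>U. A n \<subseteq> (\<Union>i. U i) \<and> (\<forall>i. bounded (U i) \<and> diameter (U i) \<le> \<delta>) \<and>
      (\<Sum>i. hausdorff_weight k (U i)) \<le> ?O (A n) + e * (1/2)^Suc n" for n
  proof -
    have "?O (A n) \<noteq> \<infinity>"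
      using ennreal_suminf_lessD[OF fin, of n] by auto
    then have "\<exists>i\<in>{U :: nat \<Rightarrow> 'a set.
        A n \<subseteq> (\<Union>i. U i) \<and> (\<forall>i. bounded (U i) \<and> diameter (U i) \<le> \<delta>)}.
        (\<Sum>j. hausdorff_weight k (i j)) < ?O (A n) + ennreal (e * (1/2)^Suc n)"
      using e by (intro INF_approx_ennreal) (auto simp: hausdorff_premeasure_eq)
    then show ?thesis
      using less_imp_le by (auto simp del: power_Suc)
  qed
  then obtain B where B: "\<And>n. A n \<subseteq> (\<Union>i. B n i)"
      "\<And>n i. bounded (B n i)" "\<And>n i. diameter (B n i) \<le> \<delta>"
      "\<And>n. (\<Sum>i. hausdorff_weight k (B n i)) \<le> ?O (A n) + e * (1/2)^Suc n"
    by metis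
  define C where "C = case_prod B o prod_decode"
  have A_C: "(\<Union>i. A i) \<subseteq> (\<Union>i. C i)"
    using B(1) by (auto simp add: C_def subset_eq) (metis prod.case prod_encode_inverse)
  have "?O (\<Union>i. A i) \<le> (\<Sum>i. hausdorff_weight k (C i))"
    using A_C B(2,3) by (intro hausdorff_premeasure_le) (auto simp: C_def split_beta)
  also have "\<dots> = (\<Sum>n. \<Sum>i. hausdorff_weight k (B n i))"
    unfolding C_def comp_def by (intro suminf_ennreal_2dimen) auto
  also have "\<dots> \<le> (\<Sum>n. ?O (A n) + e * (1/2) ^ Suc n)"
    using B(4) by (intro suminf_le) auto
  also have "... = (\<Sum>n. ?O (A n)) + (\<Sum>n. ennreal e * ennreal ((1/2) ^ Suc n))"
    using \<open>0 < e\<close> by (subst suminf_add[symmetric])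
      (auto simp del: ennreal_suminf_cmult simp add: ennreal_mult[symmetric])
  also have "\<dots> = (\<Sum>n. ?O (A n)) + e"
    unfolding ennreal_suminf_cmult
    by (subst suminf_ennreal_eq[OF zero_le_power power_half_series]) auto
  finally show "?O (\<Union>i. A i) \<le> (\<Sum>n. ?O (A n)) + e" .
qed

lemma hausdorff_premeasure_finite_subadditive:
  fixes A :: "'i \<Rightarrow> 'a::metric_space set"
  assumes "finite I" "0 \<le> \<delta>"
  shows "hausdorff_premeasure k \<delta> (\<Union>i\<in>I. A i) \<le> (\<Sum>i\<in>I. hausdorff_premeasure k \<delta> (A i))"
proof -
  obtain f where f: "bij_betw f {..<card I} I"
    using \<open>finite I\<close> bij_betw_from_nat_into_finite by blast
  have "(\<Union>i\<in>I. A i) = (\<Union>j. if j < card I then A (f j) else {})"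
    using f by (force simp: bij_betw_def)
  also have "hausdorff_premeasure k \<delta> \<dots> \<le>
      (\<Sum>j. hausdorff_premeasure k \<delta> (if j < card I then A (f j) else {}))"
    by (rule hausdorff_premeasure_subadditive)
  also have "\<dots> = (\<Sum>j<card I. hausdorff_premeasure k \<delta> (A (f j)))"
    using assms by (subst suminf_finite[of "{..<card I}"]) (auto simp: hausdorff_premeasure_empty)
  also have "\<dots> = (\<Sum>i\<in>I. hausdorff_premeasure k \<delta> (A i))"
    using f by (rule sum.reindex_bij_betw)
  finally show ?thesis .
qed

text \<open>
  A covering set of diameter at most \<open>\<delta>\<close> cannot meet two sets whose distance exceeds \<open>\<delta>\<close>, so
  every cover of the union splits into a cover of \<open>A\<close> and one of \<open>B\<close>.
\<close>

lemma hausdorff_premeasure_separated: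
  fixes A B :: "'a::metric_space set"
  assumes sep: "\<And>x y. x \<in> A \<Longrightarrow> y \<in> B \<Longrightarrow> \<delta> < dist x y"
  shows "hausdorff_premeasure k \<delta> A + hausdorff_premeasure k \<delta> B \<le> hausdorff_premeasure k \<delta> (A \<union> B)"
proof (rule hausdorff_premeasure_ge)
  fix U :: "nat \<Rightarrow> 'a set"
  assume U: "A \<union> B \<subseteq> (\<Union>i. U i)" "\<And>i. bounded (U i)" "\<And>i. diameter (U i) \<le> \<delta>"
  have bd: "diameter (U i \<inter> S) \<le> \<delta>" for i S
    using U(2,3) diameter_subset[of "U i \<inter> S" "U i"] by (meson inf_le1 order_trans)
  have "hausdorff_premeasure k \<delta> S \<le> (\<Sum>i. hausdorff_weight k (U i \<inter> S))" if "S \<subseteq> A \<union> B" for S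
    using U that bd by (intro hausdorff_premeasure_le) (auto intro: bounded_subset)
  then have "hausdorff_premeasure k \<delta> A + hausdorff_premeasure k \<delta> B \<le>
      (\<Sum>i. hausdorff_weight k (U i \<inter> A)) + (\<Sum>i. hausdorff_weight k (U i \<inter> B))"
    by (intro add_mono) auto
  also have "\<dots> = (\<Sum>i. hausdorff_weight k (U i \<inter> A) + hausdorff_weight k (U i \<inter> B))"
    by (rule suminf_add) auto
  also have "\<dots> \<le> (\<Sum>i. hausdorff_weight k (U i))"
  proof (rule suminf_le)
    fix i
    have "U i \<inter> A = {} \<or> U i \<inter> B = {}"
    proof (rule ccontr)
      assume "\<not> ?thesis"
      then obtain x y where "x \<in> U i" "x \<in> A" "y \<in> U i" "y \<in> B" by blast
      then show False
        using sep[of x y] diameter_bounded_bound[OF U(2)[of i], of x y] U(3)[of i] by linarith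
    qed
    then show "hausdorff_weight k (U i \<inter> A) + hausdorff_weight k (U i \<inter> B) \<le> hausdorff_weight k (U i)"
      using U(2)[of i] hausdorff_weight_mono[of "U i \<inter> A" "U i" k]
        hausdorff_weight_mono[of "U i \<inter> B" "U i" k] by auto
  qed auto
  finally show "hausdorff_premeasure k \<delta> A + hausdorff_premeasure k \<delta> B \<le> (\<Sum>i. hausdorff_weight k (U i))" .
qed

lemma hausdorff_premeasure_le_outer:
  "0 < \<delta> \<Longrightarrow> hausdorff_premeasure k \<delta> A \<le> hausdorff_outer k A"
  unfolding hausdorff_outer_def by (intro SUP_upper) auto

lemma hausdorff_outer_le:
  "(\<And>\<delta>. 0 < \<delta> \<Longrightarrow> hausdorff_premeasure k \<delta> A \<le> b) \<Longrightarrow> hausdorff_outer k A \<le> b"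
  unfolding hausdorff_outer_def by (intro SUP_least) auto

lemma hausdorff_outer_mono:
  assumes "A \<subseteq> B"
  shows "hausdorff_outer k A \<le> hausdorff_outer k B"
proof (rule hausdorff_outer_le)
  fix \<delta> :: real assume "0 < \<delta>"
  then show "hausdorff_premeasure k \<delta> A \<le> hausdorff_outer k B"
    by (rule order_trans[OF hausdorff_premeasure_mono[OF assms] hausdorff_premeasure_le_outer])
qed

lemma hausdorff_outer_empty [simp]: "hausdorff_outer k {} = 0"
  by (rule antisym[OF hausdorff_outer_le]) (simp_all add: hausdorff_premeasure_empty)

lemma hausdorff_outer_subadditive: "hausdorff_outer k (\<Union>i. A i) \<le> (\<Sum>i::nat. hausdorff_outer k (A i))"
proof (rule hausdorff_outer_le)
  fix \<delta> :: real assume "0 < \<delta>"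
  then show "hausdorff_premeasure k \<delta> (\<Union>i. A i) \<le> (\<Sum>i. hausdorff_outer k (A i))"
    by (intro order_trans[OF hausdorff_premeasure_subadditive] suminf_le
        hausdorff_premeasure_le_outer) auto
qed

lemma hausdorff_outer_space: "outer_measure_space (Pow UNIV) (hausdorff_outer k)"
  unfolding outer_measure_space_def positive_def increasing_def countably_subadditive_def
  by (simp add: hausdorff_outer_mono hausdorff_outer_subadditive)

lemma hausdorff_outer_Un_le: "hausdorff_outer k (A \<union> B) \<le> hausdorff_outer k A + hausdorff_outer k B"
proof -
  define F where "F i = (if i = 0 then A else if i = (1::nat) then B else {})" for i
  have "A \<union> B = F 0 \<union> F 1" by (simp add: F_def)
  also have "\<dots> \<subseteq> (\<Union>i. F i)" by blast
  finally have "hausdorff_outer k (A \<union> B) \<le> (\<Sum>i. hausdorff_outer k (F i))"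
    by (rule order_trans[OF hausdorff_outer_mono hausdorff_outer_subadditive])
  also have "\<dots> = (\<Sum>i\<in>{0, 1}. hausdorff_outer k (F i))"
    by (rule suminf_finite) (simp_all add: F_def)
  finally show ?thesis by (simp add: F_def)
qed

lemma hausdorff_outer_separated:
  fixes A B :: "'a::metric_space set"
  assumes d: "0 < d" and sep: "\<And>x y. x \<in> A \<Longrightarrow> y \<in> B \<Longrightarrow> d \<le> dist x y"
  shows "hausdorff_outer k A + hausdorff_outer k B \<le> hausdorff_outer k (A \<union> B)"
proof -
  have *: "hausdorff_premeasure k \<delta> A + hausdorff_premeasure k \<delta>' B \<le> hausdorff_outer k (A \<union> B)"
    if "0 < \<delta>" "0 < \<delta>'" for \<delta> \<delta>'
  proof -
    define \<eta> where "\<eta> = min (d/2) (min \<delta> \<delta>')"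
    have \<eta>: "0 < \<eta>" "\<eta> \<le> \<delta>" "\<eta> \<le> \<delta>'" "\<eta> < d"
      using that d by (auto simp: \<eta>_def)
    have "hausdorff_premeasure k \<delta> A + hausdorff_premeasure k \<delta>' B
        \<le> hausdorff_premeasure k \<eta> A + hausdorff_premeasure k \<eta> B"
      by (intro add_mono hausdorff_premeasure_antimono \<eta>)
    also have "\<dots> \<le> hausdorff_premeasure k \<eta> (A \<union> B)"
      using sep \<eta> by (intro hausdorff_premeasure_separated) fastforce
    also have "\<dots> \<le> hausdorff_outer k (A \<union> B)"
      using \<eta> by (intro hausdorff_premeasure_le_outer)
    finally show ?thesis .
  qed
  have "hausdorff_outer k A + hausdorff_premeasure k \<delta>' B \<le> hausdorff_outer k (A \<union> B)"
    if "0 < \<delta>'" for \<delta>'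
    unfolding hausdorff_outer_def[of k A]
    by (subst ennreal_SUP_add_left[symmetric]) (auto intro!: SUP_least * that)
  then show ?thesis
    unfolding hausdorff_outer_def[of k B]
    by (subst ennreal_SUP_add_right) (auto intro!: SUP_least)
qed

lemma ennreal_add_left_imp_le: "a \<noteq> top \<Longrightarrow> a + b \<le> a + c \<Longrightarrow> b \<le> (c::ennreal)"
  using ennreal_add_left_cancel_le[of a b c] by (simp add: infinity_ennreal_def)

text \<open>
  Caratheodory's criterion for metric outer measures: it follows from additivity on separated
  sets (lemma \<open>hausdorff_outer_separated\<close>). The points of \<open>X\<close> at distance at least \<open>1 / (n + 1)\<close>
  from \<open>C\<close> form a set \<open>A n\<close> that is separated from \<open>X \<inter> C\<close>; what \<open>A n\<close> misses in \<open>X - C\<close> lies in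
  the rings \<open>R j\<close> with \<open>j \<ge> n\<close>, whose measures have a finite sum.
\<close>

lemma closed_in_hausdorff_lambda_system:
  fixes C :: "'a::metric_space set"
  assumes C: "closed C"
  shows "C \<in> lambda_system UNIV (Pow UNIV) (hausdorff_outer k)"
proof (cases "C = {}")
  case True
  then show ?thesis by (simp add: lambda_system_def)
next
  case False
  let ?\<mu> = "hausdorff_outer k"
  have main: "?\<mu> (X \<inter> C) + ?\<mu> (X - C) \<le> ?\<mu> X" for X
  proof (cases "?\<mu> X = top")
    case True
    then show ?thesis by simp
  next
    case fin: False
    define A where "A n = {x \<in> X. 1 / real (Suc n) \<le> infdist x C}" for n
    define R where "R n = A (Suc n) - A n" for n
    have A_mono: "A m \<subseteq> A n" if "m \<le> n" for m n
    proof -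
      have "1 / real (Suc n) \<le> 1 / real (Suc m)"
        using that by (simp add: frac_le)
      then show ?thesis by (auto simp: A_def)
    qed
    have R_lt: "infdist x C < 1 / real (Suc n)" if "x \<in> R n" for x n
      using that by (auto simp: R_def A_def)
    have R_ge: "1 / real (Suc (Suc n)) \<le> infdist x C" if "x \<in> R n" for x n
      using that by (auto simp: R_def A_def)
    have infdist_gap: "infdist x C - infdist y C \<le> dist x y" for x y
      using infdist_triangle[of x C y] by simp
    \<comment> \<open>Rings two steps apart have positive distance, so the rings of one parity add up.\<close>
    have parity: "(\<Sum>j<N. ?\<mu> (R (2 * j + b))) \<le> ?\<mu> (X \<inter> (\<Union>j<N. R (2 * j + b)))" for N b
    proof (induction N)
      case (Suc N)
      let ?P = "X \<inter> (\<Union>j<N. R (2 * j + b))" and ?Q = "R (2 * N + b)"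
      have "?\<mu> ?P + ?\<mu> ?Q \<le> ?\<mu> (?P \<union> ?Q)"
      proof (cases "N = 0")
        case False
        define d where "d = 1 / real (2 * N + b) - 1 / real (2 * N + b + 1)"
        show ?thesis
        proof (rule hausdorff_outer_separated)
          show "0 < d" using False by (simp add: d_def frac_less2)
          fix x y assume "x \<in> ?P" "y \<in> ?Q"
          then obtain j where j: "j < N" "x \<in> R (2 * j + b)" by auto
          have "real (Suc (Suc (2 * j + b))) \<le> real (2 * N + b)"
            using j(1) by linarith
          then have "1 / real (2 * N + b) \<le> 1 / real (Suc (Suc (2 * j + b)))"
            by (intro divide_left_mono) auto
          also have "\<dots> \<le> infdist x C" using R_ge[OF j(2)] .
          finally have "1 / real (2 * N + b) \<le> infdist x C" .
          moreover have "infdist y C < 1 / real (Suc (2 * N + b))"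
            using \<open>y \<in> ?Q\<close> by (rule R_lt)
          ultimately show "d \<le> dist x y"
            using infdist_gap[of x y] by (simp add: d_def)
        qed
      qed auto
      also have "?P \<union> ?Q = X \<inter> (\<Union>j<Suc N. R (2 * j + b))"
        by (auto simp: lessThan_Suc R_def A_def)
      finally have "?\<mu> ?P + ?\<mu> ?Q \<le> ?\<mu> (X \<inter> (\<Union>j<Suc N. R (2 * j + b)))" .
      then have "(\<Sum>j<N. ?\<mu> (R (2 * j + b))) + ?\<mu> ?Q \<le> ?\<mu> (X \<inter> (\<Union>j<Suc N. R (2 * j + b)))"
        by (rule order_trans[OF add_right_mono[OF Suc.IH]])
      then show ?case by simp
    qed simp
    have parity': "(\<Sum>j<N. ?\<mu> (R (2 * j + b))) \<le> ?\<mu> X" for N b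
      by (rule order_trans[OF parity hausdorff_outer_mono]) auto
    have sum_le: "(\<Sum>j<2 * N. ?\<mu> (R j)) \<le> 2 * ?\<mu> X" for N
    proof -
      have "(\<Sum>j<2 * N. ?\<mu> (R j)) = (\<Sum>j<N. ?\<mu> (R (2 * j + 0))) + (\<Sum>j<N. ?\<mu> (R (2 * j + 1)))"
        by (induction N) (auto simp: algebra_simps)
      also have "\<dots> \<le> ?\<mu> X + ?\<mu> X"
        by (intro add_mono parity')
      finally show ?thesis by (simp add: mult_2)
    qed
    define S where "S = (\<Sum>j. ?\<mu> (R j))"
    have "S \<le> 2 * ?\<mu> X"
      unfolding S_def
    proof (rule suminf_le_const[OF summableI])
      fix n
      have "(\<Sum>j<n. ?\<mu> (R j)) \<le> (\<Sum>j<2 * n. ?\<mu> (R j))"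
        by (intro sum_mono2) auto
      then show "(\<Sum>j<n. ?\<mu> (R j)) \<le> 2 * ?\<mu> X"
        using sum_le[of n] by (rule order_trans)
    qed
    then have S_fin: "S < top"
      using fin by (simp add: ennreal_mult_less_top less_top order_le_less_trans)
    have decomp: "X - C \<subseteq> A n \<union> (\<Union>j. R (j + n))" for n
    proof
      fix x assume x: "x \<in> X - C"
      then have pos: "0 < infdist x C"
        using C False by (simp add: infdist_pos_not_in_closed)
      then obtain m where "1 / real (Suc m) < infdist x C"
        using reals_Archimedean by (metis inverse_eq_divide)
      then have xm: "x \<in> A m" using x by (auto simp: A_def)
      show "x \<in> A n \<union> (\<Union>j. R (j + n))"
      proof (rule ccontr)
        assume neg: "x \<notin> A n \<union> (\<Union>j. R (j + n))"
        have "x \<notin> A (n + j)" for j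
          using neg by (induction j) (auto simp: R_def add.commute)
        then show False using xm A_mono[of m "n + m"] by auto
      qed
    qed
    show ?thesis
    proof (rule ennreal_le_epsilon)
      fix e :: real assume e: "0 < e"
      obtain n where n: "S \<le> (\<Sum>j<n. ?\<mu> (R j)) + ennreal e"
      proof (cases "S = 0")
        case False
        obtain s where s: "S = ennreal s" "0 \<le> s"
          using S_fin by (cases S) auto
        have "(\<lambda>n. \<Sum>j<n. ?\<mu> (R j)) \<longlonglongrightarrow> S"
          unfolding S_def by (intro summable_LIMSEQ summableI)
        moreover have "ennreal (s - e) < S"
          using e s False by (auto simp: ennreal_less_iff ennreal_lessI)
        ultimately have "eventually (\<lambda>n. ennreal (s - e) < (\<Sum>j<n. ?\<mu> (R j))) sequentially"
          by (rule order_tendstoD)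
        then obtain n where n: "ennreal (s - e) < (\<Sum>j<n. ?\<mu> (R j))"
          using eventually_happens'[OF sequentially_bot] by blast
        have "S = ennreal (s - e + e)" using s by simp
        also have "\<dots> \<le> ennreal (s - e) + ennreal e"
          using e by (cases "0 \<le> s - e") (simp_all add: ennreal_plus[symmetric] ennreal_neg ennreal_leI del: ennreal_plus)
        also have "\<dots> \<le> (\<Sum>j<n. ?\<mu> (R j)) + ennreal e"
          using n by (intro add_right_mono) simp
        finally show ?thesis by (rule that)
      qed auto
      have "(\<Sum>j<n. ?\<mu> (R j)) + (\<Sum>j. ?\<mu> (R (j + n))) = S"
        unfolding S_def by (subst suminf_offset[where i=n, OF summableI]) (simp add: add.commute)
      then have "(\<Sum>j<n. ?\<mu> (R j)) + (\<Sum>j. ?\<mu> (R (j + n))) \<le> (\<Sum>j<n. ?\<mu> (R j)) + ennreal e"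
        using n by simp
      moreover have "(\<Sum>j<n. ?\<mu> (R j)) \<le> S"
        unfolding S_def by (rule sum_le_suminf) auto
      then have "(\<Sum>j<n. ?\<mu> (R j)) \<noteq> top"
        using S_fin by (metis leD)
      ultimately have tail: "(\<Sum>j. ?\<mu> (R (j + n))) \<le> ennreal e"
        by (rule ennreal_add_left_imp_le[rotated])
      have sep: "?\<mu> (X \<inter> C) + ?\<mu> (A n) \<le> ?\<mu> (X \<inter> C \<union> A n)"
      proof (rule hausdorff_outer_separated)
        show "0 < 1 / real (Suc n)" by simp
        fix x y assume "x \<in> X \<inter> C" "y \<in> A n"
        then show "1 / real (Suc n) \<le> dist x y"
          using infdist_le[of x C y] by (auto simp: A_def dist_commute)
      qed
      have "?\<mu> (X - C) \<le> ?\<mu> (A n) + ?\<mu> (\<Union>j. R (j + n))"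
        by (rule order_trans[OF hausdorff_outer_mono[OF decomp] hausdorff_outer_Un_le])
      also have "\<dots> \<le> ?\<mu> (A n) + ennreal e"
        by (intro add_left_mono order_trans[OF hausdorff_outer_subadditive tail])
      finally have "?\<mu> (X \<inter> C) + ?\<mu> (X - C) \<le> (?\<mu> (X \<inter> C) + ?\<mu> (A n)) + ennreal e"
        unfolding add.assoc by (rule add_left_mono)
      also have "\<dots> \<le> ?\<mu> (X \<inter> C \<union> A n) + ennreal e"
        by (intro add_right_mono sep)
      also have "\<dots> \<le> ?\<mu> X + ennreal e"
        by (intro add_right_mono hausdorff_outer_mono) (auto simp: A_def)
      finally show "?\<mu> (X \<inter> C) + ?\<mu> (X - C) \<le> ?\<mu> X + ennreal e" .
    qed
  qed
  show ?thesis
  proof (clarsimp simp: lambda_system_def)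
    fix X
    have "?\<mu> X = ?\<mu> ((X \<inter> C) \<union> (X - C))" by (simp add: Int_Diff_Un)
    also have "\<dots> \<le> ?\<mu> (X \<inter> C) + ?\<mu> (X - C)" by (rule hausdorff_outer_Un_le)
    finally have "?\<mu> (X \<inter> C) + ?\<mu> (X - C) = ?\<mu> X"
      using main[of X] by (rule antisym[rotated])
    moreover have "C \<inter> X = X \<inter> C" "(UNIV - C) \<inter> X = X - C" by auto
    ultimately show "?\<mu> (C \<inter> X) + ?\<mu> ((UNIV - C) \<inter> X) = ?\<mu> X" by simp
  qed
qed

lemma sets_hausdorff_measure [measurable_cong]: "sets (hausdorff_measure k) = sets borel"
  unfolding hausdorff_measure_def
  by (metis Pow_UNIV sets.sigma_sets_eq sets_measure_of space_borel subset_UNIV)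

text \<open>
  A measure given by \<^const>\<open>measure_of\<close> is the null measure unless the set function is countably
  additive on the sigma algebra; Caratheodory's theorem provides this for the Borel sets.
\<close>

lemma emeasure_hausdorff_measure:
  fixes A :: "'a::metric_space set"
  assumes A: "A \<in> sets borel"
  shows "emeasure (hausdorff_measure k) A = hausdorff_outer k A"
proof -
  interpret sigma_algebra "UNIV :: 'a set" "Pow UNIV" by (rule sigma_algebra_Pow)
  let ?L = "lambda_system UNIV (Pow (UNIV :: 'a set)) (hausdorff_outer k)"
  have ms: "measure_space UNIV ?L (hausdorff_outer k)"
    by (rule caratheodory_lemma[OF hausdorff_outer_space])
  then interpret L: sigma_algebra UNIV ?L by (simp add: measure_space_def)
  have sub: "sets borel \<subseteq> ?L"
    unfolding borel_eq_closed
    using L.sigma_sets_subset[of "Collect closed"] closed_in_hausdorff_lambda_system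
    by (auto simp: subset_iff)
  show ?thesis
  proof (rule emeasure_measure_of[OF hausdorff_measure_def])
    show "positive (sets (hausdorff_measure k)) (hausdorff_outer k :: 'a set \<Rightarrow> ennreal)"
      by (simp add: positive_def)
    show "sets borel \<subseteq> Pow (UNIV :: 'a set)" by simp
    show "A \<in> sets (hausdorff_measure k)" unfolding sets_hausdorff_measure by (rule A)
    show "countably_additive (sets (hausdorff_measure k)) (hausdorff_outer k :: 'a set \<Rightarrow> ennreal)"
      unfolding countably_additive_def sets_hausdorff_measure
    proof (intro allI impI)
      fix A :: "nat \<Rightarrow> 'a set"
      assume "range A \<subseteq> sets borel" "disjoint_family A" "\<Union> (range A) \<in> sets borel"
      moreover from this have "range A \<subseteq> ?L" "\<Union> (range A) \<in> ?L"
        using sub by auto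
      ultimately show "(\<Sum>i. hausdorff_outer k (A i)) = hausdorff_outer k (\<Union> (range A))"
        using ms by (auto simp: measure_space_def countably_additive_def)
    qed
  qed
qed

section \<open>The Hausdorff measure of a flat set is finite and positive\<close>

text \<open>
  The images of a cover by sets of diameter at most \<open>\<delta> / L\<close> form a cover by sets of diameter at
  most \<open>\<delta>\<close>.
\<close>

lemma hausdorff_outer_Lipschitz_image:
  fixes f :: "'a::metric_space \<Rightarrow> 'b::real_normed_vector"
  assumes L: "0 < L" and lip: "\<And>x y. x \<in> A \<Longrightarrow> y \<in> A \<Longrightarrow> dist (f x) (f y) \<le> L * dist x y"
  shows "hausdorff_outer k (f ` A) \<le> ennreal (L ^ k) * hausdorff_outer k A"
proof (rule hausdorff_outer_le)
  fix \<delta> :: real assume \<delta>: "0 < \<delta>"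
  have "ennreal ((1 / L) ^ k) * hausdorff_premeasure k \<delta> (f ` A) \<le> hausdorff_premeasure k (\<delta> / L) A"
  proof (rule hausdorff_premeasure_ge)
    fix U :: "nat \<Rightarrow> 'a set"
    assume U: "A \<subseteq> (\<Union>i. U i)" "\<And>i. bounded (U i)" "\<And>i. diameter (U i) \<le> \<delta> / L"
    define V where "V i = f ` (U i \<inter> A)" for i
    have dist_V: "dist u v \<le> L * diameter (U i)" if uv: "u \<in> V i" "v \<in> V i" for u v i
    proof -
      obtain x y where xy: "x \<in> U i \<inter> A" "y \<in> U i \<inter> A" "u = f x" "v = f y"
        using uv unfolding V_def by blast
      have "dist u v \<le> L * dist x y" using lip xy by auto
      also have "\<dots> \<le> L * diameter (U i)"
        using xy L U(2) by (intro mult_left_mono diameter_bounded_bound) auto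
      finally show ?thesis .
    qed
    have diam_V: "diameter (V i) \<le> L * diameter (U i)" for i
      using dist_V L U(2) by (intro diameter_le) (auto simp: dist_norm diameter_ge_0)
    have bdd_V: "bounded (V i)" for i
      using dist_V unfolding bounded_two_points by blast
    have weight: "hausdorff_weight k (V i) \<le> ennreal (L ^ k) * hausdorff_weight k (U i)" for i
    proof (cases "V i = {}")
      case False
      have "unit_ball_vol (real k) * (diameter (V i) / 2) ^ k
          \<le> unit_ball_vol (real k) * (L * diameter (U i) / 2) ^ k"
        using diam_V bdd_V by (intro mult_left_mono power_mono divide_right_mono) (auto simp: diameter_ge_0)
      also have "\<dots> = L ^ k * (unit_ball_vol (real k) * (diameter (U i) / 2) ^ k)"
        by (simp add: power_mult_distrib power_divide)
      finally show ?thesis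
        using False L U(2)[of i] unfolding hausdorff_weight_def
        by (auto simp: V_def ennreal_mult[symmetric] diameter_ge_0 intro!: ennreal_leI)
    qed simp
    have "hausdorff_premeasure k \<delta> (f ` A) \<le> (\<Sum>i. hausdorff_weight k (V i))"
    proof (rule hausdorff_premeasure_le)
      show "f ` A \<subseteq> (\<Union>i. V i)" using U(1) unfolding V_def by blast
      show "diameter (V i) \<le> \<delta>" for i
        using diam_V[of i] U(3)[of i] L by (simp add: pos_le_divide_eq mult.commute)
    qed (rule bdd_V)
    also have "\<dots> \<le> (\<Sum>i. ennreal (L ^ k) * hausdorff_weight k (U i))"
      by (intro suminf_le weight) auto
    also have "\<dots> = ennreal (L ^ k) * (\<Sum>i. hausdorff_weight k (U i))"
      by simp
    finally have "ennreal ((1 / L) ^ k) * hausdorff_premeasure k \<delta> (f ` A) \<le>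
        ennreal ((1 / L) ^ k) * (ennreal (L ^ k) * (\<Sum>i. hausdorff_weight k (U i)))"
      by (rule mult_left_mono) simp
    also have "\<dots> = (\<Sum>i. hausdorff_weight k (U i))"
      using L by (simp add: mult.assoc[symmetric] ennreal_mult[symmetric] power_divide)
    finally show "ennreal ((1 / L) ^ k) * hausdorff_premeasure k \<delta> (f ` A) \<le> (\<Sum>i. hausdorff_weight k (U i))" .
  qed
  also have "\<dots> \<le> hausdorff_outer k A"
    using \<delta> L by (intro hausdorff_premeasure_le_outer) simp
  finally have "ennreal (L ^ k) * (ennreal ((1 / L) ^ k) * hausdorff_premeasure k \<delta> (f ` A)) \<le>
      ennreal (L ^ k) * hausdorff_outer k A"
    by (rule mult_left_mono) simp
  then show "hausdorff_premeasure k \<delta> (f ` A) \<le> ennreal (L ^ k) * hausdorff_outer k A"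
    using L by (simp add: mult.assoc[symmetric] ennreal_mult[symmetric] power_divide)
qed

lemma interval_grid_cover:
  fixes t R :: real
  assumes "\<bar>t\<bar> \<le> R" "0 < R" "0 < N"
  shows "\<exists>i<N. - R + 2 * R * real i / real N \<le> t \<and> t \<le> - R + 2 * R * real (Suc i) / real N"
proof (cases "t = R")
  case True
  then show ?thesis using assms
    by (intro exI[of _ "N - 1"]) (auto simp: field_simps of_nat_diff)
next
  case False
  define s where "s = (t + R) * real N / (2 * R)"
  have s: "0 \<le> s" "s < real N"
    using assms False unfolding s_def
    by (auto simp: abs_le_iff pos_divide_less_eq mult_less_cancel_right intro!: divide_nonneg_pos mult_nonneg_nonneg)
  have t: "t = - R + 2 * R * s / real N"
    using assms by (simp add: s_def field_simps)
  define i where "i = nat \<lfloor>s\<rfloor>"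
  have i: "real i \<le> s" "s \<le> real (Suc i)"
    using s by (auto simp: i_def) linarith+
  have "i < N" using i s by linarith
  moreover have "- R + 2 * R * real i / real N \<le> t" "t \<le> - R + 2 * R * real (Suc i) / real N"
    unfolding t using i assms by (intro add_left_mono divide_right_mono mult_left_mono; simp)+
  ultimately show ?thesis by blast
qed

text \<open>
  A grid with \<open>N\<close> intervals along each of the other \<open>n - 1\<close> axes has \<open>N ^ (n - 1)\<close> cells of
  diameter proportional to \<open>1 / N\<close>, so the total weight is bounded independently of \<open>N\<close>.
\<close>

lemma hausdorff_outer_coordinate_square_finite:
  fixes k :: "'n::finite" and R :: real
  assumes R: "0 < R"
  shows "hausdorff_outer (CARD('n) - 1) {x :: real^'n. x $ k = 0 \<and> (\<forall>j. \<bar>x $ j\<bar> \<le> R)} < top"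
proof -
  let ?Q = "{x :: real^'n. x $ k = 0 \<and> (\<forall>j. \<bar>x $ j\<bar> \<le> R)}" and ?m = "CARD('n) - 1"
  define B where "B = unit_ball_vol (real ?m) * (real CARD('n) * R) ^ ?m"
  have "hausdorff_outer ?m ?Q \<le> ennreal B"
  proof (rule hausdorff_outer_le)
    fix \<delta> :: real assume \<delta>: "0 < \<delta>"
    obtain N :: nat where N: "real CARD('n) * (2 * R) / \<delta> < real N"
      using reals_Archimedean2 by blast
    have N0: "0 < real N" using N R \<delta> by (smt (verit) divide_pos_pos mult_pos_pos of_nat_0_less_iff zero_less_card_finite)
    define d where "d = real CARD('n) * (2 * R / real N)"
    have d: "d \<le> \<delta>" "0 \<le> d" using N N0 \<delta> R by (auto simp: d_def field_simps)
    define I where "I = (PiE UNIV (\<lambda>j. if j = k then {0} else {..<N}) :: ('n \<Rightarrow> nat) set)"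
    define U where "U f = {x :: real^'n. x $ k = 0 \<and> (\<forall>j. j \<noteq> k \<longrightarrow>
        - R + 2 * R * real (f j) / real N \<le> x $ j \<and> x $ j \<le> - R + 2 * R * real (Suc (f j)) / real N)}" for f
    have finI: "finite I" unfolding I_def by (intro finite_PiE) auto
    have "card I = (\<Prod>j\<in>UNIV. if j = k then 1 else N)"
      unfolding I_def by (subst card_PiE) (auto intro!: prod.cong)
    also have "\<dots> = (\<Prod>j\<in>UNIV - {k}. N)"
      by (rule prod.mono_neutral_cong_right) auto
    also have "\<dots> = N ^ ?m" by simp
    finally have cardI: "card I = N ^ ?m" .
    have cover: "?Q \<subseteq> (\<Union>f\<in>I. U f)"
    proof
      fix x assume x: "x \<in> ?Q"
      have "\<forall>j. \<exists>i<N. - R + 2 * R * real i / real N \<le> x $ j \<and> x $ j \<le> - R + 2 * R * real (Suc i) / real N"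
        using interval_grid_cover x R N0 by auto
      then obtain g where g: "\<And>j. g j < N"
          "\<And>j. - R + 2 * R * real (g j) / real N \<le> x $ j \<and> x $ j \<le> - R + 2 * R * real (Suc (g j)) / real N"
        by metis
      then have "g(k := 0) \<in> I" "x \<in> U (g(k := 0))"
        using x by (auto simp: I_def U_def)
      then show "x \<in> (\<Union>f\<in>I. U f)" by blast
    qed
    have norm_U: "norm (x - y) \<le> d" if "x \<in> U f" "y \<in> U f" for x y f
    proof -
      have "norm (x - y) \<le> (\<Sum>j\<in>UNIV. \<bar>(x - y) $ j\<bar>)" by (rule norm_le_l1_cart)
      also have "\<dots> \<le> (\<Sum>j\<in>(UNIV :: 'n set). 2 * R / real N)"
      proof (rule sum_mono)
        fix j show "\<bar>(x - y) $ j\<bar> \<le> 2 * R / real N"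
        proof (cases "j = k")
          case True then show ?thesis using that R N0 by (simp add: U_def)
        next
          case False
          have "2 * R * real (Suc (f j)) / real N = 2 * R * real (f j) / real N + 2 * R / real N"
            by (simp add: field_simps add_divide_distrib)
          then show ?thesis using that False by (auto simp: U_def abs_le_iff) (smt (verit))+
        qed
      qed
      finally show ?thesis by (simp add: d_def)
    qed
    have diam: "diameter (U f) \<le> d" for f
      using norm_U d by (intro diameter_le) auto
    have bdd: "bounded (U f)" for f
      unfolding bounded_two_points dist_norm using norm_U by blast
    have "hausdorff_premeasure ?m \<delta> ?Q \<le> (\<Sum>f\<in>I. hausdorff_premeasure ?m \<delta> (U f))"
      using \<delta> by (intro order_trans[OF hausdorff_premeasure_mono[OF cover]
          hausdorff_premeasure_finite_subadditive[OF finI]]) simp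
    also have "\<dots> \<le> (\<Sum>f\<in>I. ennreal (unit_ball_vol (real ?m) * (d / 2) ^ ?m))"
    proof (rule sum_mono)
      fix f
      have "hausdorff_premeasure ?m \<delta> (U f) \<le> hausdorff_weight ?m (U f)"
        using bdd diam[of f] d \<delta> by (intro hausdorff_premeasure_le_weight) auto
      also have "\<dots> \<le> ennreal (unit_ball_vol (real ?m) * (d / 2) ^ ?m)"
        unfolding hausdorff_weight_def using diam[of f] bdd[of f]
        by (auto intro!: ennreal_leI mult_left_mono power_mono divide_right_mono diameter_ge_0)
      finally show "hausdorff_premeasure ?m \<delta> (U f) \<le> ennreal (unit_ball_vol (real ?m) * (d / 2) ^ ?m)" .
    qed
    also have "\<dots> = ennreal (real (N ^ ?m) * (unit_ball_vol (real ?m) * (d / 2) ^ ?m))"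
      using d by (simp add: cardI ennreal_mult ennreal_of_nat_eq_real_of_nat del: of_nat_power)
    also have "real (N ^ ?m) * (unit_ball_vol (real ?m) * (d / 2) ^ ?m) = B"
      using N0 by (simp add: B_def d_def power_mult_distrib power_divide)
    finally show "hausdorff_premeasure ?m \<delta> ?Q \<le> ennreal B" .
  qed
  also have "ennreal B < top" by simp
  finally show ?thesis .
qed

text \<open>
  After the equation of the hyperplane has been solved for one coordinate, \<open>E\<close> is contained in
  the Lipschitz image of a square in a coordinate hyperplane.
\<close>

lemma hausdorff_outer_hyperplane_finite:
  fixes E :: "(real^'n) set"
  assumes a: "a \<noteq> 0" and E: "\<And>x. x \<in> E \<Longrightarrow> a \<bullet> x = b" and bdd: "bounded E"
  shows "hausdorff_outer (CARD('n) - 1) E < top"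
proof -
  obtain k where k: "a $ k \<noteq> 0" using a by (auto simp: vec_eq_iff)
  obtain R where R: "0 < R" "\<And>x. x \<in> E \<Longrightarrow> norm x \<le> R"
    using bdd by (meson bounded_pos)
  let ?Q = "{x :: real^'n. x $ k = 0 \<and> (\<forall>j. \<bar>x $ j\<bar> \<le> R)}" and ?m = "CARD('n) - 1"
  define f where "f x = x + ((b - a \<bullet> x) / a $ k) *\<^sub>R axis k 1" for x :: "real^'n"
  define L where "L = 1 + norm a / \<bar>a $ k\<bar>"
  have "0 < L" by (auto simp: L_def intro: add_pos_nonneg)
  have lip: "dist (f x) (f y) \<le> L * dist x y" for x y
  proof -
    have "f x - f y = (x - y) + ((b - a \<bullet> x) / a $ k - (b - a \<bullet> y) / a $ k) *\<^sub>R axis k 1"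
      by (simp add: f_def scaleR_diff_left)
    also have "(b - a \<bullet> x) / a $ k - (b - a \<bullet> y) / a $ k = - ((a \<bullet> (x - y)) / a $ k)"
      by (simp add: inner_diff_right diff_divide_distrib)
    finally have diff: "f x - f y = (x - y) - ((a \<bullet> (x - y)) / a $ k) *\<^sub>R axis k 1"
      by simp
    have "norm (f x - f y) \<le> norm (x - y) + norm (((a \<bullet> (x - y)) / a $ k) *\<^sub>R (axis k 1 :: real^'n))"
      unfolding diff by (rule norm_triangle_ineq4)
    also have "norm (((a \<bullet> (x - y)) / a $ k) *\<^sub>R (axis k 1 :: real^'n)) = \<bar>a \<bullet> (x - y)\<bar> / \<bar>a $ k\<bar>"
      by simp
    also have "\<dots> \<le> norm a * norm (x - y) / \<bar>a $ k\<bar>"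
      by (intro divide_right_mono Cauchy_Schwarz_ineq2) auto
    finally show ?thesis by (simp add: dist_norm L_def algebra_simps)
  qed
  have "E \<subseteq> f ` ?Q"
  proof
    fix x assume x: "x \<in> E"
    define y where "y = x - (x $ k) *\<^sub>R axis k 1"
    have comp: "y $ j = (if j = k then 0 else x $ j)" for j
      by (auto simp: y_def axis_def)
    have "a \<bullet> y = b - x $ k * a $ k"
      using E[OF x] by (simp add: y_def inner_diff_right inner_axis)
    then have "f y = x" using k by (simp add: f_def y_def)
    moreover have "\<bar>y $ j\<bar> \<le> R" for j
      using R comp component_le_norm_cart[of x j] R(2)[OF x] by auto
    ultimately show "x \<in> f ` ?Q" using comp by (intro image_eqI[of _ _ y]) auto
  qed
  then have "hausdorff_outer ?m E \<le> hausdorff_outer ?m (f ` ?Q)"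
    by (rule hausdorff_outer_mono)
  also have "\<dots> \<le> ennreal (L ^ ?m) * hausdorff_outer ?m ?Q"
    using \<open>0 < L\<close> lip by (intro hausdorff_outer_Lipschitz_image) auto
  also have "\<dots> < top"
    using hausdorff_outer_coordinate_square_finite[OF R(1), of k] by (simp add: ennreal_mult_less_top)
  finally show ?thesis .
qed

text \<open>
  In dimension \<open>n\<close>, a cylinder of unit length and radius \<open>d\<close> is covered by about \<open>1 / d\<close> balls
  of radius \<open>2 * d\<close>, which leaves the power \<open>n - 1\<close> of \<open>d\<close>.
\<close>

lemma emeasure_thin_cylinder_le:
  fixes a x :: "real^'n"
  assumes a: "norm a = 1" and d: "0 \<le> d" "d \<le> 1"
  defines "W \<equiv> (\<lambda>(y, t). y + t *\<^sub>R a) ` (cball x d \<times> {0..1})"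
  shows "emeasure lborel W \<le> ennreal (3 * unit_ball_vol (real CARD('n)) * 2 ^ CARD('n) * d ^ (CARD('n) - 1))"
proof -
  let ?n = "CARD('n)"
  define C where "C = 3 * unit_ball_vol (real ?n) * 2 ^ ?n"
  have "0 \<le> C" by (simp add: C_def)
  have "compact W"
    unfolding W_def by (intro compact_continuous_image compact_Times) (auto intro!: continuous_intros simp: split_beta)
  have bound: "emeasure lborel W \<le> ennreal (C * r ^ (?n - 1))" if r: "0 < r" "d \<le> r" "r \<le> 1" for r
  proof -
    define N where "N = nat \<lceil>1 / r\<rceil>"
    have N: "1 / r \<le> real N" "real N \<le> 1 / r + 1"
      using r by (auto simp: N_def)
    have N0: "0 < real N" using N r by (smt (verit) divide_pos_pos)
    have invN: "1 / real N \<le> r" using N N0 r by (simp add: field_simps)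
    have "W \<subseteq> (\<Union>j\<le>N. cball (x + (real j / real N) *\<^sub>R a) (2 * r))"
    proof
      fix w assume "w \<in> W"
      then obtain y t where w: "w = y + t *\<^sub>R a" "dist x y \<le> d" "0 \<le> t" "t \<le> 1"
        by (auto simp: W_def)
      define j where "j = nat \<lfloor>t * real N\<rfloor>"
      have j: "real j \<le> t * real N" "t * real N \<le> real j + 1"
        using w N0 by (auto simp: j_def)
      have "t * real N \<le> real N" using w N0 by (simp add: mult_left_le_one_le)
      then have "j \<le> N" using j by linarith
      have "real j / real N \<le> t" "t \<le> real j / real N + 1 / real N"
        using j N0 by (auto simp: field_simps)
      then have jt: "\<bar>t - real j / real N\<bar> \<le> r" using invN by linarith
      have "dist (x + (real j / real N) *\<^sub>R a) w = norm ((y - x) + (t - real j / real N) *\<^sub>R a)"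
        by (simp add: w dist_norm algebra_simps norm_minus_commute)
      also have "\<dots> \<le> norm (y - x) + \<bar>t - real j / real N\<bar>"
        using norm_triangle_ineq[of "y - x" "(t - real j / real N) *\<^sub>R a"] a by simp
      also have "\<dots> \<le> 2 * r" using jt w r by (simp add: dist_norm norm_minus_commute)
      finally show "w \<in> (\<Union>j\<le>N. cball (x + (real j / real N) *\<^sub>R a) (2 * r))"
        using \<open>j \<le> N\<close> by auto
    qed
    then have "emeasure lborel W \<le> emeasure lborel (\<Union>j\<le>N. cball (x + (real j / real N) *\<^sub>R a) (2 * r))"
      by (intro emeasure_mono) auto
    also have "\<dots> \<le> (\<Sum>j\<le>N. emeasure lborel (cball (x + (real j / real N) *\<^sub>R a) (2 * r)))"
      by (intro emeasure_subadditive_finite) auto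
    also have "\<dots> = ennreal ((real N + 1) * (unit_ball_vol (real ?n) * (2 * r) ^ ?n))"
      using r by (simp add: emeasure_cball ennreal_of_nat_eq_real_of_nat ennreal_mult del: ennreal_plus) (simp add: ennreal_plus[symmetric] ennreal_of_nat_eq_real_of_nat add.commute ennreal_1[symmetric] del: ennreal_1 ennreal_plus)
    also have "\<dots> \<le> ennreal (C * r ^ (?n - 1))"
    proof (rule ennreal_leI)
      have "real N + 1 \<le> 3 / r" using N r by (simp add: field_simps)
      then have "(real N + 1) * (unit_ball_vol (real ?n) * (2 * r) ^ ?n) \<le> 3 / r * (unit_ball_vol (real ?n) * (2 * r) ^ ?n)"
        using r by (intro mult_right_mono) auto
      also have "\<dots> = C * (r ^ ?n / r)" by (simp add: C_def power_mult_distrib)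
      also have "r ^ ?n / r = r ^ (?n - 1)" using r by (simp add: power_diff)
      finally show "(real N + 1) * (unit_ball_vol (real ?n) * (2 * r) ^ ?n) \<le> C * r ^ (?n - 1)" .
    qed
    finally show ?thesis .
  qed
  show ?thesis
  proof (cases "d = 0")
    case False
    then show ?thesis using bound[of d] d by (simp add: C_def)
  next
    case True
    \<comment> \<open>Radius 0 is the limit of positive radii; in dimension 1 this gives the right bound
      because \<open>0 ^ 0 = 1\<close>.\<close>
    have "((\<lambda>r. ennreal (C * r ^ (?n - 1))) \<longlongrightarrow> ennreal (C * d ^ (?n - 1))) (at_right d)"
      by (intro tendsto_ennrealI tendsto_intros)
    moreover have "eventually (\<lambda>r. emeasure lborel W \<le> ennreal (C * r ^ (?n - 1))) (at_right d)"
      using bound True by (auto simp: eventually_at_right_field intro!: exI[of _ 1])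
    ultimately have "emeasure lborel W \<le> ennreal (C * d ^ (?n - 1))"
      by (rule tendsto_lowerbound) simp
    then show ?thesis by (simp add: C_def)
  qed
qed

text \<open>
  Every cover of \<open>E\<close>, swept along a unit segment in direction \<open>a\<close>, yields a cover of the ball by
  cylinders. The volume of a cylinder is at most a constant times the Hausdorff weight of its
  base, so the total weight of the cover is bounded below by the volume of the ball.
\<close>

lemma hausdorff_outer_pos:
  fixes E :: "(real^'n) set"
  assumes a: "norm a = 1" and s: "0 < s"
    and thick: "\<And>x. x \<in> ball p s \<Longrightarrow> \<exists>y\<in>E. \<exists>t\<in>{0..1}. x = y + t *\<^sub>R a"
  shows "0 < hausdorff_outer (CARD('n) - 1) E"
proof -
  let ?n = "CARD('n)" and ?k = "CARD('n) - 1"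
  define C where "C = 3 * unit_ball_vol (real ?n) * 2 ^ ?n"
  define v where "v = unit_ball_vol (real ?k)"
  have v: "0 < v" unfolding v_def by (rule unit_ball_vol_pos) simp
  define D where "D = C * 2 ^ ?k / v"
  have D: "0 \<le> D" using v by (simp add: D_def C_def)
  have *: "emeasure lborel (ball p s) \<le> ennreal D * (\<Sum>i. hausdorff_weight ?k (U i))"
    if U: "E \<subseteq> (\<Union>i. U i)" "\<And>i. bounded (U i)" "\<And>i. diameter (U i) \<le> 1" for U
  proof -
    define W where "W i = (if U i = {} then {} else
      (\<lambda>(y, t). y + t *\<^sub>R a) ` (cball (SOME x. x \<in> U i) (diameter (U i)) \<times> {0..1}))" for i
    have meas: "W i \<in> sets lborel" for i
    proof -
      have "compact (W i)" unfolding W_def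
        by (auto intro!: compact_continuous_image compact_Times continuous_intros simp: split_beta)
      then show ?thesis by (simp add: compact_imp_closed borel_closed)
    qed
    have "ball p s \<subseteq> (\<Union>i. W i)"
    proof
      fix x assume "x \<in> ball p s"
      then obtain y t where yt: "y \<in> E" "0 \<le> t" "t \<le> 1" "x = y + t *\<^sub>R a"
        using thick by force
      then obtain i where i: "y \<in> U i" using U(1) by blast
      then have "(SOME x. x \<in> U i) \<in> U i" by (rule someI)
      then have "dist (SOME x. x \<in> U i) y \<le> diameter (U i)"
        using i U(2) by (intro diameter_bounded_bound) auto
      then have "x \<in> W i" using i yt by (auto simp: W_def)
      then show "x \<in> (\<Union>i. W i)" by blast
    qed
    then have "emeasure lborel (ball p s) \<le> emeasure lborel (\<Union>i. W i)"
      using meas by (intro emeasure_mono) auto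
    also have "\<dots> \<le> (\<Sum>i. emeasure lborel (W i))"
      using meas by (intro emeasure_subadditive_countably) auto
    also have "\<dots> \<le> (\<Sum>i. ennreal D * hausdorff_weight ?k (U i))"
    proof (intro suminf_le)
      fix i
      show "emeasure lborel (W i) \<le> ennreal D * hausdorff_weight ?k (U i)"
      proof (cases "U i = {}")
        case False
        have "emeasure lborel (W i) \<le> ennreal (C * diameter (U i) ^ ?k)"
          using False emeasure_thin_cylinder_le[OF a, of "diameter (U i)" "SOME x. x \<in> U i"] U(2,3)
          by (simp add: W_def C_def diameter_ge_0)
        also have "C * diameter (U i) ^ ?k = D * (v * (diameter (U i) / 2) ^ ?k)"
          using v by (simp add: D_def power_divide)
        also have "ennreal \<dots> = ennreal D * hausdorff_weight ?k (U i)"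
          using False D v U(2)[of i] unfolding hausdorff_weight_def v_def[symmetric]
          by (simp add: ennreal_mult diameter_ge_0)
        finally show ?thesis .
      qed (simp add: W_def)
    qed auto
    finally show ?thesis by simp
  qed
  show ?thesis
  proof (rule ccontr)
    assume "\<not> ?thesis"
    then have "hausdorff_outer ?k E = 0" by simp
    then have "hausdorff_premeasure ?k 1 E = 0"
      using hausdorff_premeasure_le_outer[of 1 ?k E] by simp
    define \<beta> where "\<beta> = unit_ball_vol (real ?n) * s ^ ?n"
    have \<beta>: "emeasure lborel (ball p s) = ennreal \<beta>" "0 < \<beta>"
      using s by (simp_all add: \<beta>_def emeasure_ball)
    define \<eta> where "\<eta> = \<beta> / (D + 1)"
    have "ennreal \<eta> \<le> hausdorff_premeasure ?k 1 E"
    proof (rule hausdorff_premeasure_ge)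
      fix U :: "nat \<Rightarrow> (real^'n) set"
      assume U: "E \<subseteq> (\<Union>i. U i)" "\<And>i. bounded (U i)" "\<And>i. diameter (U i) \<le> 1"
      let ?S = "\<Sum>i. hausdorff_weight ?k (U i)"
      have le: "ennreal \<beta> \<le> ennreal D * ?S"
        using *[OF U] by (simp add: \<beta>)
      show "ennreal \<eta> \<le> ?S"
      proof (cases ?S)
        case (real S)
        have "\<beta> \<le> D * S"
          using le real D by (simp add: ennreal_mult[symmetric])
        also have "\<dots> \<le> (D + 1) * S" using real by (intro mult_right_mono) auto
        finally have "\<eta> \<le> S" using D by (simp add: \<eta>_def field_simps)
        then show ?thesis using real by (simp add: ennreal_leI)
      qed simp
    qed
    moreover have "0 < \<eta>" using \<beta> D by (simp add: \<eta>_def)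
    ultimately show False using \<open>hausdorff_premeasure ?k 1 E = 0\<close> by simp
  qed
qed

section \<open>A supply of smooth functions\<close>

text \<open>
  For \<open>p = 1\<close> this is the standard function that is positive on the positive half-line and
  vanishes to infinite order at \<open>0\<close>; the polynomial factors make the family closed under
  differentiation.
\<close>

definition flat_exp :: "real poly \<Rightarrow> real \<Rightarrow> real" where
  "flat_exp p t = (if 0 < t then poly p (1 / t) * exp (- (1 / t)) else 0)"

lemma poly_times_exp_minus_tendsto_0: "((\<lambda>s::real. poly p s * exp (- s)) \<longlongrightarrow> 0) at_top"
proof -
  have "((\<lambda>s::real. \<Sum>i\<le>degree p. coeff p i * (s ^ i / exp s)) \<longlongrightarrow> (\<Sum>i\<le>degree p. coeff p i * 0)) at_top"
    by (intro tendsto_intros tendsto_power_div_exp_0)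
  moreover have "poly p s * exp (- s) = (\<Sum>i\<le>degree p. coeff p i * (s ^ i / exp s))" for s :: real
    by (simp add: poly_altdef sum_distrib_right exp_minus divide_inverse mult.assoc)
  ultimately show ?thesis by simp
qed

text \<open>
  At \<open>0\<close> the exponential beats every power of \<open>1 / t\<close>.
\<close>

lemma flat_exp_has_derivative:
  "(flat_exp p has_real_derivative flat_exp (monom 1 2 * (p - pderiv p)) t) (at t)"
proof -
  consider "t < 0" | "t = 0" | "0 < t" by linarith
  then show ?thesis
  proof cases
    case 1
    have "((\<lambda>_. 0) has_real_derivative flat_exp (monom 1 2 * (p - pderiv p)) t) (at t)"
      using 1 by (simp add: flat_exp_def)
    moreover have "eventually (\<lambda>s. flat_exp p s = 0) (nhds t)"
      using eventually_nhds_in_open[of "{..<0}" t] 1 by (auto elim!: eventually_mono simp: flat_exp_def)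
    ultimately show ?thesis by (subst DERIV_cong_ev[OF refl _ refl])
  next
    case 3
    have "((\<lambda>t. poly p (1 / t) * exp (- (1 / t))) has_real_derivative
        flat_exp (monom 1 2 * (p - pderiv p)) t) (at t)"
      using 3 by (auto intro!: derivative_eq_intros poly_DERIV[THEN DERIV_chain2]
          simp: flat_exp_def poly_monom power2_eq_square field_simps)
    moreover have "eventually (\<lambda>s. flat_exp p s = poly p (1 / s) * exp (- (1 / s))) (nhds t)"
      using eventually_nhds_in_open[of "{0<..}" t] 3 by (auto elim!: eventually_mono simp: flat_exp_def)
    ultimately show ?thesis by (subst DERIV_cong_ev[OF refl _ refl])
  next
    case 2
    have "((\<lambda>h. flat_exp p h / h) \<longlongrightarrow> 0) (at_right 0)"
    proof -
      have "((\<lambda>h::real. poly (p * [:0, 1:]) (1 / h) * exp (- (1 / h))) \<longlongrightarrow> 0) (at_right 0)"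
        by (rule filterlim_compose[OF poly_times_exp_minus_tendsto_0])
          (use filterlim_inverse_at_top_right in \<open>simp add: inverse_eq_divide\<close>)
      moreover have "eventually (\<lambda>h. flat_exp p h / h = poly (p * [:0, 1:]) (1 / h) * exp (- (1 / h))) (at_right 0)"
        by (auto simp: eventually_at_right_field flat_exp_def intro!: exI[of _ 1])
      ultimately show ?thesis by (subst tendsto_cong)
    qed
    moreover have "((\<lambda>h. flat_exp p h / h) \<longlongrightarrow> 0) (at_left 0)"
      by (rule tendsto_eventually) (auto simp: eventually_at_left_field flat_exp_def intro!: exI[of _ "-1"])
    ultimately have "((\<lambda>h. flat_exp p h / h) \<longlongrightarrow> 0) (at 0)"
      by (rule filterlim_split_at[rotated])
    then show ?thesis using 2 by (simp add: has_field_derivative_iff flat_exp_def[of _ 0])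
  qed
qed

definition grad :: "(real^'n \<Rightarrow> real) \<Rightarrow> real^'n \<Rightarrow> real^'n" where
  "grad f x = (\<chi> i. partial_deriv i f x)"

lemma grad_nth [simp]: "grad f x $ i = partial_deriv i f x"
  by (simp add: grad_def)

lemma has_derivative_grad:
  assumes "f differentiable (at x)"
  shows "(f has_derivative (\<lambda>h. grad f x \<bullet> h)) (at x)"
proof -
  let ?D = "frechet_derivative f (at x)"
  have D: "(f has_derivative ?D) (at x)" using assms by (simp add: frechet_derivative_works)
  interpret bounded_linear ?D using D by (rule has_derivative_bounded_linear)
  have "?D h = grad f x \<bullet> h" for h
  proof -
    have "?D h = ?D (\<Sum>i\<in>UNIV. h $ i *\<^sub>R axis i 1)"
      using basis_expansion[of h] by (simp add: scalar_mult_eq_scaleR)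
    also have "\<dots> = (\<Sum>i\<in>UNIV. h $ i * partial_deriv i f x)"
      by (simp add: sum scaleR partial_deriv_def)
    also have "\<dots> = grad f x \<bullet> h" by (simp add: inner_vec_def mult.commute)
    finally show ?thesis .
  qed
  then have "?D = (\<lambda>h. grad f x \<bullet> h)" by (rule ext)
  with D show ?thesis by simp
qed

lemma grad_unique:
  assumes "(f has_derivative (\<lambda>h. v \<bullet> h)) (at x)"
  shows "grad f x = v"
proof -
  have "frechet_derivative f (at x) = (\<lambda>h. v \<bullet> h)"
    using frechet_derivative_at[OF assms] by simp
  then show ?thesis by (simp add: vec_eq_iff partial_deriv_def inner_axis)
qed

lemma partial_deriv_unique:
  assumes "(f has_derivative f') (at x)"
  shows "partial_deriv i f x = f' (axis i 1)"
  unfolding partial_deriv_def using frechet_derivative_at[OF assms] by simp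

text \<open>
  The class contains the polynomials and enough bump functions, and it is closed under partial
  derivatives. Hence its members are smooth, without any product or chain rule for derivatives
  of higher order.
\<close>

inductive_set elementary_smooth :: "(real^'n \<Rightarrow> real) set" where
  const: "(\<lambda>x. c) \<in> elementary_smooth"
| coord: "(\<lambda>x. x $ i) \<in> elementary_smooth"
| flat: "(\<lambda>x. flat_exp p (c * x $ i + d)) \<in> elementary_smooth"
| add: "f \<in> elementary_smooth \<Longrightarrow> g \<in> elementary_smooth \<Longrightarrow> (\<lambda>x. f x + g x) \<in> elementary_smooth"
| mult: "f \<in> elementary_smooth \<Longrightarrow> g \<in> elementary_smooth \<Longrightarrow> (\<lambda>x. f x * g x) \<in> elementary_smooth"

lemma elementary_smooth_deriv:
  fixes f :: "real^'n \<Rightarrow> real"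
  assumes "f \<in> elementary_smooth"
  shows "(\<forall>x. f differentiable (at x)) \<and> (\<forall>j. partial_deriv j f \<in> elementary_smooth)"
  using assms
proof induction
  case (const c)
  have "partial_deriv j (\<lambda>x. c) = (\<lambda>x. 0)" for j :: 'n
    by (rule ext) (simp add: partial_deriv_def)
  then show ?case by (auto intro: elementary_smooth.const)
next
  case (coord i)
  have D: "((\<lambda>x. x $ i) has_derivative (\<lambda>h. h $ i)) (at x)" for x :: "real^'n"
    by (rule bounded_linear_imp_has_derivative[OF bounded_linear_vec_nth])
  have "partial_deriv j (\<lambda>x. x $ i) = (\<lambda>x. axis j 1 $ i)" for j :: 'n
    by (intro ext) (simp add: partial_deriv_unique[OF D])
  then show ?case using D by (auto intro: elementary_smooth.const differentiableI)
next
  case (flat p c i d)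
  let ?q = "monom 1 2 * (p - pderiv p)"
  have D: "((\<lambda>x. flat_exp p (c * x $ i + d)) has_derivative
      (\<lambda>h. flat_exp ?q (c * x $ i + d) * (c * h $ i))) (at x)" for x :: "real^'n"
  proof -
    have "((\<lambda>x. c * x $ i + d) has_derivative (\<lambda>h. c * h $ i)) (at x)"
      by (auto intro!: derivative_eq_intros bounded_linear_imp_has_derivative[OF bounded_linear_vec_nth])
    from has_derivative_compose[OF this, of "flat_exp p" "(*) (flat_exp ?q (c * x $ i + d))"]
    show ?thesis using flat_exp_has_derivative by (simp add: has_field_derivative_def)
  qed
  have "partial_deriv j (\<lambda>x. flat_exp p (c * x $ i + d)) =
      (\<lambda>x. flat_exp ?q (c * x $ i + d) * (c * axis j 1 $ i))" for j :: 'n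
    by (intro ext) (simp add: partial_deriv_unique[OF D])
  then show ?case using D by (auto intro: elementary_smooth.intros differentiableI)
next
  case (add f g)
  have D: "((\<lambda>x. f x + g x) has_derivative (\<lambda>h. grad f x \<bullet> h + grad g x \<bullet> h)) (at x)" for x
    using add.IH by (intro has_derivative_add has_derivative_grad) auto
  have "partial_deriv j (\<lambda>x. f x + g x) = (\<lambda>x. partial_deriv j f x + partial_deriv j g x)" for j :: 'n
    by (intro ext) (simp add: partial_deriv_unique[OF D] inner_axis)
  then show ?case using add.IH by (auto intro: elementary_smooth.add)
next
  case (mult f g)
  have D: "((\<lambda>x. f x * g x) has_derivative (\<lambda>h. f x * (grad g x \<bullet> h) + (grad f x \<bullet> h) * g x)) (at x)" for x
    using mult.IH by (intro has_derivative_mult has_derivative_grad) auto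
  have "partial_deriv j (\<lambda>x. f x * g x) = (\<lambda>x. f x * partial_deriv j g x + partial_deriv j f x * g x)" for j :: 'n
    by (intro ext) (simp add: partial_deriv_unique[OF D] inner_axis)
  then show ?case using mult.IH mult.hyps
    by (auto intro!: elementary_smooth.add elementary_smooth.mult intro: differentiableI[OF D])
qed

lemma elementary_smooth_differentiable: "f \<in> elementary_smooth \<Longrightarrow> f differentiable (at x)"
  using elementary_smooth_deriv by blast

lemma elementary_smooth_continuous: "f \<in> elementary_smooth \<Longrightarrow> continuous_on S f"
  by (meson continuous_at_imp_continuous_on differentiable_imp_continuous_within elementary_smooth_differentiable)

lemma elementary_smooth_C_k: "f \<in> elementary_smooth \<Longrightarrow> C_k k f"
  by (induction k arbitrary: f) (auto simp: elementary_smooth_continuous elementary_smooth_deriv)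

lemma elementary_smooth_sum:
  "(\<And>i. i \<in> I \<Longrightarrow> f i \<in> elementary_smooth) \<Longrightarrow> (\<lambda>x. \<Sum>i\<in>I. f i x) \<in> elementary_smooth"
  by (induction I rule: infinite_finite_induct) (auto intro: elementary_smooth.intros)

lemma elementary_smooth_prod:
  "(\<And>i. i \<in> I \<Longrightarrow> f i \<in> elementary_smooth) \<Longrightarrow> (\<lambda>x. \<Prod>i\<in>I. f i x) \<in> elementary_smooth"
  by (induction I rule: infinite_finite_induct) (auto intro: elementary_smooth.intros)

lemma elementary_smooth_power:
  "f \<in> elementary_smooth \<Longrightarrow> (\<lambda>x. f x ^ k) \<in> elementary_smooth"
  by (induction k) (auto intro: elementary_smooth.intros)

lemma elementary_smooth_diff:
  assumes "f \<in> elementary_smooth" "g \<in> elementary_smooth"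
  shows "(\<lambda>x. f x - g x) \<in> elementary_smooth"
  using elementary_smooth.add[OF assms(1) elementary_smooth.mult[OF elementary_smooth.const[of "-1"] assms(2)]]
  by simp

text \<open>
  A smooth bump with values in \<open>[0, 1]\<close> that is supported in the box with corners \<open>a\<close> and \<open>b\<close>,
  shrunk by \<open>1 / (k + 1)\<close> on each side. It tends to the indicator of the open box as \<open>k\<close> grows.
\<close>

definition box_bump :: "real^'n \<Rightarrow> real^'n \<Rightarrow> nat \<Rightarrow> real^'n \<Rightarrow> real" where
  "box_bump a b k x = (\<Prod>i\<in>UNIV. flat_exp 1 (real (Suc k) * x $ i + (- real (Suc k) * a $ i - 1)) *
                            flat_exp 1 (- real (Suc k) * x $ i + (real (Suc k) * b $ i - 1)))"

lemma flat_exp_1_range: "0 \<le> flat_exp 1 t" "flat_exp 1 t \<le> 1"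
  by (auto simp: flat_exp_def)

lemma box_bump_smooth: "box_bump a b k \<in> elementary_smooth"
  unfolding box_bump_def[abs_def]
  by (intro elementary_smooth_prod elementary_smooth.mult elementary_smooth.flat)

lemma box_bump_range: "0 \<le> box_bump a b k x" "box_bump a b k x \<le> 1"
  unfolding box_bump_def by (auto intro!: prod_nonneg prod_le_1 mult_le_one flat_exp_1_range mult_nonneg_nonneg)

lemma box_bump_support: "box_bump a b k x \<noteq> 0 \<Longrightarrow>
    x \<in> cbox (\<chi> i. a $ i + 1 / real (Suc k)) (\<chi> i. b $ i - 1 / real (Suc k))"
proof -
  assume "box_bump a b k x \<noteq> 0"
  then have "0 < real (Suc k) * x $ i + (- real (Suc k) * a $ i - 1)"
       "0 < - real (Suc k) * x $ i + (real (Suc k) * b $ i - 1)" for i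
    by (auto simp: box_bump_def flat_exp_def split: if_splits)
  then show ?thesis
    by (auto simp: mem_box_cart field_simps less_imp_le)
qed

lemma flat_exp_1_tendsto_1:
  assumes "0 < c"
  shows "(\<lambda>k. flat_exp 1 (real (Suc k) * c - 1)) \<longlonglongrightarrow> 1"
proof -
  have "filterlim (\<lambda>k. - 1 + real (Suc k) * c) at_top sequentially"
    by (intro filterlim_tendsto_add_at_top[OF tendsto_const]
        filterlim_at_top_mult_tendsto_pos[OF tendsto_const assms]
        filterlim_compose[OF filterlim_real_sequentially filterlim_Suc])
  then have lim: "filterlim (\<lambda>k. real (Suc k) * c - 1) at_top sequentially" by simp
  have "((\<lambda>s::real. exp (- (1 / s))) \<longlongrightarrow> exp (- 0)) at_top"
    by (intro tendsto_intros tendsto_divide_0[OF tendsto_const filterlim_at_top_imp_at_infinity[OF filterlim_ident]])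
  moreover have "eventually (\<lambda>s. flat_exp 1 s = exp (- (1 / s))) at_top"
    using eventually_gt_at_top[of 0] by eventually_elim (simp add: flat_exp_def)
  ultimately have "((\<lambda>s. flat_exp 1 s) \<longlongrightarrow> 1) at_top" by (simp add: tendsto_cong)
  from filterlim_compose[OF this lim] show ?thesis .
qed

lemma box_bump_tendsto: "(\<lambda>k. box_bump a b k x) \<longlonglongrightarrow> indicator (box a b) x"
proof (cases "x \<in> box a b")
  case True
  then have "0 < x $ i - a $ i" "0 < b $ i - x $ i" for i by (auto simp: mem_box_cart)
  then have "(\<lambda>k. \<Prod>i\<in>UNIV. flat_exp 1 (real (Suc k) * (x $ i - a $ i) - 1) *
      flat_exp 1 (real (Suc k) * (b $ i - x $ i) - 1)) \<longlonglongrightarrow> (\<Prod>i\<in>(UNIV::'a set). 1 * 1)"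
    by (intro tendsto_prod tendsto_mult flat_exp_1_tendsto_1)
  then show ?thesis using True by (simp add: box_bump_def algebra_simps)
next
  case False
  have "box_bump a b k x = 0" for k
  proof (rule ccontr)
    assume "box_bump a b k x \<noteq> 0"
    then have *: "a $ i + 1 / real (Suc k) \<le> x $ i" "x $ i \<le> b $ i - 1 / real (Suc k)" for i
      using box_bump_support[of a b k x] by (auto simp: mem_box_cart)
    have "0 < 1 / real (Suc k)" by simp
    with * have "a $ i < x $ i" "x $ i < b $ i" for i by (smt (verit))+
    then show False using False by (simp add: mem_box_cart)
  qed
  then show ?thesis using False by simp
qed

section \<open>Polynomials of bounded degree and their inverse estimates\<close>

lemma power2_diff_le: "(a - b)\<^sup>2 \<le> 2 * a\<^sup>2 + 2 * (b::real)\<^sup>2"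
  using zero_le_power2[of "a + b"] by (simp add: power2_eq_square algebra_simps)

text \<open>
  Lagrange interpolation. It turns any linear functional of a polynomial in one variable into a
  fixed linear combination of \<open>l + 1\<close> point values, which is the source of all estimates for
  polynomials below.
\<close>

lemma lagrange_basis_exists:
  fixes t :: "nat \<Rightarrow> real"
  assumes inj: "inj_on t {..l}"
  shows "\<exists>L :: nat \<Rightarrow> real poly. \<forall>q. degree q \<le> l \<longrightarrow> q = (\<Sum>j\<le>l. smult (poly q (t j)) (L j))"
proof -
  define L where "L j = (\<Prod>i\<in>{..l} - {j}. smult (1 / (t j - t i)) [:- t i, 1:])" for j
  have deg: "degree (L j) \<le> l" if "j \<le> l" for j
  proof -
    have "degree (L j) \<le> (\<Sum>i\<in>{..l} - {j}. degree (smult (1 / (t j - t i)) [:- t i, 1:]))"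
      unfolding L_def using degree_prod_sum_le[of "{..l} - {j}" "\<lambda>i. smult (1 / (t j - t i)) [:- t i, 1:]"]
      by (simp add: comp_def)
    also have "\<dots> \<le> (\<Sum>i\<in>{..l} - {j}. 1)"
      by (intro sum_mono) (auto intro: order_trans[OF degree_smult_le])
    also have "\<dots> = l" using that by simp
    finally show ?thesis .
  qed
  have eval: "poly (L j) (t k) = (if j = k then 1 else 0)" if "j \<le> l" "k \<le> l" for j k
  proof (cases "j = k")
    case True
    then have "poly (L j) (t k) = (\<Prod>i\<in>{..l} - {j}. 1)"
      unfolding L_def poly_prod
    proof (intro prod.cong refl)
      fix i assume "i \<in> {..l} - {j}"
      then have "t k - t i \<noteq> 0" using inj_onD[OF inj, of k i] True that by auto
      then show "poly (smult (1 / (t j - t i)) [:- t i, 1:]) (t k) = 1"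
        using True by (simp add: diff_divide_distrib[symmetric])
    qed
    then show ?thesis using True by simp
  next
    case False
    then show ?thesis using that by (auto simp: L_def poly_prod intro!: prod_zero bexI[of _ k])
  qed
  have "q = (\<Sum>j\<le>l. smult (poly q (t j)) (L j))" if "degree q \<le> l" for q
  proof (rule poly_eqI_degree[of "t ` {..l}"])
    have card: "card (t ` {..l}) = Suc l" using inj by (simp add: card_image)
    show "degree q < card (t ` {..l})" using card that by simp
    have "degree (\<Sum>j\<le>l. smult (poly q (t j)) (L j)) \<le> l"
      by (intro degree_sum_le) (auto intro: order_trans[OF degree_smult_le] deg)
    then show "degree (\<Sum>j\<le>l. smult (poly q (t j)) (L j)) < card (t ` {..l})" using card by simp
    fix s assume "s \<in> t ` {..l}"
    then obtain k where k: "k \<le> l" "s = t k" by auto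
    have "poly (\<Sum>j\<le>l. smult (poly q (t j)) (L j)) s = (\<Sum>j\<le>l. if j = k then poly q (t k) else 0)"
      unfolding poly_sum by (intro sum.cong) (use k eval in auto)
    then show "poly q s = poly (\<Sum>j\<le>l. smult (poly q (t j)) (L j)) s" using k by simp
  qed
  then show ?thesis by blast
qed

lemma finite_multi_indices: "finite {\<alpha> :: 'n::finite \<Rightarrow> nat. sum \<alpha> UNIV \<le> l}"
proof (rule finite_subset)
  show "{\<alpha> :: 'n \<Rightarrow> nat. sum \<alpha> UNIV \<le> l} \<subseteq> PiE UNIV (\<lambda>_. {..l})"
    using member_le_sum[of _ "UNIV :: 'n set"] by (auto intro: order_trans)
qed (auto intro: finite_PiE)

lemma polynomials_on_UNIV_I:
  "(\<And>x. p x = (\<Sum>\<alpha> | sum \<alpha> UNIV \<le> l. c \<alpha> * (\<Prod>i\<in>UNIV. (x $ i) ^ \<alpha> i))) \<Longrightarrow> p \<in> polynomials_on l UNIV"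
  by (auto simp: polynomials_on_def)

lemma polynomials_on_eq_restriction:
  "P \<in> polynomials_on l K \<longleftrightarrow> (\<exists>p\<in>polynomials_on l UNIV. \<forall>x\<in>K. P x = p x)"
  unfolding polynomials_on_def by (auto 4 4)

lemma polynomial_monomial:
  assumes "sum \<alpha> UNIV \<le> l"
  shows "(\<lambda>x::real^'n. \<Prod>i\<in>UNIV. (x $ i) ^ \<alpha> i) \<in> polynomials_on l UNIV"
proof (rule polynomials_on_UNIV_I[where c = "\<lambda>\<beta>. if \<beta> = \<alpha> then 1 else 0"])
  fix x :: "real^'n"
  have "(\<Sum>\<beta> | sum \<beta> UNIV \<le> l. (if \<beta> = \<alpha> then 1 else 0) * (\<Prod>i\<in>UNIV. (x $ i) ^ \<beta> i)) =
      (\<Sum>\<beta> | sum \<beta> UNIV \<le> l. if \<beta> = \<alpha> then (\<Prod>i\<in>UNIV. (x $ i) ^ \<alpha> i) else 0)"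
    by (intro sum.cong) auto
  then show "(\<Prod>i\<in>UNIV. (x $ i) ^ \<alpha> i) =
      (\<Sum>\<beta> | sum \<beta> UNIV \<le> l. (if \<beta> = \<alpha> then 1 else 0) * (\<Prod>i\<in>UNIV. (x $ i) ^ \<beta> i))"
    using assms by (simp add: sum.delta[OF finite_multi_indices])
qed

lemma polynomial_add:
  assumes "p \<in> polynomials_on l UNIV" "q \<in> polynomials_on l UNIV"
  shows "(\<lambda>x. p x + q x) \<in> polynomials_on l UNIV"
proof -
  from assms obtain c d where "\<And>x. p x = (\<Sum>\<alpha> | sum \<alpha> UNIV \<le> l. c \<alpha> * (\<Prod>i\<in>UNIV. (x $ i) ^ \<alpha> i))"
     "\<And>x. q x = (\<Sum>\<alpha> | sum \<alpha> UNIV \<le> l. d \<alpha> * (\<Prod>i\<in>UNIV. (x $ i) ^ \<alpha> i))"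
    by (auto simp: polynomials_on_def)
  then show ?thesis
    by (intro polynomials_on_UNIV_I[where c = "\<lambda>\<alpha>. c \<alpha> + d \<alpha>"]) (simp add: sum.distrib distrib_right)
qed

lemma polynomial_cmult:
  assumes "p \<in> polynomials_on l UNIV"
  shows "(\<lambda>x. k * p x) \<in> polynomials_on l UNIV"
proof -
  from assms obtain c where "\<And>x. p x = (\<Sum>\<alpha> | sum \<alpha> UNIV \<le> l. c \<alpha> * (\<Prod>i\<in>UNIV. (x $ i) ^ \<alpha> i))"
    by (auto simp: polynomials_on_def)
  then show ?thesis
    by (intro polynomials_on_UNIV_I[where c = "\<lambda>\<alpha>. k * c \<alpha>"]) (simp add: sum_distrib_left mult.assoc)
qed

lemma polynomial_diff:
  assumes "p \<in> polynomials_on l UNIV" "q \<in> polynomials_on l UNIV"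
  shows "(\<lambda>x. p x - q x) \<in> polynomials_on l UNIV"
  using polynomial_add[OF assms(1) polynomial_cmult[OF assms(2), of "-1"]] by simp

lemma polynomial_const: "(\<lambda>x::real^'n. c) \<in> polynomials_on l UNIV"
  using polynomial_cmult[OF polynomial_monomial[of "\<lambda>_. 0" l], of c] by simp

lemma polynomial_sum:
  "(\<And>i. i \<in> I \<Longrightarrow> f i \<in> polynomials_on l UNIV) \<Longrightarrow> (\<lambda>x::real^'n. \<Sum>i\<in>I. f i x) \<in> polynomials_on l UNIV"
  by (induction I rule: infinite_finite_induct) (auto intro: polynomial_const polynomial_add)

lemma polynomial_mono_degree:
  assumes "p \<in> polynomials_on l UNIV" "l \<le> l'"
  shows "p \<in> polynomials_on l' UNIV"
proof -
  from assms obtain c where c: "\<And>x. p x = (\<Sum>\<alpha> | sum \<alpha> UNIV \<le> l. c \<alpha> * (\<Prod>i\<in>UNIV. (x $ i) ^ \<alpha> i))"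
    by (auto simp: polynomials_on_def)
  have "(\<lambda>x. \<Sum>\<alpha> | sum \<alpha> UNIV \<le> l. c \<alpha> * (\<Prod>i\<in>UNIV. (x $ i) ^ \<alpha> i)) \<in> polynomials_on l' UNIV"
    using assms(2) by (intro polynomial_sum polynomial_cmult polynomial_monomial) auto
  moreover have "p = (\<lambda>x. \<Sum>\<alpha> | sum \<alpha> UNIV \<le> l. c \<alpha> * (\<Prod>i\<in>UNIV. (x $ i) ^ \<alpha> i))"
    using c by (rule ext)
  ultimately show ?thesis by simp
qed

lemma polynomial_coord_mult:
  assumes "p \<in> polynomials_on l UNIV"
  shows "(\<lambda>x. x $ j * p x) \<in> polynomials_on (Suc l) UNIV"
proof -
  from assms obtain c where c: "\<And>x. p x = (\<Sum>\<alpha> | sum \<alpha> UNIV \<le> l. c \<alpha> * (\<Prod>i\<in>UNIV. (x $ i) ^ \<alpha> i))"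
    by (auto simp: polynomials_on_def)
  have shift: "(\<Prod>i\<in>UNIV. (x $ i) ^ (\<alpha>(j := Suc (\<alpha> j))) i) = x $ j * (\<Prod>i\<in>UNIV. (x $ i) ^ \<alpha> i)"
    for x :: "real^'a" and \<alpha>
    by (simp add: prod.remove[of UNIV j] mult.assoc)
  have deg: "sum (\<alpha>(j := Suc (\<alpha> j))) UNIV = Suc (sum \<alpha> UNIV)" for \<alpha>
    by (simp add: sum.remove[of UNIV j])
  have "(\<lambda>x. \<Sum>\<alpha> | sum \<alpha> UNIV \<le> l. c \<alpha> * (\<Prod>i\<in>UNIV. (x $ i) ^ (\<alpha>(j := Suc (\<alpha> j))) i)) \<in> polynomials_on (Suc l) UNIV"
    by (intro polynomial_sum polynomial_cmult polynomial_monomial) (auto simp: deg simp del: fun_upd_apply)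
  moreover have "(\<lambda>x. x $ j * p x) = (\<lambda>x. \<Sum>\<alpha> | sum \<alpha> UNIV \<le> l. c \<alpha> * (\<Prod>i\<in>UNIV. (x $ i) ^ (\<alpha>(j := Suc (\<alpha> j))) i))"
    by (rule ext) (simp add: c shift sum_distrib_left mult.left_commute del: fun_upd_apply)
  ultimately show ?thesis by simp
qed

lemma polynomial_affine_mult:
  assumes "p \<in> polynomials_on l UNIV"
  shows "(\<lambda>x::real^'n. (a \<bullet> x + b) * p x) \<in> polynomials_on (Suc l) UNIV"
proof -
  have "(\<lambda>x. (\<Sum>i\<in>UNIV. a $ i * (x $ i * p x)) + b * p x) \<in> polynomials_on (Suc l) UNIV"
    using assms by (intro polynomial_add polynomial_sum polynomial_cmult polynomial_coord_mult
        polynomial_mono_degree[OF polynomial_cmult, of p l]) auto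
  then show ?thesis by (simp add: inner_vec_def distrib_right sum_distrib_right mult.assoc)
qed

lemma polynomial_affine_power_mult:
  assumes "p \<in> polynomials_on l UNIV"
  shows "(\<lambda>x::real^'n. (a \<bullet> x + b) ^ k * p x) \<in> polynomials_on (k + l) UNIV"
  using polynomial_affine_mult[of _ _ a b] assms by (induction k) (auto simp: mult.assoc)

text \<open>
  Substitution turns each factor of a monomial into an affine function, and multiplication by an
  affine function raises the degree by at most one.
\<close>

lemma polynomial_compose_affine:
  assumes p: "p \<in> polynomials_on l UNIV" and T: "\<And>x i. T x $ i = a i \<bullet> x + b i"
  shows "(\<lambda>x::real^'n. p (T x)) \<in> polynomials_on l UNIV"
proof -
  from p obtain c where c: "\<And>x. p x = (\<Sum>\<alpha> | sum \<alpha> UNIV \<le> l. c \<alpha> * (\<Prod>i\<in>UNIV. (x $ i) ^ \<alpha> i))"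
    by (auto simp: polynomials_on_def)
  have prod: "(\<lambda>x. \<Prod>i\<in>I. (T x $ i) ^ \<alpha> i) \<in> polynomials_on (sum \<alpha> I) UNIV" if "finite I" for I \<alpha>
    using that by induction (auto simp: T polynomial_const intro!: polynomial_affine_power_mult)
  have "(\<lambda>x. \<Prod>i\<in>UNIV. (T x $ i) ^ \<alpha> i) \<in> polynomials_on l UNIV" if "sum \<alpha> UNIV \<le> l" for \<alpha>
    using polynomial_mono_degree[OF prod that] by simp
  then have "(\<lambda>x. \<Sum>\<alpha> | sum \<alpha> UNIV \<le> l. c \<alpha> * (\<Prod>i\<in>UNIV. (T x $ i) ^ \<alpha> i)) \<in> polynomials_on l UNIV"
    by (intro polynomial_sum polynomial_cmult) auto
  then show ?thesis by (simp add: c)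
qed

lemma polynomial_on_line:
  assumes "p \<in> polynomials_on l UNIV"
  obtains q :: "real poly" where "degree q \<le> l" "\<And>t. p (x + t *\<^sub>R y) = poly q t"
proof -
  from assms obtain c where c: "\<And>x. p x = (\<Sum>\<alpha> | sum \<alpha> UNIV \<le> l. c \<alpha> * (\<Prod>i\<in>UNIV. (x $ i) ^ \<alpha> i))"
    by (auto simp: polynomials_on_def)
  define m where "m \<alpha> = (\<Prod>i\<in>UNIV. [:x $ i, y $ i:] ^ \<alpha> i)" for \<alpha>
  have deg: "degree (m \<alpha>) \<le> sum \<alpha> UNIV" for \<alpha>
  proof -
    have "degree (m \<alpha>) \<le> (\<Sum>i\<in>UNIV. degree ([:x $ i, y $ i:] ^ \<alpha> i))"
      unfolding m_def using degree_prod_sum_le[of UNIV "\<lambda>i. [:x $ i, y $ i:] ^ \<alpha> i"] by (simp add: comp_def)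
    also have "\<dots> \<le> (\<Sum>i\<in>UNIV. \<alpha> i)"
    proof (rule sum_mono)
      fix i
      have "degree ([:x $ i, y $ i:] ^ \<alpha> i) \<le> degree [:x $ i, y $ i:] * \<alpha> i" by (rule degree_power_le)
      also have "\<dots> \<le> \<alpha> i" by simp
      finally show "degree ([:x $ i, y $ i:] ^ \<alpha> i) \<le> \<alpha> i" .
    qed
    finally show ?thesis .
  qed
  show ?thesis
  proof (rule that[of "\<Sum>\<alpha> | sum \<alpha> UNIV \<le> l. smult (c \<alpha>) (m \<alpha>)"])
    show "degree (\<Sum>\<alpha> | sum \<alpha> UNIV \<le> l. smult (c \<alpha>) (m \<alpha>)) \<le> l"
      by (intro degree_sum_le finite_multi_indices order_trans[OF degree_smult_le] order_trans[OF deg]) auto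
    show "p (x + t *\<^sub>R y) = poly (\<Sum>\<alpha> | sum \<alpha> UNIV \<le> l. smult (c \<alpha>) (m \<alpha>)) t" for t
      by (simp add: c m_def poly_sum poly_prod)
  qed
qed

lemma polynomial_elementary_smooth:
  assumes "p \<in> polynomials_on l UNIV"
  shows "p \<in> elementary_smooth"
proof -
  from assms obtain c where c: "\<And>x. p x = (\<Sum>\<alpha> | sum \<alpha> UNIV \<le> l. c \<alpha> * (\<Prod>i\<in>UNIV. (x $ i) ^ \<alpha> i))"
    by (auto simp: polynomials_on_def)
  have "(\<lambda>x. \<Sum>\<alpha> | sum \<alpha> UNIV \<le> l. c \<alpha> * (\<Prod>i\<in>UNIV. (x $ i) ^ \<alpha> i)) \<in> elementary_smooth"
    by (intro elementary_smooth_sum elementary_smooth_prod elementary_smooth_power elementary_smooth.intros)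
  moreover have "p = (\<lambda>x. \<Sum>\<alpha> | sum \<alpha> UNIV \<le> l. c \<alpha> * (\<Prod>i\<in>UNIV. (x $ i) ^ \<alpha> i))"
    using c by (rule ext)
  ultimately show ?thesis by simp
qed

lemma sum_square_bound:
  fixes f w :: "nat \<Rightarrow> real"
  shows "(\<Sum>j\<le>l. f j * w j)\<^sup>2 \<le> (\<Sum>j\<le>l. (w j)\<^sup>2) * (\<Sum>j\<le>l. (f j)\<^sup>2)"
  using Cauchy_Schwarz_ineq_sum[of f w "{..l}"] by (simp add: mult.commute)

lemma inj_on_scaled_nodes: "0 < s \<Longrightarrow> inj_on (\<lambda>j::nat. s * (real j + 1)) A"
  by (auto simp: inj_on_def)

text \<open>
  On the line through \<open>m\<close> and \<open>x\<close> the polynomial has one variable. Its value at parameter \<open>1\<close> is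
  a combination of its values at \<open>l + 1\<close> nodes in \<open>{0..s}\<close>, with coefficients that depend on \<open>l\<close>
  and \<open>s\<close> only.
\<close>

lemma polynomial_extrapolation:
  fixes l :: nat and s :: real
  assumes "0 < s"
  shows "\<exists>C\<ge>0. \<forall>p \<in> polynomials_on l (UNIV :: (real^'n) set). \<forall>m x B.
     (\<forall>t\<in>{0..s}. (p (m + t *\<^sub>R (x - m)))\<^sup>2 \<le> B) \<longrightarrow> (p x)\<^sup>2 \<le> C * B"
proof -
  define t where "t j = s / (real l + 1) * (real j + 1)" for j :: nat
  have t: "t j \<in> {0..s}" if "j \<le> l" for j
  proof -
    have "t j = s * ((real j + 1) / (real l + 1))" by (simp add: t_def)
    moreover have "(real j + 1) / (real l + 1) \<le> 1" using that by simp
    ultimately have "t j \<le> s" using assms mult_left_le[of "(real j + 1) / (real l + 1)" s] by simp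
    moreover have "0 \<le> t j" using assms by (simp add: t_def)
    ultimately show ?thesis by simp
  qed
  have inj: "inj_on t {..l}"
    unfolding t_def by (rule inj_on_scaled_nodes) (use assms in simp)
  obtain L where L: "\<And>q. degree q \<le> l \<Longrightarrow> q = (\<Sum>j\<le>l. smult (poly q (t j)) (L j :: real poly))"
    using lagrange_basis_exists[OF inj] by blast
  define W where "W = (\<Sum>j\<le>l. (poly (L j) 1)\<^sup>2)"
  show ?thesis
  proof (intro exI[of _ "W * (real l + 1)"] conjI ballI allI impI)
    show "0 \<le> W * (real l + 1)" by (auto simp: W_def intro!: mult_nonneg_nonneg sum_nonneg)
    fix p :: "real^'n \<Rightarrow> real" and m x B
    assume p: "p \<in> polynomials_on l UNIV" and B: "\<forall>t\<in>{0..s}. (p (m + t *\<^sub>R (x - m)))\<^sup>2 \<le> B"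
    obtain q where q: "degree q \<le> l" "\<And>t. p (m + t *\<^sub>R (x - m)) = poly q t"
      using polynomial_on_line[OF p] by blast
    have "p x = poly q 1" using q(2)[of 1] by simp
    also have "\<dots> = (\<Sum>j\<le>l. poly q (t j) * poly (L j) 1)"
      by (subst L[OF q(1)]) (simp add: poly_sum)
    finally have "(p x)\<^sup>2 \<le> W * (\<Sum>j\<le>l. (poly q (t j))\<^sup>2)"
      using sum_square_bound unfolding W_def by simp
    also have "\<dots> \<le> W * (\<Sum>j\<le>l. B)"
      using B t q(2) by (intro mult_left_mono sum_mono) (auto simp: W_def intro: sum_nonneg)
    finally show "(p x)\<^sup>2 \<le> W * (real l + 1) * B" by (simp add: algebra_simps)
  qed
qed

lemma pderiv_sum: "pderiv (\<Sum>i\<in>I. f i) = (\<Sum>i\<in>I. pderiv (f i))"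
  by (induction I rule: infinite_finite_induct) (auto simp: pderiv_add)

text \<open>
  The derivative at the end of a segment is a fixed combination of the values at \<open>l + 1\<close> nodes
  of the segment.
\<close>

lemma polynomial_directional_derivative_bound:
  fixes l :: nat
  shows "\<exists>C\<ge>0. \<forall>p \<in> polynomials_on l (UNIV :: (real^'n) set). \<forall>x v B.
     (\<forall>t\<in>{0..1}. (p (x + t *\<^sub>R v))\<^sup>2 \<le> B) \<longrightarrow> (grad p x \<bullet> v)\<^sup>2 \<le> C * B"
proof -
  define t where "t j = 1 / (real l + 1) * (real j + 1)" for j :: nat
  have t: "t j \<in> {0..1}" if "j \<le> l" for j
    using that by (simp add: t_def)
  have inj: "inj_on t {..l}"
    unfolding t_def by (rule inj_on_scaled_nodes) simp
  obtain L where L: "\<And>q. degree q \<le> l \<Longrightarrow> q = (\<Sum>j\<le>l. smult (poly q (t j)) (L j :: real poly))"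
    using lagrange_basis_exists[OF inj] by blast
  define W where "W = (\<Sum>j\<le>l. (poly (pderiv (L j)) 0)\<^sup>2)"
  show ?thesis
  proof (intro exI[of _ "W * (real l + 1)"] conjI ballI allI impI)
    show "0 \<le> W * (real l + 1)" by (auto simp: W_def intro!: mult_nonneg_nonneg sum_nonneg)
    fix p :: "real^'n \<Rightarrow> real" and x v B
    assume p: "p \<in> polynomials_on l UNIV" and B: "\<forall>t\<in>{0..1}. (p (x + t *\<^sub>R v))\<^sup>2 \<le> B"
    obtain q where q: "degree q \<le> l" "\<And>t. p (x + t *\<^sub>R v) = poly q t"
      using polynomial_on_line[OF p] by blast
    have "((\<lambda>t. x + t *\<^sub>R v) has_derivative (\<lambda>t. t *\<^sub>R v)) (at (0::real))"
      by (auto intro!: derivative_eq_intros)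
    from has_derivative_compose[OF this, of p "\<lambda>h. grad p x \<bullet> h"]
    have "((\<lambda>t. p (x + t *\<^sub>R v)) has_derivative (\<lambda>t. grad p x \<bullet> (t *\<^sub>R v))) (at (0::real))"
      using has_derivative_grad[OF elementary_smooth_differentiable[OF polynomial_elementary_smooth[OF p]], of x]
      by simp
    then have "(poly q has_real_derivative grad p x \<bullet> v) (at 0)"
      by (simp add: q(2) has_field_derivative_def mult.commute[of _ "grad p x \<bullet> v"] mult_commute_abs)
    then have "grad p x \<bullet> v = poly (pderiv q) 0"
      using DERIV_unique poly_DERIV by blast
    also have "\<dots> = (\<Sum>j\<le>l. poly q (t j) * poly (pderiv (L j)) 0)"
      by (subst L[OF q(1)]) (simp add: poly_sum pderiv_sum pderiv_smult)
    finally have "(grad p x \<bullet> v)\<^sup>2 \<le> W * (\<Sum>j\<le>l. (poly q (t j))\<^sup>2)"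
      using sum_square_bound unfolding W_def by simp
    also have "\<dots> \<le> W * (\<Sum>j\<le>l. B)"
      using B t q(2) by (intro mult_left_mono sum_mono) (auto simp: W_def intro: sum_nonneg)
    finally show "(grad p x \<bullet> v)\<^sup>2 \<le> W * (real l + 1) * B" by (simp add: algebra_simps)
  qed
qed

text \<open>
  By convexity the segments from \<open>x\<close> to the centre \<open>c\<close> and to the point \<open>c + r *\<^sub>R e\<close>, where \<open>e\<close>
  is the direction of the gradient, lie in \<open>K\<close>. The difference of the derivatives along these
  two segments is \<open>r\<close> times the norm of the gradient.
\<close>

lemma polynomial_gradient_bound:
  fixes l :: nat
  shows "\<exists>C\<ge>0. \<forall>p \<in> polynomials_on l (UNIV :: (real^'n) set). \<forall>K x c r B.
     convex K \<longrightarrow> x \<in> K \<longrightarrow> 0 < r \<longrightarrow> cball c r \<subseteq> K \<longrightarrow> (\<forall>y\<in>K. (p y)\<^sup>2 \<le> B) \<longrightarrow>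
     (norm (grad p x))\<^sup>2 \<le> C * B / r\<^sup>2"
proof -
  obtain C where C: "0 \<le> C" "\<And>p x v B. p \<in> polynomials_on l (UNIV :: (real^'n) set) \<Longrightarrow>
     (\<forall>t\<in>{0..1}. (p (x + t *\<^sub>R v))\<^sup>2 \<le> B) \<Longrightarrow> (grad p x \<bullet> v)\<^sup>2 \<le> C * B"
    using polynomial_directional_derivative_bound by metis
  show ?thesis
  proof (intro exI[of _ "4 * C"] conjI ballI allI impI)
    fix p :: "real^'n \<Rightarrow> real" and K x c B and r :: real
    assume p: "p \<in> polynomials_on l UNIV" and K: "convex K" "x \<in> K" "0 < r" "cball c r \<subseteq> K"
      and B: "\<forall>y\<in>K. (p y)\<^sup>2 \<le> B"
    let ?g = "grad p x"
    have *: "(?g \<bullet> (y - x))\<^sup>2 \<le> C * B" if "y \<in> K" for y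
    proof (rule C(2)[OF p], intro ballI)
      fix t :: real assume "t \<in> {0..1}"
      then have "x + t *\<^sub>R (y - x) \<in> K"
        using convexD_alt[OF K(1) K(2) that, of t] by (simp add: algebra_simps)
      then show "(p (x + t *\<^sub>R (y - x)))\<^sup>2 \<le> B" using B by simp
    qed
    define e where "e = sgn ?g"
    have e: "?g \<bullet> e = norm ?g" "norm e \<le> 1"
      by (cases "?g = 0"; simp add: e_def sgn_div_norm dot_square_norm power2_eq_square)+
    have in_K: "c + r *\<^sub>R e \<in> K" "c \<in> K"
      using K e(2) by (auto simp: dist_norm mult_left_le intro!: subsetD[OF K(4)])
    have "r * norm ?g = ?g \<bullet> (c + r *\<^sub>R e - x) - ?g \<bullet> (c - x)"
      by (simp add: inner_diff_right inner_add_right e(1))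
    then have "(r * norm ?g)\<^sup>2 \<le> 2 * (?g \<bullet> (c + r *\<^sub>R e - x))\<^sup>2 + 2 * (?g \<bullet> (c - x))\<^sup>2"
      by (simp only: power2_diff_le)
    then have "(r * norm ?g)\<^sup>2 \<le> 4 * C * B"
      using *[OF in_K(1)] *[OF in_K(2)] by simp
    then show "(norm ?g)\<^sup>2 \<le> 4 * C * B / r\<^sup>2"
      using K(3) by (simp add: power_mult_distrib field_simps)
  qed (use C in auto)
qed

text \<open>
  Satisfied by the Lebesgue measure with \<open>k = CARD('n)\<close> and by the face measure with
  \<open>k = CARD('n) - 1\<close>, so that the estimate of point values below serves simplices and faces
  alike.
\<close>

definition homothety_bounded :: "nat \<Rightarrow> (real^'n) measure \<Rightarrow> bool" where
  "homothety_bounded k \<mu> \<longleftrightarrow> sets \<mu> = sets borel \<and>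
     (\<forall>x t. \<forall>B\<in>sets borel. 0 < t \<longrightarrow>
        emeasure \<mu> ((\<lambda>y. x + t *\<^sub>R (y - x)) -` B) \<le> ennreal ((1 / t) ^ k) * emeasure \<mu> B)"

lemma homothety_nn_integral_le:
  assumes \<mu>: "homothety_bounded k \<mu>" and t: "0 < t" and f: "f \<in> borel_measurable borel"
  shows "(\<integral>\<^sup>+y. f (x + t *\<^sub>R (y - x)) \<partial>\<mu>) \<le> ennreal ((1 / t) ^ k) * (\<integral>\<^sup>+y. f y \<partial>\<mu>)"
proof -
  have sets[measurable_cong]: "sets \<mu> = sets borel" using \<mu> by (simp add: homothety_bounded_def)
  then have space: "space \<mu> = UNIV" using sets_eq_imp_space_eq by fastforce
  let ?h = "\<lambda>y. x + t *\<^sub>R (y - x)" and ?N = "scale_measure (ennreal ((1 / t) ^ k)) \<mu>"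
  have h[measurable]: "?h \<in> measurable \<mu> \<mu>"
    by (simp add: measurable_cong_sets[OF sets sets])
  have f'[measurable]: "f \<in> borel_measurable \<mu>" using f by (simp add: measurable_cong_sets[OF sets refl])
  have "(\<integral>\<^sup>+y. f (?h y) \<partial>\<mu>) = (\<integral>\<^sup>+y. f y \<partial>distr \<mu> \<mu> ?h)"
    by (rule nn_integral_distr[symmetric]) auto
  also have "\<dots> \<le> (\<integral>\<^sup>+y. f y \<partial>?N)"
  proof (rule nn_integral_mono_measure)
    show "sets (distr \<mu> \<mu> ?h) = sets ?N" by simp
    show "distr \<mu> \<mu> ?h \<le> ?N"
      using \<mu> t sets by (subst le_measure) (auto intro!: le_funI simp: emeasure_distr space homothety_bounded_def emeasure_notin_sets)
  qed
  also have "\<dots> = ennreal ((1 / t) ^ k) * (\<integral>\<^sup>+y. f y \<partial>\<mu>)"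
    by (rule nn_integral_scale_measure) auto
  finally show ?thesis .
qed

text \<open>
  The value at \<open>x\<close> is interpolated from nodes on the segment from \<open>x\<close> to \<open>y\<close>, for every \<open>y \<in> K\<close>.
  Integration over \<open>y\<close> turns the value at a node into an integral over a copy of \<open>K\<close> under a
  homothety with centre \<open>x\<close>. As \<open>K\<close> is convex, the copy lies in \<open>K\<close>, and the constant does not
  depend on the shape of \<open>K\<close>.
\<close>

lemma polynomial_point_value_bound:
  fixes l k :: nat
  shows "\<exists>C\<ge>0. \<forall>p \<in> polynomials_on l (UNIV :: (real^'n) set). \<forall>\<mu> K x.
     homothety_bounded k \<mu> \<longrightarrow> convex K \<longrightarrow> K \<in> sets borel \<longrightarrow> x \<in> K \<longrightarrow>
     ennreal ((p x)\<^sup>2) * emeasure \<mu> K \<le> ennreal C * (\<integral>\<^sup>+y. indicator K y * ennreal ((p y)\<^sup>2) \<partial>\<mu>)"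
proof -
  \<comment> \<open>The nodes stay away from \<open>0\<close>, where the homothety would degenerate.\<close>
  define t where "t j = 1 / (real l + 1) * (real j + 1)" for j :: nat
  have t: "0 < t j" "t j \<le> 1" if "j \<le> l" for j
    using that by (auto simp: t_def)
  have inj: "inj_on t {..l}"
    unfolding t_def by (rule inj_on_scaled_nodes) simp
  obtain L where L: "\<And>q. degree q \<le> l \<Longrightarrow> q = (\<Sum>j\<le>l. smult (poly q (t j)) (L j :: real poly))"
    using lagrange_basis_exists[OF inj] by blast
  define W where "W = (\<Sum>j\<le>l. (poly (L j) 0)\<^sup>2)"
  have W: "0 \<le> W" by (simp add: W_def sum_nonneg)
  show ?thesis
  proof (intro exI[of _ "W * (\<Sum>j\<le>l. (1 / t j) ^ k)"] conjI ballI allI impI)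
    show "0 \<le> W * (\<Sum>j\<le>l. (1 / t j) ^ k)"
      using W t by (intro mult_nonneg_nonneg sum_nonneg) (auto simp: less_imp_le)
    fix p :: "real^'n \<Rightarrow> real" and \<mu> :: "(real^'n) measure"
      and K :: "(real^'n) set" and x
    assume p: "p \<in> polynomials_on l UNIV" and \<mu>: "homothety_bounded k \<mu>"
      and K: "convex K" "K \<in> sets borel" "x \<in> K"
    have sets[measurable_cong]: "sets \<mu> = sets borel" using \<mu> by (simp add: homothety_bounded_def)
    have p_meas[measurable]: "p \<in> borel_measurable borel"
      by (intro borel_measurable_continuous_onI elementary_smooth_continuous polynomial_elementary_smooth[OF p])
    note K(2)[measurable]
    define f :: "real^'n \<Rightarrow> ennreal" where "f y = indicator K y * ennreal ((p y)\<^sup>2)" for y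
    have f[measurable]: "f \<in> borel_measurable borel" unfolding f_def by measurable
    have pointwise: "(p x)\<^sup>2 \<le> W * (\<Sum>j\<le>l. (p (x + t j *\<^sub>R (y - x)))\<^sup>2)" for y
    proof -
      obtain q where q: "degree q \<le> l" "\<And>t. p (x + t *\<^sub>R (y - x)) = poly q t"
        using polynomial_on_line[OF p] by blast
      have "p x = poly q 0" using q(2)[of 0] by simp
      also have "\<dots> = (\<Sum>j\<le>l. poly q (t j) * poly (L j) 0)"
        by (subst L[OF q(1)]) (simp add: poly_sum)
      finally show ?thesis
        using sum_square_bound unfolding W_def q(2) by simp
    qed
    have "ennreal ((p x)\<^sup>2) * emeasure \<mu> K = (\<integral>\<^sup>+y. ennreal ((p x)\<^sup>2) * indicator K y \<partial>\<mu>)"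
      by (rule nn_integral_cmult_indicator[symmetric]) (simp add: sets K)
    also have "\<dots> \<le> (\<integral>\<^sup>+y. ennreal W * (\<Sum>j\<le>l. f (x + t j *\<^sub>R (y - x))) \<partial>\<mu>)"
    proof (rule nn_integral_mono)
      fix y
      show "ennreal ((p x)\<^sup>2) * indicator K y \<le> ennreal W * (\<Sum>j\<le>l. f (x + t j *\<^sub>R (y - x)))"
      proof (cases "y \<in> K")
        case True
        have "x + t j *\<^sub>R (y - x) \<in> K" if "j \<le> l" for j
          using convexD_alt[OF K(1) K(3) True, of "t j"] t[OF that] by (simp add: algebra_simps)
        then have "(\<Sum>j\<le>l. f (x + t j *\<^sub>R (y - x))) = ennreal (\<Sum>j\<le>l. (p (x + t j *\<^sub>R (y - x)))\<^sup>2)"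
          by (subst sum_ennreal[symmetric]) (auto simp: f_def)
        then show ?thesis
          using True pointwise[of y] W by (simp add: ennreal_mult[symmetric] sum_nonneg ennreal_leI)
      qed simp
    qed
    also have "\<dots> = ennreal W * (\<Sum>j\<le>l. \<integral>\<^sup>+y. f (x + t j *\<^sub>R (y - x)) \<partial>\<mu>)"
      by (subst nn_integral_cmult, simp, subst nn_integral_sum) auto
    also have "\<dots> \<le> ennreal W * (\<Sum>j\<le>l. ennreal ((1 / t j) ^ k) * (\<integral>\<^sup>+y. f y \<partial>\<mu>))"
      using t by (intro mult_left_mono sum_mono homothety_nn_integral_le[OF \<mu>]) auto
    also have "\<dots> = ennreal W * ((\<Sum>j\<le>l. ennreal ((1 / t j) ^ k)) * (\<integral>\<^sup>+y. f y \<partial>\<mu>))"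
      by (simp add: sum_distrib_right)
    also have "(\<Sum>j\<le>l. ennreal ((1 / t j) ^ k)) = ennreal (\<Sum>j\<le>l. (1 / t j) ^ k)"
      using t by (intro sum_ennreal) (simp add: less_imp_le)
    also have "ennreal W * (ennreal (\<Sum>j\<le>l. (1 / t j) ^ k) * (\<integral>\<^sup>+y. f y \<partial>\<mu>)) =
        ennreal (W * (\<Sum>j\<le>l. (1 / t j) ^ k)) * (\<integral>\<^sup>+y. f y \<partial>\<mu>)"
      using W t by (subst ennreal_mult) (auto intro!: sum_nonneg simp: less_imp_le mult.assoc)
    finally show "ennreal ((p x)\<^sup>2) * emeasure \<mu> K \<le>
        ennreal (W * (\<Sum>j\<le>l. (1 / t j) ^ k)) * (\<integral>\<^sup>+y. indicator K y * ennreal ((p y)\<^sup>2) \<partial>\<mu>)"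
      by (simp add: f_def)
  qed
qed

section \<open>Square integrable functions and test functions\<close>

lemma integral_lborel_translate:
  fixes f :: "'a::euclidean_space \<Rightarrow> real"
  assumes [measurable]: "f \<in> borel_measurable borel"
  shows "(\<integral>x. f (x + a) \<partial>lborel) = (\<integral>x. f x \<partial>lborel)"
proof -
  have "(\<integral>x. f x \<partial>lborel) = (\<integral>x. f x \<partial>distr lborel borel ((+) a))"
    by (simp add: lborel_distr_plus)
  also have "\<dots> = (\<integral>x. f (a + x) \<partial>lborel)"
    by (rule integral_distr) auto
  finally show ?thesis by (simp add: add.commute)
qed

lemma integrable_lborel_translate:
  fixes f :: "'a::euclidean_space \<Rightarrow> real"
  assumes f: "integrable lborel f"
  shows "integrable lborel (\<lambda>x. f (x + a))"
proof -
  have [measurable]: "f \<in> borel_measurable borel" using f by auto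
  have "integrable (distr lborel borel ((+) a)) f"
    using f by (simp add: lborel_distr_plus)
  then have "integrable lborel (\<lambda>x. f (a + x))"
    by (subst (asm) integrable_distr_eq) auto
  then show ?thesis by (simp add: add.commute)
qed

definition L2_fun :: "(real^'n \<Rightarrow> real) \<Rightarrow> bool" where
  "L2_fun f \<longleftrightarrow> f \<in> borel_measurable borel \<and> integrable lborel (\<lambda>x. (f x)\<^sup>2)"

lemma L2_fun_mult_integrable:
  assumes "L2_fun f" "L2_fun g"
  shows "integrable lborel (\<lambda>x. f x * g x)"
proof (rule Bochner_Integration.integrable_bound)
  show "integrable lborel (\<lambda>x. (f x)\<^sup>2 + (g x)\<^sup>2)"
    using assms by (simp add: L2_fun_def)
  have [measurable]: "f \<in> borel_measurable borel" "g \<in> borel_measurable borel"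
    using assms by (simp_all add: L2_fun_def)
  show "(\<lambda>x. f x * g x) \<in> borel_measurable lborel" by measurable
  have "\<bar>f x * g x\<bar> \<le> (f x)\<^sup>2 + (g x)\<^sup>2" for x
  proof -
    have "2 * \<bar>f x\<bar> * \<bar>g x\<bar> \<le> \<bar>f x\<bar>\<^sup>2 + \<bar>g x\<bar>\<^sup>2" by (rule sum_squares_bound)
    moreover have "0 \<le> \<bar>f x\<bar> * \<bar>g x\<bar>" by simp
    ultimately show ?thesis unfolding abs_mult power2_abs by linarith
  qed
  then show "AE x in lborel. norm (f x * g x) \<le> norm ((f x)\<^sup>2 + (g x)\<^sup>2)"
    by (intro AE_I2) (simp add: abs_of_nonneg)
qed

lemma L2_fun_add:
  assumes "L2_fun f" "L2_fun g"
  shows "L2_fun (\<lambda>x. f x + g x)"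
proof -
  have "integrable lborel (\<lambda>x. (f x)\<^sup>2 + (g x)\<^sup>2 + 2 * (f x * g x))"
    using assms L2_fun_mult_integrable[OF assms] by (simp add: L2_fun_def)
  moreover have [measurable]: "f \<in> borel_measurable borel" "g \<in> borel_measurable borel"
    using assms by (simp_all add: L2_fun_def)
  have "(\<lambda>x. f x + g x) \<in> borel_measurable borel" by measurable
  ultimately show ?thesis by (simp add: L2_fun_def power2_sum mult.assoc)
qed

lemma L2_fun_cmult:
  assumes "L2_fun f"
  shows "L2_fun (\<lambda>x. c * f x)"
proof -
  have [measurable]: "f \<in> borel_measurable borel" and "integrable lborel (\<lambda>x. (f x)\<^sup>2)"
    using assms by (simp_all add: L2_fun_def)
  moreover have "(\<lambda>x. c * f x) \<in> borel_measurable borel" by measurable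
  ultimately show ?thesis by (simp add: L2_fun_def power_mult_distrib)
qed

lemma L2_fun_diff:
  assumes "L2_fun f" "L2_fun g"
  shows "L2_fun (\<lambda>x. f x - g x)"
  using L2_fun_add[OF assms(1) L2_fun_cmult[OF assms(2), of "-1"]] by simp

lemma L2_fun_cong_le:
  assumes "L2_fun g" "f \<in> borel_measurable borel" "\<And>x. \<bar>f x\<bar> \<le> \<bar>g x\<bar>"
  shows "L2_fun f"
  unfolding L2_fun_def
proof (rule conjI[OF assms(2)], rule Bochner_Integration.integrable_bound[where f = "\<lambda>x. (g x)\<^sup>2"])
  show "integrable lborel (\<lambda>x. (g x)\<^sup>2)" using assms(1) by (simp add: L2_fun_def)
  show "AE x in lborel. norm ((f x)\<^sup>2) \<le> norm ((g x)\<^sup>2)"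
    using assms(3) abs_le_square_iff by (intro AE_I2) auto
qed (use assms(2) in simp)

lemma quadratic_nonneg_discriminant:
  fixes a b c :: real
  assumes "\<And>t. 0 \<le> t\<^sup>2 * a + 2 * t * b + c"
  shows "b\<^sup>2 \<le> a * c"
proof (cases "a = 0")
  case True
  have "b = 0"
  proof (rule ccontr)
    assume "b \<noteq> 0"
    then show False using assms[of "- (c + 1) / (2 * b)"] True by (simp add: field_simps)
  qed
  then show ?thesis using True by simp
next
  case False
  have "0 \<le> a"
  proof (rule ccontr)
    assume a: "\<not> 0 \<le> a"
    define t where "t = 1 + (2 * \<bar>b\<bar> + \<bar>c\<bar>) / (- a)"
    have t: "1 \<le> t" using a by (simp add: t_def divide_nonneg_neg)
    have "- a * t = - a + 2 * \<bar>b\<bar> + \<bar>c\<bar>" using a by (simp add: t_def field_simps)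
    then have ta: "t * a + 2 * \<bar>b\<bar> + \<bar>c\<bar> < 0" using a by (simp add: algebra_simps)
    have "t\<^sup>2 * a + 2 * t * b + c \<le> t * (t * a) + t * (2 * \<bar>b\<bar>) + t * \<bar>c\<bar>"
    proof -
      have "2 * t * b \<le> t * (2 * \<bar>b\<bar>)" using t by (simp add: mult_left_mono)
      moreover have "c \<le> t * \<bar>c\<bar>" using t mult_right_mono[of 1 t "\<bar>c\<bar>"] by linarith
      ultimately show ?thesis by (simp add: power2_eq_square mult.assoc)
    qed
    also have "\<dots> = t * (t * a + 2 * \<bar>b\<bar> + \<bar>c\<bar>)" by (simp add: algebra_simps)
    also have "\<dots> < 0" using ta t by (simp add: mult_pos_neg)
    finally show False using assms[of t] by simp
  qed
  then have "0 < a" using False by simp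
  then show ?thesis using assms[of "- b / a"]
    by (simp add: power2_eq_square field_simps)
qed

lemma L2_Cauchy_Schwarz:
  assumes f: "L2_fun f" and g: "L2_fun g"
  shows "(\<integral>x. f x * g x \<partial>lborel)\<^sup>2 \<le> (\<integral>x. (f x)\<^sup>2 \<partial>lborel) * (\<integral>x. (g x)\<^sup>2 \<partial>lborel)"
proof (rule quadratic_nonneg_discriminant)
  fix t :: real
  have "0 \<le> (\<integral>x. (t * f x + g x)\<^sup>2 \<partial>lborel)" by simp
  also have "\<dots> = (\<integral>x. t\<^sup>2 * (f x)\<^sup>2 + 2 * t * (f x * g x) + (g x)\<^sup>2 \<partial>lborel)"
    by (intro Bochner_Integration.integral_cong refl) (simp add: power2_eq_square algebra_simps)
  also have "\<dots> = t\<^sup>2 * (\<integral>x. (f x)\<^sup>2 \<partial>lborel) + 2 * t * (\<integral>x. f x * g x \<partial>lborel) + (\<integral>x. (g x)\<^sup>2 \<partial>lborel)"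
    using f g L2_fun_mult_integrable[OF f g] by (simp add: L2_fun_def)
  finally show "0 \<le> \<dots>" .
qed

lemma L2_sum_square_le:
  assumes "L2_fun f" "L2_fun g"
  shows "(\<integral>x. (f x + g x)\<^sup>2 \<partial>lborel) \<le> 2 * (\<integral>x. (f x)\<^sup>2 \<partial>lborel) + 2 * (\<integral>x. (g x)\<^sup>2 \<partial>lborel)"
proof -
  have "(\<integral>x. (f x + g x)\<^sup>2 \<partial>lborel) \<le> (\<integral>x. 2 * (f x)\<^sup>2 + 2 * (g x)\<^sup>2 \<partial>lborel)"
    using assms L2_fun_add[OF assms] power2_diff_le[of "f _" "- g _"]
    by (intro integral_mono) (auto simp: L2_fun_def)
  also have "\<dots> = 2 * (\<integral>x. (f x)\<^sup>2 \<partial>lborel) + 2 * (\<integral>x. (g x)\<^sup>2 \<partial>lborel)"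
    using assms by (simp add: L2_fun_def)
  finally show ?thesis .
qed

text \<open>
  Polynomials are not square integrable on the whole space, but they are to be subtracted from
  functions that are.
\<close>

definition loc_L2 :: "(real^'n \<Rightarrow> real) \<Rightarrow> bool" where
  "loc_L2 f \<longleftrightarrow> f \<in> borel_measurable borel \<and> (\<forall>R. L2_fun (\<lambda>x. indicator (cball 0 R) x * f x))"

lemma loc_L2_measurable: "loc_L2 f \<Longrightarrow> f \<in> borel_measurable borel"
  by (simp add: loc_L2_def)

lemma bounded_obtain_cball:
  assumes "bounded (A :: 'a::real_normed_vector set)"
  obtains R where "A \<subseteq> cball 0 R"
  using assms by (auto simp: bounded_iff subset_iff)

lemma loc_L2_cut:
  assumes f: "loc_L2 f" and A: "A \<in> sets borel" "bounded A"
  shows "L2_fun (\<lambda>x. indicator A x * f x)"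
proof -
  obtain R where R: "A \<subseteq> cball 0 R" using bounded_obtain_cball[OF A(2)] by blast
  show ?thesis
  proof (rule L2_fun_cong_le)
    show "L2_fun (\<lambda>x. indicator (cball 0 R) x * f x)" using f by (simp add: loc_L2_def)
    show "(\<lambda>x. indicator A x * f x) \<in> borel_measurable borel"
      using A(1) loc_L2_measurable[OF f] by measurable
    show "\<bar>indicator A x * f x\<bar> \<le> \<bar>indicator (cball 0 R) x * f x\<bar>" for x
      using R by (auto simp: indicator_def)
  qed
qed

lemma loc_L2_add:
  assumes f: "loc_L2 f" and g: "loc_L2 g"
  shows "loc_L2 (\<lambda>x. f x + g x)"
  unfolding loc_L2_def
proof (intro conjI allI)
  note [measurable] = loc_L2_measurable[OF f] loc_L2_measurable[OF g]
  show "(\<lambda>x. f x + g x) \<in> borel_measurable borel" by measurable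
  show "L2_fun (\<lambda>x. indicator (cball 0 R) x * (f x + g x))" for R
    unfolding distrib_left using f g by (intro L2_fun_add) (simp_all add: loc_L2_def)
qed

lemma loc_L2_cmult:
  assumes f: "loc_L2 f"
  shows "loc_L2 (\<lambda>x. c * f x)"
  unfolding loc_L2_def
proof (intro conjI allI)
  note [measurable] = loc_L2_measurable[OF f]
  show "(\<lambda>x. c * f x) \<in> borel_measurable borel" by measurable
  fix R
  have "L2_fun (\<lambda>x. c * (indicator (cball 0 R) x * f x))"
    using f by (intro L2_fun_cmult) (simp add: loc_L2_def)
  then show "L2_fun (\<lambda>x. indicator (cball 0 R) x * (c * f x))"
    by (simp only: mult.left_commute)
qed

lemma loc_L2_diff:
  assumes "loc_L2 f" "loc_L2 g"
  shows "loc_L2 (\<lambda>x. f x - g x)"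
  using loc_L2_add[OF assms(1) loc_L2_cmult[OF assms(2), of "-1"]] by simp

lemma L2_fun_bounded_support:
  assumes "f \<in> borel_measurable borel" "\<And>x. \<bar>f x\<bar> \<le> B" "\<And>x. x \<notin> cball 0 R \<Longrightarrow> f x = 0"
  shows "L2_fun f"
proof (rule L2_fun_cong_le)
  have "integrable lborel (\<lambda>x. B\<^sup>2 * indicator (cball (0::real^'a) R) x)"
    using emeasure_bounded_finite[OF bounded_cball, of "0::real^'a" R]
    by (intro integrable_mult_right integrable_real_indicator) auto
  moreover have "(B * indicator (cball (0::real^'a) R) x)\<^sup>2 = B\<^sup>2 * indicator (cball 0 R) x" for x
    by (auto simp: indicator_def)
  moreover have [measurable]: "cball (0::real^'a) R \<in> sets borel" by simp
  have "(\<lambda>x. B * indicator (cball (0::real^'a) R) x) \<in> borel_measurable borel" by measurable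
  ultimately show "L2_fun (\<lambda>x. B * indicator (cball (0::real^'a) R) x)"
    by (simp add: L2_fun_def)
  show "\<bar>f x\<bar> \<le> \<bar>B * indicator (cball 0 R) x\<bar>" for x
    using assms(2)[of x] assms(3)[of x] by (cases "x \<in> cball 0 R") auto
qed (use assms in auto)

lemma loc_L2_locally_bounded:
  assumes f: "f \<in> borel_measurable borel" and B: "\<And>R. \<exists>B. \<forall>x\<in>cball 0 R. \<bar>f x\<bar> \<le> B"
  shows "loc_L2 f"
  unfolding loc_L2_def
proof (intro conjI f allI)
  fix R
  obtain B where "\<forall>x\<in>cball 0 R. \<bar>f x\<bar> \<le> B" using B by blast
  then show "L2_fun (\<lambda>x. indicator (cball 0 R) x * f x)"
    using f by (intro L2_fun_bounded_support[where B = "max B 0" and R = R])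
        (auto simp: indicator_def le_max_iff_disj)
qed

lemma loc_L2_continuous:
  assumes "continuous_on UNIV f"
  shows "loc_L2 f"
proof (rule loc_L2_locally_bounded)
  show "f \<in> borel_measurable borel" using assms by (rule borel_measurable_continuous_onI)
  fix R :: real
  have "bounded (f ` cball 0 R)"
    by (intro compact_imp_bounded compact_continuous_image continuous_on_subset[OF assms]) auto
  then show "\<exists>B. \<forall>x\<in>cball 0 R. \<bar>f x\<bar> \<le> B" by (auto simp: bounded_iff)
qed

lemma loc_L2_translate:
  assumes f: "loc_L2 f"
  shows "loc_L2 (\<lambda>x. f (x + a))"
  unfolding loc_L2_def
proof (intro conjI allI)
  note [measurable] = loc_L2_measurable[OF f]
  show "(\<lambda>x. f (x + a)) \<in> borel_measurable borel" by measurable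
  fix R
  have "L2_fun (\<lambda>x. indicator (cball a R) x * f x)" using f by (rule loc_L2_cut) auto
  then have "integrable lborel (\<lambda>x. (indicator (cball a R) x * f x)\<^sup>2)" by (simp add: L2_fun_def)
  then have "integrable lborel (\<lambda>x. (indicator (cball a R) (x + a) * f (x + a))\<^sup>2)"
    by (rule integrable_lborel_translate)
  moreover have "indicator (cball a R) (x + a) = (indicator (cball 0 R) x :: real)" for x
    by (simp add: indicator_def dist_norm)
  moreover have [measurable]: "cball (0::real^'a) R \<in> sets borel" by simp
  have "(\<lambda>x. indicator (cball 0 R) x * f (x + a)) \<in> borel_measurable borel" by measurable
  ultimately show "L2_fun (\<lambda>x. indicator (cball 0 R) x * f (x + a))"
    by (simp add: L2_fun_def)
qed

lemma test_functions_mono: "A \<subseteq> B \<Longrightarrow> test_functions A \<subseteq> test_functions B"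
  by (auto simp: test_functions_def)

lemma test_function_support:
  assumes "\<phi> \<in> test_functions A" "\<phi> x \<noteq> 0"
  shows "x \<in> A"
  using assms closure_subset[of "{x. \<phi> x \<noteq> 0}"] by (auto simp: test_functions_def)

lemma test_function_C1:
  assumes "\<phi> \<in> test_functions A"
  shows "\<phi> differentiable (at x)" "continuous_on S \<phi>" "continuous_on S (partial_deriv i \<phi>)"
proof -
  have "C_k (Suc 0) \<phi>" "C_k 0 \<phi>" using assms unfolding test_functions_def by blast+
  then show "\<phi> differentiable (at x)" "continuous_on S \<phi>" "continuous_on S (partial_deriv i \<phi>)"
    by (auto intro: continuous_on_subset)
qed

text \<open>
  What integration by parts uses of a test function. In contrast to \<^const>\<open>test_functions\<close>, these
  properties pass to products with smooth functions by the product rule for first derivatives.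
\<close>

definition C1_compact :: "(real^'n \<Rightarrow> real) \<Rightarrow> bool" where
  "C1_compact f \<longleftrightarrow> (\<forall>x. f differentiable (at x)) \<and> (\<forall>i. continuous_on UNIV (partial_deriv i f)) \<and>
     (\<exists>R. \<forall>x. x \<notin> cball 0 R \<longrightarrow> f x = 0)"

lemma test_function_C1_compact:
  assumes "\<phi> \<in> test_functions A"
  shows "C1_compact \<phi>"
proof -
  have "bounded (closure {x. \<phi> x \<noteq> 0})"
    using assms by (auto simp: test_functions_def compact_imp_bounded)
  then obtain R where "closure {x. \<phi> x \<noteq> 0} \<subseteq> cball 0 R"
    using bounded_obtain_cball by blast
  then have "\<forall>x. x \<notin> cball 0 R \<longrightarrow> \<phi> x = 0" using closure_subset[of "{x. \<phi> x \<noteq> 0}"] by blast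
  then show ?thesis using test_function_C1[OF assms] unfolding C1_compact_def by blast
qed

lemma partial_deriv_zero_outside:
  assumes "closed S" "\<And>x. x \<notin> S \<Longrightarrow> f x = 0" "x \<notin> S"
  shows "partial_deriv i f x = 0"
proof -
  have "(f has_derivative (\<lambda>_. 0)) (at x)"
    by (rule has_derivative_transform_within_open[of "\<lambda>_. 0" _ _ _ "- S"]) (use assms in auto)
  then show ?thesis by (simp add: partial_deriv_unique)
qed

lemma test_function_deriv_support:
  assumes "\<phi> \<in> test_functions A" "partial_deriv i \<phi> x \<noteq> 0"
  shows "x \<in> A"
proof (rule ccontr)
  assume "x \<notin> A"
  then have "x \<notin> closure {x. \<phi> x \<noteq> 0}" using assms(1) by (auto simp: test_functions_def)
  then have "partial_deriv i \<phi> x = 0"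
    using closure_subset[of "{x. \<phi> x \<noteq> 0}"] by (intro partial_deriv_zero_outside[OF closed_closure]) auto
  then show False using assms(2) by simp
qed

lemma C1_compact_obtain:
  assumes f: "C1_compact f"
  obtains R B where "0 < B" "\<And>x. x \<notin> cball 0 R \<Longrightarrow> f x = 0" "\<And>x i. x \<notin> cball 0 R \<Longrightarrow> partial_deriv i f x = 0"
    "\<And>x. \<bar>f x\<bar> \<le> B" "\<And>x i. \<bar>partial_deriv i f x\<bar> \<le> B" "\<And>x. norm (grad f x) \<le> B"
    "\<And>x y. \<bar>f x - f y\<bar> \<le> B * norm (x - y)"
proof -
  obtain R where R: "\<And>x. x \<notin> cball 0 R \<Longrightarrow> f x = 0" using f by (auto simp: C1_compact_def)
  have cont: "continuous_on UNIV f"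
    using f by (meson C1_compact_def continuous_at_imp_continuous_on differentiable_imp_continuous_within)
  have dR: "partial_deriv i f x = 0" if "x \<notin> cball 0 R" for x i
    using R that by (intro partial_deriv_zero_outside[of "cball 0 R"]) auto
  have bdd: "\<exists>B. \<forall>x. \<bar>h x\<bar> \<le> B" if "continuous_on UNIV h" "\<And>x. x \<notin> cball 0 R \<Longrightarrow> h x = 0" for h :: "real^'a \<Rightarrow> real"
  proof -
    have "bounded (h ` cball 0 R)"
      by (intro compact_imp_bounded compact_continuous_image continuous_on_subset[OF that(1)]) auto
    then obtain B where "\<forall>x\<in>cball 0 R. \<bar>h x\<bar> \<le> B" by (auto simp: bounded_iff)
    then have "\<bar>h x\<bar> \<le> max B 0" for x using that(2)[of x]
      by (cases "x \<in> cball 0 R") (auto simp: le_max_iff_disj)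
    then show ?thesis by blast
  qed
  obtain B0 where B0: "\<And>x. \<bar>f x\<bar> \<le> B0" using bdd[OF cont R] by blast
  have "\<forall>i. \<exists>B. \<forall>x. \<bar>partial_deriv i f x\<bar> \<le> B"
    using bdd dR f unfolding C1_compact_def by blast
  then obtain b where b: "\<And>i x. \<bar>partial_deriv i f x\<bar> \<le> b i" by metis
  define B where "B = 1 + \<bar>B0\<bar> + (\<Sum>i\<in>UNIV. \<bar>b i\<bar>)"
  have sum0: "0 \<le> (\<Sum>i\<in>UNIV. \<bar>b i\<bar>)" by (simp add: sum_nonneg)
  have bB: "\<bar>partial_deriv i f x\<bar> \<le> B" for i x
    using b[where i = i and x = x] member_le_sum[of i UNIV "\<lambda>i. \<bar>b i\<bar>"] by (simp add: B_def)
  have gB: "norm (grad f x) \<le> B" for x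
  proof -
    have "norm (grad f x) \<le> (\<Sum>i\<in>UNIV. \<bar>grad f x $ i\<bar>)" by (rule norm_le_l1_cart)
    also have "\<dots> \<le> (\<Sum>i\<in>UNIV. \<bar>b i\<bar>)" unfolding grad_nth
      by (intro sum_mono order_trans[OF b] abs_ge_self)
    finally show ?thesis by (simp add: B_def)
  qed
  have "norm (f x - f y) \<le> B * norm (x - y)" for x y
  proof (rule differentiable_bound[where f' = "\<lambda>x h. grad f x \<bullet> h" and S = UNIV])
    show "(f has_derivative (\<bullet>) (grad f z)) (at z within UNIV)" for z
      using f has_derivative_grad[of f z] by (simp add: C1_compact_def)
    show "onorm ((\<bullet>) (grad f z)) \<le> B" for z
    proof (rule onorm_le)
      fix h
      have "norm (grad f z \<bullet> h) \<le> norm (grad f z) * norm h"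
        using Cauchy_Schwarz_ineq2[of "grad f z" h] by simp
      also have "\<dots> \<le> B * norm h" by (rule mult_right_mono[OF gB]) simp
      finally show "norm (grad f z \<bullet> h) \<le> B * norm h" .
    qed
  qed auto
  moreover have "0 < B" using sum0 unfolding B_def by linarith
  moreover have "\<bar>f x\<bar> \<le> B" for x
  proof -
    have "\<bar>f x\<bar> \<le> \<bar>B0\<bar>" using B0[of x] by linarith
    then show ?thesis using sum0 unfolding B_def by linarith
  qed
  ultimately show ?thesis
    using bB gB R dR by (intro that[of B R]) auto
qed

lemma C1_compact_L2:
  assumes "C1_compact f"
  shows "L2_fun f" "L2_fun (partial_deriv i f)"
proof -
  obtain R B where RB: "\<And>x. x \<notin> cball 0 R \<Longrightarrow> f x = 0" "\<And>x i. x \<notin> cball 0 R \<Longrightarrow> partial_deriv i f x = 0"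
    "\<And>x. \<bar>f x\<bar> \<le> B" "\<And>x i. \<bar>partial_deriv i f x\<bar> \<le> B"
    using C1_compact_obtain[OF assms] by metis
  have cont: "continuous_on UNIV f"
    using assms by (meson C1_compact_def continuous_at_imp_continuous_on differentiable_imp_continuous_within)
  show "L2_fun f" "L2_fun (partial_deriv i f)"
    using RB cont assms by (auto intro!: L2_fun_bounded_support[where B = B and R = R]
        borel_measurable_continuous_onI simp: C1_compact_def simp del: mem_cball)
qed

lemma loc_L2_times_compact_integrable:
  assumes f: "loc_L2 f" and h: "L2_fun h" "\<And>x. x \<notin> cball 0 R \<Longrightarrow> h x = 0"
  shows "integrable lborel (\<lambda>x. f x * h x)"
proof -
  have "integrable lborel (\<lambda>x. (indicator (cball 0 R) x * f x) * h x)"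
    using f h(1) by (intro L2_fun_mult_integrable) (auto simp: loc_L2_def)
  moreover have "(indicator (cball 0 R) x * f x) * h x = f x * h x" for x
    using h(2)[of x] by (cases "x \<in> cball 0 R") auto
  ultimately show ?thesis by simp
qed

lemma loc_L2_times_test_integrable:
  assumes f: "loc_L2 f" and \<phi>: "C1_compact \<phi>"
  shows "integrable lborel (\<lambda>x. f x * \<phi> x)" "integrable lborel (\<lambda>x. f x * partial_deriv i \<phi> x)"
proof -
  obtain R where R: "\<And>x. x \<notin> cball 0 R \<Longrightarrow> \<phi> x = 0" "\<And>x i. x \<notin> cball 0 R \<Longrightarrow> partial_deriv i \<phi> x = 0"
    using C1_compact_obtain[OF \<phi>] by metis
  show "integrable lborel (\<lambda>x. f x * \<phi> x)" "integrable lborel (\<lambda>x. f x * partial_deriv i \<phi> x)"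
    using loc_L2_times_compact_integrable[OF f] C1_compact_L2[OF \<phi>] R by blast+
qed

lemma loc_L2_test_Cauchy_Schwarz:
  assumes f: "loc_L2 f" and \<phi>: "\<phi> \<in> test_functions A" and A: "A \<in> sets borel" "bounded A"
  shows "(\<integral>x. f x * \<phi> x \<partial>lborel)\<^sup>2 \<le> (\<integral>x. indicator A x * (f x)\<^sup>2 \<partial>lborel) * (\<integral>x. (\<phi> x)\<^sup>2 \<partial>lborel)"
proof -
  have "(\<integral>x. f x * \<phi> x \<partial>lborel) = (\<integral>x. (indicator A x * f x) * \<phi> x \<partial>lborel)"
    using test_function_support[OF \<phi>] by (intro Bochner_Integration.integral_cong) (auto simp: indicator_def)
  moreover have "(\<integral>x. indicator A x * (f x)\<^sup>2 \<partial>lborel) = (\<integral>x. (indicator A x * f x)\<^sup>2 \<partial>lborel)"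
    by (intro Bochner_Integration.integral_cong) (auto simp: indicator_def)
  ultimately show ?thesis
    using L2_Cauchy_Schwarz[OF loc_L2_cut[OF f A] C1_compact_L2(1)[OF test_function_C1_compact[OF \<phi>]]]
    by simp
qed

section \<open>Test functions are dense in the space of square integrable functions\<close>

lemma elementary_smooth_test_function:
  assumes "\<phi> \<in> elementary_smooth" "compact S" "\<And>x. \<phi> x \<noteq> 0 \<Longrightarrow> x \<in> S" "S \<subseteq> A"
  shows "\<phi> \<in> test_functions A"
proof -
  have "closure {x. \<phi> x \<noteq> 0} \<subseteq> S"
    using assms by (intro closure_minimal compact_imp_closed) auto
  then show ?thesis
    using assms elementary_smooth_C_k
    by (auto simp: test_functions_def intro: compact_closure[THEN iffD2] bounded_subset[OF compact_imp_bounded])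
qed

lemma zero_test_function: "(\<lambda>x. 0) \<in> test_functions A"
  by (rule elementary_smooth_test_function[of _ "{}"]) (auto intro: elementary_smooth.const)

lemma partial_deriv_add:
  assumes "f differentiable (at x)" "g differentiable (at x)"
  shows "partial_deriv i (\<lambda>x. f x + g x) x = partial_deriv i f x + partial_deriv i g x"
  using partial_deriv_unique[OF has_derivative_add[OF has_derivative_grad[OF assms(1)] has_derivative_grad[OF assms(2)]]]
  by (simp add: inner_axis)

lemma partial_deriv_cmult:
  assumes "f differentiable (at x)"
  shows "partial_deriv i (\<lambda>x. c * f x) x = c * partial_deriv i f x"
  using partial_deriv_unique[OF has_derivative_mult_right[OF has_derivative_grad[OF assms(1)]]]
  by (simp add: inner_axis)

lemma C_k_add: "C_k k f \<Longrightarrow> C_k k g \<Longrightarrow> C_k k (\<lambda>x. f x + g x)"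
proof (induction k arbitrary: f g)
  case (Suc k)
  then have "partial_deriv i (\<lambda>x. f x + g x) = (\<lambda>x. partial_deriv i f x + partial_deriv i g x)" for i
    by (intro ext partial_deriv_add) auto
  with Suc show ?case by auto
qed (auto intro: continuous_on_add)

lemma C_k_cmult: "C_k k f \<Longrightarrow> C_k k (\<lambda>x. c * f x)"
proof (induction k arbitrary: f)
  case (Suc k)
  then have "partial_deriv i (\<lambda>x. c * f x) = (\<lambda>x. c * partial_deriv i f x)" for i
    by (intro ext partial_deriv_cmult) auto
  with Suc show ?case by auto
qed (auto intro: continuous_on_mult continuous_on_const)

lemma C_k_translate: "C_k k f \<Longrightarrow> C_k k (\<lambda>x. f (x - a))"
proof (induction k arbitrary: f)
  case 0
  then show ?case by (auto intro!: continuous_on_compose2[of UNIV f] continuous_intros)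
next
  case (Suc k)
  have D: "((\<lambda>x. f (x - a)) has_derivative (\<lambda>h. grad f (x - a) \<bullet> h)) (at x)" for x
  proof -
    have "((\<lambda>x. x - a) has_derivative (\<lambda>h. h)) (at x)" by (auto intro!: derivative_eq_intros)
    from has_derivative_compose[OF this, of f "\<lambda>h. grad f (x - a) \<bullet> h"]
    show ?thesis using Suc.prems has_derivative_grad[of f "x - a"] by simp
  qed
  then have "partial_deriv i (\<lambda>x. f (x - a)) = (\<lambda>x. partial_deriv i f (x - a))" for i
    by (intro ext) (simp add: partial_deriv_unique[OF D] inner_axis)
  with Suc D show ?case by (auto intro: differentiableI)
qed

lemma partial_deriv_translate:
  assumes "f differentiable (at (x - a))"
  shows "partial_deriv i (\<lambda>x. f (x - a)) x = partial_deriv i f (x - a)"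
proof -
  have "((\<lambda>x. x - a) has_derivative (\<lambda>h. h)) (at x)" by (auto intro!: derivative_eq_intros)
  from partial_deriv_unique[OF has_derivative_compose[OF this has_derivative_grad[OF assms]]]
  show ?thesis by (simp add: inner_axis)
qed

lemma support_closure_add:
  "closure {x. f x + g x \<noteq> (0::real)} \<subseteq> closure {x. f x \<noteq> 0} \<union> closure {x. g x \<noteq> 0}"
  unfolding closure_Un[symmetric] by (rule closure_mono) auto

lemma test_function_add:
  assumes f: "f \<in> test_functions A" and g: "g \<in> test_functions A"
  shows "(\<lambda>x. f x + g x) \<in> test_functions A"
proof -
  let ?S = "closure {x. f x \<noteq> 0} \<union> closure {x. g x \<noteq> 0}"
  have "compact ?S" "?S \<subseteq> A" using f g by (auto simp: test_functions_def intro: compact_Un)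
  moreover have "compact (closure {x. f x + g x \<noteq> 0})"
    using compact_Int_closed[OF \<open>compact ?S\<close> closed_closure[of "{x. f x + g x \<noteq> 0}"]]
      support_closure_add[of f g] by (simp add: Int_absorb1)
  moreover have "closure {x. f x + g x \<noteq> 0} \<subseteq> A"
    using support_closure_add[of f g] \<open>?S \<subseteq> A\<close> by (rule order_trans)
  ultimately show ?thesis
    using f g by (simp add: test_functions_def C_k_add)
qed

lemma test_function_cmult:
  assumes f: "f \<in> test_functions A"
  shows "(\<lambda>x. c * f x) \<in> test_functions A"
proof (cases "c = 0")
  case True
  then show ?thesis by (simp add: zero_test_function)
next
  case False
  then have "{x. c * f x \<noteq> 0} = {x. f x \<noteq> 0}" by simp
  then show ?thesis using f by (simp add: test_functions_def C_k_cmult)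
qed

lemma test_function_translate:
  assumes f: "f \<in> test_functions A" and sub: "\<And>x. x \<in> A \<Longrightarrow> x + a \<in> B"
  shows "(\<lambda>x. f (x - a)) \<in> test_functions B"
proof -
  have "{x. f (x - a) \<noteq> 0} = (+) a ` {x. f x \<noteq> 0}"
  proof (intro set_eqI iffI)
    fix x assume "x \<in> {x. f (x - a) \<noteq> 0}"
    then show "x \<in> (+) a ` {x. f x \<noteq> 0}" by (intro image_eqI[of _ _ "x - a"]) auto
  qed auto
  then have eq: "closure {x. f (x - a) \<noteq> 0} = (+) a ` closure {x. f x \<noteq> 0}"
    by (simp add: closure_translation)
  show ?thesis
  proof -
    have "compact (closure {x. f (x - a) \<noteq> 0})"
      unfolding eq using f by (intro compact_translation) (simp add: test_functions_def)
    moreover have "closure {x. f (x - a) \<noteq> 0} \<subseteq> B"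
      unfolding eq using f sub by (auto simp: test_functions_def add.commute[of a])
    ultimately show ?thesis
      using f by (simp add: test_functions_def C_k_translate)
  qed
qed

definition test_approximable :: "(real^'n) set \<Rightarrow> (real^'n \<Rightarrow> real) \<Rightarrow> bool" where
  "test_approximable A f \<longleftrightarrow> L2_fun f \<and>
     (\<forall>e>0. \<exists>\<phi>\<in>test_functions A. (\<integral>x. (\<phi> x - f x)\<^sup>2 \<partial>lborel) < e)"

lemma test_function_L2: "\<phi> \<in> test_functions A \<Longrightarrow> L2_fun \<phi>"
  by (rule C1_compact_L2(1)[OF test_function_C1_compact])

lemma test_approximable_limit:
  assumes f: "L2_fun f" and lim: "\<And>e. 0 < e \<Longrightarrow> \<exists>g. test_approximable A g \<and> (\<integral>x. (g x - f x)\<^sup>2 \<partial>lborel) < e"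
  shows "test_approximable A f"
  unfolding test_approximable_def
proof (intro conjI f allI impI)
  fix e :: real assume e: "0 < e"
  then obtain g where g: "test_approximable A g" "(\<integral>x. (g x - f x)\<^sup>2 \<partial>lborel) < e / 4"
    using lim[of "e / 4"] by auto
  then obtain \<phi> where \<phi>: "\<phi> \<in> test_functions A" "(\<integral>x. (\<phi> x - g x)\<^sup>2 \<partial>lborel) < e / 4"
    using e unfolding test_approximable_def by (meson divide_pos_pos zero_less_numeral)
  have "(\<integral>x. (\<phi> x - f x)\<^sup>2 \<partial>lborel) = (\<integral>x. ((\<phi> x - g x) + (g x - f x))\<^sup>2 \<partial>lborel)" by simp
  also have "\<dots> \<le> 2 * (\<integral>x. (\<phi> x - g x)\<^sup>2 \<partial>lborel) + 2 * (\<integral>x. (g x - f x)\<^sup>2 \<partial>lborel)"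
    using f g(1) test_function_L2[OF \<phi>(1)]
    by (intro L2_sum_square_le L2_fun_diff) (auto simp: test_approximable_def)
  also have "\<dots> < e" using g \<phi> by simp
  finally show "\<exists>\<phi>\<in>test_functions A. (\<integral>x. (\<phi> x - f x)\<^sup>2 \<partial>lborel) < e" using \<phi>(1) by blast
qed

lemma test_approximable_test: "\<phi> \<in> test_functions A \<Longrightarrow> test_approximable A \<phi>"
  unfolding test_approximable_def by (auto intro: test_function_L2 bexI[of _ \<phi>])

lemma test_approximable_add:
  assumes f: "test_approximable A f" and g: "test_approximable A g"
  shows "test_approximable A (\<lambda>x. f x + g x)"
  unfolding test_approximable_def
proof (intro conjI allI impI)
  show "L2_fun (\<lambda>x. f x + g x)" using f g by (auto simp: test_approximable_def intro: L2_fun_add)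
  fix e :: real assume "0 < e"
  then have "0 < e / 4" by simp
  then obtain \<phi> \<psi> where \<phi>: "\<phi> \<in> test_functions A" "(\<integral>x. (\<phi> x - f x)\<^sup>2 \<partial>lborel) < e / 4"
     and \<psi>: "\<psi> \<in> test_functions A" "(\<integral>x. (\<psi> x - g x)\<^sup>2 \<partial>lborel) < e / 4"
    using f g unfolding test_approximable_def by meson
  have "(\<integral>x. ((\<phi> x + \<psi> x) - (f x + g x))\<^sup>2 \<partial>lborel) = (\<integral>x. ((\<phi> x - f x) + (\<psi> x - g x))\<^sup>2 \<partial>lborel)"
    by (simp add: algebra_simps)
  also have "\<dots> \<le> 2 * (\<integral>x. (\<phi> x - f x)\<^sup>2 \<partial>lborel) + 2 * (\<integral>x. (\<psi> x - g x)\<^sup>2 \<partial>lborel)"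
    using f g test_function_L2[OF \<phi>(1)] test_function_L2[OF \<psi>(1)]
    by (intro L2_sum_square_le L2_fun_diff) (auto simp: test_approximable_def)
  also have "\<dots> < e" using \<phi> \<psi> by simp
  finally show "\<exists>\<phi>\<in>test_functions A. (\<integral>x. (\<phi> x - (f x + g x))\<^sup>2 \<partial>lborel) < e"
    using test_function_add[OF \<phi>(1) \<psi>(1)] by (intro bexI[of _ "\<lambda>x. \<phi> x + \<psi> x"]) auto
qed

lemma test_approximable_cmult:
  assumes f: "test_approximable A f"
  shows "test_approximable A (\<lambda>x. c * f x)"
  unfolding test_approximable_def
proof (intro conjI allI impI)
  show "L2_fun (\<lambda>x. c * f x)" using f by (auto simp: test_approximable_def intro: L2_fun_cmult)
  fix e :: real assume "0 < e"
  then have "0 < e / (c\<^sup>2 + 1)" by (simp add: add_nonneg_pos)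
  then obtain \<phi> where \<phi>: "\<phi> \<in> test_functions A" "(\<integral>x. (\<phi> x - f x)\<^sup>2 \<partial>lborel) < e / (c\<^sup>2 + 1)"
    using f unfolding test_approximable_def by meson
  let ?I = "\<integral>x. (\<phi> x - f x)\<^sup>2 \<partial>lborel"
  have "(\<integral>x. (c * \<phi> x - c * f x)\<^sup>2 \<partial>lborel) = (\<integral>x. c\<^sup>2 * (\<phi> x - f x)\<^sup>2 \<partial>lborel)"
    by (simp add: right_diff_distrib[symmetric] power_mult_distrib)
  also have "\<dots> = c\<^sup>2 * ?I" by simp
  also have "\<dots> \<le> (c\<^sup>2 + 1) * ?I" by (intro mult_right_mono) auto
  also have "\<dots> < e" using \<phi>(2) by (simp add: pos_less_divide_eq add_nonneg_pos mult.commute)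
  finally show "\<exists>\<phi>\<in>test_functions A. (\<integral>x. (\<phi> x - c * f x)\<^sup>2 \<partial>lborel) < e"
    using test_function_cmult[OF \<phi>(1)] by (intro bexI[of _ "\<lambda>x. c * \<phi> x"]) auto
qed

lemma L2_fun_indicator:
  assumes "S \<in> sets borel" "bounded S"
  shows "L2_fun (indicator S)"
  using loc_L2_cut[OF loc_L2_continuous[of "\<lambda>_. 1"] assms] by simp

text \<open>
  An open set is a countable union of boxes. With the bumps of the first \<open>k\<close> boxes, the
  functions \<open>1 - (\<Prod>i<k. 1 - bump i)\<close> are test functions with values in \<open>[0, 1]\<close> that tend to the
  indicator of the set.
\<close>

lemma test_approximable_open:
  fixes V :: "(real^'n) set"
  assumes V: "open V" "V \<subseteq> A" "bounded V"
  shows "test_approximable A (indicator V)"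
proof (cases "V = {}")
  case True
  then have "(indicator V :: real^'n \<Rightarrow> real) = (\<lambda>x. 0)" by (simp add: fun_eq_iff)
  then show ?thesis using test_approximable_test[OF zero_test_function, of A] by simp
next
  case False
  obtain \<D> where D: "countable \<D>" "\<D> \<subseteq> Pow V" "\<And>X. X \<in> \<D> \<Longrightarrow> \<exists>a b. X = box a b" "\<Union>\<D> = V"
    using open_countable_Union_open_box[OF V(1)] by metis
  then have "\<D> \<noteq> {}" using False by auto
  have "\<exists>a b. from_nat_into \<D> i = box a b" for i
    by (rule D(3)[OF from_nat_into[OF \<open>\<D> \<noteq> {}\<close>]])
  then obtain a b where ab: "\<And>i. from_nat_into \<D> i = box (a i) (b i)" by metis
  have V_eq: "V = (\<Union>i. box (a i) (b i))"
    using D(4) range_from_nat_into[OF \<open>\<D> \<noteq> {}\<close> D(1)] by (simp add: ab[symmetric])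
  define \<psi> where "\<psi> k x = 1 - (\<Prod>i<k. 1 - box_bump (a i) (b i) k x)" for k and x :: "real^'n"
  have prod_range: "0 \<le> (\<Prod>i\<in>I. 1 - box_bump (a i) (b i) k x)" "(\<Prod>i\<in>I. 1 - box_bump (a i) (b i) k x) \<le> 1"
    for I k x using box_bump_range by (auto intro!: prod_nonneg prod_le_1)
  have \<psi>_range: "0 \<le> \<psi> k x" "\<psi> k x \<le> 1" for k x using prod_range by (auto simp: \<psi>_def)
  have \<psi>_support: "\<exists>i<k. box_bump (a i) (b i) k x \<noteq> 0" if "\<psi> k x \<noteq> 0" for k x
    using that by (auto simp: \<psi>_def intro: ccontr)
  have \<psi>_test: "\<psi> k \<in> test_functions V" for k
  proof (rule elementary_smooth_test_function)
    let ?S = "\<Union>i<k. cbox (\<chi> j. a i $ j + 1 / real (Suc k)) (\<chi> j. b i $ j - 1 / real (Suc k))"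
    show "\<psi> k \<in> elementary_smooth" unfolding \<psi>_def[abs_def]
      by (intro elementary_smooth_diff elementary_smooth_prod elementary_smooth.const box_bump_smooth)
    show "compact ?S" by (intro compact_UN) auto
    show "x \<in> ?S" if "\<psi> k x \<noteq> 0" for x
      using \<psi>_support[OF that] box_bump_support by blast
    have "cbox (\<chi> j. a i $ j + 1 / real (Suc k)) (\<chi> j. b i $ j - 1 / real (Suc k)) \<subseteq> box (a i) (b i)" for i
    proof
      fix x assume x: "x \<in> cbox (\<chi> j. a i $ j + 1 / real (Suc k)) (\<chi> j. b i $ j - 1 / real (Suc k))"
      have "a i $ j < x $ j \<and> x $ j < b i $ j" for j
      proof -
        have "a i $ j + 1 / real (Suc k) \<le> x $ j" "x $ j \<le> b i $ j - 1 / real (Suc k)"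
          using x by (auto simp: mem_box_cart)
        moreover have "0 < 1 / real (Suc k)" by simp
        ultimately show ?thesis by linarith
      qed
      then show "x \<in> box (a i) (b i)" by (simp add: mem_box_cart)
    qed
    then show "?S \<subseteq> V" unfolding V_eq by blast
  qed
  have lim: "(\<lambda>k. \<psi> k x) \<longlonglongrightarrow> indicator V x" for x
  proof (cases "x \<in> V")
    case False
    then have "\<psi> k x = 0" for k using test_function_support[OF \<psi>_test] by blast
    then show ?thesis using False by simp
  next
    case True
    then obtain i where i: "x \<in> box (a i) (b i)" using V_eq by blast
    have lb: "(\<lambda>k. box_bump (a i) (b i) k x) \<longlonglongrightarrow> 1"
      using box_bump_tendsto[of "a i" "b i" x] i by simp
    have "eventually (\<lambda>k. box_bump (a i) (b i) k x \<le> \<psi> k x) sequentially"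
      using eventually_gt_at_top[of i]
    proof eventually_elim
      case (elim k)
      have "(\<Prod>i<k. 1 - box_bump (a i) (b i) k x) =
          (1 - box_bump (a i) (b i) k x) * (\<Prod>i\<in>{..<k} - {i}. 1 - box_bump (a i) (b i) k x)"
        using elim by (intro prod.remove) auto
      also have "\<dots> \<le> 1 - box_bump (a i) (b i) k x"
        using box_bump_range(2)[of "a i" "b i" k x] prod_range(2)[of k x "{..<k} - {i}"]
        by (intro mult_left_le) auto
      finally show ?case by (simp add: \<psi>_def)
    qed
    then have "(\<lambda>k. \<psi> k x) \<longlonglongrightarrow> 1"
      by (rule tendsto_sandwich[OF _ _ lb tendsto_const]) (use \<psi>_range in auto)
    then show ?thesis using True by simp
  qed
  have Vb: "V \<in> sets borel" using V by auto
  have "(\<lambda>k. \<integral>x. (\<psi> k x - indicator V x)\<^sup>2 \<partial>lborel) \<longlonglongrightarrow> (\<integral>x. (0::real) \<partial>(lborel :: (real^'n) measure))"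
  proof (rule integral_dominated_convergence[where w = "indicator V"])
    show "integrable lborel (indicator V :: real^'n \<Rightarrow> real)"
      using emeasure_bounded_finite[OF V(3)] Vb by (intro integrable_real_indicator) auto
    show "(\<lambda>x. (\<psi> k x - indicator V x)\<^sup>2) \<in> borel_measurable lborel" for k
      using test_function_L2[OF \<psi>_test[of k]] Vb by (auto simp: L2_fun_def)
    show "AE x in lborel. (\<lambda>k. (\<psi> k x - indicator V x)\<^sup>2) \<longlonglongrightarrow> 0"
    proof (rule AE_I2)
      fix x
      have "(\<lambda>k. (\<psi> k x - indicator V x)\<^sup>2) \<longlonglongrightarrow> (indicator V x - indicator V x)\<^sup>2"
        by (intro tendsto_intros lim)
      then show "(\<lambda>k. (\<psi> k x - indicator V x)\<^sup>2) \<longlonglongrightarrow> 0" by simp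
    qed
    show "AE x in lborel. norm ((\<psi> k x - indicator V x)\<^sup>2) \<le> indicator V x" for k
    proof (rule AE_I2)
      fix x show "norm ((\<psi> k x - indicator V x)\<^sup>2) \<le> indicator V x"
      proof (cases "x \<in> V")
        case True
        have "\<bar>\<psi> k x - 1\<bar>\<^sup>2 \<le> 1" using \<psi>_range[of k x] by (intro power_le_one) auto
        then show ?thesis using True by simp
      next
        case False
        then have "\<psi> k x = 0" using test_function_support[OF \<psi>_test] by blast
        then show ?thesis using False by simp
      qed
    qed
  qed auto
  then have lim0: "(\<lambda>k. \<integral>x. (\<psi> k x - indicator V x)\<^sup>2 \<partial>lborel) \<longlonglongrightarrow> 0" by simp
  show ?thesis
  proof (rule test_approximable_limit)
    show "L2_fun (indicator V)" by (rule L2_fun_indicator[OF Vb V(3)])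
    fix e :: real assume "0 < e"
    then have "eventually (\<lambda>k. (\<integral>x. (\<psi> k x - indicator V x)\<^sup>2 \<partial>lborel) < e) sequentially"
      using lim0 by (rule order_tendstoD(2)[rotated])
    then obtain k where "(\<integral>x. (\<psi> k x - indicator V x)\<^sup>2 \<partial>lborel) < e"
      by (auto simp: eventually_sequentially)
    then show "\<exists>g. test_approximable A g \<and> (\<integral>x. (g x - indicator V x)\<^sup>2 \<partial>lborel) < e"
      using \<psi>_test test_functions_mono[OF V(2)] by (intro exI[of _ "\<psi> k"] conjI test_approximable_test) auto
  qed
qed

text \<open>
  By outer regularity of the Lebesgue measure, a Borel set is an open set up to small measure.
\<close>

lemma test_approximable_set:
  fixes S :: "(real^'n) set"
  assumes S: "S \<in> sets borel" "S \<subseteq> A" and A: "open A" "bounded A"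
  shows "test_approximable A (indicator S)"
proof (rule test_approximable_limit)
  have bS: "bounded S" using S A bounded_subset by blast
  show "L2_fun (indicator S)" by (rule L2_fun_indicator[OF S(1) bS])
  fix e :: real assume e: "0 < e"
  obtain T where T: "open T" "S \<subseteq> T" "(T - S) \<in> lmeasurable" "emeasure lebesgue (T - S) < ennreal e"
    using sets_lebesgue_outer_open[of S e] S(1) e by (metis sets_completionI_sets sets_lborel)
  let ?V = "T \<inter> A"
  have "(\<integral>x. (indicator ?V x - indicator S x :: real)\<^sup>2 \<partial>lborel) = (\<integral>x. indicator (?V - S) x \<partial>(lborel :: (real^'n) measure))"
    using S(2) T(2) by (intro Bochner_Integration.integral_cong) (auto simp: indicator_def)
  also have "\<dots> = measure lborel (?V - S)" by simp
  also have "\<dots> < e"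
  proof -
    have "emeasure lborel (?V - S) \<le> emeasure lborel (T - S)"
      using S T A by (intro emeasure_mono) auto
    also have "\<dots> < ennreal e" using T S by simp
    finally have "emeasure lborel (?V - S) < ennreal e" .
    moreover from this have "emeasure lborel (?V - S) = ennreal (measure lborel (?V - S))"
      by (intro emeasure_eq_ennreal_measure) auto
    ultimately show ?thesis by (simp add: ennreal_less_iff)
  qed
  finally show "\<exists>g. test_approximable A g \<and> (\<integral>x. (g x - indicator S x)\<^sup>2 \<partial>lborel) < e"
    using test_approximable_open[of ?V A] T A by (intro exI[of _ "indicator ?V"]) (auto intro: bounded_subset)
qed

lemma test_approximable_sum:
  "finite I \<Longrightarrow> (\<And>i. i \<in> I \<Longrightarrow> test_approximable A (f i)) \<Longrightarrow> test_approximable A (\<lambda>x. \<Sum>i\<in>I. f i x)"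
  by (induction I rule: finite_induct)
    (auto intro: test_approximable_add test_approximable_test[OF zero_test_function])

text \<open>
  Simple functions bounded by \<open>2 * \<bar>f\<bar>\<close> converge to \<open>f\<close>; the bound makes their level sets for
  nonzero values subsets of \<open>A\<close>.
\<close>

lemma L2_test_approximable:
  fixes f :: "real^'n \<Rightarrow> real"
  assumes f: "L2_fun f" and supp: "\<And>x. x \<notin> A \<Longrightarrow> f x = 0" and A: "open A" "bounded A"
  shows "test_approximable A f"
proof -
  have [measurable]: "f \<in> borel_measurable borel" using f by (simp add: L2_fun_def)
  obtain F where F: "\<And>i. simple_function lborel (F i)" "\<And>x. (\<lambda>i. F i x) \<longlonglongrightarrow> f x"
      "\<And>i x. \<bar>F i x\<bar> \<le> 2 * \<bar>f x\<bar>"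
    using borel_measurable_implies_sequence_metric[of f lborel 0] by (auto simp: dist_real_def)
  have [measurable]: "F i \<in> borel_measurable borel" for i
    using borel_measurable_simple_function[OF F(1)[of i]] by simp
  have F_approx: "test_approximable A (F i)" for i
  proof -
    have fin: "finite (range (F i))" using F(1)[of i] by (simp add: simple_function_def)
    have "test_approximable A (\<lambda>x. y * indicator (F i -` {y}) x)" for y
    proof (cases "y = 0")
      case True
      then show ?thesis by (simp add: test_approximable_test zero_test_function)
    next
      case False
      have "F i -` {y} \<in> sets borel"
        using measurable_sets[of "F i" borel borel "{y}"] by simp
      moreover have "F i -` {y} \<subseteq> A"
      proof
        fix x assume "x \<in> F i -` {y}"
        then have "f x \<noteq> 0" using F(3)[of i x] False by auto
        then show "x \<in> A" using supp by blast
      qed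
      ultimately show ?thesis using A by (intro test_approximable_cmult test_approximable_set)
    qed
    then have "test_approximable A (\<lambda>x. \<Sum>y\<in>range (F i). y * indicator (F i -` {y}) x)"
      by (intro test_approximable_sum fin)
    moreover have "(\<Sum>y\<in>range (F i). y * indicator (F i -` {y}) x) = F i x" for x
    proof -
      have "(\<Sum>y\<in>range (F i). y * indicator (F i -` {y}) x) = (\<Sum>y\<in>range (F i). if y = F i x then F i x else 0)"
        by (intro sum.cong) (auto simp: indicator_def)
      also have "\<dots> = F i x" using fin by simp
      finally show ?thesis .
    qed
    ultimately show ?thesis by simp
  qed
  have "(\<lambda>i. \<integral>x. (F i x - f x)\<^sup>2 \<partial>lborel) \<longlonglongrightarrow> (\<integral>x. (0::real) \<partial>(lborel :: (real^'n) measure))"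
  proof (rule integral_dominated_convergence[where w = "\<lambda>x. 9 * (f x)\<^sup>2"])
    show "integrable lborel (\<lambda>x. 9 * (f x)\<^sup>2)" using f by (simp add: L2_fun_def)
    show "AE x in lborel. (\<lambda>i. (F i x - f x)\<^sup>2) \<longlonglongrightarrow> 0"
    proof (rule AE_I2)
      fix x
      have "(\<lambda>k. (F k x - f x)\<^sup>2) \<longlonglongrightarrow> (f x - f x)\<^sup>2" by (intro tendsto_intros F)
      then show "(\<lambda>k. (F k x - f x)\<^sup>2) \<longlonglongrightarrow> 0" by simp
    qed
    show "AE x in lborel. norm ((F i x - f x)\<^sup>2) \<le> 9 * (f x)\<^sup>2" for i
    proof (rule AE_I2)
      fix x
      have "\<bar>F i x - f x\<bar> \<le> 3 * \<bar>f x\<bar>" using F(3)[of i x] by linarith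
      then have "\<bar>F i x - f x\<bar>\<^sup>2 \<le> (3 * \<bar>f x\<bar>)\<^sup>2" by (intro power_mono) auto
      then show "norm ((F i x - f x)\<^sup>2) \<le> 9 * (f x)\<^sup>2" by (simp add: power_mult_distrib)
    qed
  qed auto
  then have lim0: "(\<lambda>i. \<integral>x. (F i x - f x)\<^sup>2 \<partial>lborel) \<longlonglongrightarrow> 0" by simp
  show ?thesis
  proof (rule test_approximable_limit[OF f])
    fix e :: real assume "0 < e"
    then have "eventually (\<lambda>k. (\<integral>x. (F k x - f x)\<^sup>2 \<partial>lborel) < e) sequentially"
      using lim0 by (rule order_tendstoD(2)[rotated])
    then obtain k where "(\<integral>x. (F k x - f x)\<^sup>2 \<partial>lborel) < e"
      by (auto simp: eventually_sequentially)
    then show "\<exists>g. test_approximable A g \<and> (\<integral>x. (g x - f x)\<^sup>2 \<partial>lborel) < e"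
      using F_approx by blast
  qed
qed

text \<open>
  The form in which density is used: a bound on all pairings with test functions bounds the
  norm. Test functions that approach \<open>indicator A * f\<close> give \<open>N\<^sup>2 \<le> M * N\<close> in the limit, where \<open>N\<close>
  is the squared norm.
\<close>

lemma L2_duality:
  fixes f :: "real^'n \<Rightarrow> real"
  assumes f: "loc_L2 f" and A: "open A" "bounded A" and M: "0 \<le> M"
    and bound: "\<And>\<phi>. \<phi> \<in> test_functions A \<Longrightarrow>
      (\<integral>x. f x * \<phi> x \<partial>lborel)\<^sup>2 \<le> M * (\<integral>x. (\<phi> x)\<^sup>2 \<partial>lborel)"
  shows "(\<integral>x. indicator A x * (f x)\<^sup>2 \<partial>lborel) \<le> M"
proof -
  let ?h = "\<lambda>x. indicator A x * f x"
  have Ab: "A \<in> sets borel" using A by auto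
  have h: "L2_fun ?h" by (rule loc_L2_cut[OF f Ab A(2)])
  define N where "N = (\<integral>x. (?h x)\<^sup>2 \<partial>lborel)"
  have N_eq: "N = (\<integral>x. indicator A x * (f x)\<^sup>2 \<partial>lborel)"
    unfolding N_def by (intro Bochner_Integration.integral_cong) (auto simp: indicator_def)
  have N0: "0 \<le> N" by (simp add: N_def)
  have "test_approximable A ?h" using h A by (intro L2_test_approximable) auto
  then have "\<exists>\<phi>\<in>test_functions A. (\<integral>x. (\<phi> x - ?h x)\<^sup>2 \<partial>lborel) < 1 / real (Suc k)" for k
    unfolding test_approximable_def by simp
  then obtain \<phi> where \<phi>: "\<And>k. \<phi> k \<in> test_functions A" "\<And>k. (\<integral>x. (\<phi> k x - ?h x)\<^sup>2 \<partial>lborel) < 1 / real (Suc k)"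
    by metis
  define d where "d k = (\<integral>x. (\<phi> k x - ?h x)\<^sup>2 \<partial>lborel)" for k
  have d0: "0 \<le> d k" for k by (simp add: d_def)
  have d_lim: "d \<longlonglongrightarrow> 0"
  proof (rule tendsto_sandwich)
    show "eventually (\<lambda>k. 0 \<le> d k) sequentially" using d0 by simp
    show "eventually (\<lambda>k. d k \<le> 1 / real (Suc k)) sequentially"
      using \<phi>(2) by (auto simp: d_def less_imp_le)
    show "(\<lambda>k. 1 / real (Suc k)) \<longlonglongrightarrow> 0" using LIMSEQ_inverse_real_of_nat by (simp add: inverse_eq_divide)
  qed auto
  define c where "c k = (\<integral>x. ?h x * (\<phi> k x - ?h x) \<partial>lborel)" for k
  have diff_L2: "L2_fun (\<lambda>x. \<phi> k x - ?h x)" for k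
    using test_function_L2[OF \<phi>(1)] h by (intro L2_fun_diff)
  have c_le: "(c k)\<^sup>2 \<le> N * d k" for k
    unfolding c_def N_def d_def by (rule L2_Cauchy_Schwarz[OF h diff_L2])
  have c_lim: "c \<longlonglongrightarrow> 0"
  proof -
    have "(\<lambda>k. sqrt (N * d k)) \<longlonglongrightarrow> sqrt (N * 0)"
      by (intro tendsto_real_sqrt tendsto_mult tendsto_const d_lim)
    moreover have "\<bar>c k\<bar> \<le> sqrt (N * d k)" for k
      using c_le[of k] by (metis real_sqrt_abs real_sqrt_le_mono)
    ultimately show ?thesis
      by (intro Lim_null_comparison[of c "\<lambda>k. sqrt (N * d k)"]) auto
  qed
  have pair: "(\<integral>x. f x * \<phi> k x \<partial>lborel) = N + c k" for k
  proof -
    have "(\<integral>x. f x * \<phi> k x \<partial>lborel) = (\<integral>x. (?h x)\<^sup>2 + ?h x * (\<phi> k x - ?h x) \<partial>lborel)"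
      using test_function_support[OF \<phi>(1)[of k]]
      by (intro Bochner_Integration.integral_cong refl) (auto simp: indicator_def power2_eq_square algebra_simps)
    also have "\<dots> = N + c k"
      unfolding N_def c_def using h L2_fun_mult_integrable[OF h diff_L2[of k]]
      by (intro Bochner_Integration.integral_add) (auto simp: L2_fun_def)
    finally show ?thesis .
  qed
  have sq: "(\<integral>x. (\<phi> k x)\<^sup>2 \<partial>lborel) = N + 2 * c k + d k" for k
  proof -
    have "(\<integral>x. (\<phi> k x)\<^sup>2 \<partial>lborel) = (\<integral>x. ((?h x)\<^sup>2 + 2 * (?h x * (\<phi> k x - ?h x))) + (\<phi> k x - ?h x)\<^sup>2 \<partial>lborel)"
      by (intro Bochner_Integration.integral_cong refl) (simp add: power2_eq_square algebra_simps)
    also have "\<dots> = N + 2 * c k + d k"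
      unfolding N_def c_def d_def using h diff_L2[of k] L2_fun_mult_integrable[OF h diff_L2[of k]]
      by (subst Bochner_Integration.integral_add, auto simp: L2_fun_def)+
    finally show ?thesis .
  qed
  have "(N + c k)\<^sup>2 \<le> M * (N + 2 * c k + d k)" for k
    using bound[OF \<phi>(1)[of k]] by (simp add: pair sq)
  moreover have "(\<lambda>k. (N + c k)\<^sup>2) \<longlonglongrightarrow> (N + 0)\<^sup>2" by (intro tendsto_intros c_lim)
  moreover have "(\<lambda>k. M * (N + 2 * c k + d k)) \<longlonglongrightarrow> M * (N + 2 * 0 + 0)" by (intro tendsto_intros c_lim d_lim)
  ultimately have "(N + 0)\<^sup>2 \<le> M * (N + 2 * 0 + 0)" by (intro LIMSEQ_le) auto
  then have "N * N \<le> M * N" by (simp add: power2_eq_square)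
  then have "N \<le> M" using N0 M by (cases "N = 0") auto
  then show ?thesis using N_eq by simp
qed

section \<open>Weak gradients\<close>

text \<open>
  Test functions vanish outside \<open>\<Omega>\<close>, so the integrals may extend over the whole space. Functions
  are Borel representatives here, which makes translations and Fubini's theorem available.
\<close>

definition wgrad :: "(real^'n) set \<Rightarrow> (real^'n \<Rightarrow> real) \<Rightarrow> (real^'n \<Rightarrow> real^'n) \<Rightarrow> bool" where
  "wgrad \<Omega> v g \<longleftrightarrow> (\<forall>\<phi>\<in>test_functions \<Omega>. \<forall>i.
     (\<integral>x. v x * partial_deriv i \<phi> x \<partial>lborel) = - (\<integral>x. g x $ i * \<phi> x \<partial>lborel))"

definition loc_L2_vec :: "(real^'n \<Rightarrow> real^'n) \<Rightarrow> bool" where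
  "loc_L2_vec g \<longleftrightarrow> (\<forall>i. loc_L2 (\<lambda>x. g x $ i))"

lemma wgrad_mono: "wgrad \<Omega> v g \<Longrightarrow> \<Omega>' \<subseteq> \<Omega> \<Longrightarrow> wgrad \<Omega>' v g"
  using test_functions_mono unfolding wgrad_def by blast

lemma loc_L2_vec_diff: "loc_L2_vec f \<Longrightarrow> loc_L2_vec g \<Longrightarrow> loc_L2_vec (\<lambda>x. f x - g x)"
  by (simp add: loc_L2_vec_def loc_L2_diff)

lemma wgrad_diff:
  assumes v: "wgrad \<Omega> v g" and w: "wgrad \<Omega> w f" and L2: "loc_L2 v" "loc_L2_vec g" "loc_L2 w" "loc_L2_vec f"
  shows "wgrad \<Omega> (\<lambda>x. v x - w x) (\<lambda>x. g x - f x)"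
  unfolding wgrad_def
proof (intro ballI allI)
  fix \<phi> i assume \<phi>: "\<phi> \<in> test_functions \<Omega>"
  note C1 = test_function_C1_compact[OF \<phi>]
  have "(\<integral>x. (v x - w x) * partial_deriv i \<phi> x \<partial>lborel) =
      (\<integral>x. v x * partial_deriv i \<phi> x - w x * partial_deriv i \<phi> x \<partial>lborel)"
    by (simp add: left_diff_distrib)
  also have "\<dots> = (\<integral>x. v x * partial_deriv i \<phi> x \<partial>lborel) - (\<integral>x. w x * partial_deriv i \<phi> x \<partial>lborel)"
    using L2 by (intro Bochner_Integration.integral_diff loc_L2_times_test_integrable[OF _ C1])
  also have "\<dots> = - ((\<integral>x. g x $ i * \<phi> x \<partial>lborel) - (\<integral>x. f x $ i * \<phi> x \<partial>lborel))"
    using v w \<phi> by (simp add: wgrad_def)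
  also have "(\<integral>x. g x $ i * \<phi> x \<partial>lborel) - (\<integral>x. f x $ i * \<phi> x \<partial>lborel) = (\<integral>x. g x $ i * \<phi> x - f x $ i * \<phi> x \<partial>lborel)"
    using L2 by (intro Bochner_Integration.integral_diff[symmetric] loc_L2_times_test_integrable[OF _ C1])
      (auto simp: loc_L2_vec_def)
  finally show "(\<integral>x. (v x - w x) * partial_deriv i \<phi> x \<partial>lborel) = - (\<integral>x. (g x - f x) $ i * \<phi> x \<partial>lborel)"
    by (simp add: left_diff_distrib)
qed

lemma directional_derivative_tendsto:
  fixes f :: "'a::real_normed_vector \<Rightarrow> real"
  assumes "(f has_derivative f') (at x)"
  shows "((\<lambda>t. (f (x + t *\<^sub>R e) - f x) / t) \<longlongrightarrow> f' e) (at 0)"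
proof -
  have "((\<lambda>t. x + t *\<^sub>R e) has_derivative (\<lambda>t. t *\<^sub>R e)) (at (0::real))"
    by (auto intro!: derivative_eq_intros)
  from has_derivative_compose[OF this, of f f'] assms
  have "((\<lambda>t. f (x + t *\<^sub>R e)) has_derivative (\<lambda>t. f' (t *\<^sub>R e))) (at (0::real))" by simp
  moreover have "f' (t *\<^sub>R e) = t * f' e" for t
    using linear_cmul[OF has_derivative_linear[OF assms]] by simp
  ultimately have "((\<lambda>t. f (x + t *\<^sub>R e)) has_real_derivative f' e) (at 0)"
    by (simp add: has_field_derivative_def mult_commute_abs)
  then show ?thesis by (simp add: DERIV_def)
qed

text \<open>
  The difference quotients have integral \<open>0\<close> by translation invariance and converge to \<open>D\<close> under
  an integrable bound. This is integration by parts for functions that are differentiable only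
  almost everywhere.
\<close>

lemma integral_derivative_Lipschitz:
  fixes f :: "real^'n \<Rightarrow> real"
  assumes lip: "\<And>x y. \<bar>f x - f y\<bar> \<le> B * norm (x - y)"
    and bdd: "\<And>x. \<bar>f x\<bar> \<le> B'" and supp: "\<And>x. x \<notin> cball 0 R \<Longrightarrow> f x = 0"
    and D: "D \<in> borel_measurable borel" and f: "f \<in> borel_measurable borel"
    and deriv: "AE x in lborel. ((\<lambda>t. (f (x + t *\<^sub>R e) - f x) / t) \<longlongrightarrow> D x) (at 0)"
  shows "(\<integral>x. D x \<partial>lborel) = 0"
proof -
  note [measurable] = D f
  define h where "h k = 1 / real (Suc k)" for k
  have h: "0 < h k" "h k \<le> 1" for k by (auto simp: h_def)
  define s where "s k x = (f (x + h k *\<^sub>R e) - f x) / h k" for k x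
  have f_int: "integrable lborel f"
  proof -
    have "L2_fun f" using f bdd supp by (rule L2_fun_bounded_support)
    moreover have "L2_fun (indicator (cball (0::real^'n) R))"
      by (rule L2_fun_indicator) auto
    ultimately have "integrable lborel (\<lambda>x. f x * indicator (cball 0 R) x)" by (rule L2_fun_mult_integrable)
    moreover have "f x * indicator (cball 0 R) x = f x" for x using supp[of x] by (auto simp: indicator_def)
    ultimately show ?thesis by simp
  qed
  have zero: "(\<integral>x. s k x \<partial>lborel) = 0" for k
  proof -
    have "(\<integral>x. s k x \<partial>lborel) = ((\<integral>x. f (x + h k *\<^sub>R e) \<partial>lborel) - (\<integral>x. f x \<partial>lborel)) / h k"
      unfolding s_def using f_int integrable_lborel_translate[OF f_int] by simp
    then show ?thesis by (simp add: integral_lborel_translate)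
  qed
  have "(\<lambda>k. \<integral>x. s k x \<partial>lborel) \<longlonglongrightarrow> (\<integral>x. D x \<partial>lborel)"
  proof (rule integral_dominated_convergence[where w = "\<lambda>x. B * norm e * indicator (cball 0 (R + norm e)) x"])
    show "integrable lborel (\<lambda>x. B * norm e * indicator (cball (0::real^'n) (R + norm e)) x)"
      using emeasure_bounded_finite[OF bounded_cball, of "0::real^'n" "R + norm e"]
      by (intro integrable_mult_right integrable_real_indicator) auto
    show "AE x in lborel. norm (s k x) \<le> B * norm e * indicator (cball 0 (R + norm e)) x" for k
    proof (rule AE_I2)
      fix x
      show "norm (s k x) \<le> B * norm e * indicator (cball 0 (R + norm e)) x"
      proof (cases "x \<in> cball 0 (R + norm e)")
        case True
        have "\<bar>f (x + h k *\<^sub>R e) - f x\<bar> \<le> B * (h k * norm e)"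
          using lip[of "x + h k *\<^sub>R e" x] h[of k] by simp
        then show ?thesis using True h[of k] by (simp add: s_def abs_of_pos divide_le_eq mult.assoc mult.left_commute mult.commute)
      next
        case False
        then have n: "norm x > R + norm e" by simp
        have "norm x \<le> norm (x + h k *\<^sub>R e) + norm (h k *\<^sub>R e)"
          using norm_triangle_ineq4[of "x + h k *\<^sub>R e" "h k *\<^sub>R e"] by simp
        moreover have "norm (h k *\<^sub>R e) \<le> norm e" using h[of k] by (simp add: mult_left_le_one_le)
        ultimately have "R < norm (x + h k *\<^sub>R e)" "R < norm x" using n norm_ge_zero[of e] by linarith+
        then have "f (x + h k *\<^sub>R e) = 0" "f x = 0" by (auto intro!: supp)
        then show ?thesis using False by (simp add: s_def)
      qed
    qed
    show "AE x in lborel. (\<lambda>k. s k x) \<longlonglongrightarrow> D x"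
      using deriv
    proof eventually_elim
      case (elim x)
      have "filterlim h (at 0) sequentially"
        unfolding filterlim_at using h LIMSEQ_inverse_real_of_nat
        by (auto simp: h_def[abs_def] inverse_eq_divide)
      from filterlim_compose[OF elim this] show ?case by (simp add: s_def)
    qed
    show "s k \<in> borel_measurable lborel" for k unfolding s_def by measurable
  qed auto
  then show ?thesis using zero LIMSEQ_unique tendsto_const by (metis (no_types, lifting) LIMSEQ_const_iff ext)
qed

text \<open>
  The segment between two points on different sides meets the hyperplane, where both functions
  agree.
\<close>

lemma glue_Lipschitz:
  fixes a b :: "real^'n \<Rightarrow> real"
  assumes a: "\<And>x y. \<bar>a x - a y\<bar> \<le> B * norm (x - y)" and b: "\<And>x y. \<bar>b x - b y\<bar> \<le> B * norm (x - y)"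
    and agree: "\<And>x. n \<bullet> (x - m) = 0 \<Longrightarrow> a x = b x"
  defines "F \<equiv> \<lambda>x. if 0 \<le> n \<bullet> (x - m) then a x else b x"
  shows "\<bar>F x - F y\<bar> \<le> B * norm (x - y)"
proof -
  have cross: "\<bar>a x - b y\<bar> \<le> B * norm (x - y)" if "0 \<le> n \<bullet> (x - m)" "n \<bullet> (y - m) < 0" for x y
  proof -
    define s where "s = n \<bullet> (x - m) / (n \<bullet> (x - m) - n \<bullet> (y - m))"
    have s: "0 \<le> s" "s \<le> 1" using that by (auto simp: s_def)
    define p where "p = x + s *\<^sub>R (y - x)"
    have "n \<bullet> (p - m) = n \<bullet> (x - m) + s * (n \<bullet> (y - m) - n \<bullet> (x - m))"
      by (simp add: p_def inner_diff_right inner_add_right)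
    also have "s * (n \<bullet> (y - m) - n \<bullet> (x - m)) = - (n \<bullet> (x - m))"
      using that by (simp add: s_def field_simps)
    finally have "a p = b p" using agree by simp
    then have "\<bar>a x - b y\<bar> \<le> \<bar>a x - a p\<bar> + \<bar>b p - b y\<bar>" by linarith
    also have "\<dots> \<le> B * norm (x - p) + B * norm (p - y)" by (intro add_mono a b)
    also have "x - p = s *\<^sub>R (x - y)" by (simp add: p_def algebra_simps)
    also have "p - y = (1 - s) *\<^sub>R (x - y)" by (simp add: p_def algebra_simps)
    also have "B * norm (s *\<^sub>R (x - y)) + B * norm ((1 - s) *\<^sub>R (x - y)) = B * norm (x - y)"
      unfolding norm_scaleR using s by (simp add: algebra_simps)
    finally show ?thesis .
  qed
  show ?thesis
    using a[of x y] b[of x y] cross[of x y] cross[of y x]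
    by (auto simp: F_def norm_minus_commute abs_minus_commute)
qed

lemma AE_not_on_hyperplane:
  assumes "n \<noteq> (0::real^'n)"
  shows "AE x in lborel. n \<bullet> (x - m) \<noteq> 0"
proof -
  have "negligible {x. n \<bullet> x = n \<bullet> m}" using assms by (intro negligible_hyperplane) auto
  moreover have "{x. n \<bullet> x = n \<bullet> m} \<in> sets borel" by (intro borel_closed closed_hyperplane)
  ultimately have "{x. n \<bullet> x = n \<bullet> m} \<in> null_sets lborel"
    by (simp add: negligible_iff_null_sets null_sets_completion_iff)
  then show ?thesis by (rule AE_I') (auto simp: inner_diff_right)
qed

lemma C1_compact_smooth_mult:
  assumes f: "f \<in> elementary_smooth" and \<phi>: "C1_compact \<phi>"
  shows "C1_compact (\<lambda>x. f x * \<phi> x)"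
    and "partial_deriv i (\<lambda>x. f x * \<phi> x) x = f x * partial_deriv i \<phi> x + partial_deriv i f x * \<phi> x"
proof -
  have D: "((\<lambda>x. f x * \<phi> x) has_derivative (\<lambda>h. f x * (grad \<phi> x \<bullet> h) + (grad f x \<bullet> h) * \<phi> x)) (at x)" for x
    using f \<phi> by (intro has_derivative_mult has_derivative_grad)
      (auto simp: C1_compact_def elementary_smooth_differentiable)
  have pd: "partial_deriv i (\<lambda>x. f x * \<phi> x) x = f x * partial_deriv i \<phi> x + partial_deriv i f x * \<phi> x" for i x
    by (simp add: partial_deriv_unique[OF D] inner_axis)
  show "partial_deriv i (\<lambda>x. f x * \<phi> x) x = f x * partial_deriv i \<phi> x + partial_deriv i f x * \<phi> x" by (rule pd)
  have cont: "continuous_on UNIV \<phi>"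
    using \<phi> by (meson C1_compact_def continuous_at_imp_continuous_on differentiable_imp_continuous_within)
  have "continuous_on UNIV (partial_deriv i (\<lambda>x. f x * \<phi> x))" for i
    unfolding pd[abs_def] using \<phi> elementary_smooth_deriv[OF f] cont
    by (intro continuous_on_add continuous_on_mult elementary_smooth_continuous[OF f]
        elementary_smooth_continuous[of "partial_deriv i f"]) (auto simp: C1_compact_def)
  moreover obtain R where "\<And>x. x \<notin> cball 0 R \<Longrightarrow> \<phi> x = 0" using \<phi> by (auto simp: C1_compact_def)
  ultimately show "C1_compact (\<lambda>x. f x * \<phi> x)"
    unfolding C1_compact_def by (intro conjI allI differentiableI[OF D] exI[of _ R]) auto
qed

lemma loc_L2_piecewise:
  fixes g h :: "real^'n \<Rightarrow> real"
  assumes g: "continuous_on UNIV g" and h: "continuous_on UNIV h"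
  shows "loc_L2 (\<lambda>x. if 0 \<le> n \<bullet> (x - m) then g x else h x)"
proof (rule loc_L2_locally_bounded)
  have [measurable]: "g \<in> borel_measurable borel" "h \<in> borel_measurable borel"
    using g h by (auto intro: borel_measurable_continuous_onI)
  show "(\<lambda>x. if 0 \<le> n \<bullet> (x - m) then g x else h x) \<in> borel_measurable borel" by measurable
  fix R
  have "bounded (g ` cball 0 R)" "bounded (h ` cball 0 R)"
    by (intro compact_imp_bounded compact_continuous_image continuous_on_subset[OF g]
        continuous_on_subset[OF h]; simp)+
  then obtain A B where "\<forall>x\<in>cball 0 R. \<bar>g x\<bar> \<le> A" "\<forall>x\<in>cball 0 R. \<bar>h x\<bar> \<le> B"
    by (auto simp: bounded_iff)
  then show "\<exists>B. \<forall>x\<in>cball 0 R. \<bar>if 0 \<le> n \<bullet> (x - m) then g x else h x\<bar> \<le> B"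
    by (intro exI[of _ "max A B"]) (auto simp: le_max_iff_disj)
qed

lemma loc_L2_vec_piecewise_grad:
  assumes "f1 \<in> elementary_smooth" "f2 \<in> elementary_smooth"
  shows "loc_L2_vec (\<lambda>x. if 0 \<le> n \<bullet> (x - m) then grad f1 x else grad f2 x)"
  unfolding loc_L2_vec_def
proof
  fix i
  have "loc_L2 (\<lambda>x. if 0 \<le> n \<bullet> (x - m) then partial_deriv i f1 x else partial_deriv i f2 x)"
    using assms elementary_smooth_deriv by (intro loc_L2_piecewise elementary_smooth_continuous) auto
  moreover have "(\<lambda>x. (if 0 \<le> n \<bullet> (x - m) then grad f1 x else grad f2 x) $ i) =
      (\<lambda>x. if 0 \<le> n \<bullet> (x - m) then partial_deriv i f1 x else partial_deriv i f2 x)"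
    by auto
  ultimately show "loc_L2 (\<lambda>x. (if 0 \<le> n \<bullet> (x - m) then grad f1 x else grad f2 x) $ i)" by simp
qed

text \<open>
  Multiplied by a test function, the glued function is Lipschitz with compact support and
  differentiable off the hyperplane, so its partial derivatives have integral \<open>0\<close>. Continuity
  across the hyperplane enters through the Lipschitz bound.
\<close>

lemma wgrad_piecewise:
  fixes f1 f2 :: "real^'n \<Rightarrow> real"
  assumes f: "f1 \<in> elementary_smooth" "f2 \<in> elementary_smooth" and n: "n \<noteq> 0"
    and agree: "\<And>x. n \<bullet> (x - m) = 0 \<Longrightarrow> f1 x = f2 x"
  shows "wgrad \<Omega> (\<lambda>x. if 0 \<le> n \<bullet> (x - m) then f1 x else f2 x)
                  (\<lambda>x. if 0 \<le> n \<bullet> (x - m) then grad f1 x else grad f2 x)"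
  unfolding wgrad_def
proof (intro ballI allI)
  fix \<phi> i assume \<phi>: "\<phi> \<in> test_functions \<Omega>"
  note C1 = test_function_C1_compact[OF \<phi>]
  let ?s = "\<lambda>x. 0 \<le> n \<bullet> (x - m)"
  let ?F = "\<lambda>x. if ?s x then f1 x else f2 x" and ?G = "\<lambda>x. if ?s x then grad f1 x else grad f2 x"
  define a where "a x = f1 x * \<phi> x" for x
  define b where "b x = f2 x * \<phi> x" for x
  have C1a: "C1_compact a" and C1b: "C1_compact b"
    unfolding a_def b_def using f C1 by (auto intro: C1_compact_smooth_mult)
  obtain Ra Ba where a: "\<And>x. x \<notin> cball 0 Ra \<Longrightarrow> a x = 0" "\<And>x. \<bar>a x\<bar> \<le> Ba" "\<And>x y. \<bar>a x - a y\<bar> \<le> Ba * norm (x - y)"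
    using C1_compact_obtain[OF C1a] by metis
  obtain Rb Bb where b: "\<And>x. x \<notin> cball 0 Rb \<Longrightarrow> b x = 0" "\<And>x. \<bar>b x\<bar> \<le> Bb" "\<And>x y. \<bar>b x - b y\<bar> \<le> Bb * norm (x - y)"
    using C1_compact_obtain[OF C1b] by metis
  define B where "B = max Ba Bb"
  have lip_a: "\<bar>a x - a y\<bar> \<le> B * norm (x - y)" for x y
    using a(3)[of x y] mult_right_mono[of Ba B "norm (x - y)"] by (simp add: B_def)
  have lip_b: "\<bar>b x - b y\<bar> \<le> B * norm (x - y)" for x y
    using b(3)[of x y] mult_right_mono[of Bb B "norm (x - y)"] by (simp add: B_def)
  define F where "F x = (if ?s x then a x else b x)" for x
  define D where "D x = (if ?s x then partial_deriv i a x else partial_deriv i b x)" for x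
  have half[measurable]: "Measurable.pred borel ?s" by measurable
  have [measurable]: "a \<in> borel_measurable borel" "b \<in> borel_measurable borel"
      "partial_deriv i a \<in> borel_measurable borel" "partial_deriv i b \<in> borel_measurable borel"
    using C1_compact_L2[OF C1a] C1_compact_L2[OF C1b] by (auto simp: L2_fun_def)
  have "(\<integral>x. D x \<partial>lborel) = 0"
  proof (rule integral_derivative_Lipschitz)
    show "\<bar>F x - F y\<bar> \<le> B * norm (x - y)" for x y
      unfolding F_def by (rule glue_Lipschitz[OF lip_a lip_b]) (auto simp: a_def b_def agree)
    show "\<bar>F x\<bar> \<le> B" for x
      using a(2)[of x] b(2)[of x] by (auto simp: F_def B_def)
    show "F x = 0" if "x \<notin> cball 0 (max Ra Rb)" for x
      using that a(1)[of x] b(1)[of x] by (auto simp: F_def)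
    show "D \<in> borel_measurable borel" "F \<in> borel_measurable borel" unfolding D_def F_def by measurable
    show "AE x in lborel. ((\<lambda>t. (F (x + t *\<^sub>R axis i 1) - F x) / t) \<longlongrightarrow> D x) (at 0)"
      using AE_not_on_hyperplane[OF n, of m]
    proof eventually_elim
      case (elim x)
      have der_a: "(a has_derivative (\<bullet>) (grad a x)) (at x)" and der_b: "(b has_derivative (\<bullet>) (grad b x)) (at x)"
        using C1a C1b by (auto intro!: has_derivative_grad simp: C1_compact_def)
      show ?case
      proof (cases "0 < n \<bullet> (x - m)")
        case True
        have "open {y. 0 < n \<bullet> (y - m)}" by (intro open_Collect_less continuous_intros)
        then have "(F has_derivative (\<bullet>) (grad a x)) (at x)"
          by (rule has_derivative_transform_within_open[OF der_a]) (use True in \<open>auto simp: F_def\<close>)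
        from directional_derivative_tendsto[OF this, of "axis i 1"] show ?thesis
          using True by (simp add: D_def inner_axis)
      next
        case False
        then have neg: "n \<bullet> (x - m) < 0" using elim by simp
        have "open {y. n \<bullet> (y - m) < 0}" by (intro open_Collect_less continuous_intros)
        then have "(F has_derivative (\<bullet>) (grad b x)) (at x)"
          by (rule has_derivative_transform_within_open[OF der_b]) (use neg in \<open>auto simp: F_def\<close>)
        from directional_derivative_tendsto[OF this, of "axis i 1"] show ?thesis
          using neg by (simp add: D_def inner_axis)
      qed
    qed
  qed
  moreover have D_eq: "D x = ?F x * partial_deriv i \<phi> x + ?G x $ i * \<phi> x" for x
    using C1_compact_smooth_mult(2)[OF f(1) C1] C1_compact_smooth_mult(2)[OF f(2) C1]
    by (simp add: D_def a_def[abs_def] b_def[abs_def])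
  moreover have "integrable lborel (\<lambda>x. ?F x * partial_deriv i \<phi> x)" "integrable lborel (\<lambda>x. ?G x $ i * \<phi> x)"
  proof -
    have "loc_L2 ?F" using f by (intro loc_L2_piecewise elementary_smooth_continuous)
    moreover have "loc_L2 (\<lambda>x. ?G x $ i)"
      using loc_L2_vec_piecewise_grad[OF f, of n m] unfolding loc_L2_vec_def by blast
    ultimately show "integrable lborel (\<lambda>x. ?F x * partial_deriv i \<phi> x)" "integrable lborel (\<lambda>x. ?G x $ i * \<phi> x)"
      using loc_L2_times_test_integrable[OF _ C1] by simp_all
  qed
  ultimately have "(\<integral>x. ?F x * partial_deriv i \<phi> x \<partial>lborel) + (\<integral>x. ?G x $ i * \<phi> x \<partial>lborel) = 0"
    by (subst Bochner_Integration.integral_add[symmetric]) auto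
  then show "(\<integral>x. ?F x * partial_deriv i \<phi> x \<partial>lborel) = - (\<integral>x. ?G x $ i * \<phi> x \<partial>lborel)"
    by linarith
qed

lemma wgrad_smooth:
  assumes "f \<in> elementary_smooth"
  shows "wgrad \<Omega> f (grad f)"
  using wgrad_piecewise[OF assms assms, of "axis undefined 1" 0] by (simp add: axis_eq_0_iff)

lemma AE_zero_of_integral_square:
  assumes f: "loc_L2 f" and A: "A \<in> sets borel" "bounded A"
    and zero: "(\<integral>x. indicator A x * (f x)\<^sup>2 \<partial>lborel) \<le> 0"
  shows "AE x in lborel. x \<in> A \<longrightarrow> f x = 0"
proof -
  have L2: "L2_fun (\<lambda>x. indicator A x * f x)" by (rule loc_L2_cut[OF f A])
  have eq: "(indicator A x * f x)\<^sup>2 = indicator A x * (f x)\<^sup>2" for x by (simp add: indicator_def)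
  have "integrable lborel (\<lambda>x. indicator A x * (f x)\<^sup>2)" using L2 by (simp add: L2_fun_def eq)
  moreover have "0 \<le> (\<integral>x. indicator A x * (f x)\<^sup>2 \<partial>lborel)" by (intro integral_nonneg_AE) auto
  then have "(\<integral>x. indicator A x * (f x)\<^sup>2 \<partial>lborel) = 0" using zero by linarith
  ultimately have "AE x in lborel. indicator A x * (f x)\<^sup>2 = 0"
    using integral_nonneg_eq_0_iff_AE[of lborel "\<lambda>x. indicator A x * (f x)\<^sup>2"] by simp
  then show ?thesis by eventually_elim (auto simp: indicator_def)
qed

text \<open>
  The difference of two weak gradients is orthogonal to all test functions, so duality applies
  with \<open>M = 0\<close>.
\<close>

lemma wgrad_unique:
  assumes \<Omega>: "open \<Omega>" "bounded \<Omega>" and g: "loc_L2_vec g" "wgrad \<Omega> v g" and f: "loc_L2_vec f" "wgrad \<Omega> v f"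
  shows "AE x in lborel. x \<in> \<Omega> \<longrightarrow> g x = f x"
proof -
  have "AE x in lborel. x \<in> \<Omega> \<longrightarrow> g x $ i - f x $ i = 0" for i
  proof (rule AE_zero_of_integral_square)
    show L2: "loc_L2 (\<lambda>x. g x $ i - f x $ i)"
      using g f by (intro loc_L2_diff) (auto simp: loc_L2_vec_def)
    show "\<Omega> \<in> sets borel" using \<Omega> by auto
    show "(\<integral>x. indicator \<Omega> x * (g x $ i - f x $ i)\<^sup>2 \<partial>lborel) \<le> 0"
    proof (rule L2_duality[OF L2 \<Omega> order_refl])
      fix \<phi> assume \<phi>: "\<phi> \<in> test_functions \<Omega>"
      note C1 = test_function_C1_compact[OF \<phi>]
      have "(\<integral>x. (g x $ i - f x $ i) * \<phi> x \<partial>lborel) = (\<integral>x. g x $ i * \<phi> x - f x $ i * \<phi> x \<partial>lborel)"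
        by (simp add: left_diff_distrib)
      also have "\<dots> = (\<integral>x. g x $ i * \<phi> x \<partial>lborel) - (\<integral>x. f x $ i * \<phi> x \<partial>lborel)"
        using g f by (intro Bochner_Integration.integral_diff loc_L2_times_test_integrable[OF _ C1])
          (auto simp: loc_L2_vec_def)
      also have "\<dots> = 0"
        using bspec[OF g(2)[unfolded wgrad_def] \<phi>] bspec[OF f(2)[unfolded wgrad_def] \<phi>] by (metis add.inverse_inverse right_minus_eq)
      finally show "(\<integral>x. (g x $ i - f x $ i) * \<phi> x \<partial>lborel)\<^sup>2 \<le> 0 * (\<integral>x. (\<phi> x)\<^sup>2 \<partial>lborel)" by simp
    qed
  qed (rule \<Omega>(2))
  then have "AE x in lborel. \<forall>i\<in>UNIV. x \<in> \<Omega> \<longrightarrow> g x $ i - f x $ i = 0"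
    by (intro AE_finite_allI) auto
  then show ?thesis by eventually_elim (simp add: vec_eq_iff)
qed

section \<open>Translation estimates and the Poincare inequality\<close>

lemma loc_L2_inner: "loc_L2_vec g \<Longrightarrow> loc_L2 (\<lambda>x. z \<bullet> g x)"
proof -
  assume g: "loc_L2_vec g"
  have "loc_L2 (\<lambda>x. \<Sum>i\<in>I. z $ i * g x $ i)" if "finite I" for I
    using that
  proof induction
    case empty
    show ?case by (simp add: loc_L2_continuous)
  next
    case (insert i I)
    then show ?case using g by (simp add: loc_L2_add loc_L2_cmult loc_L2_vec_def)
  qed
  then show ?thesis by (simp add: inner_vec_def)
qed

text \<open>
  The difference quotient falls on the test function, where it converges boundedly.
\<close>

lemma translate_integral_DERIV:
  assumes U: "loc_L2 U" and \<phi>: "C1_compact \<phi>"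
  shows "((\<lambda>t. \<integral>x. U x * \<phi> (x - t *\<^sub>R z) \<partial>lborel) has_real_derivative
          - (\<integral>x. U x * (z \<bullet> grad \<phi> (x - t *\<^sub>R z)) \<partial>lborel)) (at t)"
proof -
  obtain R B where RB: "0 < B" "\<And>x. x \<notin> cball 0 R \<Longrightarrow> \<phi> x = 0" "\<And>x y. \<bar>\<phi> x - \<phi> y\<bar> \<le> B * norm (x - y)"
    using C1_compact_obtain[OF \<phi>] by metis
  note [measurable] = loc_L2_measurable[OF U]
  have [measurable]: "\<phi> \<in> borel_measurable borel" "partial_deriv i \<phi> \<in> borel_measurable borel" for i
    using C1_compact_L2[OF \<phi>] by (auto simp: L2_fun_def)
  have sum_form: "z \<bullet> grad \<phi> y = (\<Sum>i\<in>UNIV. z $ i * partial_deriv i \<phi> y)" for y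
    by (simp add: inner_vec_def)
  have [measurable]: "(\<lambda>y. z \<bullet> grad \<phi> y) \<in> borel_measurable borel" unfolding sum_form by measurable
  have shift_zero: "\<phi> (x - s *\<^sub>R z) = 0" if "x \<notin> cball 0 (R + b * norm z)" "\<bar>s\<bar> \<le> b" for x s b
  proof (rule RB(2))
    have "norm x \<le> norm (x - s *\<^sub>R z) + norm (s *\<^sub>R z)"
      using norm_triangle_ineq[of "x - s *\<^sub>R z" "s *\<^sub>R z"] by simp
    moreover have "norm (s *\<^sub>R z) \<le> b * norm z" using that(2) by (simp add: mult_right_mono)
    ultimately show "x - s *\<^sub>R z \<notin> cball 0 R" using that(1) by simp
  qed
  have int: "integrable lborel (\<lambda>x. U x * \<phi> (x - s *\<^sub>R z))" for s
  proof -
    have "L2_fun (\<lambda>x. \<phi> (x - s *\<^sub>R z))"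
      using integrable_lborel_translate[of "\<lambda>x. (\<phi> x)\<^sup>2" "- s *\<^sub>R z"] C1_compact_L2(1)[OF \<phi>]
      by (simp add: L2_fun_def)
    then show ?thesis
      using shift_zero[of _ "\<bar>s\<bar>" s] by (intro loc_L2_times_compact_integrable[OF U, where R = "R + \<bar>s\<bar> * norm z"]) auto
  qed
  define F where "F t = (\<integral>x. U x * \<phi> (x - t *\<^sub>R z) \<partial>lborel)" for t
  have "((\<lambda>h. (F (t + h) - F t) / h) \<longlongrightarrow> - (\<integral>x. U x * (z \<bullet> grad \<phi> (x - t *\<^sub>R z)) \<partial>lborel)) (at 0)"
    unfolding tendsto_at_iff_sequentially
  proof (intro allI impI)
    fix X :: "nat \<Rightarrow> real" assume X: "\<forall>i. X i \<in> UNIV - {0}" "X \<longlonglongrightarrow> 0"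
    obtain M where M: "\<And>i. \<bar>X i\<bar> \<le> M"
      using X(2) convergent_imp_Bseq[of X] unfolding convergent_def Bseq_def by (auto simp: real_norm_def)
    define R' where "R' = R + (\<bar>t\<bar> + M) * norm z"
    define s where "s i x = U x * ((\<phi> (x - (t + X i) *\<^sub>R z) - \<phi> (x - t *\<^sub>R z)) / X i)" for i x
    have eq: "(F (t + X i) - F t) / X i = (\<integral>x. s i x \<partial>lborel)" for i
    proof -
      have "(F (t + X i) - F t) / X i = (\<integral>x. (U x * \<phi> (x - (t + X i) *\<^sub>R z) - U x * \<phi> (x - t *\<^sub>R z)) / X i \<partial>lborel)"
        unfolding F_def using int by simp
      then show ?thesis by (simp add: s_def right_diff_distrib)
    qed
    have "(\<lambda>i. \<integral>x. s i x \<partial>lborel) \<longlonglongrightarrow> (\<integral>x. - (U x * (z \<bullet> grad \<phi> (x - t *\<^sub>R z))) \<partial>lborel)"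
    proof (rule integral_dominated_convergence[where w = "\<lambda>x. \<bar>U x * (B * norm z * indicator (cball 0 R') x)\<bar>"])
      have "L2_fun (\<lambda>x. B * norm z * indicator (cball 0 R') x)"
        by (intro L2_fun_cmult L2_fun_indicator) auto
      then have "integrable lborel (\<lambda>x. U x * (B * norm z * indicator (cball 0 R') x))"
        by (intro loc_L2_times_compact_integrable[OF U, where R = R']) auto
      then show "integrable lborel (\<lambda>x. \<bar>U x * (B * norm z * indicator (cball 0 R') x)\<bar>)" by (rule integrable_abs)
      show "AE x in lborel. norm (s i x) \<le> \<bar>U x * (B * norm z * indicator (cball 0 R') x)\<bar>" for i
      proof (rule AE_I2)
        fix x
        show "norm (s i x) \<le> \<bar>U x * (B * norm z * indicator (cball 0 R') x)\<bar>"
        proof (cases "x \<in> cball 0 R'")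
          case True
          have "\<bar>\<phi> (x - (t + X i) *\<^sub>R z) - \<phi> (x - t *\<^sub>R z)\<bar> \<le> B * norm (- (X i *\<^sub>R z))"
            using RB(3)[of "x - (t + X i) *\<^sub>R z" "x - t *\<^sub>R z"] by (simp add: algebra_simps)
          then have "\<bar>(\<phi> (x - (t + X i) *\<^sub>R z) - \<phi> (x - t *\<^sub>R z)) / X i\<bar> \<le> B * norm z"
            using X(1) by (simp add: divide_le_eq mult.assoc mult.left_commute mult.commute)
          then have "\<bar>U x\<bar> * \<bar>(\<phi> (x - (t + X i) *\<^sub>R z) - \<phi> (x - t *\<^sub>R z)) / X i\<bar> \<le> \<bar>U x\<bar> * (B * norm z)"
            by (rule mult_left_mono) simp
          then show ?thesis using True RB(1) by (simp add: s_def abs_mult)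
        next
          case False
          have "\<phi> (x - (t + X i) *\<^sub>R z) = 0"
            by (rule shift_zero[of _ "\<bar>t\<bar> + M"]) (use False M[of i] in \<open>auto simp: R'_def\<close>)
          moreover have "\<phi> (x - t *\<^sub>R z) = 0"
            by (rule shift_zero[of _ "\<bar>t\<bar> + M"]) (use False M[of i] in \<open>auto simp: R'_def\<close>)
          ultimately show ?thesis by (simp add: s_def)
        qed
      qed
      show "AE x in lborel. (\<lambda>i. s i x) \<longlonglongrightarrow> - (U x * (z \<bullet> grad \<phi> (x - t *\<^sub>R z)))"
      proof (rule AE_I2)
        fix x
        let ?y = "x - t *\<^sub>R z"
        have "((\<lambda>h. (\<phi> (?y + h *\<^sub>R (- z)) - \<phi> ?y) / h) \<longlongrightarrow> grad \<phi> ?y \<bullet> (- z)) (at 0)"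
          using \<phi> by (intro directional_derivative_tendsto has_derivative_grad) (simp add: C1_compact_def)
        then have "(\<lambda>i. (\<phi> (?y + X i *\<^sub>R (- z)) - \<phi> ?y) / X i) \<longlonglongrightarrow> grad \<phi> ?y \<bullet> (- z)"
          using X unfolding tendsto_at_iff_sequentially by (auto simp: comp_def)
        from tendsto_mult_left[OF this, of "U x"]
        show "(\<lambda>i. s i x) \<longlonglongrightarrow> - (U x * (z \<bullet> grad \<phi> ?y))"
          by (simp add: s_def algebra_simps inner_commute)
      qed
      show "s i \<in> borel_measurable lborel" for i unfolding s_def by measurable
      show "(\<lambda>x. - (U x * (z \<bullet> grad \<phi> (x - t *\<^sub>R z)))) \<in> borel_measurable lborel"
        unfolding sum_form by measurable
    qed
    then show "((\<lambda>h. (F (t + h) - F t) / h) \<circ> X) \<longlonglongrightarrow> - (\<integral>x. U x * (z \<bullet> grad \<phi> (x - t *\<^sub>R z)) \<partial>lborel)"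
      by (simp add: comp_def eq)
  qed
  then show ?thesis by (simp add: DERIV_def F_def)
qed

text \<open>
  Paired with a test function \<open>\<phi>\<close>, the difference is \<open>F 1 - F 0\<close>, where \<open>F t\<close> is the pairing of
  \<open>U\<close> with \<open>\<phi>\<close> translated by \<open>t *\<^sub>R z\<close>. By the mean value theorem it equals a single derivative
  \<open>F' t\<close>, in which a translate of \<open>\<phi>\<close> that is still a test function on \<open>\<Omega>\<close> is differentiated;
  the definition of the weak gradient applies to it. This argument takes the place of an
  approximation of \<open>U\<close> by smooth functions.
\<close>

lemma difference_quotient_bound:
  fixes U :: "real^'n \<Rightarrow> real"
  assumes U: "loc_L2 U" and g: "loc_L2_vec g" and wg: "wgrad \<Omega> U g"
    and \<Omega>: "open \<Omega>" "bounded \<Omega>" and A: "open A" "bounded A"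
    and sub: "\<And>x t. x \<in> A \<Longrightarrow> 0 \<le> t \<Longrightarrow> t \<le> 1 \<Longrightarrow> x + t *\<^sub>R z \<in> \<Omega>"
  shows "(\<integral>x. indicator A x * (U (x + z) - U x)\<^sup>2 \<partial>lborel) \<le> (\<integral>x. indicator \<Omega> x * (z \<bullet> g x)\<^sup>2 \<partial>lborel)"
proof (rule L2_duality[OF _ A])
  show "loc_L2 (\<lambda>x. U (x + z) - U x)" using U by (intro loc_L2_diff loc_L2_translate)
  let ?M = "\<integral>x. indicator \<Omega> x * (z \<bullet> g x)\<^sup>2 \<partial>lborel"
  show "0 \<le> ?M" by (intro integral_nonneg_AE) auto
  fix \<phi> assume \<phi>: "\<phi> \<in> test_functions A"
  note C1 = test_function_C1_compact[OF \<phi>]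
  note [measurable] = loc_L2_measurable[OF U]
  have [measurable]: "\<phi> \<in> borel_measurable borel" using C1_compact_L2[OF C1] by (auto simp: L2_fun_def)
  have C1s: "C1_compact (\<lambda>x. \<phi> (x - a))" for a
  proof -
    have "(\<lambda>x. \<phi> (x - a)) \<in> test_functions UNIV" by (rule test_function_translate[OF \<phi>]) simp
    then show ?thesis by (rule test_function_C1_compact)
  qed
  define F where "F t = (\<integral>x. U x * \<phi> (x - t *\<^sub>R z) \<partial>lborel)" for t
  define F' where "F' t = - (\<integral>x. U x * (z \<bullet> grad \<phi> (x - t *\<^sub>R z)) \<partial>lborel)" for t
  have "(F has_real_derivative F' t) (at t)" for t
    unfolding F_def F'_def by (rule translate_integral_DERIV[OF U C1])
  then obtain t where t: "0 < t" "t < 1" "F 1 - F 0 = F' t"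
    using MVT2[of 0 1 F F'] by auto
  define \<psi> where "\<psi> x = \<phi> (x - t *\<^sub>R z)" for x
  have \<psi>: "\<psi> \<in> test_functions \<Omega>"
    unfolding \<psi>_def using sub t by (intro test_function_translate[OF \<phi>]) auto
  note C1\<psi> = test_function_C1_compact[OF \<psi>]
  have pd: "partial_deriv i \<psi> x = partial_deriv i \<phi> (x - t *\<^sub>R z)" for i x
    unfolding \<psi>_def using C1 by (intro partial_deriv_translate) (simp add: C1_compact_def)
  have "F' t = - (\<integral>x. (\<Sum>i\<in>UNIV. z $ i * (U x * partial_deriv i \<psi> x)) \<partial>lborel)"
    unfolding F'_def by (simp add: inner_vec_def pd sum_distrib_left mult.left_commute)
  also have "\<dots> = - (\<Sum>i\<in>UNIV. z $ i * (\<integral>x. U x * partial_deriv i \<psi> x \<partial>lborel))"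
    using loc_L2_times_test_integrable[OF U C1\<psi>] by (subst Bochner_Integration.integral_sum) auto
  also have "\<dots> = (\<Sum>i\<in>UNIV. z $ i * (\<integral>x. g x $ i * \<psi> x \<partial>lborel))"
    using wg \<psi> by (simp add: wgrad_def sum_negf[symmetric])
  also have "\<dots> = (\<integral>x. (\<Sum>i\<in>UNIV. z $ i * (g x $ i * \<psi> x)) \<partial>lborel)"
    using loc_L2_times_test_integrable[OF _ C1\<psi>] g
    by (subst Bochner_Integration.integral_sum) (auto simp: loc_L2_vec_def)
  also have "\<dots> = (\<integral>x. (z \<bullet> g x) * \<psi> x \<partial>lborel)"
    by (simp add: inner_vec_def sum_distrib_right mult.assoc)
  finally have F't: "F' t = (\<integral>x. (z \<bullet> g x) * \<psi> x \<partial>lborel)" .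
  have "(F' t)\<^sup>2 \<le> ?M * (\<integral>x. (\<psi> x)\<^sup>2 \<partial>lborel)"
    unfolding F't using \<Omega> by (intro loc_L2_test_Cauchy_Schwarz[OF loc_L2_inner[OF g] \<psi>]) auto
  also have "(\<integral>x. (\<psi> x)\<^sup>2 \<partial>lborel) = (\<integral>x. (\<phi> x)\<^sup>2 \<partial>lborel)"
    unfolding \<psi>_def using integral_lborel_translate[of "\<lambda>x. (\<phi> x)\<^sup>2" "- (t *\<^sub>R z)"] by simp
  finally have bound: "(F 1 - F 0)\<^sup>2 \<le> ?M * (\<integral>x. (\<phi> x)\<^sup>2 \<partial>lborel)" by (simp add: t(3))
  have "F 1 = (\<integral>x. U (x + z) * \<phi> x \<partial>lborel)"
    unfolding F_def using integral_lborel_translate[of "\<lambda>x. U x * \<phi> (x - z)" z] by simp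
  moreover have "F 0 = (\<integral>x. U x * \<phi> x \<partial>lborel)" by (simp add: F_def)
  moreover have "(\<integral>x. (U (x + z) - U x) * \<phi> x \<partial>lborel) = (\<integral>x. U (x + z) * \<phi> x - U x * \<phi> x \<partial>lborel)"
    by (simp add: left_diff_distrib)
  moreover have "\<dots> = (\<integral>x. U (x + z) * \<phi> x \<partial>lborel) - (\<integral>x. U x * \<phi> x \<partial>lborel)"
    using U by (intro Bochner_Integration.integral_diff loc_L2_times_test_integrable[OF _ C1] loc_L2_translate)
  ultimately show "(\<integral>x. (U (x + z) - U x) * \<phi> x \<partial>lborel)\<^sup>2 \<le> ?M * (\<integral>x. (\<phi> x)\<^sup>2 \<partial>lborel)"
    using bound by simp
qed

definition norm_sq_on :: "(real^'n) set \<Rightarrow> (real^'n \<Rightarrow> real) \<Rightarrow> real" where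
  "norm_sq_on A f = (\<integral>x. indicator A x * (f x)\<^sup>2 \<partial>lborel)"

definition grad_sq_on :: "(real^'n) set \<Rightarrow> (real^'n \<Rightarrow> real^'n) \<Rightarrow> real" where
  "grad_sq_on A g = (\<integral>x. indicator A x * (norm (g x))\<^sup>2 \<partial>lborel)"

lemma norm_sq_on_integrable:
  assumes "loc_L2 f" "A \<in> sets borel" "bounded A"
  shows "integrable lborel (\<lambda>x. indicator A x * (f x)\<^sup>2)"
proof -
  have "(indicator A x * f x)\<^sup>2 = indicator A x * (f x)\<^sup>2" for x by (simp add: indicator_def)
  then show ?thesis using loc_L2_cut[OF assms] by (simp add: L2_fun_def)
qed

lemma grad_sq_on_integrable:
  assumes "loc_L2_vec g" "A \<in> sets borel" "bounded A"
  shows "integrable lborel (\<lambda>x. indicator A x * (norm (g x))\<^sup>2)"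
proof -
  have "integrable lborel (\<lambda>x. \<Sum>i\<in>UNIV. indicator A x * (g x $ i)\<^sup>2)"
    using assms by (intro Bochner_Integration.integrable_sum norm_sq_on_integrable) (auto simp: loc_L2_vec_def)
  moreover have "(\<Sum>i\<in>UNIV. indicator A x * (g x $ i)\<^sup>2) = indicator A x * (norm (g x))\<^sup>2" for x
    by (simp only: power2_norm_eq_inner inner_vec_def inner_real_def sum_distrib_left
        power2_eq_square[of "_ $ _"])
  ultimately show ?thesis by simp
qed

lemma norm_sq_on_nonneg: "0 \<le> norm_sq_on A f" and grad_sq_on_nonneg: "0 \<le> grad_sq_on A g"
  unfolding norm_sq_on_def grad_sq_on_def by (auto intro!: integral_nonneg_AE)

lemma directional_le_grad_sq_on:
  assumes g: "loc_L2_vec g" and A: "A \<in> sets borel" "bounded A"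
  shows "norm_sq_on A (\<lambda>x. z \<bullet> g x) \<le> (norm z)\<^sup>2 * grad_sq_on A g"
proof -
  have "norm_sq_on A (\<lambda>x. z \<bullet> g x) \<le> (\<integral>x. (norm z)\<^sup>2 * (indicator A x * (norm (g x))\<^sup>2) \<partial>lborel)"
    unfolding norm_sq_on_def
  proof (rule integral_mono)
    show "integrable lborel (\<lambda>x. indicator A x * (z \<bullet> g x)\<^sup>2)"
      using A by (intro norm_sq_on_integrable loc_L2_inner[OF g])
    show "integrable lborel (\<lambda>x. (norm z)\<^sup>2 * (indicator A x * (norm (g x))\<^sup>2))"
      using grad_sq_on_integrable[OF g A] by simp
    fix x
    have "\<bar>z \<bullet> g x\<bar>\<^sup>2 \<le> (norm z * norm (g x))\<^sup>2" by (intro power_mono Cauchy_Schwarz_ineq2) auto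
    then show "indicator A x * (z \<bullet> g x)\<^sup>2 \<le> (norm z)\<^sup>2 * (indicator A x * (norm (g x))\<^sup>2)"
      by (simp add: indicator_def power_mult_distrib)
  qed
  then show ?thesis by (simp add: grad_sq_on_def)
qed

lemma nn_integral_lborel_translate:
  fixes f :: "'a::euclidean_space \<Rightarrow> ennreal"
  assumes [measurable]: "f \<in> borel_measurable borel"
  shows "(\<integral>\<^sup>+x. f (a + x) \<partial>lborel) = (\<integral>\<^sup>+x. f x \<partial>lborel)"
proof -
  have "(\<integral>\<^sup>+x. f x \<partial>lborel) = (\<integral>\<^sup>+x. f x \<partial>distr lborel borel ((+) a))"
    by (simp add: lborel_distr_plus)
  also have "\<dots> = (\<integral>\<^sup>+x. f (a + x) \<partial>lborel)" by (rule nn_integral_distr) auto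
  finally show ?thesis by simp
qed

text \<open>
  By assumption \<open>w\<close> is no larger than \<open>w - w x\<close> in the mean square over \<open>K\<close>, for every \<open>x \<in> K\<close>.
  Integrate this over \<open>x\<close>, substitute \<open>y = x + z\<close> in the double integral and exchange the order
  of integration: for fixed \<open>z\<close>, lemma \<open>difference_quotient_bound\<close> bounds the integral over \<open>x\<close>,
  and only \<open>z\<close> with \<open>norm z \<le> h\<close> contribute.
\<close>

lemma Poincare_convex:
  fixes w :: "real^'n \<Rightarrow> real"
  assumes w: "loc_L2 w" and g: "loc_L2_vec g" and wg: "wgrad K w g"
    and K: "open K" "convex K" "bounded K" and h: "0 \<le> h" "\<And>x y. x \<in> K \<Longrightarrow> y \<in> K \<Longrightarrow> norm (y - x) \<le> h"
    and best: "\<And>c. norm_sq_on K w \<le> norm_sq_on K (\<lambda>x. w x - c)"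
  shows "measure lborel K * norm_sq_on K w \<le> h\<^sup>2 * measure lborel (cball (0::real^'n) h) * grad_sq_on K g"
proof -
  note [measurable] = loc_L2_measurable[OF w]
  have Kb[measurable]: "K \<in> sets borel" using K by auto
  let ?N = "norm_sq_on K w" and ?G = "grad_sq_on K g"
  define f :: "real^'n \<Rightarrow> real^'n \<Rightarrow> ennreal" where
    "f x y = indicator K x * indicator K y * ennreal ((w y - w x)\<^sup>2)" for x y
  have f_meas[measurable]: "(\<lambda>(x, y). f x y) \<in> borel_measurable (borel \<Otimes>\<^sub>M borel)"
    unfolding f_def by measurable
  have inner: "(\<integral>\<^sup>+x. f x (x + z) \<partial>lborel) \<le> ennreal (h\<^sup>2 * ?G) * indicator (cball 0 h) z" for z
  proof (cases "norm z \<le> h")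
    case False
    have "f x (x + z) = 0" for x
      using h(2)[of x "x + z"] False by (auto simp: f_def indicator_def)
    then show ?thesis by simp
  next
    case True
    define A where "A = K \<inter> {x. x + z \<in> K}"
    have A: "open A" "bounded A"
    proof -
      have "continuous_on UNIV (\<lambda>x. x + z)" by (intro continuous_intros)
      from open_vimage[OF K(1) this] have "open {x. x + z \<in> K}" by (simp add: vimage_def)
      then show "open A" using K(1) by (auto simp: A_def)
      show "bounded A" using K(3) by (auto simp: A_def intro: bounded_subset)
    qed
    have Ab: "A \<in> sets borel" using A by auto
    have L2: "loc_L2 (\<lambda>x. w (x + z) - w x)" using w by (intro loc_L2_diff loc_L2_translate)
    have "(\<integral>\<^sup>+x. f x (x + z) \<partial>lborel) = (\<integral>\<^sup>+x. ennreal (indicator A x * (w (x + z) - w x)\<^sup>2) \<partial>lborel)"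
      by (intro nn_integral_cong) (auto simp: f_def A_def indicator_def)
    also have "\<dots> = ennreal (norm_sq_on A (\<lambda>x. w (x + z) - w x))"
      unfolding norm_sq_on_def by (intro nn_integral_eq_integral norm_sq_on_integrable L2 Ab A) auto
    also have "norm_sq_on A (\<lambda>x. w (x + z) - w x) \<le> norm_sq_on K (\<lambda>x. z \<bullet> g x)"
      unfolding norm_sq_on_def
    proof (rule difference_quotient_bound[OF w g wg K(1,3) A])
      fix x and t :: real assume "x \<in> A" "0 \<le> t" "t \<le> 1"
      then show "x + t *\<^sub>R z \<in> K"
        using convexD_alt[OF K(2), of x "x + z" t] by (auto simp: A_def algebra_simps)
    qed
    also have "\<dots> \<le> (norm z)\<^sup>2 * ?G" by (rule directional_le_grad_sq_on[OF g Kb K(3)])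
    also have "\<dots> \<le> h\<^sup>2 * ?G" using True by (intro mult_right_mono power_mono grad_sq_on_nonneg) auto
    finally show ?thesis using True by (simp add: ennreal_leI)
  qed
  have outer: "ennreal ?N * indicator K x \<le> (\<integral>\<^sup>+y. f x y \<partial>lborel)" for x
  proof (cases "x \<in> K")
    case True
    have L2: "loc_L2 (\<lambda>y. w y - w x)" by (rule loc_L2_diff[OF w loc_L2_continuous[OF continuous_on_const]])
    have "ennreal ?N \<le> ennreal (norm_sq_on K (\<lambda>y. w y - w x))" by (intro ennreal_leI best)
    also have "\<dots> = (\<integral>\<^sup>+y. ennreal (indicator K y * (w y - w x)\<^sup>2) \<partial>lborel)"
      unfolding norm_sq_on_def by (intro nn_integral_eq_integral[symmetric] norm_sq_on_integrable L2 Kb K(3)) auto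
    also have "\<dots> = (\<integral>\<^sup>+y. f x y \<partial>lborel)"
      using True by (intro nn_integral_cong) (auto simp: f_def indicator_def)
    finally show ?thesis using True by simp
  qed simp
  have fin: "emeasure lborel K = ennreal (measure lborel K)"
    using emeasure_bounded_finite[OF K(3)] by (intro emeasure_eq_ennreal_measure) auto
  have finb: "emeasure lborel (cball (0::real^'n) h) = ennreal (measure lborel (cball (0::real^'n) h))"
    using emeasure_bounded_finite[OF bounded_cball, of "0::real^'n" h]
    by (intro emeasure_eq_ennreal_measure) auto
  have "ennreal (?N * measure lborel K) = (\<integral>\<^sup>+x. ennreal ?N * indicator K x \<partial>lborel)"
    by (simp add: nn_integral_cmult_indicator fin ennreal_mult norm_sq_on_nonneg)
  also have "\<dots> \<le> (\<integral>\<^sup>+x. \<integral>\<^sup>+y. f x y \<partial>lborel \<partial>lborel)" by (intro nn_integral_mono outer)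
  also have "\<dots> = (\<integral>\<^sup>+x. \<integral>\<^sup>+z. f x (x + z) \<partial>lborel \<partial>lborel)"
  proof (rule nn_integral_cong)
    fix x :: "real^'n"
    have "f x \<in> borel_measurable borel" unfolding f_def[abs_def] by measurable
    from nn_integral_lborel_translate[OF this, of x]
    show "(\<integral>\<^sup>+y. f x y \<partial>lborel) = (\<integral>\<^sup>+z. f x (x + z) \<partial>lborel)" by simp
  qed
  also have "\<dots> = (\<integral>\<^sup>+z. \<integral>\<^sup>+x. f x (x + z) \<partial>lborel \<partial>lborel)"
    by (rule lborel_pair.Fubini') (simp add: f_def, measurable)
  also have "\<dots> \<le> (\<integral>\<^sup>+z. ennreal (h\<^sup>2 * ?G) * indicator (cball 0 h) z \<partial>(lborel :: (real^'n) measure))"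
    by (intro nn_integral_mono inner)
  also have "\<dots> = ennreal (h\<^sup>2 * ?G * measure lborel (cball (0::real^'n) h))"
    by (subst nn_integral_cmult_indicator) (simp_all add: finb ennreal_mult grad_sq_on_nonneg)
  finally have "?N * measure lborel K \<le> h\<^sup>2 * ?G * measure lborel (cball (0::real^'n) h)"
    by (subst (asm) ennreal_le_iff) (auto intro!: mult_nonneg_nonneg grad_sq_on_nonneg)
  then show ?thesis by (simp add: ac_simps)
qed

section \<open>The energy norm in terms of Borel representatives\<close>

lemma lebesgue_AE_borel:
  fixes f f' :: "'a::euclidean_space \<Rightarrow> real"
  assumes f': "f' \<in> borel_measurable borel" and ae: "AE x in lborel. f x = f' x"
  shows "f \<in> borel_measurable lebesgue" "integrable lebesgue f \<longleftrightarrow> integrable lborel f'"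
    "(\<integral>x. f x \<partial>lebesgue) = (\<integral>x. f' x \<partial>lborel)"
proof -
  have m': "f' \<in> borel_measurable lebesgue" using f' by (intro measurable_completion) simp
  have ae': "AE x in lebesgue. f' x = f x" using AE_completion[OF ae] by eventually_elim simp
  show m: "f \<in> borel_measurable lebesgue" by (rule borel_measurable_AE[OF m' ae'])
  have "integrable lebesgue f \<longleftrightarrow> integrable lebesgue f'"
    using m m' ae' by (intro integrable_cong_AE) auto
  also have "\<dots> \<longleftrightarrow> integrable lborel f'" using f' by (intro integrable_completion) simp
  finally show "integrable lebesgue f \<longleftrightarrow> integrable lborel f'" .
  have "(\<integral>x. f x \<partial>lebesgue) = (\<integral>x. f' x \<partial>lebesgue)"
    using m m' ae' by (intro integral_cong_AE) auto
  also have "\<dots> = (\<integral>x. f' x \<partial>lborel)" using f' by (intro integral_completion) simp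
  finally show "(\<integral>x. f x \<partial>lebesgue) = (\<integral>x. f' x \<partial>lborel)" .
qed

lemma square_integrable_on_borel_version:
  fixes v :: "real^'n \<Rightarrow> real"
  assumes v: "v square_integrable_on A" and A: "A \<in> sets borel"
  shows "\<exists>v'. loc_L2 v' \<and> (AE x in lborel. x \<in> A \<longrightarrow> v x = v' x)"
proof -
  have "(\<lambda>x. indicator A x * v x) \<in> borel_measurable lebesgue"
    using v by (simp add: square_integrable_on_def set_borel_measurable_def)
  then obtain f where f: "f \<in> borel_measurable lborel" "AE x in lborel. indicator A x * v x = f x"
    using completion_ex_borel_measurable_real by blast
  have "AE x in lborel. indicator A x * (v x)\<^sup>2 = (f x)\<^sup>2"
    using f(2)
  proof eventually_elim
    case (elim x)
    then show ?case unfolding elim[symmetric] by (simp add: indicator_def)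
  qed
  moreover have "integrable lebesgue (\<lambda>x. indicator A x * (v x)\<^sup>2)"
    using v by (simp add: square_integrable_on_def set_integrable_def)
  ultimately have "L2_fun f"
    using lebesgue_AE_borel(2)[of "\<lambda>x. (f x)\<^sup>2" "\<lambda>x. indicator A x * (v x)\<^sup>2"] f(1)
    by (simp add: L2_fun_def)
  moreover have "L2_fun (\<lambda>x. indicator (cball 0 R) x * f x)" for R
  proof (rule L2_fun_cong_le[OF \<open>L2_fun f\<close>])
    have [measurable]: "f \<in> borel_measurable borel" "cball (0::real^'n) R \<in> sets borel" using f(1) by auto
    show "(\<lambda>x. indicator (cball 0 R) x * f x) \<in> borel_measurable borel" by measurable
  qed (simp add: indicator_def)
  ultimately have "loc_L2 f" by (simp add: loc_L2_def L2_fun_def)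
  moreover have "AE x in lborel. x \<in> A \<longrightarrow> v x = f x" using f(2) by eventually_elim auto
  ultimately show ?thesis by blast
qed

lemma square_integrable_on_borel_version_vec:
  fixes g :: "real^'n \<Rightarrow> real^'n"
  assumes g: "g square_integrable_on A" and A: "A \<in> sets borel"
  shows "\<exists>g'. loc_L2_vec g' \<and> (AE x in lborel. x \<in> A \<longrightarrow> g x = g' x)"
proof -
  have comp: "(\<lambda>x. g x $ i) square_integrable_on A" for i
  proof -
    have m: "(\<lambda>x. indicator A x *\<^sub>R g x) \<in> borel_measurable lebesgue"
      using g by (simp add: square_integrable_on_def set_borel_measurable_def)
    then have "(\<lambda>x. (indicator A x *\<^sub>R g x) \<bullet> axis i 1) \<in> borel_measurable lebesgue"
      by (intro borel_measurable_inner) auto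
    then have mi: "(\<lambda>x. indicator A x * g x $ i) \<in> borel_measurable lebesgue"
      by (simp add: inner_axis)
    have "integrable lebesgue (\<lambda>x. indicator A x * (g x $ i)\<^sup>2)"
    proof (rule Bochner_Integration.integrable_bound)
      show "integrable lebesgue (\<lambda>x. indicator A x * (norm (g x))\<^sup>2)"
        using g by (simp add: square_integrable_on_def set_integrable_def)
      have "(\<lambda>x. (indicator A x * g x $ i)\<^sup>2) \<in> borel_measurable lebesgue" using mi by measurable
      moreover have "(indicator A x * g x $ i)\<^sup>2 = indicator A x * (g x $ i)\<^sup>2" for x by (simp add: indicator_def)
      ultimately show "(\<lambda>x. indicator A x * (g x $ i)\<^sup>2) \<in> borel_measurable lebesgue" by simp
      have "\<bar>g x $ i\<bar>\<^sup>2 \<le> (norm (g x))\<^sup>2" for x by (intro power_mono component_le_norm_cart) auto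
      then show "AE x in lebesgue. norm (indicator A x * (g x $ i)\<^sup>2) \<le> norm (indicator A x * (norm (g x))\<^sup>2)"
        by (intro AE_I2) (simp add: indicator_def)
    qed
    then show ?thesis using mi by (simp add: square_integrable_on_def set_borel_measurable_def set_integrable_def)
  qed
  then have "\<forall>i. \<exists>v'. loc_L2 v' \<and> (AE x in lborel. x \<in> A \<longrightarrow> g x $ i = v' x)"
    using square_integrable_on_borel_version[OF _ A] by blast
  then obtain G where G: "\<And>i. loc_L2 (G i)" "\<And>i. AE x in lborel. x \<in> A \<longrightarrow> g x $ i = G i x" by metis
  have "AE x in lborel. \<forall>i\<in>UNIV. x \<in> A \<longrightarrow> g x $ i = G i x"
    using G(2) by (intro AE_finite_allI) auto
  then have "AE x in lborel. x \<in> A \<longrightarrow> g x = (\<chi> i. G i x)"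
    by eventually_elim (simp add: vec_eq_iff)
  moreover have "loc_L2_vec (\<lambda>x. \<chi> i. G i x)" using G(1) by (simp add: loc_L2_vec_def)
  ultimately show ?thesis by blast
qed

lemma has_weak_gradient_iff_wgrad:
  assumes v': "loc_L2 v'" "AE x in lborel. x \<in> interior A \<longrightarrow> v x = v' x"
    and g': "loc_L2_vec g'" "AE x in lborel. x \<in> interior A \<longrightarrow> g x = g' x"
  shows "has_weak_gradient A v g \<longleftrightarrow> wgrad (interior A) v' g'"
proof -
  have "(LINT x:interior A|lebesgue. v x * partial_deriv i \<phi> x) = (\<integral>x. v' x * partial_deriv i \<phi> x \<partial>lborel)"
      "(LINT x:interior A|lebesgue. g x $ i * \<phi> x) = (\<integral>x. g' x $ i * \<phi> x \<partial>lborel)"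
    if \<phi>: "\<phi> \<in> test_functions (interior A)" for \<phi> i
  proof -
    note C1 = test_function_C1_compact[OF \<phi>]
    have gi: "loc_L2 (\<lambda>x. g' x $ i)" using g' by (simp add: loc_L2_vec_def)
    show "(LINT x:interior A|lebesgue. v x * partial_deriv i \<phi> x) = (\<integral>x. v' x * partial_deriv i \<phi> x \<partial>lborel)"
      unfolding set_lebesgue_integral_def
    proof (rule lebesgue_AE_borel(3))
      show "(\<lambda>x. v' x * partial_deriv i \<phi> x) \<in> borel_measurable borel"
        using loc_L2_times_test_integrable(2)[OF v'(1) C1, of i] by auto
      show "AE x in lborel. indicator (interior A) x *\<^sub>R (v x * partial_deriv i \<phi> x) = v' x * partial_deriv i \<phi> x"
        using v'(2) by eventually_elim (use test_function_deriv_support[OF \<phi>] in \<open>auto simp: indicator_def\<close>)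
    qed
    show "(LINT x:interior A|lebesgue. g x $ i * \<phi> x) = (\<integral>x. g' x $ i * \<phi> x \<partial>lborel)"
      unfolding set_lebesgue_integral_def
    proof (rule lebesgue_AE_borel(3))
      show "(\<lambda>x. g' x $ i * \<phi> x) \<in> borel_measurable borel"
        using loc_L2_times_test_integrable(1)[OF gi C1] by auto
      show "AE x in lborel. indicator (interior A) x *\<^sub>R (g x $ i * \<phi> x) = g' x $ i * \<phi> x"
        using g'(2) by eventually_elim (use test_function_support[OF \<phi>] in \<open>auto simp: indicator_def\<close>)
    qed
  qed
  then show ?thesis by (simp add: has_weak_gradient_def wgrad_def)
qed

lemma L2_norm_eq_norm_sq_on:
  assumes "loc_L2 v'" "AE x in lborel. x \<in> A \<longrightarrow> v x = v' x" "A \<in> sets borel"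
  shows "(L2_norm lebesgue A v)\<^sup>2 = norm_sq_on A v'"
proof -
  note [measurable] = loc_L2_measurable[OF assms(1)] assms(3)
  have "(LINT x:A|lebesgue. (norm (v x))\<^sup>2) = norm_sq_on A v'"
    unfolding set_lebesgue_integral_def norm_sq_on_def
  proof (rule lebesgue_AE_borel(3))
    show "(\<lambda>x. indicator A x * (v' x)\<^sup>2) \<in> borel_measurable borel" by measurable
    show "AE x in lborel. indicator A x *\<^sub>R (norm (v x))\<^sup>2 = indicator A x * (v' x)\<^sup>2"
      using assms(2) by eventually_elim (auto simp: indicator_def)
  qed
  then show ?thesis using norm_sq_on_nonneg[of A v'] by (simp add: L2_norm_def)
qed

lemma loc_L2_vec_norm_measurable:
  assumes "loc_L2_vec g"
  shows "(\<lambda>x. norm (g x)) \<in> borel_measurable borel"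
proof -
  have [measurable]: "(\<lambda>x. g x $ i) \<in> borel_measurable borel" for i
    using assms loc_L2_measurable by (auto simp: loc_L2_vec_def)
  show ?thesis unfolding norm_vec_def L2_set_def by measurable
qed

lemma L2_norm_eq_grad_sq_on:
  assumes "loc_L2_vec g'" "AE x in lborel. x \<in> A \<longrightarrow> g x = g' x" "A \<in> sets borel"
  shows "(L2_norm lebesgue A g)\<^sup>2 = grad_sq_on A g'"
proof -
  note [measurable] = loc_L2_vec_norm_measurable[OF assms(1)] assms(3)
  have "(LINT x:A|lebesgue. (norm (g x))\<^sup>2) = grad_sq_on A g'"
    unfolding set_lebesgue_integral_def grad_sq_on_def
  proof (rule lebesgue_AE_borel(3))
    show "(\<lambda>x. indicator A x * (norm (g' x))\<^sup>2) \<in> borel_measurable borel" by measurable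
    show "AE x in lborel. indicator A x *\<^sub>R (norm (g x))\<^sup>2 = indicator A x * (norm (g' x))\<^sup>2"
      using assms(2) by eventually_elim (auto simp: indicator_def)
  qed
  then show ?thesis using grad_sq_on_nonneg[of A g'] by (simp add: L2_norm_def)
qed

lemma square_integrable_on_vec_I:
  assumes g: "loc_L2_vec g" and A: "A \<in> sets borel" "bounded A"
  shows "g square_integrable_on A"
proof -
  have comp: "(\<lambda>x. g x \<bullet> b) \<in> borel_measurable borel" if b: "b \<in> Basis" for b
  proof -
    obtain i where "b = axis i 1" using b by (auto simp: Basis_vec_def)
    then show ?thesis using g loc_L2_measurable by (auto simp: loc_L2_vec_def inner_axis)
  qed
  have "g \<in> borel_measurable borel" by (rule borel_measurable_euclidean_space[THEN iffD2]) (use comp in blast)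
  then have gl: "g \<in> borel_measurable lebesgue" by (intro measurable_completion) simp
  have "set_borel_measurable lebesgue A g"
    unfolding set_borel_measurable_def
    using A(1) by (intro borel_measurable_scaleR borel_measurable_indicator gl) auto
  moreover have "set_integrable lebesgue A (\<lambda>x. (norm (g x))\<^sup>2)"
    unfolding set_integrable_def using grad_sq_on_integrable[OF g A]
    by (subst integrable_completion) auto
  ultimately show ?thesis by (simp add: square_integrable_on_def)
qed

text \<open>
  The weak gradient in the energy norm is an arbitrary choice. It agrees with the given one
  almost everywhere in the interior by uniqueness, and the boundary is a null set.
\<close>

lemma energy_norm_sq:
  fixes v' :: "real^'n \<Rightarrow> real"
  assumes A: "A \<in> sets borel" "bounded A" "AE x in lborel. x \<in> A \<longrightarrow> x \<in> interior A"
    and v': "loc_L2 v'" "AE x in lborel. x \<in> A \<longrightarrow> v x = v' x"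
    and g': "loc_L2_vec g'" "wgrad (interior A) v' g'" and \<epsilon>: "0 \<le> \<epsilon>"
  shows "(energy_norm \<epsilon> A v)\<^sup>2 = norm_sq_on A v' + \<epsilon> * grad_sq_on A g'"
proof -
  let ?G = "weak_gradient A v"
  have v'_int: "AE x in lborel. x \<in> interior A \<longrightarrow> v x = v' x"
    using v'(2) by eventually_elim (use interior_subset in blast)
  have "g' square_integrable_on A \<and> has_weak_gradient A v g'"
    using square_integrable_on_vec_I[OF g'(1) A(1,2)] has_weak_gradient_iff_wgrad[OF v'(1) v'_int g'(1)] g'(2)
    by simp
  then have G: "?G square_integrable_on A" "has_weak_gradient A v ?G"
    unfolding weak_gradient_def by (metis (mono_tags, lifting) someI)+
  obtain G' where G': "loc_L2_vec G'" "AE x in lborel. x \<in> A \<longrightarrow> ?G x = G' x"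
    using square_integrable_on_borel_version_vec[OF G(1) A(1)] by blast
  have "AE x in lborel. x \<in> interior A \<longrightarrow> ?G x = G' x"
    using G'(2) by eventually_elim (use interior_subset in blast)
  then have "wgrad (interior A) v' G'"
    using has_weak_gradient_iff_wgrad[OF v'(1) v'_int G'(1)] G(2) by blast
  then have "AE x in lborel. x \<in> interior A \<longrightarrow> g' x = G' x"
    using g' G'(1) A(2) by (intro wgrad_unique[where v = v']) (auto intro: bounded_subset interior_subset)
  then have "AE x in lborel. x \<in> A \<longrightarrow> ?G x = g' x"
    using A(3) G'(2) by eventually_elim auto
  then have "(L2_norm lebesgue A ?G)\<^sup>2 = grad_sq_on A g'"
    using g'(1) A(1) by (intro L2_norm_eq_grad_sq_on)
  moreover have "(L2_norm lebesgue A v)\<^sup>2 = norm_sq_on A v'"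
    using v' A(1) by (intro L2_norm_eq_norm_sq_on)
  ultimately show ?thesis
    using \<epsilon> norm_sq_on_nonneg[of A v'] grad_sq_on_nonneg[of A g'] by (simp add: energy_norm_def)
qed

section \<open>A simplex near the barycentre of a facet\<close>

text \<open>
  The barycentric coordinates, as affine functions on the whole space.
\<close>

lemma barycentric_functionals:
  fixes C :: "(real^'n) set"
  assumes C: "\<not> affine_dependent C" "card C = Suc CARD('n)"
  obtains a b where "\<And>v w. v \<in> C \<Longrightarrow> w \<in> C \<Longrightarrow> a v \<bullet> w + b v = (if v = w then 1 else (0::real))"
    "\<And>x. x = (\<Sum>v\<in>C. (a v \<bullet> x + b v) *\<^sub>R v)" "\<And>x. (\<Sum>v\<in>C. a v \<bullet> x + b v) = 1"
proof -
  have finC: "finite C" using C(2) card_ge_0_finite[of C] by simp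
  have "\<exists>a b. \<forall>w\<in>C. a \<bullet> w + b = (if v = w then 1 else (0::real))" if v: "v \<in> C" for v
  proof -
    let ?B = "(\<lambda>w. - v + w) ` (C - {v})"
    have "\<not> affine_dependent (insert v (C - {v}))" using C(1) v by (simp add: insert_absorb)
    then have "independent ?B" by (subst (asm) affine_dependent_iff_dependent) auto
    then obtain g :: "real^'n \<Rightarrow> real" where g: "linear g" "\<forall>x\<in>?B. g x = - 1"
      using linear_independent_extend[of ?B "\<lambda>_. - 1"] by blast
    have ad: "g x = adjoint g 1 \<bullet> x" for x
      using adjoint_works[OF g(1), of x 1] by (simp add: inner_commute)
    have "adjoint g 1 \<bullet> w + (1 - g v) = (if v = w then 1 else 0)" if w: "w \<in> C" for w
    proof (cases "v = w")
      case False
      then have "g (- v + w) = - 1" using g(2) w by auto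
      then have "g w - g v = - 1" using linear_diff[OF g(1)] by simp
      then show ?thesis using False by (simp add: ad[symmetric])
    qed (simp add: ad[symmetric])
    then show ?thesis by blast
  qed
  then obtain a b where ab: "\<And>v w. v \<in> C \<Longrightarrow> w \<in> C \<Longrightarrow> a v \<bullet> w + b v = (if v = w then 1 else (0::real))"
    by metis
  have coord: "\<exists>u. (\<Sum>v\<in>C. u v) = 1 \<and> x = (\<Sum>v\<in>C. u v *\<^sub>R v) \<and> (\<forall>v\<in>C. a v \<bullet> x + b v = u v)" for x
  proof -
    have "affine hull C = UNIV" using C by (intro affine_independent_span_eq) auto
    then obtain u where u: "sum u C = 1" "(\<Sum>v\<in>C. u v *\<^sub>R v) = x"
      using affine_hull_finite[OF finC] by blast
    have "a w \<bullet> x + b w = u w" if w: "w \<in> C" for w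
    proof -
      have "a w \<bullet> x + b w = (\<Sum>v\<in>C. u v * (a w \<bullet> v)) + b w * sum u C"
        by (simp add: u(2)[symmetric] inner_sum_right u(1))
      also have "\<dots> = (\<Sum>v\<in>C. u v * (a w \<bullet> v + b w))"
        by (simp add: distrib_left sum.distrib sum_distrib_left mult.commute)
      also have "\<dots> = (\<Sum>v\<in>C. if v = w then u w else 0)"
        using ab w by (intro sum.cong) auto
      also have "\<dots> = u w" using finC w by simp
      finally show ?thesis .
    qed
    then show ?thesis using u by auto
  qed
  show ?thesis
  proof (rule that[OF ab])
    fix x
    obtain u where u: "(\<Sum>v\<in>C. u v) = 1" "x = (\<Sum>v\<in>C. u v *\<^sub>R v)" "\<forall>v\<in>C. a v \<bullet> x + b v = u v"
      using coord by blast
    have "(\<Sum>v\<in>C. (a v \<bullet> x + b v) *\<^sub>R v) = (\<Sum>v\<in>C. u v *\<^sub>R v)" using u(3) by (intro sum.cong) auto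
    then show "x = (\<Sum>v\<in>C. (a v \<bullet> x + b v) *\<^sub>R v)" using u(2) by simp
    have "(\<Sum>v\<in>C. a v \<bullet> x + b v) = (\<Sum>v\<in>C. u v)" using u(3) by (intro sum.cong) auto
    then show "(\<Sum>v\<in>C. a v \<bullet> x + b v) = 1" using u(1) by simp
  qed auto
qed

text \<open>
  Defined through extreme points, so that it depends on the facet only and two adjacent
  simplices give the same point.
\<close>

definition face_barycentre :: "(real^'n) set \<Rightarrow> real^'n" where
  "face_barycentre E = (1 / real CARD('n)) *\<^sub>R (\<Sum>v | v extreme_point_of E. v)"

text \<open>
  The barycentric coordinates take values in \<open>[0, 1]\<close> on the inscribed ball of radius \<open>s\<close>, so
  their gradients have norm at most \<open>1 / (2 * s)\<close>. At \<open>m\<close> one of them vanishes and all others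
  are \<open>1 / n\<close>; within distance \<open>2 * s / n\<close> of \<open>m\<close> those others remain nonnegative.
\<close>

lemma simplex_half_ball:
  fixes K :: "(real^'n) set"
  assumes K: "int CARD('n) simplex K" and E: "E facet_of K" and s: "0 < s" "cball c s \<subseteq> K"
  defines "m \<equiv> face_barycentre E"
  obtains a where "a \<noteq> 0" "m \<in> E" "\<And>x. x \<in> K \<Longrightarrow> 0 \<le> a \<bullet> (x - m)" "\<And>x. x \<in> E \<Longrightarrow> a \<bullet> (x - m) = 0"
    "\<And>x. norm (x - m) < 2 * s / real CARD('n) \<Longrightarrow> 0 \<le> a \<bullet> (x - m) \<Longrightarrow> x \<in> K"
proof -
  let ?n = "CARD('n)"
  obtain C where C: "\<not> affine_dependent C" "int (card C) = int ?n + 1" "K = convex hull C"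
    using K by (auto simp: simplex_def)
  then have cardC: "card C = Suc ?n" by simp
  then have finC: "finite C" using card_ge_0_finite[of C] by simp
  obtain \<alpha> \<beta> where ab: "\<And>v w. v \<in> C \<Longrightarrow> w \<in> C \<Longrightarrow> \<alpha> v \<bullet> w + \<beta> v = (if v = w then 1 else (0::real))"
    "\<And>x. x = (\<Sum>v\<in>C. (\<alpha> v \<bullet> x + \<beta> v) *\<^sub>R v)" "\<And>x. (\<Sum>v\<in>C. \<alpha> v \<bullet> x + \<beta> v) = 1"
    using barycentric_functionals[OF C(1) cardC] by blast
  define bc where "bc v x = \<alpha> v \<bullet> x + \<beta> v" for v x
  have lam_vert: "bc v w = (if v = w then 1 else 0)" if "v \<in> C" "w \<in> C" for v w
    using ab(1) that by (simp add: bc_def)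
  have lam_diff: "bc v x - bc v y = \<alpha> v \<bullet> (x - y)" for v x y by (simp add: bc_def inner_diff_right)
  have lam_comb: "bc v (\<Sum>w\<in>D. u w *\<^sub>R w) = (\<Sum>w\<in>D. u w * bc v w)" if "sum u D = 1" for v u D
  proof -
    have "(\<Sum>w\<in>D. u w * bc v w) = (\<Sum>w\<in>D. u w * (\<alpha> v \<bullet> w)) + \<beta> v * sum u D"
      by (simp add: bc_def distrib_left sum.distrib sum_distrib_left mult.commute)
    then show ?thesis using that by (simp add: bc_def inner_sum_right)
  qed
  have K_iff: "x \<in> K \<longleftrightarrow> (\<forall>v\<in>C. 0 \<le> bc v x)" for x
  proof
    assume "x \<in> K"
    then obtain u where u: "\<forall>v\<in>C. 0 \<le> u v" "sum u C = 1" "(\<Sum>v\<in>C. u v *\<^sub>R v) = x"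
      unfolding C(3) convex_hull_finite[OF finC] by blast
    show "\<forall>v\<in>C. 0 \<le> bc v x"
      using u(1) lam_vert by (auto simp: u(3)[symmetric] lam_comb[OF u(2)] intro!: sum_nonneg)
  next
    assume "\<forall>v\<in>C. 0 \<le> bc v x"
    then show "x \<in> K"
      unfolding C(3) convex_hull_finite[OF finC] using ab(2)[of x] ab(3)[of x]
      by (intro CollectI exI[of _ "\<lambda>v. bc v x"]) (auto simp: bc_def)
  qed
  obtain v0 where v0: "v0 \<in> C" "E = convex hull (C - {v0})"
    using E facet_of_convex_hull_affine_independent[OF C(1)] by (auto simp: C(3))
  have indC0: "\<not> affine_dependent (C - {v0})" using C(1) affine_dependent_subset by blast
  have cardC0: "card (C - {v0}) = ?n" using cardC v0(1) by simp
  have "{v. v extreme_point_of E} = C - {v0}"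
    unfolding v0(2) using extreme_point_of_convex_hull_affine_independent[OF indC0] by blast
  then have m_eq: "m = (\<Sum>w\<in>C - {v0}. (1 / real ?n) *\<^sub>R w)"
    by (simp add: m_def face_barycentre_def scaleR_sum_right)
  have sum1: "(\<Sum>w\<in>C - {v0}. 1 / real ?n) = 1" using cardC0 by simp
  have lam_m: "bc v m = (if v = v0 then 0 else 1 / real ?n)" if "v \<in> C" for v
  proof -
    have "bc v m = (\<Sum>w\<in>C - {v0}. (1 / real ?n) * bc v w)" unfolding m_eq by (rule lam_comb[OF sum1])
    also have "\<dots> = (\<Sum>w\<in>C - {v0}. if w = v then 1 / real ?n else 0)"
      using that lam_vert by (intro sum.cong) auto
    also have "\<dots> = (if v = v0 then 0 else 1 / real ?n)" using finC that by (simp add: sum.delta)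
    finally show ?thesis .
  qed
  have m_E: "m \<in> E"
    unfolding v0(2) convex_hull_finite[OF finite_Diff[OF finC]] m_eq
    by (intro CollectI exI[of _ "\<lambda>_. 1 / real ?n"] conjI ballI sum1 refl) simp
  have L_eq: "\<alpha> v0 \<bullet> (x - m) = bc v0 x" for x
    using lam_diff[of v0 x m] lam_m[OF v0(1)] by simp
  have slope: "norm (\<alpha> v) * (2 * s) \<le> 1" if v: "v \<in> C" for v
  proof -
    define e where "e = sgn (\<alpha> v)"
    have e: "\<alpha> v \<bullet> e = norm (\<alpha> v)" "norm e \<le> 1"
      by (cases "\<alpha> v = 0"; simp add: e_def sgn_div_norm dot_square_norm power2_eq_square)+
    have "c + s *\<^sub>R e \<in> K" "c - s *\<^sub>R e \<in> K"
      using s e(2) by (auto simp: dist_norm mult_left_le intro!: subsetD[OF s(2)])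
    then have "bc v (c + s *\<^sub>R e) \<le> 1" "0 \<le> bc v (c - s *\<^sub>R e)"
    proof -
      assume p: "c + s *\<^sub>R e \<in> K" "c - s *\<^sub>R e \<in> K"
      have "bc v (c + s *\<^sub>R e) \<le> (\<Sum>w\<in>C. bc w (c + s *\<^sub>R e))"
        using p(1) K_iff finC v by (intro member_le_sum) auto
      then show "bc v (c + s *\<^sub>R e) \<le> 1" using ab(3)[of "c + s *\<^sub>R e"] by (simp add: bc_def)
      show "0 \<le> bc v (c - s *\<^sub>R e)" using p(2) K_iff v by blast
    qed
    then have "bc v (c + s *\<^sub>R e) - bc v (c - s *\<^sub>R e) \<le> 1" by simp
    moreover have "c + s *\<^sub>R e - (c - s *\<^sub>R e) = (2 * s) *\<^sub>R e" by (simp add: algebra_simps flip: scaleR_2)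
    ultimately show ?thesis using e(1) by (simp add: lam_diff mult.commute)
  qed
  show ?thesis
  proof (rule that[of "\<alpha> v0"])
    show "\<alpha> v0 \<noteq> 0" using L_eq[of v0] lam_vert[OF v0(1) v0(1)] by auto
    show "m \<in> E" by (rule m_E)
    show "0 \<le> \<alpha> v0 \<bullet> (x - m)" if "x \<in> K" for x using that K_iff v0(1) by (simp add: L_eq)
    show "\<alpha> v0 \<bullet> (x - m) = 0" if x: "x \<in> E" for x
    proof -
      obtain u where u: "sum u (C - {v0}) = 1" "(\<Sum>v\<in>C - {v0}. u v *\<^sub>R v) = x"
        using x unfolding v0(2) convex_hull_finite[OF finite_Diff[OF finC]] by blast
      have "bc v0 x = (\<Sum>w\<in>C - {v0}. u w * bc v0 w)" unfolding u(2)[symmetric] by (rule lam_comb[OF u(1)])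
      also have "\<dots> = 0" using lam_vert v0(1) by (intro sum.neutral) auto
      finally show ?thesis by (simp add: L_eq)
    qed
    show "x \<in> K" if x: "norm (x - m) < 2 * s / real ?n" "0 \<le> \<alpha> v0 \<bullet> (x - m)" for x
      unfolding K_iff
    proof
      fix v assume v: "v \<in> C"
      show "0 \<le> bc v x"
      proof (cases "v = v0")
        case True then show ?thesis using x(2) by (simp add: L_eq)
      next
        case False
        have "\<bar>\<alpha> v \<bullet> (x - m)\<bar> \<le> norm (\<alpha> v) * norm (x - m)" by (rule Cauchy_Schwarz_ineq2)
        also have "\<dots> \<le> norm (\<alpha> v) * (2 * s / real ?n)" using x(1) by (intro mult_left_mono) auto
        also have "\<dots> = (norm (\<alpha> v) * (2 * s)) / real ?n" by simp
        also have "\<dots> \<le> 1 / real ?n" using slope[OF v] by (intro divide_right_mono) auto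
        finally show ?thesis using lam_diff[of v x m] lam_m[OF v] False by simp
      qed
    qed
  qed
qed

text \<open>
  The facet lies in the plane where the barycentric coordinate opposite to it vanishes, for
  either simplex. A point near \<open>m\<close> that is strictly on the positive side for one simplex and on
  the nonnegative side for the other would belong to the common facet but not to its plane, so
  the simplices lie on opposite sides of one plane.
\<close>

lemma adjacent_simplices_ball:
  fixes K1 K2 :: "(real^'n) set"
  assumes K: "int CARD('n) simplex K1" "int CARD('n) simplex K2"
    and E: "(K1 \<inter> K2) facet_of K1" "(K1 \<inter> K2) facet_of K2"
    and s: "0 < s" "cball c1 s \<subseteq> K1" "cball c2 s \<subseteq> K2"
  obtains a m where "norm a = 1" "m \<in> K1 \<inter> K2"
    "\<And>x. x \<in> K1 \<Longrightarrow> 0 \<le> a \<bullet> (x - m)" "\<And>x. x \<in> K2 \<Longrightarrow> a \<bullet> (x - m) \<le> 0"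
    "\<And>x. norm (x - m) < 2 * s / real CARD('n) \<Longrightarrow> 0 \<le> a \<bullet> (x - m) \<Longrightarrow> x \<in> K1"
    "\<And>x. norm (x - m) < 2 * s / real CARD('n) \<Longrightarrow> a \<bullet> (x - m) \<le> 0 \<Longrightarrow> x \<in> K2"
proof -
  define m where "m = face_barycentre (K1 \<inter> K2)"
  define r where "r = 2 * s / real CARD('n)"
  have r: "0 < r" using s by (simp add: r_def)
  obtain a1 where a1: "a1 \<noteq> 0" "m \<in> K1 \<inter> K2" "\<And>x. x \<in> K1 \<Longrightarrow> 0 \<le> a1 \<bullet> (x - m)"
      "\<And>x. x \<in> K1 \<inter> K2 \<Longrightarrow> a1 \<bullet> (x - m) = 0" "\<And>x. norm (x - m) < r \<Longrightarrow> 0 \<le> a1 \<bullet> (x - m) \<Longrightarrow> x \<in> K1"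
    using simplex_half_ball[OF K(1) E(1) s(1,2)] unfolding m_def r_def by blast
  obtain a2 where "a2 \<noteq> 0" "m \<in> K1 \<inter> K2" and a2: "\<And>x. x \<in> K2 \<Longrightarrow> 0 \<le> a2 \<bullet> (x - m)"
      "\<And>x. x \<in> K1 \<inter> K2 \<Longrightarrow> a2 \<bullet> (x - m) = 0" "\<And>x. norm (x - m) < r \<Longrightarrow> 0 \<le> a2 \<bullet> (x - m) \<Longrightarrow> x \<in> K2"
    using simplex_half_ball[OF K(2) E(2) s(1,3)] unfolding m_def r_def by blast
  have side2: "a1 \<bullet> (x - m) \<le> 0" if x: "x \<in> K2" for x
  proof (rule ccontr)
    assume "\<not> ?thesis"
    then have pos: "0 < a1 \<bullet> (x - m)" by simp
    define t where "t = r / (2 * (norm (x - m) + 1))"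
    have t: "0 < t" using r by (auto simp: t_def intro!: divide_pos_pos add_nonneg_pos)
    define y where "y = m + t *\<^sub>R (x - m)"
    have "t * norm (x - m) < r"
    proof -
      have "t * norm (x - m) \<le> t * (norm (x - m) + 1)" using t by simp
      also have "\<dots> = r / 2" unfolding t_def using norm_ge_zero[of "x - m"] by (simp add: field_simps add_nonneg_eq_0_iff)
      finally show ?thesis using r by simp
    qed
    then have "norm (y - m) < r" using t by (simp add: y_def)
    moreover have "a1 \<bullet> (y - m) > 0" using t pos by (simp add: y_def)
    moreover have "0 \<le> a2 \<bullet> (y - m)" using t a2(1)[OF x] by (simp add: y_def)
    ultimately have "y \<in> K1 \<inter> K2" using a1(5) a2(3) by auto
    then show False using a1(4)[of y] \<open>a1 \<bullet> (y - m) > 0\<close> by simp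
  qed
  have ball2: "x \<in> K2" if x: "norm (x - m) < r" "a1 \<bullet> (x - m) \<le> 0" for x
  proof (rule a2(3)[OF x(1)], rule ccontr)
    assume neg: "\<not> 0 \<le> a2 \<bullet> (x - m)"
    \<comment> \<open>Reflection at \<open>m\<close> turns \<open>x\<close> into a point near \<open>m\<close> that lies in the half-spaces of both
      simplices.\<close>
    define y where "y = m - (x - m)"
    have y: "y - m = - (x - m)" by (simp add: y_def)
    have "norm (y - m) < r" using x(1) unfolding y norm_minus_cancel .
    moreover have "0 \<le> a1 \<bullet> (y - m)" "0 < a2 \<bullet> (y - m)" using x(2) neg unfolding y inner_minus_right by auto
    ultimately have "y \<in> K1 \<inter> K2" using a1(5) a2(3) by auto
    then show False using a2(2)[of y] \<open>0 < a2 \<bullet> (y - m)\<close> by simp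
  qed
  show ?thesis
  proof (rule that[of "a1 /\<^sub>R norm a1" m])
    show "norm (a1 /\<^sub>R norm a1) = 1" using a1(1) by simp
    have sgn: "0 \<le> (a1 /\<^sub>R norm a1) \<bullet> v \<longleftrightarrow> 0 \<le> a1 \<bullet> v" "(a1 /\<^sub>R norm a1) \<bullet> v \<le> 0 \<longleftrightarrow> a1 \<bullet> v \<le> 0" for v
      using a1(1) by (auto simp: zero_le_mult_iff mult_le_0_iff)
    show "0 \<le> (a1 /\<^sub>R norm a1) \<bullet> (x - m)" if "x \<in> K1" for x using a1(3)[OF that] sgn by blast
    show "(a1 /\<^sub>R norm a1) \<bullet> (x - m) \<le> 0" if "x \<in> K2" for x using side2[OF that] sgn by blast
    show "x \<in> K1" if "norm (x - m) < 2 * s / real CARD('n)" "0 \<le> (a1 /\<^sub>R norm a1) \<bullet> (x - m)" for x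
      using a1(5)[of x] that sgn by (simp add: r_def)
    show "x \<in> K2" if "norm (x - m) < 2 * s / real CARD('n)" "(a1 /\<^sub>R norm a1) \<bullet> (x - m) \<le> 0" for x
      using ball2[of x] that sgn by (simp add: r_def)
  qed (rule a1(2))
qed

lemma simplex_basic:
  fixes K :: "(real^'n) set"
  assumes K: "int CARD('n) simplex K"
  shows "compact K" "convex K" "interior K \<noteq> {}" "AE x in lborel. x \<in> K \<longrightarrow> x \<in> interior K"
proof -
  obtain C where C: "\<not> affine_dependent C" "int (card C) = int CARD('n) + 1" "K = convex hull C"
    using K by (auto simp: simplex_def)
  then have cardC: "card C = Suc CARD('n)" by simp
  then have finC: "finite C" using card_ge_0_finite[of C] by simp
  show "compact K" "convex K" using finC by (auto simp: C(3) finite_imp_compact_convex_hull)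
  have "affine hull K = UNIV" using affine_independent_span_eq[OF C(1)] cardC by (simp add: C(3))
  moreover have "rel_interior K \<noteq> {}"
    using \<open>convex K\<close> cardC by (auto simp: rel_interior_eq_empty C(3))
  ultimately show "interior K \<noteq> {}" using rel_interior_interior by blast
  have "negligible (frontier K)" using \<open>convex K\<close> by (rule negligible_convex_frontier)
  moreover have "frontier K \<in> sets borel" by simp
  ultimately have "frontier K \<in> null_sets lborel"
    by (simp add: negligible_iff_null_sets null_sets_completion_iff)
  then show "AE x in lborel. x \<in> K \<longrightarrow> x \<in> interior K"
    using \<open>compact K\<close> by (intro AE_I'[of "frontier K"]) (auto simp: frontier_def compact_imp_closed)
qed

text \<open>
  The inball diameter is defined as a supremum. Rather than showing that it is attained, take a
  ball whose diameter exceeds half of it; this costs a factor \<open>2\<close> in the radius.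
\<close>

lemma inball_diameter_ball:
  fixes K :: "(real^'n) set"
  assumes K: "compact K" "interior K \<noteq> {}"
  shows "0 < inball_diameter K" "inball_diameter K \<le> diameter K" "\<exists>c. cball c (inball_diameter K / 4) \<subseteq> K"
proof -
  let ?S = "{diameter (cball a r) | a r. cball a r \<subseteq> K}"
  obtain x e where e: "0 < e" "cball x e \<subseteq> K"
    using K(2) mem_interior_cball by blast
  have le: "d \<le> diameter K" if "d \<in> ?S" for d
  proof -
    obtain a r where ar: "d = diameter (cball a r)" "cball a r \<subseteq> K" using \<open>d \<in> ?S\<close> by blast
    show ?thesis unfolding ar(1) using ar(2) compact_imp_bounded[OF K(1)] by (rule diameter_subset)
  qed
  then have bdd: "bdd_above ?S" unfolding bdd_above_def by blast
  have mem: "diameter (cball x e) \<in> ?S" using e by blast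
  have "2 * e \<le> inball_diameter K"
    unfolding inball_diameter_def using cSup_upper[OF mem bdd] e by simp
  then show pos: "0 < inball_diameter K" using e by simp
  show "inball_diameter K \<le> diameter K"
    unfolding inball_diameter_def using mem le by (intro cSup_least) auto
  have "inball_diameter K / 2 < Sup ?S" using pos by (simp add: inball_diameter_def)
  then obtain d where "d \<in> ?S" "inball_diameter K / 2 < d"
    using less_cSup_iff[of ?S "inball_diameter K / 2"] bdd mem by blast
  then obtain a r where ar: "cball a r \<subseteq> K" "inball_diameter K / 2 < diameter (cball a r)" by blast
  then have "inball_diameter K / 4 \<le> r" using pos by (auto split: if_splits)
  then show "\<exists>c. cball c (inball_diameter K / 4) \<subseteq> K" using ar(1) by (meson order_trans subset_cball)
qed

section \<open>Lebesgue and face measure of polynomials\<close>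

lemma homothety_bounded_lborel: "homothety_bounded CARD('n) (lborel :: (real^'n) measure)"
  unfolding homothety_bounded_def
proof (intro conjI allI ballI impI)
  fix x :: "real^'n" and t :: real and B :: "(real^'n) set"
  assume B: "B \<in> sets borel" and t: "0 < t"
  let ?h = "\<lambda>y. x + t *\<^sub>R (y - x)"
  have h_eq: "?h = (\<lambda>y. (x - t *\<^sub>R x) + t *\<^sub>R y)" by (auto simp: algebra_simps)
  have hB: "?h -` B \<in> sets borel"
    using measurable_sets[of ?h borel borel B] B by simp
  have "emeasure lborel B = emeasure (density (distr lborel borel ?h) (\<lambda>_. ennreal (\<bar>t\<bar> ^ DIM(real^'n)))) B"
    unfolding h_eq using t by (subst lborel_affine[of t "x - t *\<^sub>R x"]) auto
  also have "\<dots> = ennreal (t ^ CARD('n)) * emeasure (distr lborel borel ?h) B"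
    using B t by (simp add: emeasure_density_const)
  also have "emeasure (distr lborel borel ?h) B = emeasure lborel (?h -` B)"
    using B by (subst emeasure_distr) auto
  finally have "ennreal ((1 / t) ^ CARD('n)) * emeasure lborel B =
      ennreal ((1 / t) ^ CARD('n)) * (ennreal (t ^ CARD('n)) * emeasure lborel (?h -` B))" by simp
  also have "\<dots> = emeasure lborel (?h -` B)"
    using t by (simp add: mult.assoc[symmetric] ennreal_mult[symmetric] power_divide)
  finally show "emeasure lborel (?h -` B) \<le> ennreal ((1 / t) ^ CARD('n)) * emeasure lborel B" by simp
qed simp

lemma homothety_bounded_face_measure: "homothety_bounded (CARD('n) - 1) (face_measure :: (real^'n) measure)"
  unfolding homothety_bounded_def face_measure_def
proof (intro conjI allI ballI impI sets_hausdorff_measure)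
  fix x :: "real^'n" and t :: real and B :: "(real^'n) set"
  assume B: "B \<in> sets borel" and t: "0 < t"
  let ?h = "\<lambda>y. x + t *\<^sub>R (y - x)" and ?f = "\<lambda>z. x + (1 / t) *\<^sub>R (z - x)" and ?k = "CARD('n) - 1"
  have hB: "?h -` B \<in> sets borel"
    using measurable_sets[of ?h borel borel B] B by simp
  have "?h -` B = ?f ` B"
  proof (intro set_eqI iffI)
    fix y assume "y \<in> ?h -` B"
    then show "y \<in> ?f ` B" using t by (intro image_eqI[of _ _ "?h y"]) auto
  qed (use t in auto)
  moreover have "hausdorff_outer ?k (?f ` B) \<le> ennreal ((1 / t) ^ ?k) * hausdorff_outer ?k B"
  proof (rule hausdorff_outer_Lipschitz_image)
    show "dist (?f y) (?f z) \<le> 1 / t * dist y z" for y z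
    proof -
      have "?f y - ?f z = (1 / t) *\<^sub>R (y - z)" by (simp add: algebra_simps)
      then show ?thesis using t by (simp add: dist_norm)
    qed
  qed (use t in simp)
  ultimately show "emeasure (hausdorff_measure ?k) (?h -` B) \<le> ennreal ((1 / t) ^ ?k) * emeasure (hausdorff_measure ?k) B"
    using B hB by (simp add: emeasure_hausdorff_measure)
qed

text \<open>
  Swept along the unit segment in the normal direction, the disc of radius \<open>r\<close> in \<open>E\<close> covers a
  ball.
\<close>

lemma face_measure_pos_finite:
  fixes E :: "(real^'n) set"
  assumes E: "compact E" and a: "norm a = 1" "\<And>x. x \<in> E \<Longrightarrow> a \<bullet> (x - m) = 0"
    and r: "0 < r" "\<And>x. norm (x - m) < r \<Longrightarrow> a \<bullet> (x - m) = 0 \<Longrightarrow> x \<in> E"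
  shows "0 < measure face_measure E" "emeasure face_measure E = ennreal (measure face_measure E)"
proof -
  let ?k = "CARD('n) - 1"
  have Eb: "E \<in> sets borel" using E by (simp add: compact_imp_closed borel_closed)
  have eq: "emeasure face_measure E = hausdorff_outer ?k E"
    unfolding face_measure_def by (rule emeasure_hausdorff_measure[OF Eb])
  have "hausdorff_outer ?k E < top"
  proof (rule hausdorff_outer_hyperplane_finite)
    show "a \<noteq> 0" using a(1) by auto
    show "a \<bullet> x = a \<bullet> m" if "x \<in> E" for x using a(2)[OF that] by (simp add: inner_diff_right)
  qed (use E compact_imp_bounded in blast)
  then show fin: "emeasure face_measure E = ennreal (measure face_measure E)"
    using eq by (intro emeasure_eq_ennreal_measure) auto
  define q where "q = min r 1 / 4"
  have q: "0 < q" "2 * q < r" "2 * q \<le> 1" using r(1) by (auto simp: q_def)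
  have "0 < hausdorff_outer ?k E"
  proof (rule hausdorff_outer_pos[OF a(1) q(1)])
    fix x assume x: "x \<in> ball (m + q *\<^sub>R a) q"
    define t where "t = a \<bullet> (x - m)"
    have aa: "a \<bullet> a = 1" using a(1) by (simp add: dot_square_norm)
    have xa: "norm (x - (m + q *\<^sub>R a)) < q" using x by (simp add: dist_norm norm_minus_commute)
    have "t - q = a \<bullet> (x - (m + q *\<^sub>R a))" by (simp add: t_def inner_diff_right inner_add_right aa)
    then have "\<bar>t - q\<bar> < q" using Cauchy_Schwarz_ineq2[of a "x - (m + q *\<^sub>R a)"] a(1) xa by simp
    then have t: "0 \<le> t" "t \<le> 1" using q by auto
    define y where "y = x - t *\<^sub>R a"
    have ay: "a \<bullet> (y - m) = 0" by (simp add: y_def t_def inner_diff_right aa)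
    have "norm (y - m) < r"
    proof -
      have ym: "y - m = (x - (m + q *\<^sub>R a)) - (t - q) *\<^sub>R a" by (simp add: y_def algebra_simps)
      have "norm (y - m) \<le> norm (x - (m + q *\<^sub>R a)) + norm ((t - q) *\<^sub>R a)"
        unfolding ym by (rule norm_triangle_ineq4)
      also have "norm ((t - q) *\<^sub>R a) = \<bar>t - q\<bar>" using a(1) by simp
      finally show ?thesis using xa \<open>\<bar>t - q\<bar> < q\<close> q by simp
    qed
    then have "y \<in> E" using r(2) ay by blast
    then show "\<exists>y\<in>E. \<exists>t\<in>{0..1}. x = y + t *\<^sub>R a" using t by (intro bexI[of _ y] bexI[of _ t]) (auto simp: y_def)
  qed
  then have "ennreal (measure face_measure E) \<noteq> 0" unfolding fin[symmetric] eq by simp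
  then have "measure face_measure E \<noteq> 0" by auto
  then show "0 < measure face_measure E" using measure_nonneg[of face_measure E] by linarith
qed

lemma polynomial_continuous: "p \<in> polynomials_on l UNIV \<Longrightarrow> continuous_on S p"
  by (rule elementary_smooth_continuous[OF polynomial_elementary_smooth])

lemma polynomial_square_integrable:
  fixes \<mu> :: "(real^'n) measure"
  assumes \<mu>: "sets \<mu> = sets borel" and K: "compact K" "emeasure \<mu> K = ennreal M"
    and p: "p \<in> polynomials_on l UNIV"
  shows "integrable \<mu> (\<lambda>y. indicator K y * (p y)\<^sup>2)"
proof -
  have Kb: "K \<in> sets borel" using K(1) by (simp add: compact_imp_closed borel_closed)
  have "bounded (p ` K)"
    by (intro compact_imp_bounded compact_continuous_image polynomial_continuous[OF p] K(1))
  then obtain B where B: "\<And>y. y \<in> K \<Longrightarrow> \<bar>p y\<bar> \<le> B" by (auto simp: bounded_iff)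
  show ?thesis
  proof (rule Bochner_Integration.integrable_bound)
    show "integrable \<mu> (\<lambda>y. B\<^sup>2 * indicator K y)"
      using K Kb \<mu> by (intro integrable_mult_right integrable_real_indicator) auto
    have [measurable]: "p \<in> borel_measurable borel" "K \<in> sets borel"
      using Kb by (auto intro: borel_measurable_continuous_onI polynomial_continuous[OF p])
    have "(\<lambda>y. indicator K y * (p y)\<^sup>2) \<in> borel_measurable borel" by measurable
    then show "(\<lambda>y. indicator K y * (p y)\<^sup>2) \<in> borel_measurable \<mu>"
      by (simp add: measurable_cong_sets[OF \<mu> refl])
    show "AE y in \<mu>. norm (indicator K y * (p y)\<^sup>2) \<le> norm (B\<^sup>2 * indicator K y)"
    proof (rule AE_I2)
      fix y
      have "\<bar>p y\<bar>\<^sup>2 \<le> B\<^sup>2" if "y \<in> K" using B[OF that] by (intro power_mono) auto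
      then show "norm (indicator K y * (p y)\<^sup>2) \<le> norm (B\<^sup>2 * indicator K y)" by (simp add: indicator_def)
    qed
  qed
qed

lemma polynomial_point_value_bound_real:
  fixes l k :: nat
  obtains C where "0 \<le> C" "\<And>p \<mu> K x M. p \<in> polynomials_on l (UNIV :: (real^'n) set) \<Longrightarrow>
     homothety_bounded k \<mu> \<Longrightarrow> compact K \<Longrightarrow> convex K \<Longrightarrow> x \<in> K \<Longrightarrow> 0 \<le> M \<Longrightarrow> emeasure \<mu> K = ennreal M \<Longrightarrow>
     (p x)\<^sup>2 * M \<le> C * (\<integral>y. indicator K y * (p y)\<^sup>2 \<partial>\<mu>)"
proof -
  obtain C where C: "0 \<le> C" "\<And>p \<mu> K x. p \<in> polynomials_on l (UNIV :: (real^'n) set) \<Longrightarrow>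
     homothety_bounded k \<mu> \<Longrightarrow> convex K \<Longrightarrow> K \<in> sets borel \<Longrightarrow> x \<in> K \<Longrightarrow>
     ennreal ((p x)\<^sup>2) * emeasure \<mu> K \<le> ennreal C * (\<integral>\<^sup>+y. indicator K y * ennreal ((p y)\<^sup>2) \<partial>\<mu>)"
    using polynomial_point_value_bound[of l k] by blast
  show ?thesis
  proof (rule that[OF C(1)])
    fix p \<mu> and K :: "(real^'n) set" and x M
    assume p: "p \<in> polynomials_on l (UNIV :: (real^'n) set)" and \<mu>: "homothety_bounded k \<mu>"
      and K: "compact K" "convex K" "x \<in> K" and M: "0 \<le> M" "emeasure \<mu> K = ennreal M"
    have sets: "sets \<mu> = sets borel" using \<mu> by (simp add: homothety_bounded_def)
    let ?I = "\<integral>y. indicator K y * (p y)\<^sup>2 \<partial>\<mu>"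
    have I0: "0 \<le> ?I" by (intro integral_nonneg_AE) auto
    have "ennreal ((p x)\<^sup>2 * M) = ennreal ((p x)\<^sup>2) * emeasure \<mu> K" using M by (simp add: ennreal_mult)
    also have "\<dots> \<le> ennreal C * (\<integral>\<^sup>+y. indicator K y * ennreal ((p y)\<^sup>2) \<partial>\<mu>)"
      using K by (intro C(2)[OF p \<mu>]) (auto simp: compact_imp_closed borel_closed)
    also have "(\<integral>\<^sup>+y. indicator K y * ennreal ((p y)\<^sup>2) \<partial>\<mu>) = (\<integral>\<^sup>+y. ennreal (indicator K y * (p y)\<^sup>2) \<partial>\<mu>)"
      by (intro nn_integral_cong) (simp add: indicator_def)
    also have "\<dots> = ennreal ?I"
      using polynomial_square_integrable[OF sets K(1) M(2) p] by (intro nn_integral_eq_integral) auto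
    also have "ennreal C * ennreal ?I = ennreal (C * ?I)" using C(1) I0 by (simp add: ennreal_mult)
    finally show "(p x)\<^sup>2 * M \<le> C * ?I" using C(1) I0 by (simp add: ennreal_le_iff)
  qed
qed

section \<open>Residuals on two simplices with a common facet\<close>

lemma grad_add_const:
  assumes "p differentiable (at x)"
  shows "grad (\<lambda>y. p y + c) x = grad p x"
  using has_derivative_add_const[OF has_derivative_grad[OF assms], of c] by (rule grad_unique)

lemma grad_diff:
  assumes "p differentiable (at x)" "q differentiable (at x)"
  shows "grad (\<lambda>y. p y - q y) x = grad p x - grad q x"
  using has_derivative_diff[OF has_derivative_grad[OF assms(1)] has_derivative_grad[OF assms(2)]]
  by (intro grad_unique) (simp add: inner_diff_left)

lemma loc_L2_vec_grad: "f \<in> elementary_smooth \<Longrightarrow> loc_L2_vec (grad f)"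
  using elementary_smooth_deriv[of f]
  by (auto simp: loc_L2_vec_def intro!: loc_L2_continuous elementary_smooth_continuous)

lemma norm_sq_on_add_le:
  assumes "loc_L2 f" "loc_L2 g" "A \<in> sets borel" "bounded A"
  shows "norm_sq_on A (\<lambda>x. f x + g x) \<le> 2 * norm_sq_on A f + 2 * norm_sq_on A g"
proof -
  have eq: "norm_sq_on A h = (\<integral>x. (indicator A x * h x)\<^sup>2 \<partial>lborel)" for h
    unfolding norm_sq_on_def by (intro Bochner_Integration.integral_cong) (auto simp: indicator_def)
  have "norm_sq_on A (\<lambda>x. f x + g x) = (\<integral>x. (indicator A x * f x + indicator A x * g x)\<^sup>2 \<partial>lborel)"
    by (simp only: eq distrib_left)
  also have "\<dots> \<le> 2 * norm_sq_on A f + 2 * norm_sq_on A g"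
    unfolding eq using assms by (intro L2_sum_square_le loc_L2_cut)
  finally show ?thesis .
qed

lemma grad_sq_on_add_le:
  assumes "loc_L2_vec f" "loc_L2_vec g" "A \<in> sets borel" "bounded A"
  shows "grad_sq_on A (\<lambda>x. f x + g x) \<le> 2 * grad_sq_on A f + 2 * grad_sq_on A g"
proof -
  have sum: "loc_L2_vec (\<lambda>x. f x + g x)" using assms by (simp add: loc_L2_vec_def loc_L2_add)
  have "grad_sq_on A (\<lambda>x. f x + g x) \<le>
      (\<integral>x. 2 * (indicator A x * (norm (f x))\<^sup>2) + 2 * (indicator A x * (norm (g x))\<^sup>2) \<partial>lborel)"
    unfolding grad_sq_on_def
  proof (rule integral_mono)
    show "integrable lborel (\<lambda>x. indicator A x * (norm (f x + g x))\<^sup>2)"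
      by (rule grad_sq_on_integrable[OF sum assms(3,4)])
    show "integrable lborel (\<lambda>x. 2 * (indicator A x * (norm (f x))\<^sup>2) + 2 * (indicator A x * (norm (g x))\<^sup>2))"
      using grad_sq_on_integrable[OF assms(1,3,4)] grad_sq_on_integrable[OF assms(2,3,4)] by simp
    fix x
    have "(norm (f x + g x))\<^sup>2 \<le> (norm (f x) + norm (g x))\<^sup>2" by (intro power_mono norm_triangle_ineq) auto
    also have "\<dots> \<le> 2 * (norm (f x))\<^sup>2 + 2 * (norm (g x))\<^sup>2"
      using power2_diff_le[of "norm (f x)" "- norm (g x)"] by simp
    finally show "indicator A x * (norm (f x + g x))\<^sup>2 \<le>
        2 * (indicator A x * (norm (f x))\<^sup>2) + 2 * (indicator A x * (norm (g x))\<^sup>2)"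
      by (simp add: indicator_def)
  qed
  also have "\<dots> = 2 * grad_sq_on A f + 2 * grad_sq_on A g"
    unfolding grad_sq_on_def
    using grad_sq_on_integrable[OF assms(1,3,4)] grad_sq_on_integrable[OF assms(2,3,4)] by simp
  finally show ?thesis .
qed

lemma norm_sq_on_le_const:
  assumes f: "loc_L2 f" and A: "A \<in> sets borel" "bounded A" and B: "\<And>x. x \<in> A \<Longrightarrow> (f x)\<^sup>2 \<le> B"
  shows "norm_sq_on A f \<le> measure lborel A * B"
proof -
  have "norm_sq_on A f \<le> (\<integral>x. B * indicator A x \<partial>lborel)"
    unfolding norm_sq_on_def
    using A emeasure_bounded_finite[OF A(2)] B
    by (intro integral_mono norm_sq_on_integrable f integrable_mult_right integrable_real_indicator)
      (auto simp: indicator_def)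
  then show ?thesis using A by (simp add: mult.commute)
qed

lemma grad_sq_on_le_const:
  assumes g: "loc_L2_vec g" and A: "A \<in> sets borel" "bounded A" and B: "\<And>x. x \<in> A \<Longrightarrow> (norm (g x))\<^sup>2 \<le> B"
  shows "grad_sq_on A g \<le> measure lborel A * B"
proof -
  have "grad_sq_on A g \<le> (\<integral>x. B * indicator A x \<partial>lborel)"
    unfolding grad_sq_on_def
    using A emeasure_bounded_finite[OF A(2)] B
    by (intro integral_mono grad_sq_on_integrable g integrable_mult_right integrable_real_indicator)
      (auto simp: indicator_def)
  then show ?thesis using A by (simp add: mult.commute)
qed

lemma energy_norm_nonneg: "0 \<le> \<epsilon> \<Longrightarrow> 0 \<le> energy_norm \<epsilon> A v"
  by (simp add: energy_norm_def)

lemma is_best_approx_le: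
  assumes "is_best_approx \<epsilon> A V u P" "Q \<in> V" "0 \<le> \<epsilon>"
  shows "(energy_norm \<epsilon> A (\<lambda>x. u x - P x))\<^sup>2 \<le> (energy_norm \<epsilon> A (\<lambda>x. u x - Q x))\<^sup>2"
proof (rule power_mono)
  have "bdd_below ((\<lambda>Q. energy_norm \<epsilon> A (\<lambda>x. u x - Q x)) ` V)"
    by (intro bdd_belowI[of _ 0]) (use energy_norm_nonneg[OF assms(3)] in auto)
  then show "energy_norm \<epsilon> A (\<lambda>x. u x - P x) \<le> energy_norm \<epsilon> A (\<lambda>x. u x - Q x)"
    using assms(1,2) unfolding is_best_approx_def by (auto intro: cINF_lower)
qed (rule energy_norm_nonneg[OF assms(3)])

text \<open>
  The common facet is described by what the estimates use of it: it lies in the plane through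
  \<open>m\<close> with unit normal \<open>a\<close>, the simplices lie on different sides of this plane, and the two half
  balls of radius \<open>r\<close> around \<open>m\<close> are contained in them.
\<close>

locale facing_pair =
  fixes K1 K2 :: "(real^'n) set" and a m :: "real^'n" and r :: real
  assumes simplex: "int CARD('n) simplex K1" "int CARD('n) simplex K2"
    and unit: "norm a = 1" and centre: "m \<in> K1 \<inter> K2"
    and side: "\<And>x. x \<in> K1 \<Longrightarrow> 0 \<le> a \<bullet> (x - m)" "\<And>x. x \<in> K2 \<Longrightarrow> a \<bullet> (x - m) \<le> 0"
    and r_pos: "0 < r"
    and half_ball: "\<And>x. norm (x - m) < r \<Longrightarrow> 0 \<le> a \<bullet> (x - m) \<Longrightarrow> x \<in> K1"
      "\<And>x. norm (x - m) < r \<Longrightarrow> a \<bullet> (x - m) \<le> 0 \<Longrightarrow> x \<in> K2"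
begin

lemma unit_inner: "a \<bullet> a = 1" and unit_nonzero: "a \<noteq> 0"
  using unit by (auto simp: dot_square_norm)

lemma K1_facts: "compact K1" "convex K1" "K1 \<in> sets borel" "bounded K1"
  using simplex_basic[OF simplex(1)] by (auto simp: compact_imp_closed borel_closed compact_imp_bounded)

lemma K2_facts: "compact K2" "convex K2" "K2 \<in> sets borel" "bounded K2"
  using simplex_basic[OF simplex(2)] by (auto simp: compact_imp_closed borel_closed compact_imp_bounded)

lemma face_plane: "x \<in> K1 \<inter> K2 \<Longrightarrow> a \<bullet> (x - m) = 0"
  using side[of x] by fastforce

lemma face_disc: "norm (x - m) < r \<Longrightarrow> a \<bullet> (x - m) = 0 \<Longrightarrow> x \<in> K1 \<inter> K2"
  using half_ball[of x] by auto

text \<open>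
  The facet contains a disc around \<open>m\<close>, from which the difference extrapolates to the plane.
\<close>

lemma polynomials_agree_on_plane:
  assumes p: "p \<in> polynomials_on l UNIV" "q \<in> polynomials_on l UNIV"
    and eq: "\<And>x. x \<in> K1 \<inter> K2 \<Longrightarrow> p x = q x" and x: "a \<bullet> (x - m) = 0"
  shows "p x = q x"
proof -
  define s where "s = r / (2 * (norm (x - m) + 1))"
  have s: "0 < s" using r_pos by (auto simp: s_def intro!: divide_pos_pos add_nonneg_pos)
  have "s * norm (x - m) < r"
  proof -
    have "s * norm (x - m) \<le> s * (norm (x - m) + 1)" using s by simp
    also have "\<dots> = r / 2" unfolding s_def using norm_ge_zero[of "x - m"] by (simp add: field_simps add_nonneg_eq_0_iff)
    finally show ?thesis using r_pos by simp
  qed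
  obtain C where C: "\<And>d y z B. d \<in> polynomials_on l (UNIV :: (real^'n) set) \<Longrightarrow>
     (\<forall>t\<in>{0..s}. (d (y + t *\<^sub>R (z - y)))\<^sup>2 \<le> B) \<Longrightarrow> (d z)\<^sup>2 \<le> C * B"
    using polynomial_extrapolation[OF s, of l] by blast
  have "(p x - q x)\<^sup>2 \<le> C * 0"
  proof (rule C[OF polynomial_diff[OF p], of m], intro ballI)
    fix t assume t: "t \<in> {0..s}"
    have "norm (m + t *\<^sub>R (x - m) - m) \<le> s * norm (x - m)" using t by (simp add: mult_right_mono)
    then have "m + t *\<^sub>R (x - m) \<in> K1 \<inter> K2"
      using \<open>s * norm (x - m) < r\<close> x by (intro face_disc) auto
    then show "(p (m + t *\<^sub>R (x - m)) - q (m + t *\<^sub>R (x - m)))\<^sup>2 \<le> 0" using eq by simp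
  qed
  then show ?thesis by simp
qed

lemma union_interior: "AE x in lborel. x \<in> K1 \<union> K2 \<longrightarrow> x \<in> interior (K1 \<union> K2)"
  using simplex_basic(4)[OF simplex(1)] simplex_basic(4)[OF simplex(2)]
proof eventually_elim
  case (elim x)
  then show ?case using interior_mono[of K1 "K1 \<union> K2"] interior_mono[of K2 "K1 \<union> K2"] by auto
qed

lemma ball_in_union: "ball m r \<subseteq> interior (K1 \<union> K2)"
proof (rule interior_maximal)
  show "ball m r \<subseteq> K1 \<union> K2"
  proof
    fix x assume "x \<in> ball m r"
    then have "norm (x - m) < r" by (simp add: dist_norm norm_minus_commute)
    then show "x \<in> K1 \<union> K2" using half_ball[of x] by (cases "0 \<le> a \<bullet> (x - m)") auto
  qed
qed simp

definition plane_proj :: "real^'n \<Rightarrow> real^'n" where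
  "plane_proj x = x - (a \<bullet> (x - m)) *\<^sub>R a"

lemma plane_proj_plane: "a \<bullet> (plane_proj x - m) = 0"
  by (simp add: plane_proj_def inner_diff_right unit_inner)

lemma plane_proj_fix: "a \<bullet> (x - m) = 0 \<Longrightarrow> plane_proj x = x"
  by (simp add: plane_proj_def)

lemma plane_proj_shift: "plane_proj (x + t *\<^sub>R a) = plane_proj x"
proof -
  have "a \<bullet> (x + t *\<^sub>R a - m) = a \<bullet> (x - m) + t"
    by (simp add: inner_diff_right inner_add_right unit_inner)
  then show ?thesis by (simp add: plane_proj_def algebra_simps)
qed

lemma plane_proj_norm: "norm (plane_proj x - m) \<le> norm (x - m)"
proof -
  let ?v = "x - m" and ?w = "plane_proj x - m"
  have w: "?w = ?v - (a \<bullet> ?v) *\<^sub>R a" by (simp add: plane_proj_def)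
  have "(v - (a \<bullet> v) *\<^sub>R a) \<bullet> (v - (a \<bullet> v) *\<^sub>R a) = v \<bullet> v - (a \<bullet> v)\<^sup>2" for v
    by (simp add: inner_diff_left inner_diff_right inner_commute[of v a] unit_inner power2_eq_square)
  then have "?w \<bullet> ?w = ?v \<bullet> ?v - (a \<bullet> ?v)\<^sup>2" unfolding w .
  then have "(norm ?w)\<^sup>2 \<le> (norm ?v)\<^sup>2" by (simp add: power2_norm_eq_inner)
  then show ?thesis by (rule power2_le_imp_le) simp
qed

lemma polynomial_plane_proj:
  assumes "q \<in> polynomials_on l UNIV"
  shows "(\<lambda>x. q (plane_proj x)) \<in> polynomials_on l UNIV"
proof (rule polynomial_compose_affine[OF assms])
  fix x i
  show "plane_proj x $ i = (axis i 1 - (a $ i) *\<^sub>R a) \<bullet> x + (a \<bullet> m) * a $ i"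
    by (simp add: plane_proj_def inner_diff_left inner_diff_right inner_axis' algebra_simps)
qed

lemma grad_plane_proj_orthogonal:
  assumes "q \<in> polynomials_on l UNIV"
  shows "a \<bullet> grad (\<lambda>x. q (plane_proj x)) x = 0"
proof -
  let ?J = "\<lambda>x. q (plane_proj x)"
  have "(?J has_derivative (\<bullet>) (grad ?J x)) (at x)"
    by (intro has_derivative_grad elementary_smooth_differentiable
        polynomial_elementary_smooth[OF polynomial_plane_proj[OF assms]])
  from directional_derivative_tendsto[OF this, of a]
  have "((\<lambda>t::real. 0) \<longlongrightarrow> grad ?J x \<bullet> a) (at 0)" by (simp add: plane_proj_shift)
  then have "grad ?J x \<bullet> a = 0" using tendsto_const tendsto_unique[OF at_neq_bot] by blast
  then show ?thesis by (simp add: inner_commute)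
qed

end

text \<open>
  Here \<open>u'\<close> and \<open>g\<close> are Borel representatives of \<open>u\<close> and of its weak gradient.
\<close>

locale facing_pair_H1 = facing_pair K1 K2 a m r
  for K1 K2 :: "(real^'n) set" and a m r +
  fixes u u' :: "real^'n \<Rightarrow> real" and g :: "real^'n \<Rightarrow> real^'n" and \<epsilon> :: real
  assumes eps: "0 < \<epsilon>" and u': "loc_L2 u'" and g: "loc_L2_vec g"
    and wg: "wgrad (interior (K1 \<union> K2)) u' g"
    and u_eq: "AE x in lborel. x \<in> K1 \<union> K2 \<longrightarrow> u x = u' x"
begin

text \<open>
  The squared energy norm of \<open>u - p\<close> on \<open>K\<close> for smooth \<open>p\<close>; see lemma \<open>energy_norm_local\<close>.
\<close>

definition local_energy :: "(real^'n) set \<Rightarrow> (real^'n \<Rightarrow> real) \<Rightarrow> real" where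
  "local_energy K p = norm_sq_on K (\<lambda>x. u' x - p x) + \<epsilon> * grad_sq_on K (\<lambda>x. g x - grad p x)"

lemma local_energy_parts:
  "norm_sq_on K (\<lambda>x. u' x - p x) \<le> local_energy K p"
  "\<epsilon> * grad_sq_on K (\<lambda>x. g x - grad p x) \<le> local_energy K p" "0 \<le> local_energy K p"
  using eps by (auto simp: local_energy_def norm_sq_on_nonneg grad_sq_on_nonneg)

lemma residual_L2:
  assumes "p \<in> elementary_smooth"
  shows "loc_L2 (\<lambda>x. u' x - p x)" "loc_L2_vec (\<lambda>x. g x - grad p x)"
    "wgrad (interior (K1 \<union> K2)) (\<lambda>x. u' x - p x) (\<lambda>x. g x - grad p x)"
  using assms u' g wg loc_L2_vec_grad[OF assms] loc_L2_continuous[OF elementary_smooth_continuous[OF assms]] wgrad_smooth[OF assms]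
  by (auto intro!: loc_L2_diff loc_L2_vec_diff wgrad_diff)

lemma energy_norm_local:
  assumes K: "int CARD('n) simplex K" "K \<subseteq> K1 \<union> K2" and p: "p \<in> elementary_smooth"
    and P: "\<And>x. x \<in> K \<Longrightarrow> P x = p x"
  shows "(energy_norm \<epsilon> K (\<lambda>x. u x - P x))\<^sup>2 = local_energy K p"
  unfolding local_energy_def
proof (rule energy_norm_sq)
  show "K \<in> sets borel" "bounded K" "AE x in lborel. x \<in> K \<longrightarrow> x \<in> interior K"
    using simplex_basic[OF K(1)] by (auto simp: compact_imp_closed borel_closed compact_imp_bounded)
  show "AE x in lborel. x \<in> K \<longrightarrow> u x - P x = u' x - p x"
    using u_eq by eventually_elim (use K(2) P in auto)
  show "wgrad (interior K) (\<lambda>x. u' x - p x) (\<lambda>x. g x - grad p x)"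
    using residual_L2(3)[OF p] interior_mono[OF K(2)] by (rule wgrad_mono)
qed (use residual_L2[OF p] eps in auto)

text \<open>
  Since \<open>p1\<close> and \<open>p2\<close> agree on the plane, the piecewise gradient is the weak gradient of the
  glued function on the union, so the energy is the sum over the two simplices.
\<close>

lemma energy_norm_union:
  assumes p: "p1 \<in> elementary_smooth" "p2 \<in> elementary_smooth"
    and agree: "\<And>x. a \<bullet> (x - m) = 0 \<Longrightarrow> p1 x = p2 x"
    and P: "\<And>x. x \<in> K1 \<Longrightarrow> P x = p1 x" "\<And>x. x \<in> K2 \<Longrightarrow> P x = p2 x"
  shows "(energy_norm \<epsilon> (K1 \<union> K2) (\<lambda>x. u x - P x))\<^sup>2 = local_energy K1 p1 + local_energy K2 p2"
proof -
  let ?\<omega> = "K1 \<union> K2"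
  define F where "F x = (if 0 \<le> a \<bullet> (x - m) then p1 x else p2 x)" for x
  define G where "G x = (if 0 \<le> a \<bullet> (x - m) then grad p1 x else grad p2 x)" for x
  have F: "loc_L2 F" "loc_L2_vec G" "wgrad (interior ?\<omega>) F G"
    unfolding F_def[abs_def] G_def[abs_def]
    using p agree by (auto intro!: loc_L2_piecewise loc_L2_vec_piecewise_grad wgrad_piecewise
        elementary_smooth_continuous unit_nonzero)
  have \<omega>: "?\<omega> \<in> sets borel" "bounded ?\<omega>" using K1_facts K2_facts by auto
  have PF: "P x = F x" if "x \<in> ?\<omega>" for x
    using that P side[of x] agree[of x] by (auto simp: F_def)
  have "(energy_norm \<epsilon> ?\<omega> (\<lambda>x. u x - P x))\<^sup>2 =
      norm_sq_on ?\<omega> (\<lambda>x. u' x - F x) + \<epsilon> * grad_sq_on ?\<omega> (\<lambda>x. g x - G x)"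
  proof (rule energy_norm_sq[OF \<omega> union_interior])
    show "AE x in lborel. x \<in> ?\<omega> \<longrightarrow> u x - P x = u' x - F x"
      using u_eq by eventually_elim (use PF in auto)
  qed (use F u' g wg eps in \<open>auto intro!: loc_L2_diff loc_L2_vec_diff wgrad_diff\<close>)
  also have "norm_sq_on ?\<omega> (\<lambda>x. u' x - F x) =
      norm_sq_on K1 (\<lambda>x. u' x - p1 x) + norm_sq_on K2 (\<lambda>x. u' x - p2 x)"
  proof -
    have int: "integrable lborel (\<lambda>x. indicator K1 x * (u' x - p1 x)\<^sup>2)"
      "integrable lborel (\<lambda>x. indicator K2 x * (u' x - p2 x)\<^sup>2)"
      using K1_facts K2_facts residual_L2(1)[OF p(1)] residual_L2(1)[OF p(2)]
      by (auto intro!: norm_sq_on_integrable)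
    have "norm_sq_on ?\<omega> (\<lambda>x. u' x - F x) =
        (\<integral>x. indicator K1 x * (u' x - p1 x)\<^sup>2 + indicator K2 x * (u' x - p2 x)\<^sup>2 \<partial>lborel)"
      unfolding norm_sq_on_def
    proof (rule integral_cong_AE)
      show "AE x in lborel. indicator ?\<omega> x * (u' x - F x)\<^sup>2 =
          indicator K1 x * (u' x - p1 x)\<^sup>2 + indicator K2 x * (u' x - p2 x)\<^sup>2"
        using AE_not_on_hyperplane[OF unit_nonzero, of m]
        by eventually_elim (use side in \<open>force simp: F_def indicator_def\<close>)
      show "(\<lambda>x. indicator ?\<omega> x * (u' x - F x)\<^sup>2) \<in> borel_measurable lborel"
        using norm_sq_on_integrable[OF loc_L2_diff[OF u' F(1)] \<omega>] by (rule borel_measurable_integrable)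
    qed (use int in auto)
    then show ?thesis unfolding norm_sq_on_def using int by simp
  qed
  also have "grad_sq_on ?\<omega> (\<lambda>x. g x - G x) =
      grad_sq_on K1 (\<lambda>x. g x - grad p1 x) + grad_sq_on K2 (\<lambda>x. g x - grad p2 x)"
  proof -
    have int: "integrable lborel (\<lambda>x. indicator K1 x * (norm (g x - grad p1 x))\<^sup>2)"
      "integrable lborel (\<lambda>x. indicator K2 x * (norm (g x - grad p2 x))\<^sup>2)"
      using K1_facts K2_facts residual_L2(2)[OF p(1)] residual_L2(2)[OF p(2)]
      by (auto intro!: grad_sq_on_integrable)
    have "grad_sq_on ?\<omega> (\<lambda>x. g x - G x) =
        (\<integral>x. indicator K1 x * (norm (g x - grad p1 x))\<^sup>2 + indicator K2 x * (norm (g x - grad p2 x))\<^sup>2 \<partial>lborel)"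
      unfolding grad_sq_on_def
    proof (rule integral_cong_AE)
      show "AE x in lborel. indicator ?\<omega> x * (norm (g x - G x))\<^sup>2 =
          indicator K1 x * (norm (g x - grad p1 x))\<^sup>2 + indicator K2 x * (norm (g x - grad p2 x))\<^sup>2"
        using AE_not_on_hyperplane[OF unit_nonzero, of m]
        by eventually_elim (use side in \<open>force simp: G_def indicator_def\<close>)
      show "(\<lambda>x. indicator ?\<omega> x * (norm (g x - G x))\<^sup>2) \<in> borel_measurable lborel"
        using grad_sq_on_integrable[OF loc_L2_vec_diff[OF g F(2)] \<omega>] by (rule borel_measurable_integrable)
    qed (use int in auto)
    then show ?thesis unfolding grad_sq_on_def using int by simp
  qed
  finally show ?thesis by (simp add: local_energy_def algebra_simps)
qed

end

section \<open>The jump is controlled by the gradients of the residuals\<close>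

lemma volume_le_diameter:
  fixes K :: "(real^'n) set"
  assumes K: "K \<in> sets borel" "bounded K" "K \<noteq> {}" and h: "diameter K \<le> h"
  shows "measure lborel K \<le> unit_ball_vol (real CARD('n)) * h ^ CARD('n)"
proof -
  obtain x where x: "x \<in> K" using K(3) by blast
  have h0: "0 \<le> h" using diameter_ge_0[OF K(2)] h by linarith
  have "K \<subseteq> cball x h"
    using diameter_bounded_bound[OF K(2) x] h by (force intro: order_trans)
  then have "measure lborel K \<le> measure lborel (cball x h)"
    using K emeasure_bounded_finite[OF bounded_cball, of x h] by (intro measure_mono_fmeasurable) (auto simp: fmeasurable_def)
  then show ?thesis using content_cball[OF h0, of x] by simp
qed

lemma volume_ge_inball:
  fixes K :: "(real^'n) set"
  assumes K: "K \<in> sets borel" "bounded K" and s: "0 \<le> s" "cball c s \<subseteq> K"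
  shows "unit_ball_vol (real CARD('n)) * s ^ CARD('n) \<le> measure lborel K"
proof -
  have "measure lborel (cball c s) \<le> measure lborel K"
    using K s emeasure_bounded_finite[OF K(2)] by (intro measure_mono_fmeasurable) (auto simp: fmeasurable_def)
  then show ?thesis using content_cball[OF s(1), of c] by simp
qed

lemma sq_sum3_le: "(x + y + z :: real)\<^sup>2 \<le> 3 * x\<^sup>2 + 3 * y\<^sup>2 + 3 * z\<^sup>2"
proof -
  have "0 \<le> (x - y)\<^sup>2 + (y - z)\<^sup>2 + (x - z)\<^sup>2" by simp
  then show ?thesis by (simp add: power2_eq_square algebra_simps)
qed

context facing_pair
begin

definition half_cball :: "real \<Rightarrow> (real^'n) set" where
  "half_cball s = cball m s \<inter> {x. 0 \<le> a \<bullet> (x - m)}"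

lemma half_cball_facts: "compact (half_cball s)" "convex (half_cball s)" "half_cball s \<in> sets borel" "bounded (half_cball s)"
proof -
  have eq: "{x. 0 \<le> a \<bullet> (x - m)} = {x. a \<bullet> m \<le> a \<bullet> x}" by (simp add: inner_diff_right)
  have cl: "closed {x. 0 \<le> a \<bullet> (x - m)}" and cv: "convex {x. 0 \<le> a \<bullet> (x - m)}"
    unfolding eq using closed_halfspace_ge[of "a \<bullet> m" a] convex_halfspace_ge[of "a \<bullet> m" a] by simp_all
  show c: "compact (half_cball s)" unfolding half_cball_def using cl by (intro compact_Int_closed) auto
  show "convex (half_cball s)" unfolding half_cball_def using cv by (intro convex_Int) auto
  show "half_cball s \<in> sets borel" using c by (simp add: compact_imp_closed borel_closed)
  show "bounded (half_cball s)" using c by (rule compact_imp_bounded)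
qed

lemma half_cball_volume:
  assumes s: "0 < s"
  shows "unit_ball_vol (real CARD('n)) * (s / 2) ^ CARD('n) \<le> measure lborel (half_cball s)"
proof (rule volume_ge_inball[OF half_cball_facts(3,4)])
  show "cball (m + (s / 2) *\<^sub>R a) (s / 2) \<subseteq> half_cball s"
  proof
    fix x assume "x \<in> cball (m + (s / 2) *\<^sub>R a) (s / 2)"
    then have x: "norm (x - (m + (s / 2) *\<^sub>R a)) \<le> s / 2" by (simp add: dist_norm norm_minus_commute)
    have "norm (x - m) \<le> norm (x - (m + (s / 2) *\<^sub>R a)) + norm ((s / 2) *\<^sub>R a)"
      using norm_triangle_ineq[of "x - (m + (s / 2) *\<^sub>R a)" "(s / 2) *\<^sub>R a"] by simp
    then have "norm (x - m) \<le> s" using x s unit by simp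
    moreover have "0 \<le> a \<bullet> (x - m)"
    proof -
      have "\<bar>a \<bullet> (x - (m + (s / 2) *\<^sub>R a))\<bar> \<le> s / 2"
        using Cauchy_Schwarz_ineq2[of a "x - (m + (s / 2) *\<^sub>R a)"] unit x by simp
      moreover have "a \<bullet> (x - (m + (s / 2) *\<^sub>R a)) = a \<bullet> (x - m) - s / 2"
        by (simp add: inner_diff_right inner_add_right unit_inner)
      ultimately show ?thesis by linarith
    qed
    ultimately show "x \<in> half_cball s" by (simp add: half_cball_def dist_norm norm_minus_commute)
  qed
qed (use s in simp)

end

context facing_pair_H1
begin

text \<open>
  Glue \<open>p1\<close> and \<open>p2 - J\<close> along the plane to a function \<open>F\<close> and put \<open>U = u' - F\<close>. The translation
  by \<open>z = - (r / 2) *\<^sub>R a\<close> carries the half ball from \<open>K1\<close> into \<open>K2\<close>, and \<open>J\<close> is constant in the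
  direction of \<open>a\<close>. Hence \<open>J\<close> is the difference \<open>U (x + z) - U x\<close> plus residuals of \<open>p1\<close> at \<open>x\<close>
  and of \<open>p2\<close> at \<open>x + z\<close>. The difference is bounded by the derivative of \<open>U\<close> along \<open>z\<close>, to which
  \<open>J\<close> does not contribute.
\<close>

lemma jump_half_ball:
  assumes p: "p1 \<in> polynomials_on l UNIV" "p2 \<in> polynomials_on l UNIV"
  defines "J \<equiv> \<lambda>x. p2 (plane_proj x) - p1 (plane_proj x)"
  shows "norm_sq_on (half_cball (r / 8)) J \<le>
     3 * ((r / 2)\<^sup>2 * (grad_sq_on K1 (\<lambda>x. g x - grad p1 x) + grad_sq_on K2 (\<lambda>x. g x - grad p2 x))
       + norm_sq_on K1 (\<lambda>x. u' x - p1 x) + norm_sq_on K2 (\<lambda>x. u' x - p2 x))"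
proof -
  define q where "q x = p2 x - J x" for x
  have J: "J \<in> polynomials_on l UNIV"
    unfolding J_def by (intro polynomial_diff polynomial_plane_proj p)
  have qP: "q \<in> polynomials_on l UNIV" unfolding q_def[abs_def] by (intro polynomial_diff p J)
  note sm = polynomial_elementary_smooth[OF p(1)] polynomial_elementary_smooth[OF p(2)]
    polynomial_elementary_smooth[OF J] polynomial_elementary_smooth[OF qP]
  define F where "F x = (if 0 \<le> a \<bullet> (x - m) then p1 x else q x)" for x
  define G where "G x = (if 0 \<le> a \<bullet> (x - m) then grad p1 x else grad q x)" for x
  have F: "loc_L2 F" "loc_L2_vec G" "wgrad (interior (K1 \<union> K2)) F G"
    unfolding F_def[abs_def] G_def[abs_def]
    using sm by (auto intro!: loc_L2_piecewise loc_L2_vec_piecewise_grad wgrad_piecewise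
        elementary_smooth_continuous unit_nonzero simp: q_def J_def plane_proj_fix)
  define U where "U x = u' x - F x" for x
  define H where "H x = g x - G x" for x
  have U: "loc_L2 U" "loc_L2_vec H" "wgrad (ball m r) U H"
    unfolding U_def[abs_def] H_def[abs_def]
    using F u' g wg wgrad_mono[OF _ ball_in_union]
    by (auto intro!: loc_L2_diff loc_L2_vec_diff wgrad_diff)
  define A where "A = ball m (r / 4) \<inter> {x. 0 < a \<bullet> (x - m)}"
  have A: "open A" "bounded A"
    unfolding A_def by (auto intro!: open_Int open_Collect_less continuous_intros intro: bounded_subset[of "ball m (r/4)"])
  have Ab: "A \<in> sets borel" using A by auto
  define z where "z = (- (r / 2)) *\<^sub>R a"
  have nz: "norm z = r / 2" using unit r_pos by (simp add: z_def)
  let ?w1 = "\<lambda>x. u' x - p1 x" and ?w2 = "\<lambda>x. u' x - p2 x"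
  let ?g1 = "\<lambda>x. g x - grad p1 x" and ?g2 = "\<lambda>x. g x - grad p2 x"
  note w1 = residual_L2[OF sm(1)] and w2 = residual_L2[OF sm(2)]
  have in_A: "norm (x - m) < r / 4" "0 < a \<bullet> (x - m)" "a \<bullet> (x - m) < r / 4" if "x \<in> A" for x
  proof -
    show 1: "norm (x - m) < r / 4" "0 < a \<bullet> (x - m)"
      using that by (auto simp: A_def dist_norm norm_minus_commute)
    show "a \<bullet> (x - m) < r / 4" using Cauchy_Schwarz_ineq2[of a "x - m"] unit 1 by simp
  qed
  \<comment> \<open>Starting within \<open>r / 4\<close> of \<open>m\<close>, the translation by a vector of length \<open>r / 2\<close> ends on the
    other side of the plane and stays in the ball of radius \<open>r\<close>.\<close>
  have path: "norm (x + t *\<^sub>R z - m) < r" if "x \<in> A" "0 \<le> t" "t \<le> 1" for x t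
  proof -
    have "norm (x + t *\<^sub>R z - m) \<le> norm (x - m) + norm (t *\<^sub>R z)"
      using norm_triangle_ineq[of "x - m" "t *\<^sub>R z"] by (simp add: algebra_simps)
    moreover have "norm (t *\<^sub>R z) \<le> r / 2" using that r_pos by (simp add: nz mult_left_le_one_le)
    ultimately show ?thesis using in_A(1)[OF that(1)] r_pos by linarith
  qed
  have diffq: "(\<integral>x. indicator A x * (U (x + z) - U x)\<^sup>2 \<partial>lborel) \<le> (\<integral>x. indicator (ball m r) x * (z \<bullet> H x)\<^sup>2 \<partial>lborel)"
    using path by (intro difference_quotient_bound[OF U open_ball bounded_ball A])
      (auto simp: dist_norm norm_minus_commute)
  have int1: "integrable lborel (\<lambda>x. indicator K1 x * (norm (?g1 x))\<^sup>2)"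
    and int2: "integrable lborel (\<lambda>x. indicator K2 x * (norm (?g2 x))\<^sup>2)"
    using K1_facts K2_facts w1 w2 by (auto intro!: grad_sq_on_integrable)
  have "(\<integral>x. indicator (ball m r) x * (z \<bullet> H x)\<^sup>2 \<partial>lborel) \<le>
      (\<integral>x. (r / 2)\<^sup>2 * (indicator K1 x * (norm (?g1 x))\<^sup>2) + (r / 2)\<^sup>2 * (indicator K2 x * (norm (?g2 x))\<^sup>2) \<partial>lborel)"
  proof (rule integral_mono_AE)
    show "integrable lborel (\<lambda>x. indicator (ball m r) x * (z \<bullet> H x)\<^sup>2)"
      by (intro norm_sq_on_integrable loc_L2_inner U) auto
    show "integrable lborel (\<lambda>x. (r / 2)\<^sup>2 * (indicator K1 x * (norm (?g1 x))\<^sup>2) + (r / 2)\<^sup>2 * (indicator K2 x * (norm (?g2 x))\<^sup>2))"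
      using int1 int2 by simp
    have cs: "(z \<bullet> v)\<^sup>2 \<le> (r / 2)\<^sup>2 * (norm v)\<^sup>2" for v
    proof -
      have "\<bar>z \<bullet> v\<bar>\<^sup>2 \<le> (norm z * norm v)\<^sup>2" by (intro power_mono Cauchy_Schwarz_ineq2) auto
      then show ?thesis by (simp only: power2_abs nz power_mult_distrib)
    qed
    show "AE x in lborel. indicator (ball m r) x * (z \<bullet> H x)\<^sup>2 \<le>
        (r / 2)\<^sup>2 * (indicator K1 x * (norm (?g1 x))\<^sup>2) + (r / 2)\<^sup>2 * (indicator K2 x * (norm (?g2 x))\<^sup>2)"
      using AE_not_on_hyperplane[OF unit_nonzero, of m]
    proof eventually_elim
      case (elim x)
      show ?case
      proof (cases "x \<in> ball m r")
        case True
        then have x: "norm (x - m) < r" by (simp add: dist_norm norm_minus_commute)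
        show ?thesis
        proof (cases "0 \<le> a \<bullet> (x - m)")
          case pos: True
          then have "x \<in> K1" using half_ball(1)[OF x] by simp
          then show ?thesis using True pos cs[of "?g1 x"] by (simp add: H_def G_def add_increasing2)
        next
          case neg: False
          then have "x \<in> K2" using half_ball(2)[OF x] by simp
          moreover have "grad q x = grad p2 x - grad J x"
            unfolding q_def[abs_def] using sm by (intro grad_diff elementary_smooth_differentiable)
          moreover have "z \<bullet> grad J x = 0"
            using grad_plane_proj_orthogonal[OF polynomial_diff[OF p(2) p(1)], of x] by (simp add: z_def J_def)
          ultimately have "z \<bullet> H x = z \<bullet> ?g2 x"
            using neg by (simp add: H_def G_def inner_diff_right)
          then show ?thesis using True \<open>x \<in> K2\<close> cs[of "?g2 x"] by (simp add: add_increasing)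
        qed
      qed simp
    qed
  qed
  also have "\<dots> = (r / 2)\<^sup>2 * (grad_sq_on K1 ?g1 + grad_sq_on K2 ?g2)"
    unfolding grad_sq_on_def using int1 int2 by (simp add: distrib_left)
  finally have D: "(\<integral>x. indicator A x * (U (x + z) - U x)\<^sup>2 \<partial>lborel) \<le> (r / 2)\<^sup>2 * (grad_sq_on K1 ?g1 + grad_sq_on K2 ?g2)"
    using diffq by linarith
  have iD: "integrable lborel (\<lambda>x. indicator A x * (U (x + z) - U x)\<^sup>2)"
    by (intro norm_sq_on_integrable loc_L2_diff loc_L2_translate U Ab A)
  have i1: "integrable lborel (\<lambda>x. indicator K1 x * (?w1 x)\<^sup>2)" and i2: "integrable lborel (\<lambda>x. indicator K2 x * (?w2 x)\<^sup>2)"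
    using K1_facts K2_facts w1 w2 by (auto intro!: norm_sq_on_integrable)
  have i2': "integrable lborel (\<lambda>x. indicator K2 (x + z) * (?w2 (x + z))\<^sup>2)"
    by (rule integrable_lborel_translate[OF i2])
  have "norm_sq_on (half_cball (r / 8)) J \<le> (\<integral>x. 3 * (indicator A x * (U (x + z) - U x)\<^sup>2) +
      3 * (indicator K1 x * (?w1 x)\<^sup>2) + 3 * (indicator K2 (x + z) * (?w2 (x + z))\<^sup>2) \<partial>lborel)"
    unfolding norm_sq_on_def
  proof (rule integral_mono_AE)
    show "integrable lborel (\<lambda>x. indicator (half_cball (r / 8)) x * (J x)\<^sup>2)"
      using half_cball_facts sm(3) by (intro norm_sq_on_integrable loc_L2_continuous elementary_smooth_continuous)
    show "integrable lborel (\<lambda>x. 3 * (indicator A x * (U (x + z) - U x)\<^sup>2) +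
      3 * (indicator K1 x * (?w1 x)\<^sup>2) + 3 * (indicator K2 (x + z) * (?w2 (x + z))\<^sup>2))"
      using iD i1 i2' by simp
    show "AE x in lborel. indicator (half_cball (r / 8)) x * (J x)\<^sup>2 \<le> 3 * (indicator A x * (U (x + z) - U x)\<^sup>2) +
      3 * (indicator K1 x * (?w1 x)\<^sup>2) + 3 * (indicator K2 (x + z) * (?w2 (x + z))\<^sup>2)"
      using AE_not_on_hyperplane[OF unit_nonzero, of m]
    proof eventually_elim
      case (elim x)
      show ?case
      proof (cases "x \<in> half_cball (r / 8)")
        case True
        then have xA: "x \<in> A" using elim r_pos by (auto simp: half_cball_def A_def)
        have x1: "x \<in> K1" using in_A[OF xA] r_pos by (intro half_ball(1)) auto
        have "a \<bullet> (x + z - m) = a \<bullet> (x - m) - r / 2"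
          by (simp add: z_def inner_diff_right inner_add_right unit_inner)
        then have neg: "a \<bullet> (x + z - m) < 0" using in_A(3)[OF xA] r_pos by linarith
        have x2: "x + z \<in> K2" using path[OF xA, of 1] neg by (intro half_ball(2)) auto
        have "plane_proj (x + z) = plane_proj x" unfolding z_def by (rule plane_proj_shift)
        then have Jz: "J (x + z) = J x" by (simp add: J_def)
        have "J x = (U (x + z) - U x) + ?w1 x + (- ?w2 (x + z))"
          using neg in_A(2)[OF xA] by (simp add: U_def F_def q_def Jz)
        then have "(J x)\<^sup>2 \<le> 3 * (U (x + z) - U x)\<^sup>2 + 3 * (?w1 x)\<^sup>2 + 3 * (- ?w2 (x + z))\<^sup>2"
          by (simp only: sq_sum3_le)
        then show ?thesis using True xA x1 x2 by (simp only: indicator_simps power2_minus mult_1 simp_thms)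
      qed simp
    qed
  qed
  also have "\<dots> = 3 * (\<integral>x. indicator A x * (U (x + z) - U x)\<^sup>2 \<partial>lborel) + 3 * norm_sq_on K1 ?w1 +
      3 * (\<integral>x. indicator K2 (x + z) * (?w2 (x + z))\<^sup>2 \<partial>lborel)"
    unfolding norm_sq_on_def using iD i1 i2' by simp
  also have "(\<integral>x. indicator K2 (x + z) * (?w2 (x + z))\<^sup>2 \<partial>lborel) = norm_sq_on K2 ?w2"
    unfolding norm_sq_on_def using i2 by (intro integral_lborel_translate[of "\<lambda>x. indicator K2 x * (?w2 x)\<^sup>2"]) auto
  finally show ?thesis using D by simp
qed

text \<open>
  Adding a constant to \<open>p\<close> does not change the gradient part of the energy, so a minimiser of
  the energy cannot be improved in the mean square by a constant.
\<close>

lemma residual_Poincare: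
  assumes K: "int CARD('n) simplex K" "K \<subseteq> K1 \<union> K2" and p: "p \<in> elementary_smooth"
    and best: "\<And>c. local_energy K p \<le> local_energy K (\<lambda>x. p x + c)" and h: "diameter K \<le> h"
  shows "measure lborel K * norm_sq_on K (\<lambda>x. u' x - p x) \<le>
     h\<^sup>2 * (unit_ball_vol (real CARD('n)) * h ^ CARD('n)) * grad_sq_on K (\<lambda>x. g x - grad p x)"
proof -
  let ?w = "\<lambda>x. u' x - p x" and ?g = "\<lambda>x. g x - grad p x" and ?I = "interior K"
  note S = simplex_basic[OF K(1)] and R = residual_L2[OF p]
  have Kb: "K \<in> sets borel" "bounded K" using S by (auto simp: compact_imp_closed borel_closed compact_imp_bounded)
  have Ib: "?I \<in> sets borel" "bounded ?I" using Kb(2) interior_subset bounded_subset by auto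
  have h0: "0 \<le> h" using diameter_ge_0[OF Kb(2)] h by linarith
  have ind: "AE x in lborel. indicator ?I x = (indicator K x :: real)"
    using S(4) by eventually_elim (use interior_subset[of K] in \<open>auto simp: indicator_def\<close>)
  have eqn: "norm_sq_on ?I f = norm_sq_on K f" if f: "loc_L2 f" for f
    unfolding norm_sq_on_def
  proof (rule integral_cong_AE)
    show "(\<lambda>x. indicator ?I x * (f x)\<^sup>2) \<in> borel_measurable lborel" "(\<lambda>x. indicator K x * (f x)\<^sup>2) \<in> borel_measurable lborel"
      using norm_sq_on_integrable[OF f Ib] norm_sq_on_integrable[OF f Kb] by auto
    show "AE x in lborel. indicator ?I x * (f x)\<^sup>2 = indicator K x * (f x)\<^sup>2" using ind by eventually_elim simp
  qed
  have eqg: "grad_sq_on ?I ?g = grad_sq_on K ?g"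
    unfolding grad_sq_on_def
  proof (rule integral_cong_AE)
    show "(\<lambda>x. indicator ?I x * (norm (?g x))\<^sup>2) \<in> borel_measurable lborel" "(\<lambda>x. indicator K x * (norm (?g x))\<^sup>2) \<in> borel_measurable lborel"
      using grad_sq_on_integrable[OF R(2) Ib] grad_sq_on_integrable[OF R(2) Kb] by auto
    show "AE x in lborel. indicator ?I x * (norm (?g x))\<^sup>2 = indicator K x * (norm (?g x))\<^sup>2" using ind by eventually_elim simp
  qed
  have "measure lborel ?I = measure lborel K"
  proof -
    have "measure lborel ?I = norm_sq_on ?I (\<lambda>_. 1)" "measure lborel K = norm_sq_on K (\<lambda>_. 1)"
      using Ib Kb by (auto simp: norm_sq_on_def)
    then show ?thesis using eqn[of "\<lambda>_. 1"] by (simp add: loc_L2_continuous)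
  qed
  moreover have "measure lborel ?I * norm_sq_on ?I ?w \<le> h\<^sup>2 * measure lborel (cball (0::real^'n) h) * grad_sq_on ?I ?g"
  proof (rule Poincare_convex[OF R(1,2)])
    show "wgrad ?I ?w ?g" using R(3) interior_mono[OF K(2)] by (rule wgrad_mono)
    show "norm (y - x) \<le> h" if "x \<in> ?I" "y \<in> ?I" for x y
    proof -
      have "x \<in> K" "y \<in> K" using that interior_subset by auto
      then show ?thesis using diameter_bounded_bound[OF Kb(2), of y x] h by (simp add: dist_norm)
    qed
    show "norm_sq_on ?I ?w \<le> norm_sq_on ?I (\<lambda>x. ?w x - c)" for c
    proof -
      have "grad (\<lambda>y. p y + c) = grad p" by (intro ext grad_add_const elementary_smooth_differentiable p)
      then have "norm_sq_on K ?w \<le> norm_sq_on K (\<lambda>x. u' x - (p x + c))"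
        using best[of c] by (simp add: local_energy_def)
      moreover have "(\<lambda>x. u' x - (p x + c)) = (\<lambda>x. ?w x - c)" by auto
      ultimately show ?thesis
        using eqn[OF R(1)] eqn[OF loc_L2_diff[OF R(1) loc_L2_continuous[OF continuous_on_const]]] by simp
    qed
  qed (use Ib S h0 in \<open>auto intro: convex_interior\<close>)
  ultimately show ?thesis
    using eqn[OF R(1)] eqg content_cball[OF h0, of "0::real^'n"] by simp
qed

end

section \<open>Two-sided estimates for the energy of the residuals\<close>

context facing_pair
begin

lemma face_facts: "compact (K1 \<inter> K2)" "convex (K1 \<inter> K2)" "0 < measure face_measure (K1 \<inter> K2)"
  "emeasure face_measure (K1 \<inter> K2) = ennreal (measure face_measure (K1 \<inter> K2))"
proof -
  show "compact (K1 \<inter> K2)" "convex (K1 \<inter> K2)" using K1_facts K2_facts by (auto intro: compact_Int convex_Int)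
  then show "0 < measure face_measure (K1 \<inter> K2)"
    "emeasure face_measure (K1 \<inter> K2) = ennreal (measure face_measure (K1 \<inter> K2))"
    using face_measure_pos_finite[OF _ unit face_plane r_pos face_disc] by blast+
qed

text \<open>
  For \<open>q = P\<^sub>1 - P\<^sub>2\<close> this is the face term \<open>h\<^sub>E \<parallel>P\<^sub>1 - P\<^sub>2\<parallel>\<^sub>E\<^sup>2\<close>.
\<close>

definition face_jump :: "(real^'n \<Rightarrow> real) \<Rightarrow> real" where
  "face_jump q = min (measure lborel K1) (measure lborel K2) / measure face_measure (K1 \<inter> K2) *
     (\<integral>x. indicator (K1 \<inter> K2) x * (q x)\<^sup>2 \<partial>face_measure)"

lemma face_jump_nonneg: "0 \<le> face_jump q"
  unfolding face_jump_def by (intro mult_nonneg_nonneg divide_nonneg_nonneg) (auto intro!: integral_nonneg_AE)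

end

lemma emeasure_lborel_bounded: "bounded K \<Longrightarrow> emeasure lborel K = ennreal (measure lborel K)"
  using emeasure_bounded_finite[of K] by (intro emeasure_eq_ennreal_measure) auto

context facing_pair_H1
begin

text \<open>
  On the disc of radius \<open>r / 8\<close> around \<open>m\<close> the jump obeys two bounds: \<open>B1\<close> by the face term and
  \<open>B2\<close> by the mean square of \<open>J\<close> over a half ball, hence by the gradients of the residuals.
  Either of them extends to \<open>J\<close> on all of \<open>K2\<close> by extrapolation. The first one estimates the
  values of \<open>J\<close> and the second one its gradient, so that the weight \<open>\<epsilon>\<close> meets only gradients of
  residuals. The inverse estimates for polynomials enter as hypotheses, with constants chosen in
  advance; this shows that the final constant depends on \<open>h / \<rho>\<close>, the dimension and those
  constants only.
\<close>

lemma upper_estimate: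
  fixes h \<rho> CE CP CQ CG :: real
  defines "\<sigma> \<equiv> h / \<rho>" and "N \<equiv> CARD('n)"
  assumes p: "p1 \<in> polynomials_on l UNIV" "p2 \<in> polynomials_on l UNIV"
    and best: "\<And>c. local_energy K1 p1 \<le> local_energy K1 (\<lambda>x. p1 x + c)"
      "\<And>c. local_energy K2 p2 \<le> local_energy K2 (\<lambda>x. p2 x + c)"
    and h: "diameter K1 \<le> h" "diameter K2 \<le> h" and \<rho>: "0 < \<rho>" "\<rho> \<le> h"
    and balls: "cball c1 (\<rho> / 4) \<subseteq> K1" "cball c2 (\<rho> / 4) \<subseteq> K2" and r_eq: "r = \<rho> / (2 * real N)"
    and const_nonneg: "0 \<le> CE" "0 \<le> CP" "0 \<le> CQ" "0 \<le> CG"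
    and ext: "\<And>p x B. p \<in> polynomials_on l (UNIV :: (real^'n) set) \<Longrightarrow>
      (\<forall>t\<in>{0..1 / (16 * real N * \<sigma>)}. (p (m + t *\<^sub>R (x - m)))\<^sup>2 \<le> B) \<Longrightarrow> (p x)\<^sup>2 \<le> CE * B"
    and pv: "\<And>p K x. p \<in> polynomials_on l (UNIV :: (real^'n) set) \<Longrightarrow> compact K \<Longrightarrow> convex K \<Longrightarrow> x \<in> K \<Longrightarrow>
      (p x)\<^sup>2 * measure lborel K \<le> CP * norm_sq_on K p"
    and pvE: "\<And>p x. p \<in> polynomials_on l (UNIV :: (real^'n) set) \<Longrightarrow> x \<in> K1 \<inter> K2 \<Longrightarrow>
      (p x)\<^sup>2 * measure face_measure (K1 \<inter> K2) \<le> CQ * (\<integral>y. indicator (K1 \<inter> K2) y * (p y)\<^sup>2 \<partial>face_measure)"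
    and gr: "\<And>p x B. p \<in> polynomials_on l (UNIV :: (real^'n) set) \<Longrightarrow> x \<in> K2 \<Longrightarrow>
      (\<forall>y\<in>K2. (p y)\<^sup>2 \<le> B) \<Longrightarrow> (norm (grad p x))\<^sup>2 \<le> CG * B / (\<rho> / 4)\<^sup>2"
  shows "local_energy K1 p1 + local_energy K2 (\<lambda>x. p2 x - (p2 (plane_proj x) - p1 (plane_proj x))) \<le>
    (2 + 2 * CE * CQ * (4 * \<sigma>) ^ N + 96 * CG * CE * CP * \<sigma>\<^sup>2 * (1 + (4 * \<sigma>) ^ N) * (32 * real N * \<sigma>) ^ N) *
    (face_jump (\<lambda>x. p2 x - p1 x) + (local_energy K1 p1 + local_energy K2 p2))"
proof -
  let ?q = "\<lambda>x. p2 x - p1 x" and ?E = "K1 \<inter> K2"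
  define J where "J = (\<lambda>x. p2 (plane_proj x) - p1 (plane_proj x))"
  define v where "v = unit_ball_vol (real N)"
  have v: "0 < v" by (simp add: v_def)
  have N: "0 < real N" by (simp add: N_def)
  have h0: "0 < h" using \<rho> by linarith
  have \<sigma>: "1 \<le> \<sigma>" "h = \<sigma> * \<rho>" using \<rho> by (auto simp: \<sigma>_def)
  have qP: "?q \<in> polynomials_on l UNIV" by (intro polynomial_diff p)
  have JP: "J \<in> polynomials_on l UNIV" unfolding J_def by (intro polynomial_diff polynomial_plane_proj p)
  note sm1 = polynomial_elementary_smooth[OF p(1)] and sm2 = polynomial_elementary_smooth[OF p(2)]
    and smJ = polynomial_elementary_smooth[OF JP]
  define V1 where "V1 = measure lborel K1"
  define V2 where "V2 = measure lborel K2"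
  \<comment> \<open>All volumes are compared with the ball of radius \<open>\<rho> / 4\<close>, which both simplices contain.\<close>
  define S where "S = v * (\<rho> / 4) ^ N"
  have S: "0 < S" using v \<rho> by (simp add: S_def)
  have ball_le: "S \<le> V1" "S \<le> V2"
    unfolding S_def v_def V1_def V2_def N_def
    using K1_facts K2_facts \<rho> balls by (auto intro!: volume_ge_inball)
  have nonempty: "K1 \<noteq> {}" "K2 \<noteq> {}" using centre by auto
  have vol_le: "V1 \<le> v * h ^ N" "V2 \<le> v * h ^ N"
    unfolding v_def V1_def V2_def N_def
    using K1_facts K2_facts nonempty h by (auto intro!: volume_le_diameter)
  have hN: "v * h ^ N = (4 * \<sigma>) ^ N * S"
  proof -
    have "h = (4 * \<sigma>) * (\<rho> / 4)" using \<sigma> by simp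
    then have "h ^ N = (4 * \<sigma>) ^ N * (\<rho> / 4) ^ N" by (metis power_mult_distrib)
    then show ?thesis by (simp add: S_def)
  qed
  have V2_min: "V2 \<le> (4 * \<sigma>) ^ N * min V1 V2"
  proof -
    have "V2 \<le> (4 * \<sigma>) ^ N * S" using vol_le hN by simp
    also have "\<dots> \<le> (4 * \<sigma>) ^ N * min V1 V2" using ball_le \<sigma> by (intro mult_left_mono) auto
    finally show ?thesis .
  qed
  define G1 where "G1 = grad_sq_on K1 (\<lambda>x. g x - grad p1 x)"
  define G2 where "G2 = grad_sq_on K2 (\<lambda>x. g x - grad p2 x)"
  define N1 where "N1 = norm_sq_on K1 (\<lambda>x. u' x - p1 x)"
  define N2 where "N2 = norm_sq_on K2 (\<lambda>x. u' x - p2 x)"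
  have G: "0 \<le> G1" "0 \<le> G2" by (simp_all add: G1_def G2_def grad_sq_on_nonneg)
  have N12: "0 \<le> N1" "0 \<le> N2" by (simp_all add: N1_def N2_def norm_sq_on_nonneg)
  \<comment> \<open>The Poincare inequality carries the ratio of \<open>v * h ^ N\<close> to the volume of the simplex.\<close>
  have absorb: "Ni \<le> h\<^sup>2 * (4 * \<sigma>) ^ N * Gi" if "Vi * Ni \<le> h\<^sup>2 * (v * h ^ N) * Gi" "S \<le> Vi" "0 \<le> Ni" for Vi Ni Gi
  proof -
    have "S * Ni \<le> Vi * Ni" using that by (intro mult_right_mono) auto
    also have "\<dots> \<le> S * (h\<^sup>2 * (4 * \<sigma>) ^ N * Gi)" using that(1) by (simp add: hN ac_simps)
    finally show ?thesis using S by simp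
  qed
  have P1: "N1 \<le> h\<^sup>2 * (4 * \<sigma>) ^ N * G1"
    using residual_Poincare[OF simplex(1) Un_upper1 sm1 best(1) h(1)] ball_le(1) N12(1)
    unfolding N1_def G1_def V1_def v_def N_def[symmetric] by (intro absorb) (auto simp: V1_def v_def)
  have P2: "N2 \<le> h\<^sup>2 * (4 * \<sigma>) ^ N * G2"
    using residual_Poincare[OF simplex(2) Un_upper2 sm2 best(2) h(2)] ball_le(2) N12(2)
    unfolding N2_def G2_def V2_def v_def N_def[symmetric] by (intro absorb) (auto simp: V2_def v_def)
  define JA where "JA = norm_sq_on (half_cball (r / 8)) J"
  have JA0: "0 \<le> JA" by (simp add: JA_def norm_sq_on_nonneg)
  have r_h: "r / 2 \<le> h"
  proof -
    have "1 \<le> real N" by (simp add: N_def Suc_le_eq)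
    then have "\<rho> / (2 * real N) \<le> \<rho> / 1" using \<rho> by (intro divide_left_mono) auto
    then show ?thesis using \<rho> r_eq r_pos by simp
  qed
  have JA_le: "JA \<le> 3 * h\<^sup>2 * (1 + (4 * \<sigma>) ^ N) * (G1 + G2)"
  proof -
    have "JA \<le> 3 * ((r / 2)\<^sup>2 * (G1 + G2) + N1 + N2)"
      using jump_half_ball[OF p] by (simp add: JA_def J_def G1_def G2_def N1_def N2_def)
    also have "(r / 2)\<^sup>2 * (G1 + G2) \<le> h\<^sup>2 * (G1 + G2)"
      using r_h r_pos G by (intro mult_right_mono power_mono) auto
    finally have "JA \<le> 3 * (h\<^sup>2 * (G1 + G2) + h\<^sup>2 * (4 * \<sigma>) ^ N * G1 + h\<^sup>2 * (4 * \<sigma>) ^ N * G2)"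
      using P1 P2 by simp
    then show ?thesis by (simp add: algebra_simps)
  qed
  define VA where "VA = measure lborel (half_cball (r / 8))"
  have VA: "v * (r / 16) ^ N \<le> VA"
    using half_cball_volume[of "r / 8"] r_pos by (simp add: VA_def v_def N_def)
  have "0 < v * (r / 16) ^ N" using v r_pos by simp
  then have VA_pos: "0 < VA" using VA by linarith
  have V2_VA: "V2 \<le> (32 * real N * \<sigma>) ^ N * VA"
  proof -
    have "h = (32 * real N * \<sigma>) * (r / 16)" using \<sigma> N by (simp add: r_eq)
    then have "h ^ N = (32 * real N * \<sigma>) ^ N * (r / 16) ^ N" by (metis power_mult_distrib)
    then have "V2 \<le> (32 * real N * \<sigma>) ^ N * (v * (r / 16) ^ N)" using vol_le(2) by (simp add: ac_simps)
    also have "\<dots> \<le> (32 * real N * \<sigma>) ^ N * VA" using VA \<sigma> N by (intro mult_left_mono) auto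
    finally show ?thesis .
  qed
  define IE where "IE = (\<integral>y. indicator ?E y * (?q y)\<^sup>2 \<partial>face_measure)"
  define mE where "mE = measure face_measure ?E"
  have mE: "0 < mE" using face_facts by (simp add: mE_def)
  have IE0: "0 \<le> IE" unfolding IE_def by (intro integral_nonneg_AE) auto
  define B1 where "B1 = CQ * IE / mE"
  define B2 where "B2 = CP * JA / VA"
  have B0: "0 \<le> B1" "0 \<le> B2" using const_nonneg IE0 JA0 mE VA_pos by (auto simp: B1_def B2_def)
  have disc: "(?q y)\<^sup>2 \<le> B1" "(?q y)\<^sup>2 \<le> B2" if y: "norm (y - m) \<le> r / 8" "a \<bullet> (y - m) = 0" for y
  proof -
    have "y \<in> ?E" using y r_pos by (intro face_disc) auto
    then show "(?q y)\<^sup>2 \<le> B1"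
      using pvE[OF qP, of y] mE by (simp add: B1_def IE_def mE_def pos_le_divide_eq)
    have "y \<in> half_cball (r / 8)" using y by (simp add: half_cball_def dist_norm norm_minus_commute)
    then have "(J y)\<^sup>2 * VA \<le> CP * JA"
      using pv[OF JP half_cball_facts(1,2), of y "r / 8"] by (simp add: VA_def JA_def)
    then show "(?q y)\<^sup>2 \<le> B2"
      using VA_pos y(2) by (simp add: B2_def pos_le_divide_eq J_def plane_proj_fix)
  qed
  have J_bound: "(J x)\<^sup>2 \<le> CE * B"
    if x: "x \<in> K2" and B: "\<And>y. norm (y - m) \<le> r / 8 \<Longrightarrow> a \<bullet> (y - m) = 0 \<Longrightarrow> (?q y)\<^sup>2 \<le> B" for x B
  proof -
    have "(?q (plane_proj x))\<^sup>2 \<le> CE * B"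
    proof (rule ext[OF qP], intro ballI)
      \<comment> \<open>With this range of \<open>t\<close> the segment towards a point at distance at most \<open>h\<close> stays
        within \<open>r / 8 = h / (16 * N * \<sigma>)\<close> of \<open>m\<close>.\<close>
      fix t assume t: "t \<in> {0..1 / (16 * real N * \<sigma>)}"
      let ?y = "m + t *\<^sub>R (plane_proj x - m)"
      have "norm (plane_proj x - m) \<le> norm (x - m)" by (rule plane_proj_norm)
      also have "\<dots> \<le> h"
        using diameter_bounded_bound[OF K2_facts(4) x, of m] centre h(2) by (simp add: dist_norm)
      finally have "t * norm (plane_proj x - m) \<le> 1 / (16 * real N * \<sigma>) * h"
        using t h0 \<sigma> N by (intro mult_mono) auto
      also have "\<dots> = r / 8" using \<sigma> N by (simp add: r_eq)
      finally have "norm (?y - m) \<le> r / 8" using t by simp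
      moreover have "a \<bullet> (?y - m) = 0" by (simp add: plane_proj_plane)
      ultimately show "(?q ?y)\<^sup>2 \<le> B" by (rule B)
    qed
    then show ?thesis by (simp add: J_def)
  qed
  define NJ where "NJ = norm_sq_on K2 J"
  define GJ where "GJ = grad_sq_on K2 (grad J)"
  have LJ: "loc_L2 J" "loc_L2_vec (grad J)"
    using smJ by (auto intro: loc_L2_continuous elementary_smooth_continuous loc_L2_vec_grad)
  have NJ_le: "NJ \<le> CE * CQ * (4 * \<sigma>) ^ N * face_jump ?q"
  proof -
    have "NJ \<le> V2 * (CE * B1)"
      unfolding NJ_def V2_def using J_bound[OF _ disc(1)] K2_facts by (intro norm_sq_on_le_const LJ) auto
    also have "\<dots> \<le> ((4 * \<sigma>) ^ N * min V1 V2) * (CE * B1)"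
      using V2_min B0 const_nonneg by (intro mult_right_mono) auto
    also have "\<dots> = CE * CQ * (4 * \<sigma>) ^ N * face_jump ?q"
      by (simp add: B1_def face_jump_def IE_def mE_def V1_def V2_def)
    finally show ?thesis .
  qed
  have GJ_le: "GJ \<le> 48 * CG * CE * CP * \<sigma>\<^sup>2 * (1 + (4 * \<sigma>) ^ N) * (32 * real N * \<sigma>) ^ N * (G1 + G2)"
  proof -
    have "GJ \<le> V2 * (CG * (CE * B2) / (\<rho> / 4)\<^sup>2)"
      unfolding GJ_def V2_def
    proof (rule grad_sq_on_le_const[OF LJ(2) K2_facts(3,4)])
      fix x assume "x \<in> K2"
      then show "(norm (grad J x))\<^sup>2 \<le> CG * (CE * B2) / (\<rho> / 4)\<^sup>2"
        using J_bound[OF _ disc(2)] by (intro gr JP) auto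
    qed
    also have "\<dots> \<le> ((32 * real N * \<sigma>) ^ N * VA) * (CG * (CE * B2) / (\<rho> / 4)\<^sup>2)"
      using V2_VA B0 const_nonneg by (intro mult_right_mono) auto
    also have "\<dots> = (32 * real N * \<sigma>) ^ N * (16 * CG * CE * CP) / \<rho>\<^sup>2 * JA"
      using VA_pos \<rho> by (simp add: B2_def power_divide field_simps)
    also have "\<dots> \<le> (32 * real N * \<sigma>) ^ N * (16 * CG * CE * CP) / \<rho>\<^sup>2 * (3 * h\<^sup>2 * (1 + (4 * \<sigma>) ^ N) * (G1 + G2))"
      using JA_le \<sigma> N const_nonneg by (intro mult_left_mono) auto
    also have "\<dots> = 48 * CG * CE * CP * \<sigma>\<^sup>2 * (1 + (4 * \<sigma>) ^ N) * (32 * real N * \<sigma>) ^ N * (G1 + G2)"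
      using \<rho> by (simp add: \<sigma>(2) power_mult_distrib)
    finally show ?thesis .
  qed
  define e1 where "e1 = local_energy K1 p1"
  define e2 where "e2 = local_energy K2 p2"
  have e: "e1 = N1 + \<epsilon> * G1" "e2 = N2 + \<epsilon> * G2"
    by (simp_all add: e1_def e2_def local_energy_def N1_def N2_def G1_def G2_def)
  have epsG: "\<epsilon> * (G1 + G2) \<le> e1 + e2" using N12 by (simp add: e distrib_left)
  define X where "X = CE * CQ * (4 * \<sigma>) ^ N"
  define Y where "Y = 48 * CG * CE * CP * \<sigma>\<^sup>2 * (1 + (4 * \<sigma>) ^ N) * (32 * real N * \<sigma>) ^ N"
  have XY: "0 \<le> X" "0 \<le> Y"
    unfolding X_def Y_def using const_nonneg \<sigma> N by (auto intro!: mult_nonneg_nonneg)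
  have first: "local_energy K2 (\<lambda>x. p2 x - J x) \<le> 2 * e2 + 2 * (NJ + \<epsilon> * GJ)"
  proof -
    have "(\<lambda>x. u' x - (p2 x - J x)) = (\<lambda>x. (u' x - p2 x) + J x)" by auto
    then have "norm_sq_on K2 (\<lambda>x. u' x - (p2 x - J x)) \<le> 2 * N2 + 2 * NJ"
      unfolding N2_def NJ_def using norm_sq_on_add_le[OF residual_L2(1)[OF sm2] LJ(1) K2_facts(3,4)] by simp
    moreover have "(\<lambda>x. g x - grad (\<lambda>x. p2 x - J x) x) = (\<lambda>x. (g x - grad p2 x) + grad J x)"
      using sm2 smJ by (auto simp: grad_diff elementary_smooth_differentiable)
    then have "grad_sq_on K2 (\<lambda>x. g x - grad (\<lambda>x. p2 x - J x) x) \<le> 2 * G2 + 2 * GJ"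
      unfolding G2_def GJ_def using grad_sq_on_add_le[OF residual_L2(2)[OF sm2] LJ(2) K2_facts(3,4)] by simp
    then have "\<epsilon> * grad_sq_on K2 (\<lambda>x. g x - grad (\<lambda>x. p2 x - J x) x) \<le> \<epsilon> * (2 * G2 + 2 * GJ)"
      using eps by (intro mult_left_mono) auto
    ultimately show ?thesis by (simp add: local_energy_def e algebra_simps)
  qed
  have grad_part: "\<epsilon> * GJ \<le> Y * (e1 + e2)"
  proof -
    have "\<epsilon> * GJ \<le> \<epsilon> * (Y * (G1 + G2))" using GJ_le eps by (intro mult_left_mono) (auto simp: Y_def)
    also have "\<dots> = Y * (\<epsilon> * (G1 + G2))" by (simp only: mult.left_commute)
    also have "\<dots> \<le> Y * (e1 + e2)" using epsG XY(2) by (rule mult_left_mono)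
    finally show ?thesis .
  qed
  have value_part: "NJ \<le> X * face_jump ?q" using NJ_le by (simp add: X_def)
  have main: "local_energy K2 (\<lambda>x. p2 x - J x) \<le> 2 * e2 + 2 * (X * face_jump ?q + Y * (e1 + e2))"
    by (rule order.trans[OF first add_left_mono[OF mult_left_mono[OF add_mono[OF value_part grad_part]]]]) simp
  have e0: "0 \<le> e1" "0 \<le> e2" by (simp_all add: e1_def e2_def local_energy_parts)
  have "e1 + local_energy K2 (\<lambda>x. p2 x - J x) \<le> e1 + 2 * e2 + 2 * (X * face_jump ?q + Y * (e1 + e2))"
    using add_left_mono[OF main, of e1] by (simp only: add.assoc)
  also have "\<dots> \<le> (2 + 2 * X + 2 * Y) * (face_jump ?q + (e1 + e2))"
  proof -
    have "0 \<le> X * (e1 + e2)" "0 \<le> Y * face_jump ?q" using XY e0 face_jump_nonneg by simp_all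
    then show ?thesis using e0 face_jump_nonneg[of ?q] by (simp add: algebra_simps)
  qed
  finally have "e1 + local_energy K2 (\<lambda>x. p2 x - J x) \<le> (2 + 2 * X + 2 * Y) * (face_jump ?q + (e1 + e2))" .
  moreover have "2 + 2 * X + 2 * Y = 2 + 2 * CE * CQ * (4 * \<sigma>) ^ N + 96 * CG * CE * CP * \<sigma>\<^sup>2 * (1 + (4 * \<sigma>) ^ N) * (32 * real N * \<sigma>) ^ N"
    by (simp add: X_def Y_def)
  ultimately show ?thesis by (simp add: e1_def e2_def J_def)
qed

text \<open>
  For the face term, \<open>p2 - p1 = (p2 - s2) - (p1 - s1)\<close> on the face. Each summand is a polynomial
  whose point values are bounded by its mean square over its simplex, and the smaller of the two
  volumes cancels the volume in that bound. Both \<open>p\<close> and \<open>s\<close> are close to \<open>u'\<close> in terms of the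
  energy of \<open>s\<close>, which gives the factor \<open>4\<close>.
\<close>

lemma lower_estimate:
  fixes CP :: real
  assumes p: "p1 \<in> polynomials_on l UNIV" "p2 \<in> polynomials_on l UNIV"
    and s: "s1 \<in> polynomials_on l UNIV" "s2 \<in> polynomials_on l UNIV" "\<And>x. x \<in> K1 \<inter> K2 \<Longrightarrow> s1 x = s2 x"
    and le: "local_energy K1 p1 \<le> local_energy K1 s1" "local_energy K2 p2 \<le> local_energy K2 s2"
    and CP: "0 \<le> CP"
    and pv: "\<And>p K x. p \<in> polynomials_on l (UNIV :: (real^'n) set) \<Longrightarrow> compact K \<Longrightarrow> convex K \<Longrightarrow> x \<in> K \<Longrightarrow>
      (p x)\<^sup>2 * measure lborel K \<le> CP * norm_sq_on K p"
  shows "face_jump (\<lambda>x. p2 x - p1 x) + (local_energy K1 p1 + local_energy K2 p2) \<le>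
     (1 + 8 * CP) * (local_energy K1 s1 + local_energy K2 s2)"
proof -
  let ?E = "K1 \<inter> K2" and ?q = "\<lambda>x. p2 x - p1 x"
  define V1 where "V1 = measure lborel K1"
  define V2 where "V2 = measure lborel K2"
  have V: "0 < V1" "0 < V2"
  proof -
    have pos: "0 < measure lborel K" if K: "int CARD('n) simplex K" for K :: "(real^'n) set"
    proof -
      note S = simplex_basic[OF K]
      obtain x e where e: "0 < e" "cball x e \<subseteq> K" using S(3) mem_interior_cball by blast
      have "0 < unit_ball_vol (real CARD('n)) * e ^ CARD('n)" using e by simp
      also have "\<dots> \<le> measure lborel K"
        using e S by (intro volume_ge_inball) (auto simp: compact_imp_closed borel_closed compact_imp_bounded)
      finally show ?thesis .
    qed
    show "0 < V1" "0 < V2" using pos simplex by (auto simp: V1_def V2_def)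
  qed
  define A1 where "A1 = local_energy K1 s1"
  define A2 where "A2 = local_energy K2 s2"
  have A: "0 \<le> A1" "0 \<le> A2" by (simp_all add: A1_def A2_def local_energy_parts)
  have diff: "norm_sq_on K (\<lambda>x. p x - s x) \<le> 4 * local_energy K s"
    if K: "K \<in> sets borel" "bounded K" and ps: "p \<in> polynomials_on l UNIV" "s \<in> polynomials_on l UNIV"
      and best: "local_energy K p \<le> local_energy K s" for K p s
  proof -
    note smp = polynomial_elementary_smooth[OF ps(1)] and sms = polynomial_elementary_smooth[OF ps(2)]
    have "(\<lambda>x. p x - s x) = (\<lambda>x. (u' x - s x) + (- 1) * (u' x - p x))" by auto
    then have "norm_sq_on K (\<lambda>x. p x - s x) \<le>
        2 * norm_sq_on K (\<lambda>x. u' x - s x) + 2 * norm_sq_on K (\<lambda>x. (- 1) * (u' x - p x))"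
      using norm_sq_on_add_le[OF residual_L2(1)[OF sms] loc_L2_cmult[OF residual_L2(1)[OF smp], of "-1"] K] by simp
    also have "norm_sq_on K (\<lambda>x. (- 1) * (u' x - p x)) = norm_sq_on K (\<lambda>x. u' x - p x)"
      by (simp add: norm_sq_on_def power2_commute)
    finally show ?thesis
      using local_energy_parts(1)[of K p] local_energy_parts(1)[of K s] best by linarith
  qed
  define X1 where "X1 = norm_sq_on K1 (\<lambda>x. p1 x - s1 x)"
  define X2 where "X2 = norm_sq_on K2 (\<lambda>x. p2 x - s2 x)"
  have X: "X1 \<le> 4 * A1" "X2 \<le> 4 * A2"
    unfolding X1_def X2_def A1_def A2_def using diff K1_facts K2_facts p s le by blast+
  have X0: "0 \<le> X1" "0 \<le> X2" by (simp_all add: X1_def X2_def norm_sq_on_nonneg)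
  define B where "B = 2 * (CP * X1 / V1) + 2 * (CP * X2 / V2)"
  have B0: "0 \<le> B" using CP X0 V by (simp add: B_def)
  have pointwise: "(?q x)\<^sup>2 \<le> B" if x: "x \<in> ?E" for x
  proof -
    have "(p1 x - s1 x)\<^sup>2 \<le> CP * X1 / V1"
      using pv[OF polynomial_diff[OF p(1) s(1)] K1_facts(1,2), of x] x V by (simp add: X1_def V1_def pos_le_divide_eq)
    moreover have "(p2 x - s2 x)\<^sup>2 \<le> CP * X2 / V2"
      using pv[OF polynomial_diff[OF p(2) s(2)] K2_facts(1,2), of x] x V by (simp add: X2_def V2_def pos_le_divide_eq)
    moreover have "?q x = (p2 x - s2 x) - (p1 x - s1 x)" using s(3)[OF x] by simp
    then have "(?q x)\<^sup>2 \<le> 2 * (p2 x - s2 x)\<^sup>2 + 2 * (p1 x - s1 x)\<^sup>2" by (simp only: power2_diff_le)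
    ultimately show ?thesis unfolding B_def by linarith
  qed
  define mE where "mE = measure face_measure ?E"
  have mE: "0 < mE" using face_facts by (simp add: mE_def)
  have Eb: "?E \<in> sets face_measure"
    using face_facts(1) by (simp add: face_measure_def sets_hausdorff_measure compact_imp_closed borel_closed)
  have sets_fm: "sets (face_measure :: (real^'n) measure) = sets borel" by (simp add: face_measure_def sets_hausdorff_measure)
  have "(\<integral>x. indicator ?E x * (?q x)\<^sup>2 \<partial>face_measure) \<le> (\<integral>x. B * indicator ?E x \<partial>face_measure)"
  proof (rule integral_mono)
    show "integrable face_measure (\<lambda>x. indicator ?E x * (?q x)\<^sup>2)"
      by (rule polynomial_square_integrable[OF sets_fm face_facts(1,4) polynomial_diff[OF p(2,1)]])
    show "integrable face_measure (\<lambda>x. B * indicator ?E x)"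
      using Eb face_facts(4) by (intro integrable_mult_right integrable_real_indicator) auto
  qed (use pointwise in \<open>auto simp: indicator_def\<close>)
  also have "\<dots> = B * mE" using Eb by (simp add: mE_def)
  finally have "face_jump ?q \<le> min V1 V2 / mE * (B * mE)"
    unfolding face_jump_def V1_def[symmetric] V2_def[symmetric] mE_def[symmetric]
    using V mE by (intro mult_left_mono) auto
  also have "\<dots> = 2 * (CP * X1 * (min V1 V2 / V1)) + 2 * (CP * X2 * (min V1 V2 / V2))"
    using mE V by (simp add: B_def field_simps)
  also have "\<dots> \<le> 2 * (CP * X1 * 1) + 2 * (CP * X2 * 1)"
    using V CP X0 by (intro add_mono mult_left_mono) (auto simp: divide_le_eq_1)
  also have "\<dots> \<le> 8 * CP * (A1 + A2)"
    using mult_left_mono[OF X(1) CP] mult_left_mono[OF X(2) CP] by (simp add: algebra_simps)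
  finally show ?thesis
    using le by (simp add: A1_def A2_def algebra_simps)
qed

end

section \<open>Equivalence for the best approximations\<close>

context facing_pair
begin

lemma face_jump_eq:
  assumes "\<And>x. x \<in> K1 \<inter> K2 \<Longrightarrow> P1 x - P2 x = - q x"
  shows "face_height K1 K2 * (L2_norm face_measure (K1 \<inter> K2) (\<lambda>x. P1 x - P2 x))\<^sup>2 = face_jump q"
proof -
  have "(LINT x:K1 \<inter> K2|face_measure. (norm (P1 x - P2 x))\<^sup>2) =
      (\<integral>x. indicator (K1 \<inter> K2) x * (q x)\<^sup>2 \<partial>face_measure)"
    unfolding set_lebesgue_integral_def
    by (intro Bochner_Integration.integral_cong) (auto simp: assms indicator_def)
  moreover have "0 \<le> (\<integral>x. indicator (K1 \<inter> K2) x * (q x)\<^sup>2 \<partial>face_measure)"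
    by (intro integral_nonneg_AE) auto
  moreover have "measure lebesgue K1 = measure lborel K1" "measure lebesgue K2 = measure lborel K2"
    using K1_facts(3) K2_facts(3) by (simp_all add: measure_completion)
  ultimately show ?thesis by (simp add: face_height_def face_jump_def L2_norm_def)
qed

lemma glued_polynomial:
  assumes p: "p1 \<in> polynomials_on l UNIV" "p2 \<in> polynomials_on l UNIV"
    and agree: "\<And>x. a \<bullet> (x - m) = 0 \<Longrightarrow> p1 x = p2 x"
  obtains P where "P \<in> continuous_pw_polynomials l K1 K2"
    "\<And>x. x \<in> K1 \<Longrightarrow> P x = p1 x" "\<And>x. x \<in> K2 \<Longrightarrow> P x = p2 x"
proof
  define P where "P = (\<lambda>x. if a \<bullet> (x - m) \<le> 0 then p2 x else p1 x)"
  show P1: "P x = p1 x" if "x \<in> K1" for x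
    using side(1)[OF that] agree[of x] by (auto simp: P_def)
  show P2: "P x = p2 x" if "x \<in> K2" for x
    using side(2)[OF that] by (simp add: P_def)
  have cont: "continuous_on A p1" "continuous_on A p2" for A
    using p by (auto intro!: continuous_on_subset[of UNIV _ A] elementary_smooth_continuous polynomial_elementary_smooth)
  have "continuous_on (K1 \<union> K2) P"
    unfolding P_def by (intro continuous_on_cases_le cont continuous_intros) (simp add: agree)
  moreover have "P \<in> polynomials_on l K1" "P \<in> polynomials_on l K2"
    using p P1 P2 by (auto simp: polynomials_on_eq_restriction[of P])
  ultimately show "P \<in> continuous_pw_polynomials l K1 K2"
    by (simp add: continuous_pw_polynomials_def)
qed

end

lemma H1_borel_version:
  fixes A :: "(real^'n) set"
  assumes u: "u \<in> H1 A" and A: "A \<in> sets borel"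
  obtains u' g where "loc_L2 u'" "loc_L2_vec g" "wgrad (interior A) u' g" "AE x in lborel. x \<in> A \<longrightarrow> u x = u' x"
proof -
  obtain g where g: "u square_integrable_on A" "g square_integrable_on A" "has_weak_gradient A u g"
    using u by (auto simp: H1_def)
  obtain u' where u': "loc_L2 u'" "AE x in lborel. x \<in> A \<longrightarrow> u x = u' x"
    using square_integrable_on_borel_version[OF g(1) A] by blast
  obtain g' where g': "loc_L2_vec g'" "AE x in lborel. x \<in> A \<longrightarrow> g x = g' x"
    using square_integrable_on_borel_version_vec[OF g(2) A] by blast
  have "AE x in lborel. x \<in> interior A \<longrightarrow> u x = u' x" "AE x in lborel. x \<in> interior A \<longrightarrow> g x = g' x"
    by (rule eventually_mono[OF u'(2)], use interior_subset[of A] in blast)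
      (rule eventually_mono[OF g'(2)], use interior_subset[of A] in blast)
  then have "wgrad (interior A) u' g'"
    using g(3) has_weak_gradient_iff_wgrad[OF u'(1) _ g'(1)] by blast
  then show ?thesis using that u' g'(1) by blast
qed

lemma shape_ratio_bounds:
  fixes K1 K2 :: "(real^'n) set"
  assumes "int CARD('n) simplex K1" "int CARD('n) simplex K2"
  shows "0 < min (inball_diameter K1) (inball_diameter K2)"
    "min (inball_diameter K1) (inball_diameter K2) \<le> max (diameter K1) (diameter K2)"
    "1 \<le> shape_ratio K1 K2"
proof -
  note S1 = simplex_basic[OF assms(1)] and S2 = simplex_basic[OF assms(2)]
  show *: "0 < min (inball_diameter K1) (inball_diameter K2)"
    "min (inball_diameter K1) (inball_diameter K2) \<le> max (diameter K1) (diameter K2)"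
    using inball_diameter_ball[OF S1(1,3)] inball_diameter_ball[OF S2(1,3)] by linarith+
  then show "1 \<le> shape_ratio K1 K2" by (simp add: shape_ratio_def)
qed

text \<open>
  The constants of the inverse estimates depend on \<open>l\<close>, \<open>\<sigma>\<close> and the dimension, so they can be
  chosen before \<open>\<epsilon>\<close>, the simplices and \<open>u\<close>. All norms are then expressed by the local energies
  of polynomials on the whole space that extend the best approximations.
\<close>

lemma best_approximation_equivalence:
  fixes l :: nat and \<sigma> :: real
  assumes \<sigma>: "0 < \<sigma>"
  shows "\<exists>C1 C2. \<forall>\<epsilon> (K1 :: (real^'n) set) K2 u PE P1 P2.
      0 < \<epsilon> \<longrightarrow> int CARD('n) simplex K1 \<longrightarrow> int CARD('n) simplex K2 \<longrightarrow>
      (K1 \<inter> K2) facet_of K1 \<longrightarrow> (K1 \<inter> K2) facet_of K2 \<longrightarrow> u \<in> H1 (K1 \<union> K2) \<longrightarrow>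
      is_best_approx \<epsilon> (K1 \<union> K2) (continuous_pw_polynomials l K1 K2) u PE \<longrightarrow>
      is_best_approx \<epsilon> K1 (polynomials_on l K1) u P1 \<longrightarrow>
      is_best_approx \<epsilon> K2 (polynomials_on l K2) u P2 \<longrightarrow> shape_ratio K1 K2 = \<sigma> \<longrightarrow>
      (let lhs = energy_norm \<epsilon> (K1 \<union> K2) (\<lambda>x. u x - PE x);
           rhs = sqrt (face_height K1 K2 * (L2_norm face_measure (K1 \<inter> K2) (\<lambda>x. P1 x - P2 x))\<^sup>2
                   + ((energy_norm \<epsilon> K1 (\<lambda>x. u x - P1 x))\<^sup>2 + (energy_norm \<epsilon> K2 (\<lambda>x. u x - P2 x))\<^sup>2))
       in lhs \<le> C1 * rhs \<and> rhs \<le> C2 * lhs)"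
proof -
  have s: "0 < 1 / (16 * real CARD('n) * \<sigma>)" using \<sigma> by simp
  obtain CE where CE: "0 \<le> CE" and ext: "\<And>p m x B. p \<in> polynomials_on l (UNIV :: (real^'n) set) \<Longrightarrow>
      (\<forall>t\<in>{0..1 / (16 * real CARD('n) * \<sigma>)}. (p (m + t *\<^sub>R (x - m)))\<^sup>2 \<le> B) \<Longrightarrow> (p x)\<^sup>2 \<le> CE * B"
    using polynomial_extrapolation[OF s, of l, where 'n = 'n] by auto
  obtain CP where CP: "0 \<le> CP" and pv0: "\<And>p \<mu> K x M. p \<in> polynomials_on l (UNIV :: (real^'n) set) \<Longrightarrow>
     homothety_bounded CARD('n) \<mu> \<Longrightarrow> compact K \<Longrightarrow> convex K \<Longrightarrow> x \<in> K \<Longrightarrow> 0 \<le> M \<Longrightarrow> emeasure \<mu> K = ennreal M \<Longrightarrow>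
     (p x)\<^sup>2 * M \<le> CP * (\<integral>y. indicator K y * (p y)\<^sup>2 \<partial>\<mu>)"
    using polynomial_point_value_bound_real[of l "CARD('n)", where 'n = 'n] by blast
  obtain CQ where CQ: "0 \<le> CQ" and pvE0: "\<And>p \<mu> K x M. p \<in> polynomials_on l (UNIV :: (real^'n) set) \<Longrightarrow>
     homothety_bounded (CARD('n) - 1) \<mu> \<Longrightarrow> compact K \<Longrightarrow> convex K \<Longrightarrow> x \<in> K \<Longrightarrow> 0 \<le> M \<Longrightarrow> emeasure \<mu> K = ennreal M \<Longrightarrow>
     (p x)\<^sup>2 * M \<le> CQ * (\<integral>y. indicator K y * (p y)\<^sup>2 \<partial>\<mu>)"
    using polynomial_point_value_bound_real[of l "CARD('n) - 1", where 'n = 'n] by blast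
  obtain CG where CG: "0 \<le> CG" and CG': "\<forall>p \<in> polynomials_on l (UNIV :: (real^'n) set). \<forall>K x c r B.
     convex K \<longrightarrow> x \<in> K \<longrightarrow> 0 < r \<longrightarrow> cball c r \<subseteq> K \<longrightarrow> (\<forall>y\<in>K. (p y)\<^sup>2 \<le> B) \<longrightarrow>
     (norm (grad p x))\<^sup>2 \<le> CG * B / r\<^sup>2"
    using polynomial_gradient_bound[of l, where 'n = 'n] by blast
  note gr = CG'[THEN bspec, THEN spec, THEN spec, THEN spec, THEN spec, THEN spec,
      THEN mp, THEN mp, THEN mp, THEN mp, THEN mp]
  have pv: "(p x)\<^sup>2 * measure lborel K \<le> CP * norm_sq_on K p"
    if "p \<in> polynomials_on l (UNIV :: (real^'n) set)" "compact K" "convex K" "x \<in> K" for p K x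
    unfolding norm_sq_on_def using that
    by (intro pv0 homothety_bounded_lborel emeasure_lborel_bounded compact_imp_bounded) auto
  define A where "A = 2 + 2 * CE * CQ * (4 * \<sigma>) ^ CARD('n) +
    96 * CG * CE * CP * \<sigma>\<^sup>2 * (1 + (4 * \<sigma>) ^ CARD('n)) * (32 * real CARD('n) * \<sigma>) ^ CARD('n)"
  define B where "B = 1 + 8 * CP"
  show ?thesis
  proof (rule exI[of _ "sqrt A"], rule exI[of _ "sqrt B"], intro allI impI)
    fix \<epsilon> and K1 K2 :: "(real^'n) set" and u PE P1 P2
    assume eps: "0 < \<epsilon>" and K: "int CARD('n) simplex K1" "int CARD('n) simplex K2"
      and E: "(K1 \<inter> K2) facet_of K1" "(K1 \<inter> K2) facet_of K2" and u: "u \<in> H1 (K1 \<union> K2)"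
      and bestE: "is_best_approx \<epsilon> (K1 \<union> K2) (continuous_pw_polynomials l K1 K2) u PE"
      and best: "is_best_approx \<epsilon> K1 (polynomials_on l K1) u P1" "is_best_approx \<epsilon> K2 (polynomials_on l K2) u P2"
      and shape: "shape_ratio K1 K2 = \<sigma>"
    define h where "h = max (diameter K1) (diameter K2)"
    define \<rho> where "\<rho> = min (inball_diameter K1) (inball_diameter K2)"
    have \<rho>: "0 < \<rho>" "\<rho> \<le> h" using shape_ratio_bounds[OF K] by (auto simp: \<rho>_def h_def)
    have ratio: "h / \<rho> = \<sigma>" using shape by (simp add: shape_ratio_def h_def \<rho>_def)
    note S1 = simplex_basic[OF K(1)] and S2 = simplex_basic[OF K(2)]
    obtain c1 where "cball c1 (inball_diameter K1 / 4) \<subseteq> K1" using inball_diameter_ball(3)[OF S1(1,3)] by blast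
    then have c1: "cball c1 (\<rho> / 4) \<subseteq> K1"
      using subset_cball[of "\<rho> / 4" "inball_diameter K1 / 4" c1] by (simp add: \<rho>_def)
    obtain c2 where "cball c2 (inball_diameter K2 / 4) \<subseteq> K2" using inball_diameter_ball(3)[OF S2(1,3)] by blast
    then have c2: "cball c2 (\<rho> / 4) \<subseteq> K2"
      using subset_cball[of "\<rho> / 4" "inball_diameter K2 / 4" c2] by (simp add: \<rho>_def)
    have \<rho>4: "0 < \<rho> / 4" using \<rho> by simp
    define r where "r = \<rho> / (2 * real CARD('n))"
    have r: "2 * (\<rho> / 4) / real CARD('n) = r" by (simp add: r_def)
    obtain a m where am: "norm a = 1" "m \<in> K1 \<inter> K2"
      "\<And>x. x \<in> K1 \<Longrightarrow> 0 \<le> a \<bullet> (x - m)" "\<And>x. x \<in> K2 \<Longrightarrow> a \<bullet> (x - m) \<le> 0"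
      "\<And>x. norm (x - m) < r \<Longrightarrow> 0 \<le> a \<bullet> (x - m) \<Longrightarrow> x \<in> K1"
      "\<And>x. norm (x - m) < r \<Longrightarrow> a \<bullet> (x - m) \<le> 0 \<Longrightarrow> x \<in> K2"
      by (rule adjacent_simplices_ball[OF K E \<rho>4 c1 c2, unfolded r]) (rule that)
    have r0: "0 < r" using \<rho> by (simp add: r_def)
    interpret facing_pair K1 K2 a m r
      by (rule facing_pair.intro) (fact K am r0)+
    have "K1 \<union> K2 \<in> sets borel" using K1_facts(3) K2_facts(3) by blast
    then obtain u' g where ug: "loc_L2 u'" "loc_L2_vec g" "wgrad (interior (K1 \<union> K2)) u' g"
        "AE x in lborel. x \<in> K1 \<union> K2 \<longrightarrow> u x = u' x"
      using H1_borel_version[OF u] by blast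
    interpret facing_pair_H1 K1 K2 a m r u u' g \<epsilon>
      by unfold_locales (fact eps ug)+

    have P1: "P1 \<in> polynomials_on l K1" and P2: "P2 \<in> polynomials_on l K2"
      using best by (simp_all add: is_best_approx_def)
    have PE: "PE \<in> polynomials_on l K1" "PE \<in> polynomials_on l K2"
      using bestE by (simp_all add: is_best_approx_def continuous_pw_polynomials_def)
    obtain p1 where p1: "p1 \<in> polynomials_on l UNIV" "\<And>x. x \<in> K1 \<Longrightarrow> P1 x = p1 x"
      using iffD1[OF polynomials_on_eq_restriction P1] by blast
    obtain p2 where p2: "p2 \<in> polynomials_on l UNIV" "\<And>x. x \<in> K2 \<Longrightarrow> P2 x = p2 x"
      using iffD1[OF polynomials_on_eq_restriction P2] by blast
    obtain s1 where s1: "s1 \<in> polynomials_on l UNIV" "\<And>x. x \<in> K1 \<Longrightarrow> PE x = s1 x"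
      using iffD1[OF polynomials_on_eq_restriction PE(1)] by blast
    obtain s2 where s2: "s2 \<in> polynomials_on l UNIV" "\<And>x. x \<in> K2 \<Longrightarrow> PE x = s2 x"
      using iffD1[OF polynomials_on_eq_restriction PE(2)] by blast
    note p = p1(1) p2(1) and P = p1(2) p2(2) and s = s1(1) s2(1) and S = s1(2) s2(2)
    have sE: "s1 x = s2 x" if "x \<in> K1 \<inter> K2" for x using S[of x] that by auto

    have energy1: "(energy_norm \<epsilon> K1 (\<lambda>x. u x - Q x))\<^sup>2 = local_energy K1 q"
      if "q \<in> polynomials_on l UNIV" "\<And>x. x \<in> K1 \<Longrightarrow> Q x = q x" for Q q
      using that by (intro energy_norm_local K polynomial_elementary_smooth[of q l]) auto
    have energy2: "(energy_norm \<epsilon> K2 (\<lambda>x. u x - Q x))\<^sup>2 = local_energy K2 q"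
      if "q \<in> polynomials_on l UNIV" "\<And>x. x \<in> K2 \<Longrightarrow> Q x = q x" for Q q
      using that by (intro energy_norm_local K polynomial_elementary_smooth[of q l]) auto
    have min1: "local_energy K1 p1 \<le> local_energy K1 q" if q: "q \<in> polynomials_on l UNIV" for q
    proof -
      have "q \<in> polynomials_on l K1" using q by (auto simp: polynomials_on_eq_restriction[of q l K1])
      from is_best_approx_le[OF best(1) this] show ?thesis
        using eps by (simp add: energy1[OF p(1) P(1)] energy1[OF q])
    qed
    have min2: "local_energy K2 p2 \<le> local_energy K2 q" if q: "q \<in> polynomials_on l UNIV" for q
    proof -
      have "q \<in> polynomials_on l K2" using q by (auto simp: polynomials_on_eq_restriction[of q l K2])
      from is_best_approx_le[OF best(2) this] show ?thesis
        using eps by (simp add: energy2[OF p(2) P(2)] energy2[OF q])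
    qed
    let ?L = "energy_norm \<epsilon> (K1 \<union> K2) (\<lambda>x. u x - PE x)"
    define R where "R = face_jump (\<lambda>x. p2 x - p1 x) + (local_energy K1 p1 + local_energy K2 p2)"
    have R_eq: "face_height K1 K2 * (L2_norm face_measure (K1 \<inter> K2) (\<lambda>x. P1 x - P2 x))\<^sup>2
        + ((energy_norm \<epsilon> K1 (\<lambda>x. u x - P1 x))\<^sup>2 + (energy_norm \<epsilon> K2 (\<lambda>x. u x - P2 x))\<^sup>2) = R"
      using face_jump_eq[of P1 P2 "\<lambda>x. p2 x - p1 x"] P
      by (simp add: R_def energy1[OF p(1) P(1)] energy2[OF p(2) P(2)])

    have "?L\<^sup>2 \<le> A * R"
    proof -
      define J where "J = (\<lambda>x. p2 (plane_proj x) - p1 (plane_proj x))"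
      have J: "J \<in> polynomials_on l UNIV"
        unfolding J_def by (intro polynomial_diff polynomial_plane_proj p)
      have p2J: "(\<lambda>x. p2 x - J x) \<in> polynomials_on l UNIV" by (intro polynomial_diff p J)
      have agree: "p1 x = p2 x - J x" if "a \<bullet> (x - m) = 0" for x
        using that by (simp add: J_def plane_proj_fix)
      obtain Q where Q: "Q \<in> continuous_pw_polynomials l K1 K2"
        "\<And>x. x \<in> K1 \<Longrightarrow> Q x = p1 x" "\<And>x. x \<in> K2 \<Longrightarrow> Q x = p2 x - J x"
        by (rule glued_polynomial[OF p(1) p2J], erule agree) (rule that)
      have "?L\<^sup>2 \<le> (energy_norm \<epsilon> (K1 \<union> K2) (\<lambda>x. u x - Q x))\<^sup>2"
        using is_best_approx_le[OF bestE Q(1)] eps by simp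
      also have "\<dots> = local_energy K1 p1 + local_energy K2 (\<lambda>x. p2 x - J x)"
        by (rule energy_norm_union[OF polynomial_elementary_smooth[OF p(1)] polynomial_elementary_smooth[OF p2J]])
          (fact agree Q)+
      also have "\<dots> \<le> A * R"
        unfolding J_def A_def R_def ratio[symmetric]
      proof (rule upper_estimate[OF p _ _ _ _ \<rho> c1 c2 r_def CE CP CQ CG])
        show "local_energy K1 p1 \<le> local_energy K1 (\<lambda>x. p1 x + c)"
          "local_energy K2 p2 \<le> local_energy K2 (\<lambda>x. p2 x + c)" for c
          by (intro min1 min2 polynomial_add polynomial_const p)+
        show "diameter K1 \<le> h" "diameter K2 \<le> h" by (simp_all add: h_def)
        show "(p x)\<^sup>2 \<le> CE * B" if "p \<in> polynomials_on l UNIV"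
          "\<forall>t\<in>{0..1 / (16 * real CARD('n) * (h / \<rho>))}. (p (m + t *\<^sub>R (x - m)))\<^sup>2 \<le> B" for p x B
          using that unfolding ratio by (rule ext)
        show "(p x)\<^sup>2 * measure face_measure (K1 \<inter> K2) \<le> CQ * (\<integral>y. indicator (K1 \<inter> K2) y * (p y)\<^sup>2 \<partial>face_measure)"
          if "p \<in> polynomials_on l UNIV" "x \<in> K1 \<inter> K2" for p x
          using that face_facts by (intro pvE0 homothety_bounded_face_measure) auto
        show "(norm (grad p x))\<^sup>2 \<le> CG * B / (\<rho> / 4)\<^sup>2"
          if "p \<in> polynomials_on l UNIV" "x \<in> K2" "\<forall>y\<in>K2. (p y)\<^sup>2 \<le> B" for p x B
          using that K2_facts(2) \<rho>4 c2 by (intro gr) auto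
      qed (rule pv)
      finally show ?thesis .
    qed
    moreover have "R \<le> B * ?L\<^sup>2"
    proof -
      have agree: "s1 x = s2 x" if "a \<bullet> (x - m) = 0" for x
        by (rule polynomials_agree_on_plane[OF s _ that]) (rule sE)
      have L_eq: "?L\<^sup>2 = local_energy K1 s1 + local_energy K2 s2"
        by (rule energy_norm_union[OF polynomial_elementary_smooth[OF s(1)] polynomial_elementary_smooth[OF s(2)]])
          (fact agree S)+
      show ?thesis
        unfolding R_def B_def L_eq
        by (rule lower_estimate[OF p s _ min1[OF s(1)] min2[OF s(2)] CP]) (fact sE pv)+
    qed
    moreover have "0 \<le> ?L" using eps by (intro energy_norm_nonneg) simp
    ultimately have "?L \<le> sqrt A * sqrt R \<and> sqrt R \<le> sqrt B * ?L"
      using real_sqrt_le_mono[of "?L\<^sup>2" "A * R"] real_sqrt_le_mono[of R "B * ?L\<^sup>2"]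
      by (simp add: real_sqrt_mult)
    then show "let lhs = ?L;
           rhs = sqrt (face_height K1 K2 * (L2_norm face_measure (K1 \<inter> K2) (\<lambda>x. P1 x - P2 x))\<^sup>2
                   + ((energy_norm \<epsilon> K1 (\<lambda>x. u x - P1 x))\<^sup>2 + (energy_norm \<epsilon> K2 (\<lambda>x. u x - P2 x))\<^sup>2))
       in lhs \<le> sqrt A * rhs \<and> rhs \<le> sqrt B * lhs"
      by (simp add: R_eq Let_def)
  qed
qed

theorem theorem6p2:
  shows "\<exists>C1 C2 :: nat \<Rightarrow> real \<Rightarrow> real.
    \<forall>(l::nat) (\<epsilon>::real) (K1 :: (real^'n) set) K2 E \<omega> u PE P1 P2.
      1 \<le> l \<longrightarrow> 0 < \<epsilon> \<longrightarrow>
      int CARD('n) simplex K1 \<longrightarrow> int CARD('n) simplex K2 \<longrightarrow>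
      \<omega> = K1 \<union> K2 \<longrightarrow> E = K1 \<inter> K2 \<longrightarrow> E facet_of K1 \<longrightarrow> E facet_of K2 \<longrightarrow>
      u \<in> H1 \<omega> \<longrightarrow>
      is_best_approx \<epsilon> \<omega> (continuous_pw_polynomials l K1 K2) u PE \<longrightarrow>
      is_best_approx \<epsilon> K1 (polynomials_on l K1) u P1 \<longrightarrow>
      is_best_approx \<epsilon> K2 (polynomials_on l K2) u P2 \<longrightarrow>
      (let \<sigma> = shape_ratio K1 K2;
           lhs = energy_norm \<epsilon> \<omega> (\<lambda>x. u x - PE x);
           rhs = sqrt (face_height K1 K2 * (L2_norm face_measure E (\<lambda>x. P1 x - P2 x))\<^sup>2
                   + ((energy_norm \<epsilon> K1 (\<lambda>x. u x - P1 x))\<^sup>2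
                    + (energy_norm \<epsilon> K2 (\<lambda>x. u x - P2 x))\<^sup>2))
       in lhs \<le> C1 l \<sigma> * rhs \<and> rhs \<le> C2 l \<sigma> * lhs)"
proof -
  define Q where "Q l \<sigma> c1 c2 \<longleftrightarrow> (\<forall>\<epsilon> (K1 :: (real^'n) set) K2 u PE P1 P2.
      0 < \<epsilon> \<longrightarrow> int CARD('n) simplex K1 \<longrightarrow> int CARD('n) simplex K2 \<longrightarrow>
      (K1 \<inter> K2) facet_of K1 \<longrightarrow> (K1 \<inter> K2) facet_of K2 \<longrightarrow> u \<in> H1 (K1 \<union> K2) \<longrightarrow>
      is_best_approx \<epsilon> (K1 \<union> K2) (continuous_pw_polynomials l K1 K2) u PE \<longrightarrow>
      is_best_approx \<epsilon> K1 (polynomials_on l K1) u P1 \<longrightarrow>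
      is_best_approx \<epsilon> K2 (polynomials_on l K2) u P2 \<longrightarrow> shape_ratio K1 K2 = \<sigma> \<longrightarrow>
      (let lhs = energy_norm \<epsilon> (K1 \<union> K2) (\<lambda>x. u x - PE x);
           rhs = sqrt (face_height K1 K2 * (L2_norm face_measure (K1 \<inter> K2) (\<lambda>x. P1 x - P2 x))\<^sup>2
                   + ((energy_norm \<epsilon> K1 (\<lambda>x. u x - P1 x))\<^sup>2 + (energy_norm \<epsilon> K2 (\<lambda>x. u x - P2 x))\<^sup>2))
       in lhs \<le> c1 * rhs \<and> rhs \<le> c2 * lhs))" for l :: nat and \<sigma> c1 c2 :: real
  have "\<forall>l \<sigma>. \<exists>c1 c2. 0 < \<sigma> \<longrightarrow> Q l \<sigma> c1 c2"
    using best_approximation_equivalence[where 'n = 'n] unfolding Q_def by blast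
  then obtain C1 C2 where C: "\<And>l \<sigma>. 0 < \<sigma> \<Longrightarrow> Q l \<sigma> (C1 l \<sigma>) (C2 l \<sigma>)" by metis
  show ?thesis
  proof (rule exI[of _ C1], rule exI[of _ C2], intro allI impI)
    fix l \<epsilon> and K1 K2 E \<omega> :: "(real^'n) set" and u PE P1 P2
    assume "0 < \<epsilon>" and K: "int CARD('n) simplex K1" "int CARD('n) simplex K2"
      and [simp]: "\<omega> = K1 \<union> K2" "E = K1 \<inter> K2" and "E facet_of K1" "E facet_of K2" "u \<in> H1 \<omega>"
      "is_best_approx \<epsilon> \<omega> (continuous_pw_polynomials l K1 K2) u PE"
      "is_best_approx \<epsilon> K1 (polynomials_on l K1) u P1" "is_best_approx \<epsilon> K2 (polynomials_on l K2) u P2"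
    moreover have "0 < shape_ratio K1 K2" using shape_ratio_bounds(3)[OF K] by simp
    ultimately show "let \<sigma> = shape_ratio K1 K2;
           lhs = energy_norm \<epsilon> \<omega> (\<lambda>x. u x - PE x);
           rhs = sqrt (face_height K1 K2 * (L2_norm face_measure E (\<lambda>x. P1 x - P2 x))\<^sup>2
                   + ((energy_norm \<epsilon> K1 (\<lambda>x. u x - P1 x))\<^sup>2
                    + (energy_norm \<epsilon> K2 (\<lambda>x. u x - P2 x))\<^sup>2))
       in lhs \<le> C1 l \<sigma> * rhs \<and> rhs \<le> C2 l \<sigma> * lhs"
      using C[of "shape_ratio K1 K2" l] by (simp add: Q_def)
  qed
qed

end
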